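(* For integers $r\geq 2$, $0\leq \mu\leq r-2$, and $t\in[0,T]$, there is a constant $C$ independent of $h$ such that the solution $(\tilde\eta,\tilde u)\in S_h(\mu,r)\times S_h^0(\mu,r)$ of the semidiscrete problem $$\begin{aligned} &A_b(\tilde{\eta}_t,\chi)+\big([\tilde{u}+\tilde{\eta}\tilde{u}+a\, \partial^2_h \tilde{u}]_x,\chi\big)=0 \quad \forall\chi\in S_h,\\ &A_d(\tilde{u}_t,\phi)+(\tilde{\eta}_x+\tilde{u}\tilde{u}_x,\phi)= 0 \quad \forall\phi\in S_h^0, \end{aligned}\qquad 0<t\le T,$$ with initial conditions $\tilde\eta(\cdot,0)=R_h\eta_0$, $\tilde u(\cdot,0)=R_h^0u_0$, converges as $h\to0$ to the exact solution $(\eta,u)$ of the initial-boundary value problem $$\begin{aligned} &\eta_t+u_x+(\eta u)_x+a u_{xxx}-b \eta_{xxt} =0,\qquad u_t+\eta_x+uu_x -du_{xxt}=0,\qquad (x,t)\in(-L,L)\times(0,T),\\ &\eta(x,0)=\eta_0(x),\quad u(x,0)=u_0(x),\qquad u(\pm L,t)=0,\quad u_{xx}(\pm L,t)=0, \end{aligned}$$ and satisfies the a priori error estimates $$\|\tilde{\eta}-\eta\|+\|\tilde{u}-u\|\leq Ch^r\qquad\text{and}\qquad \|\tilde{\eta}-\eta\|_{1}+\|\tilde{u}-u\|_{1}\leq Ch^{r-1}.$$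
   Context: Fix $L>0$ and real parameters $a<0$, $b>0$, $d>0$ with $a+b+d=\tfrac13$. $(\cdot,\cdot)$ and $\|\cdot\|$ are the inner product and norm of $L^2(-L,L)$; $H^s=H^s(-L,L)$ with norm $\|v\|_s=\left(\sum_{j=0}^s\|\partial_x^jv\|^2\right)^{1/2}$; $H^1_0=\{v\in H^1:v(\pm L)=0\}$. $T>0$ is assumed to be the maximal time of existence of the smooth solution $(\eta,u)$ of the initial-boundary value problem. Here smooth solutions are those given by local existence theory: for $m\ge1$ and initial data $(\eta_0,u_0)\in\widetilde C_0^m\times C_0^{m+1}$ there is, locally in time, a unique solution (of the time-integrated form of the problem) that is continuous in time with values in $\widetilde C_0^m\times C_0^{m+1}$, where $C^m$ is the space of $m$-times continuously differentiable real functions on $[-L,L]$, $C_0^{m+1}=\{w\in C^{m+1}: w(\pm L)=0,\ w_{xx}(\pm L)=0\}$ and $\widetilde C_0^m=\{v\in C^m: v_x(\pm L)=0\}$. No particular value of the index $m$ is specified. Uniform grid: $-L=x_0<x_1<\dots<x_N=L$, $h=x_{i+1}-x_i=2L/N$. With $\mathbb P_q$ the polynomials of degree at most $q$, $$S_h=S_h(\mu,r)=\{\phi\in C^\mu[-L,L]:\phi|_{[x_i,x_{i+1}]}\in\mathbb P_{r-1}\},\qquad S_h^0=S_h^0(\mu,r)=\{\phi\in S_h:\phi(\pm L)=0\}.$$ For $q>0$, $A_q(v,w)=(v,w)+q(v_x,w_x)$ for $v,w\in H^1$. The discrete Laplacian $\partial_h^2:H^1_0\to S_h^0$ is defined by $(\partial_h^2v,\phi)=-(v_x,\phi_x)$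 for all $\phi\in S_h^0$. The elliptic projections $R_h:H^1\to S_h$ and $R_h^0:H^1_0\to S_h^0$ are defined by $A_b(R_hw,\chi)=A_b(w,\chi)$ for all $\chi\in S_h$ and $A_d(R_h^0v,\phi)=A_d(v,\phi)$ for all $\phi\in S_h^0$. *)

theory Defs
  imports "HOL-Analysis.Analysis" "HOL-Computational_Algebra.Polynomial"
begin

text \<open>
  Functions of space and time are curried with time first, so that \<open>\<eta> t\<close> is the function
  \<open>x \<mapsto> \<eta>(x,t)\<close>. Only values for \<open>x \<in> [-L,L]\<close> and \<open>t \<in> [0,T]\<close> are relevant.
\<close>


section \<open>Spaces of continuously differentiable functions\<close>

definition dx :: "real \<Rightarrow> (real \<Rightarrow> real) \<Rightarrow> real \<Rightarrow> real" where
  "dx L f = (\<lambda>x. vector_derivative f (at x within {-L..L}))"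

definition C_space :: "real \<Rightarrow> nat \<Rightarrow> (real \<Rightarrow> real) set" where
  "C_space L k = {f. (\<forall>j<k. (dx L ^^ j) f differentiable_on {-L..L}) \<and>
                     (\<forall>j\<le>k. continuous_on {-L..L} ((dx L ^^ j) f))}"

definition C0_space :: "real \<Rightarrow> nat \<Rightarrow> (real \<Rightarrow> real) set" where
  "C0_space L k = {w \<in> C_space L k. w (-L) = 0 \<and> w L = 0 \<and>
                     (dx L ^^ 2) w (-L) = 0 \<and> (dx L ^^ 2) w L = 0}"

definition C0_tilde_space :: "real \<Rightarrow> nat \<Rightarrow> (real \<Rightarrow> real) set" where
  "C0_tilde_space L k = {v \<in> C_space L k. dx L v (-L) = 0 \<and> dx L v L = 0}"

text \<open>Continuity of \<open>t \<mapsto> f t\<close> on \<open>[0,T]\<close> with respect to the norm of \<open>C\<^sup>k[-L,L]\<close>.\<close>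

definition continuous_in_C :: "real \<Rightarrow> real \<Rightarrow> nat \<Rightarrow> (real \<Rightarrow> real \<Rightarrow> real) \<Rightarrow> bool" where
  "continuous_in_C L T k f \<longleftrightarrow>
     (\<forall>t\<in>{0..T}. \<forall>j\<le>k.
        uniform_limit {-L..L} (\<lambda>s. (dx L ^^ j) (f s)) ((dx L ^^ j) (f t)) (at t within {0..T}))"


section \<open>The initial-boundary value problem\<close>

text \<open>
  Regularity index \<open>m\<close>; the two equations are meaningful for \<open>m \<ge> 2\<close>. The boundary conditions
  are part of the function classes. The mixed derivatives \<open>\<eta>\<^sub>x\<^sub>x\<^sub>t\<close>, \<open>u\<^sub>x\<^sub>x\<^sub>t\<close> are time derivatives of
  \<open>\<eta>\<^sub>x\<^sub>x\<close>, \<open>u\<^sub>x\<^sub>x\<close>.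
\<close>

definition smooth_solution ::
  "nat \<Rightarrow> real \<Rightarrow> real \<Rightarrow> real \<Rightarrow> real \<Rightarrow> real \<Rightarrow> (real \<Rightarrow> real) \<Rightarrow> (real \<Rightarrow> real) \<Rightarrow>
   (real \<Rightarrow> real \<Rightarrow> real) \<Rightarrow> (real \<Rightarrow> real \<Rightarrow> real) \<Rightarrow> bool" where
  "smooth_solution m L T a b d \<eta>0 u0 \<eta> u \<longleftrightarrow>
     (\<forall>t\<in>{0..T}. \<eta> t \<in> C0_tilde_space L m \<and> u t \<in> C0_space L (m + 1)) \<and>
     continuous_in_C L T m \<eta> \<and> continuous_in_C L T (m + 1) u \<and>
     (\<forall>x\<in>{-L..L}. \<eta> 0 x = \<eta>0 x \<and> u 0 x = u0 x) \<and>
     (\<forall>t\<in>{0<..<T}. \<forall>x\<in>{-L<..<L}.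
        (\<lambda>s. \<eta> s x) differentiable (at t) \<and>
        (\<lambda>s. (dx L ^^ 2) (\<eta> s) x) differentiable (at t) \<and>
        (\<lambda>s. u s x) differentiable (at t) \<and>
        (\<lambda>s. (dx L ^^ 2) (u s) x) differentiable (at t) \<and>
        deriv (\<lambda>s. \<eta> s x) t + dx L (u t) x + dx L (\<lambda>y. \<eta> t y * u t y) x
          + a * (dx L ^^ 3) (u t) x - b * deriv (\<lambda>s. (dx L ^^ 2) (\<eta> s) x) t = 0 \<and>
        deriv (\<lambda>s. u s x) t + dx L (\<eta> t) x + u t x * dx L (u t) x
          - d * deriv (\<lambda>s. (dx L ^^ 2) (u s) x) t = 0)"


section \<open>Inner products and norms\<close>

definition ip :: "real \<Rightarrow> (real \<Rightarrow> real) \<Rightarrow> (real \<Rightarrow> real) \<Rightarrow> real" where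
  "ip L v w = (LINT x:{-L..L}|lborel. v x * w x)"

definition L2_norm :: "real \<Rightarrow> (real \<Rightarrow> real) \<Rightarrow> real" where
  "L2_norm L v = sqrt (ip L v v)"

text \<open>
  Functions in \<open>H\<^sup>1(-L,L)\<close> are represented by their absolutely continuous representative, whose
  weak derivative is its pointwise derivative \<^const>\<open>deriv\<close>, defined almost everywhere.
\<close>

definition H1_norm :: "real \<Rightarrow> (real \<Rightarrow> real) \<Rightarrow> real" where
  "H1_norm L v = sqrt ((L2_norm L v)\<^sup>2 + (L2_norm L (deriv v))\<^sup>2)"

definition A_form :: "real \<Rightarrow> real \<Rightarrow> (real \<Rightarrow> real) \<Rightarrow> (real \<Rightarrow> real) \<Rightarrow> real" where
  "A_form L q v w = ip L v w + q * ip L (deriv v) (deriv w)"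


section \<open>Spline spaces and discrete operators\<close>

definition mesh :: "real \<Rightarrow> nat \<Rightarrow> real" where
  "mesh L N = 2 * L / real N"

definition node :: "real \<Rightarrow> nat \<Rightarrow> nat \<Rightarrow> real" where
  "node L N i = - L + real i * mesh L N"

definition Sh :: "real \<Rightarrow> nat \<Rightarrow> nat \<Rightarrow> nat \<Rightarrow> (real \<Rightarrow> real) set" where
  "Sh L N \<mu> r = {\<phi> \<in> C_space L \<mu>.
     \<forall>i<N. \<exists>p :: real poly. degree p \<le> r - 1 \<and>
       (\<forall>x\<in>{node L N i..node L N (i + 1)}. \<phi> x = poly p x)}"

definition Sh0 :: "real \<Rightarrow> nat \<Rightarrow> nat \<Rightarrow> nat \<Rightarrow> (real \<Rightarrow> real) set" where
  "Sh0 L N \<mu> r = {\<phi> \<in> Sh L N \<mu> r. \<phi> (-L) = 0 \<and> \<phi> L = 0}"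

text \<open>
  The functions selected by \<open>SOME\<close> below are uniquely determined on \<open>[-L,L]\<close>; their values
  elsewhere are irrelevant.
\<close>

definition discrete_laplacian ::
  "real \<Rightarrow> nat \<Rightarrow> nat \<Rightarrow> nat \<Rightarrow> (real \<Rightarrow> real) \<Rightarrow> real \<Rightarrow> real" where
  "discrete_laplacian L N \<mu> r v =
     (SOME w. w \<in> Sh0 L N \<mu> r \<and> (\<forall>\<phi>\<in>Sh0 L N \<mu> r. ip L w \<phi> = - ip L (deriv v) (deriv \<phi>)))"

definition Rh :: "real \<Rightarrow> nat \<Rightarrow> nat \<Rightarrow> nat \<Rightarrow> real \<Rightarrow> (real \<Rightarrow> real) \<Rightarrow> real \<Rightarrow> real" where
  "Rh L N \<mu> r b w =
     (SOME z. z \<in> Sh L N \<mu> r \<and> (\<forall>\<psi>\<in>Sh L N \<mu> r. A_form L b z \<psi> = A_form L b w \<psi>))"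

definition Rh0 :: "real \<Rightarrow> nat \<Rightarrow> nat \<Rightarrow> nat \<Rightarrow> real \<Rightarrow> (real \<Rightarrow> real) \<Rightarrow> real \<Rightarrow> real" where
  "Rh0 L N \<mu> r d v =
     (SOME z. z \<in> Sh0 L N \<mu> r \<and> (\<forall>\<phi>\<in>Sh0 L N \<mu> r. A_form L d z \<phi> = A_form L d v \<phi>))"


section \<open>The semidiscrete problem\<close>

definition dt :: "real \<Rightarrow> (real \<Rightarrow> real \<Rightarrow> real) \<Rightarrow> real \<Rightarrow> real \<Rightarrow> real" where
  "dt T f t = (\<lambda>x. vector_derivative (\<lambda>s. f s x) (at t within {0..T}))"

definition semidiscrete_solution ::
  "real \<Rightarrow> nat \<Rightarrow> nat \<Rightarrow> nat \<Rightarrow> real \<Rightarrow> real \<Rightarrow> real \<Rightarrow> real \<Rightarrow> (real \<Rightarrow> real) \<Rightarrow> (real \<Rightarrow> real) \<Rightarrow>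
   (real \<Rightarrow> real \<Rightarrow> real) \<Rightarrow> (real \<Rightarrow> real \<Rightarrow> real) \<Rightarrow> bool" where
  "semidiscrete_solution L N \<mu> r T a b d \<eta>0 u0 \<eta>h uh \<longleftrightarrow>
     (\<forall>t\<in>{0..T}. \<eta>h t \<in> Sh L N \<mu> r \<and> uh t \<in> Sh0 L N \<mu> r) \<and>
     (\<forall>x\<in>{-L..L}. continuous_on {0..T} (\<lambda>t. \<eta>h t x) \<and> continuous_on {0..T} (\<lambda>t. uh t x)) \<and>
     (\<forall>x\<in>{-L..L}. \<forall>t\<in>{0<..T}.
        (\<lambda>s. \<eta>h s x) differentiable (at t within {0..T}) \<and>
        (\<lambda>s. uh s x) differentiable (at t within {0..T})) \<and>
     (\<forall>t\<in>{0<..T}. \<forall>\<psi>\<in>Sh L N \<mu> r.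
        A_form L b (dt T \<eta>h t) \<psi>
        + ip L (deriv (\<lambda>x. uh t x + \<eta>h t x * uh t x
                            + a * discrete_laplacian L N \<mu> r (uh t) x)) \<psi> = 0) \<and>
     (\<forall>t\<in>{0<..T}. \<forall>\<phi>\<in>Sh0 L N \<mu> r.
        A_form L d (dt T uh t) \<phi>
        + ip L (\<lambda>x. deriv (\<eta>h t) x + uh t x * deriv (uh t) x) \<phi> = 0) \<and>
     (\<forall>x\<in>{-L..L}. \<eta>h 0 x = Rh L N \<mu> r b \<eta>0 x \<and> uh 0 x = Rh0 L N \<mu> r d u0 x)"

end

theory Submission imports Defs begin

text \<open>
  The errors are split by the elliptic projections into \<open>\<theta> = \<eta>\<^sub>h - R\<^sub>h \<eta>\<close> and \<open>\<xi> = u\<^sub>h - R\<^sub>h\<^sup>0 u\<close>. The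
  term \<open>a \<partial>\<^sub>h\<^sup>2 u\<^sub>h\<close> prevents an energy argument in a single norm, but the system closes in
  \<open>\<parallel>\<theta>\<parallel> + \<parallel>\<xi>\<parallel>\<^sub>1\<close>: in time-integrated form, the second equation tested with \<open>\<xi>\<close> bounds \<open>\<parallel>\<xi>\<parallel>\<^sub>1\<close>,
  while \<open>\<parallel>\<theta>\<parallel>\<close> is bounded by duality with the Neumann problem \<open>\<Psi> - b \<Psi>\<^sub>x\<^sub>x = \<theta>\<close>, in which \<open>(\<partial>\<^sub>h\<^sup>2 \<xi>, \<Psi>\<^sub>x)\<close> may be moved back
  to \<open>(\<xi>\<^sub>x, \<Psi>\<^sub>x\<^sub>x)\<close> up to projection errors because \<open>\<Psi>\<^sub>x\<close> vanishes at \<open>\<plusminus>L\<close>. Gronwall's inequality then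
  gives the optimal orders.

  The nonlinearities are first truncated at a level above the exact solution, which makes the
  semidiscrete problem a globally Lipschitz differential equation, solvable on \<open>[0, T]\<close>. By the error
  estimate in \<open>H\<^sup>1\<close> and Sobolev's inequality the truncation is inactive on fine meshes. The finitely many coarse meshes
  only enlarge the constant, since on each of them the solution, if there is one, is unique and bounded.
\<close>

section \<open>Bilinear forms on finite-dimensional function spaces\<close>

text \<open>Testing the first error equation with \<open>\<theta>\<close> leaves the term
  \<open>(\<partial>\<^sub>h\<^sup>2 \<xi>, \<theta>\<^sub>x)\<close>, one derivative of
  \<open>\<xi>\<close> more than the form \<open>A\<^sub>d\<close> controls; the inverse inequality
  would then put 1/h into Gronwall's exponent. The dual function supplies the derivative that
  neither error can spare. Integration in time takes the projection errors out of the left-hand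
  sides: \<open>A\<^sub>b (R\<^sub>h \<eta>) \<chi> = A\<^sub>b \<eta> \<chi>\<close> holds for
  splines at each fixed time, so these errors enter only through the fluxes, in L2, and
  undifferentiated in time. The mixed derivatives of the exact solution are known to exist merely
  pointwise, and the integrated form makes this sufficient. All fluxes are written with the space
  derivative on the test function. Hence a Lipschitz clamp can truncate them, and apart from the
  discrete Laplacian they ask only for L2 information on the errors. The dispersive term stays
  consistent to order r because u_xx vanishes at the ends as well: it can be approximated in the
  spline space with zero boundary values.\<close>

definition fun_subspace :: "(real \<Rightarrow> real) set \<Rightarrow> bool" where
  "fun_subspace V \<longleftrightarrow> (\<lambda>x. 0) \<in> V \<and> (\<forall>f\<in>V. \<forall>g\<in>V. (\<lambda>x. f x + g x) \<in> V) \<and>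
     (\<forall>f\<in>V. \<forall>c. (\<lambda>x. c * f x) \<in> V)"

lemma
  assumes "fun_subspace V"
  shows fun_subspace_zero: "(\<lambda>x. 0) \<in> V"
    and fun_subspace_add: "f \<in> V \<Longrightarrow> g \<in> V \<Longrightarrow> (\<lambda>x. f x + g x) \<in> V"
    and fun_subspace_scale: "f \<in> V \<Longrightarrow> (\<lambda>x. c * f x) \<in> V"
  using assms unfolding fun_subspace_def by blast+

lemma fun_subspace_diff:
  assumes "fun_subspace V" "f \<in> V" "g \<in> V"
  shows "(\<lambda>x. f x - g x) \<in> V"
  using fun_subspace_add[OF assms(1,2) fun_subspace_scale[OF assms(1,3), of "-1"]] by simp

lemma fun_subspace_sum:
  assumes "fun_subspace V" "finite A" "\<And>i. i \<in> A \<Longrightarrow> f i \<in> V"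
  shows "(\<lambda>x. \<Sum>i\<in>A. c i * f i x) \<in> V"
  using assms(2,3)
proof (induction A rule: finite_induct)
  case empty
  then show ?case using fun_subspace_zero[OF assms(1)] by simp
next
  case (insert a A)
  then show ?case
    using fun_subspace_add[OF assms(1) fun_subspace_scale[OF assms(1), of "f a" "c a"]] by simp
qed

text \<open>Prepares the induction step of both basis constructions below: discarding one spanning
  function leaves those members of \<open>W\<close> that the others still represent on
  \<open>X\<close>.\<close>

lemma spanned_subspace:
  assumes "fun_subspace W"
  shows "fun_subspace {v \<in> W. \<exists>c. \<forall>x\<in>X. v x = (\<Sum>j\<in>J. c j * e j x)}" (is "fun_subspace ?V")
  unfolding fun_subspace_def
proof (intro conjI ballI allI)
  show "(\<lambda>x. 0) \<in> ?V"
    using fun_subspace_zero[OF assms] by (auto intro!: exI[of _ "\<lambda>_. 0"])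
next
  fix f g assume f: "f \<in> ?V" and g: "g \<in> ?V"
  from f obtain c1 where c1: "f \<in> W" "\<forall>x\<in>X. f x = (\<Sum>j\<in>J. c1 j * e j x)" by auto
  from g obtain c2 where c2: "g \<in> W" "\<forall>x\<in>X. g x = (\<Sum>j\<in>J. c2 j * e j x)" by auto
  have "\<forall>x\<in>X. f x + g x = (\<Sum>j\<in>J. (c1 j + c2 j) * e j x)"
    using c1 c2 by (simp add: sum.distrib distrib_right)
  then show "(\<lambda>x. f x + g x) \<in> ?V"
    using fun_subspace_add[OF assms c1(1) c2(1)] by (auto intro!: exI[of _ "\<lambda>j. c1 j + c2 j"])
next
  fix f k assume f: "f \<in> ?V"
  from f obtain c1 where c1: "f \<in> W" "\<forall>x\<in>X. f x = (\<Sum>j\<in>J. c1 j * e j x)" by auto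
  have "\<forall>x\<in>X. k * f x = (\<Sum>j\<in>J. (k * c1 j) * e j x)"
    using c1 by (simp add: sum_distrib_left mult_ac)
  then show "(\<lambda>x. k * f x) \<in> ?V"
    using fun_subspace_scale[OF assms c1(1)] by (auto intro!: exI[of _ "\<lambda>j. k * c1 j"])
qed

text \<open>Only semidefiniteness is demanded: functions that agree on the interval, or off finitely
  many of its points, are distinct members of \<open>V\<close> that the integrals cannot tell
  apart.\<close>

locale psd_form =
  fixes V :: "(real \<Rightarrow> real) set" and B :: "(real \<Rightarrow> real) \<Rightarrow> (real \<Rightarrow> real) \<Rightarrow> real"
  assumes V: "fun_subspace V"
    and sym: "f \<in> V \<Longrightarrow> g \<in> V \<Longrightarrow> B f g = B g f"
    and add_left: "f \<in> V \<Longrightarrow> g \<in> V \<Longrightarrow> h \<in> V \<Longrightarrow> B (\<lambda>x. f x + g x) h = B f h + B g h"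
    and scale_left: "f \<in> V \<Longrightarrow> g \<in> V \<Longrightarrow> B (\<lambda>x. c * f x) g = c * B f g"
    and nonneg: "f \<in> V \<Longrightarrow> 0 \<le> B f f"
begin

lemmas V_zero = fun_subspace_zero[OF V]
  and V_add = fun_subspace_add[OF V]
  and V_scale = fun_subspace_scale[OF V]
  and V_diff = fun_subspace_diff[OF V]
  and V_sum = fun_subspace_sum[OF V]

lemma diff_left: "f \<in> V \<Longrightarrow> g \<in> V \<Longrightarrow> h \<in> V \<Longrightarrow> B (\<lambda>x. f x - g x) h = B f h - B g h"
  using add_left[of f "\<lambda>x. -1 * g x" h] scale_left[of g h "-1"] V_scale[of g "-1"] by simp

lemma add_right: "f \<in> V \<Longrightarrow> g \<in> V \<Longrightarrow> h \<in> V \<Longrightarrow> B h (\<lambda>x. f x + g x) = B h f + B h g"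
  using add_left[of f g h] sym V_add by simp

lemma diff_right: "f \<in> V \<Longrightarrow> g \<in> V \<Longrightarrow> h \<in> V \<Longrightarrow> B h (\<lambda>x. f x - g x) = B h f - B h g"
  using diff_left[of f g h] sym V_diff by simp

lemma scale_right: "f \<in> V \<Longrightarrow> g \<in> V \<Longrightarrow> B g (\<lambda>x. c * f x) = c * B g f"
  using scale_left[of f g c] sym V_scale by simp

lemma zero_left: "f \<in> V \<Longrightarrow> B (\<lambda>x. 0) f = 0"
  using scale_left[of "\<lambda>x. 0" f 0] V_zero by simp

lemma sum_left:
  assumes "finite A" "\<And>i. i \<in> A \<Longrightarrow> f i \<in> V" "g \<in> V"
  shows "B (\<lambda>x. \<Sum>i\<in>A. c i * f i x) g = (\<Sum>i\<in>A. c i * B (f i) g)"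
  using assms(1,2)
proof (induction A rule: finite_induct)
  case empty
  then show ?case using zero_left[OF assms(3)] by simp
next
  case (insert a A)
  have "(\<lambda>x. \<Sum>i\<in>A. c i * f i x) \<in> V" using V_sum[of A f c] insert by auto
  then show ?case
    using insert add_left[of "\<lambda>x. c a * f a x" "\<lambda>x. \<Sum>i\<in>A. c i * f i x" g]
      V_scale[of "f a" "c a"] scale_left[of "f a" g "c a"] assms(3) by simp
qed

lemma sum_right:
  assumes "finite A" "\<And>i. i \<in> A \<Longrightarrow> f i \<in> V" "g \<in> V"
  shows "B g (\<lambda>x. \<Sum>i\<in>A. c i * f i x) = (\<Sum>i\<in>A. c i * B g (f i))"
proof -
  have "(\<lambda>x. \<Sum>i\<in>A. c i * f i x) \<in> V" using V_sum[of A f c] assms by auto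
  then have "B g (\<lambda>x. \<Sum>i\<in>A. c i * f i x) = (\<Sum>i\<in>A. c i * B (f i) g)"
    using sum_left[of A f g c] sym[OF assms(3)] assms by simp
  also have "\<dots> = (\<Sum>i\<in>A. c i * B g (f i))"
    using assms sym[OF assms(3)] by (intro sum.cong) auto
  finally show ?thesis .
qed

lemma square_add:
  assumes "f \<in> V" "g \<in> V"
  shows "B (\<lambda>x. f x + g x) (\<lambda>x. f x + g x) = B f f + 2 * B f g + B g g"
  using assms add_left[OF assms V_add[OF assms]] add_right[OF assms] sym[OF assms] by simp

lemma square_scale:
  assumes "f \<in> V"
  shows "B (\<lambda>x. c * f x) (\<lambda>x. c * f x) = c\<^sup>2 * B f f"
  using scale_left[OF assms V_scale[OF assms], of c c] scale_right[OF assms assms, of c]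
  by (simp add: power2_eq_square)

lemma Cauchy_Schwarz:
  assumes "f \<in> V" "g \<in> V"
  shows "(B f g)\<^sup>2 \<le> B f f * B g g"
proof -
  have *: "0 \<le> B f f + 2 * c * B f g + c\<^sup>2 * B g g" for c
    using nonneg[OF V_add[OF assms(1) V_scale[OF assms(2), of c]]]
      square_add[OF assms(1) V_scale[OF assms(2), of c]] square_scale[OF assms(2), of c]
      scale_right[OF assms(2,1), of c] by simp
  show ?thesis
  proof (cases "B g g = 0")
    case True
    have "B f g = 0"
    proof (rule ccontr)
      assume n: "B f g \<noteq> 0"
      show False using *[of "- (B f f + 1) / (2 * B f g)"] n nonneg[OF assms(1)] True
        by (simp add: field_simps)
    qed
    then show ?thesis using True by simp
  next
    case False
    then have pos: "0 < B g g" using nonneg[OF assms(2)] by simp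
    have "0 \<le> B f f - (B f g)\<^sup>2 / B g g"
      using *[of "- B f g / B g g"] pos by (simp add: power2_eq_square field_simps)
    then show ?thesis using pos by (simp add: field_simps)
  qed
qed

lemma abs_le:
  assumes "f \<in> V" "g \<in> V"
  shows "\<bar>B f g\<bar> \<le> sqrt (B f f) * sqrt (B g g)"
proof -
  have "\<bar>B f g\<bar> = sqrt ((B f g)\<^sup>2)" by simp
  also have "\<dots> \<le> sqrt (B f f * B g g)" using Cauchy_Schwarz[OF assms] real_sqrt_le_mono by blast
  finally show ?thesis by (simp add: real_sqrt_mult)
qed

lemma triangle_add:
  assumes "f \<in> V" "g \<in> V"
  shows "sqrt (B (\<lambda>x. f x + g x) (\<lambda>x. f x + g x)) \<le> sqrt (B f f) + sqrt (B g g)"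
proof (rule real_le_lsqrt)
  show "B (\<lambda>x. f x + g x) (\<lambda>x. f x + g x) \<le> (sqrt (B f f) + sqrt (B g g))\<^sup>2"
    using abs_le[OF assms] nonneg[OF assms(1)] nonneg[OF assms(2)] square_add[OF assms]
    by (simp add: power2_sum)
qed (use nonneg assms in auto)

lemma sqrt_scale: "f \<in> V \<Longrightarrow> sqrt (B (\<lambda>x. c * f x) (\<lambda>x. c * f x)) = \<bar>c\<bar> * sqrt (B f f)"
  using square_scale[of f c] by (simp add: real_sqrt_mult)

lemma triangle_diff:
  assumes "f \<in> V" "g \<in> V"
  shows "sqrt (B (\<lambda>x. f x - g x) (\<lambda>x. f x - g x)) \<le> sqrt (B f f) + sqrt (B g g)"
  using triangle_add[OF assms(1) V_scale[OF assms(2), of "-1"]] sqrt_scale[OF assms(2), of "-1"]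
  by simp

lemma null_left:
  assumes "f \<in> V" "g \<in> V" "B f f = 0"
  shows "B f g = 0"
  using Cauchy_Schwarz[OF assms(1,2)] assms(3) by simp

text \<open>Gram-Schmidt, by induction on the spanning set. The \<open>e j\<close> merely represent
  members of \<open>W\<close> on \<open>X\<close> and may lie outside \<open>W\<close> and
  \<open>V\<close>: splines will be represented by discontinuous truncated monomials. The expansion
  is therefore expressed through \<open>B\<close>, not through the \<open>e j\<close>.\<close>

lemma orthonormal_basis:
  assumes "finite J" "W \<subseteq> V" "fun_subspace W"
    and "\<And>v. v \<in> W \<Longrightarrow> \<exists>c. \<forall>x\<in>X. v x = (\<Sum>j\<in>J. c j * e j x)"
    and "\<And>v. v \<in> W \<Longrightarrow> B v v = 0 \<longleftrightarrow> (\<forall>x\<in>X. v x = 0)"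
  shows "\<exists>(n::nat) \<phi>. (\<forall>i<n. \<phi> i \<in> W) \<and> (\<forall>i<n. \<forall>j<n. B (\<phi> i) (\<phi> j) = (if i = j then 1 else 0)) \<and>
    (\<forall>v\<in>W. \<forall>x\<in>X. v x = (\<Sum>i<n. B v (\<phi> i) * \<phi> i x))"
  using assms
proof (induction J arbitrary: W rule: finite_induct)
  case empty
  then show ?case by (intro exI[of _ 0]) auto
next
  case (insert j J)
  note WV = insert.prems(1) and Wsub = insert.prems(2) and span = insert.prems(3)
    and def = insert.prems(4)
  define W' where "W' = {v \<in> W. \<exists>c. \<forall>x\<in>X. v x = (\<Sum>j\<in>J. c j * e j x)}"
  have W'W: "W' \<subseteq> W" by (auto simp: W'_def)
  have W'sub: "fun_subspace W'" unfolding W'_def by (rule spanned_subspace[OF Wsub])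
  have "\<exists>(n::nat) \<phi>. (\<forall>i<n. \<phi> i \<in> W') \<and> (\<forall>i<n. \<forall>j<n. B (\<phi> i) (\<phi> j) = (if i = j then 1 else 0)) \<and>
    (\<forall>v\<in>W'. \<forall>x\<in>X. v x = (\<Sum>i<n. B v (\<phi> i) * \<phi> i x))"
  proof (rule insert.IH)
    show "W' \<subseteq> V" using W'W WV by blast
    show "fun_subspace W'" by (rule W'sub)
    show "\<And>v. v \<in> W' \<Longrightarrow> \<exists>c. \<forall>x\<in>X. v x = (\<Sum>j\<in>J. c j * e j x)" by (auto simp: W'_def)
    show "\<And>v. v \<in> W' \<Longrightarrow> (B v v = 0) = (\<forall>x\<in>X. v x = 0)" using def W'W by blast
  qed
  then obtain n :: nat and \<phi> where *: "(\<forall>i<n. \<phi> i \<in> W') \<and>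
    (\<forall>i<n. \<forall>j<n. B (\<phi> i) (\<phi> j) = (if i = j then 1 else 0)) \<and>
    (\<forall>v\<in>W'. \<forall>x\<in>X. v x = (\<Sum>i<n. B v (\<phi> i) * \<phi> i x))" by blast
  have phi: "\<phi> i \<in> W'" if "i < n" for i using * that by blast
  have ortho: "B (\<phi> i) (\<phi> j) = (if i = j then 1 else 0)" if "i < n" "j < n" for i j
    using conjunct1[OF conjunct2[OF *]] that by blast
  have expand: "v x = (\<Sum>i<n. B v (\<phi> i) * \<phi> i x)" if "v \<in> W'" "x \<in> X" for v x
    using conjunct2[OF conjunct2[OF *]] that by blast
  show ?case
  proof (cases "W = W'")
    case True
    show ?thesis using phi ortho expand unfolding True by (intro exI[of _ n] exI[of _ \<phi>]) auto
  next
    case False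
    then obtain v where v: "v \<in> W" "v \<notin> W'" using W'W by blast
    obtain cv where cv: "\<And>x. x \<in> X \<Longrightarrow> v x = (\<Sum>j\<in>insert j J. cv j * e j x)"
      using span[OF v(1)] by blast
    have cvj: "cv j \<noteq> 0"
    proof
      assume "cv j = 0"
      then have "\<forall>x\<in>X. v x = (\<Sum>j\<in>J. cv j * e j x)" using cv insert.hyps by simp
      then show False using v by (auto simp: W'_def)
    qed
    define p where "p = (\<lambda>x. \<Sum>i<n. B v (\<phi> i) * \<phi> i x)"
    define w where "w = (\<lambda>x. v x - p x)"
    have pW': "p \<in> W'" unfolding p_def by (rule fun_subspace_sum[OF W'sub]) (use phi in auto)
    have wW: "w \<in> W" unfolding w_def by (rule fun_subspace_diff[OF Wsub v(1)]) (use pW' W'W in blast)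
    have wW': "w \<notin> W'"
    proof
      assume "w \<in> W'"
      from fun_subspace_add[OF W'sub this pW'] have "v \<in> W'" by (simp add: w_def)
      then show False using v by simp
    qed
    have "B w w \<noteq> 0"
    proof
      assume "B w w = 0"
      then have "\<forall>x\<in>X. w x = (\<Sum>j\<in>J. 0 * e j x)" using def[OF wW] by simp
      then have "w \<in> W'" unfolding W'_def using wW by (auto intro!: exI[of _ "\<lambda>_. 0"])
      then show False using wW' by simp
    qed
    then have pos: "0 < B w w" using nonneg[of w] wW WV by force
    define \<psi> where "\<psi> = (\<lambda>x. (1 / sqrt (B w w)) * w x)"
    have psiW: "\<psi> \<in> W" unfolding \<psi>_def by (rule fun_subspace_scale[OF Wsub wW])
    have psi1: "B \<psi> \<psi> = 1" unfolding \<psi>_def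
      using square_scale[of w "1 / sqrt (B w w)"] pos wW WV by (auto simp: power_divide)
    have orth_phi: "B (\<phi> i) w = 0" if "i < n" for i
    proof -
      have ph: "\<phi> i \<in> V" using phi[OF that] W'W WV by blast
      have "B (\<phi> i) w = B (\<phi> i) v - B (\<phi> i) p"
        unfolding w_def using diff_right[of v p "\<phi> i"] ph v pW' W'W WV by blast
      also have "B (\<phi> i) p = (\<Sum>k<n. B v (\<phi> k) * B (\<phi> i) (\<phi> k))"
        unfolding p_def by (rule sum_right) (use phi W'W WV ph in auto)
      also have "\<dots> = (\<Sum>k<n. if k = i then B v (\<phi> k) else 0)"
        using ortho[OF that] by (intro sum.cong) auto
      also have "\<dots> = B v (\<phi> i)" using that by simp
      also have "B v (\<phi> i) = B (\<phi> i) v" using sym[of v "\<phi> i"] ph v WV by blast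
      finally show ?thesis by simp
    qed
    \<comment> \<open>The expansion of \<open>u\<close> holds on \<open>X\<close> only, so
      \<open>z\<close> may be nonzero elsewhere; but \<open>B z z = 0\<close>, and Cauchy-Schwarz
      makes \<open>z\<close> orthogonal to everything.\<close>
    have orth: "B u \<psi> = 0" if u: "u \<in> W'" for u
    proof -
      define z where "z = (\<lambda>x. u x - (\<Sum>i<n. B u (\<phi> i) * \<phi> i x))"
      have sW': "(\<lambda>x. \<Sum>i<n. B u (\<phi> i) * \<phi> i x) \<in> W'"
        by (rule fun_subspace_sum[OF W'sub]) (use phi in auto)
      have zW: "z \<in> W'" unfolding z_def by (rule fun_subspace_diff[OF W'sub u sW'])
      have "\<forall>x\<in>X. z x = 0" using expand[OF u] by (simp add: z_def)
      then have "B z z = 0" using def[of z] zW W'W by blast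
      then have "B z w = 0" using null_left[of z w] zW wW W'W WV by blast
      moreover have "B z w = B u w - B (\<lambda>x. \<Sum>i<n. B u (\<phi> i) * \<phi> i x) w"
        unfolding z_def using diff_left[of u _ w] u sW' wW W'W WV by blast
      moreover have "B (\<lambda>x. \<Sum>i<n. B u (\<phi> i) * \<phi> i x) w = (\<Sum>i<n. B u (\<phi> i) * B (\<phi> i) w)"
        by (rule sum_left) (use phi W'W WV wW in auto)
      moreover have "(\<Sum>i<n. B u (\<phi> i) * B (\<phi> i) w) = 0" using orth_phi by simp
      ultimately have "B u w = 0" by simp
      moreover have "B u \<psi> = (1 / sqrt (B w w)) * B u w"
        unfolding \<psi>_def using scale_right[of w u] u wW W'W WV by blast
      ultimately show ?thesis by simp
    qed
    have expand': "u x = (\<Sum>i<n. B u (\<phi> i) * \<phi> i x) + B u \<psi> * \<psi> x" if u: "u \<in> W" and x: "x \<in> X" for u x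
    proof -
      obtain cu where cu: "\<And>x. x \<in> X \<Longrightarrow> u x = (\<Sum>j\<in>insert j J. cu j * e j x)"
        using span[OF u] by blast
      \<comment> \<open>Cancels the coefficient of \<open>e j\<close>, so that
        \<open>u - l * v\<close> falls into \<open>W'\<close>: the codimension of \<open>W'\<close>
        in \<open>W\<close> is one.\<close>
      define l where "l = cu j / cv j"
      have lW: "(\<lambda>x. l * w x) \<in> W" by (rule fun_subspace_scale[OF Wsub wW])
      have "(\<lambda>x. u x - l * v x) \<in> W'"
        unfolding W'_def
      proof (intro CollectI conjI exI ballI)
        show "(\<lambda>x. u x - l * v x) \<in> W"
          by (intro fun_subspace_diff[OF Wsub] fun_subspace_scale[OF Wsub] u v)
        fix x assume x: "x \<in> X"
        show "u x - l * v x = (\<Sum>j\<in>J. (cu j - l * cv j) * e j x)"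
          using cu[OF x] cv[OF x] insert.hyps cvj
          by (simp add: l_def sum_subtractf sum_distrib_left algebra_simps)
      qed
      from fun_subspace_add[OF W'sub this fun_subspace_scale[OF W'sub pW', of l]]
      have mem: "(\<lambda>x. u x - l * w x) \<in> W'" by (simp add: w_def algebra_simps)
      have uV: "u \<in> V" and lV: "(\<lambda>x. l * w x) \<in> V" and psiV: "\<psi> \<in> V" and wV: "w \<in> V"
        using u lW psiW wW WV by blast+
      have "B (\<lambda>x. l * w x) \<psi> = l * B w \<psi>" by (rule scale_left[OF wV psiV])
      also have "B w \<psi> = (1 / sqrt (B w w)) * B w w" unfolding \<psi>_def by (rule scale_right[OF wV wV])
      finally have 1: "B (\<lambda>x. l * w x) \<psi> = l * sqrt (B w w)" using pos by (simp add: real_div_sqrt)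
      have "B u \<psi> - B (\<lambda>x. l * w x) \<psi> = 0"
        using orth[OF mem] diff_left[OF uV lV psiV] by simp
      then have 2: "B u \<psi> * \<psi> x = l * w x" using 1 pos by (simp add: \<psi>_def)
      have 3: "B (\<lambda>x. u x - l * w x) (\<phi> i) = B u (\<phi> i)" if "i < n" for i
      proof -
        have ph: "\<phi> i \<in> V" using phi[OF that] W'W WV by blast
        have "B (\<lambda>x. u x - l * w x) (\<phi> i) = B u (\<phi> i) - l * B w (\<phi> i)"
          using diff_left[OF uV lV ph] scale_left[OF wV ph] by simp
        then show ?thesis using orth_phi[OF that] sym[OF wV ph] by simp
      qed
      have "u x - l * w x = (\<Sum>i<n. B u (\<phi> i) * \<phi> i x)"
        using expand[OF mem x] 3 by simp
      then show ?thesis using 2 by simp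
    qed
    define \<phi>' where "\<phi>' = (\<lambda>i. if i < n then \<phi> i else \<psi>)"
    have "\<forall>i<Suc n. \<phi>' i \<in> W" using phi W'W psiW by (auto simp: \<phi>'_def)
    moreover have "\<forall>i<Suc n. \<forall>j<Suc n. B (\<phi>' i) (\<phi>' j) = (if i = j then 1 else 0)"
    proof -
      have 1: "B (\<phi> i) \<psi> = 0" "B \<psi> (\<phi> i) = 0" if "i < n" for i
        using orth[OF phi[OF that]] sym[of \<psi> "\<phi> i"] phi[OF that] psiW W'W WV by auto
      show ?thesis using 1 ortho psi1 by (auto simp: \<phi>'_def less_Suc_eq)
    qed
    moreover have "\<forall>v\<in>W. \<forall>x\<in>X. v x = (\<Sum>i<Suc n. B v (\<phi>' i) * \<phi>' i x)"
    proof (intro ballI)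
      fix v x assume "v \<in> W" "x \<in> X"
      from expand'[OF this] show "v x = (\<Sum>i<Suc n. B v (\<phi>' i) * \<phi>' i x)" by (simp add: \<phi>'_def)
    qed
    ultimately show ?thesis by (intro exI[of _ "Suc n"] exI[of _ \<phi>'] conjI)
  qed
qed

end

text \<open>The same induction with point evaluations in place of a form: a \<open>w\<close> outside
  \<open>W'\<close> that vanishes at the old points is nonzero at some further point of
  \<open>X\<close>. Point values become coordinates, which turns hypotheses on
  \<open>t \<mapsto> v t x\<close> at fixed \<open>x\<close> into statements about norms.\<close>

lemma nodal_basis:
  assumes "finite J" "fun_subspace W"
    and "\<And>v. v \<in> W \<Longrightarrow> \<exists>c. \<forall>x\<in>X. v x = (\<Sum>j\<in>J. c j * e j x)"
  shows "\<exists>(n::nat) \<phi> p. (\<forall>i<n. \<phi> i \<in> W \<and> p i \<in> X) \<and>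
    (\<forall>i<n. \<forall>j<n. \<phi> i (p j) = (if i = j then 1 else 0)) \<and>
    (\<forall>v\<in>W. \<forall>x\<in>X. v x = (\<Sum>i<n. v (p i) * \<phi> i x))"
  using assms
proof (induction J arbitrary: W rule: finite_induct)
  case empty
  then show ?case by (intro exI[of _ 0]) auto
next
  case (insert j J)
  note Wsub = insert.prems(1) and span = insert.prems(2)
  define W' where "W' = {v \<in> W. \<exists>c. \<forall>x\<in>X. v x = (\<Sum>j\<in>J. c j * e j x)}"
  have W'W: "W' \<subseteq> W" by (auto simp: W'_def)
  have W'sub: "fun_subspace W'" unfolding W'_def by (rule spanned_subspace[OF Wsub])
  have "\<exists>(n::nat) \<phi> p. (\<forall>i<n. \<phi> i \<in> W' \<and> p i \<in> X) \<and>
    (\<forall>i<n. \<forall>j<n. \<phi> i (p j) = (if i = j then 1 else 0)) \<and>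
    (\<forall>v\<in>W'. \<forall>x\<in>X. v x = (\<Sum>i<n. v (p i) * \<phi> i x))"
    by (rule insert.IH[OF W'sub]) (auto simp: W'_def)
  then obtain n :: nat and \<phi> p where *: "(\<forall>i<n. \<phi> i \<in> W' \<and> p i \<in> X) \<and>
    (\<forall>i<n. \<forall>j<n. \<phi> i (p j) = (if i = j then 1 else 0)) \<and>
    (\<forall>v\<in>W'. \<forall>x\<in>X. v x = (\<Sum>i<n. v (p i) * \<phi> i x))" by blast
  have phi: "\<phi> i \<in> W'" and p: "p i \<in> X" if "i < n" for i using * that by blast+
  have delta: "\<phi> i (p j) = (if i = j then 1 else 0)" if "i < n" "j < n" for i j
    using conjunct1[OF conjunct2[OF *]] that by blast
  have expand: "v x = (\<Sum>i<n. v (p i) * \<phi> i x)" if "v \<in> W'" "x \<in> X" for v x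
    using conjunct2[OF conjunct2[OF *]] that by blast
  show ?case
  proof (cases "W = W'")
    case True
    show ?thesis using phi p delta expand unfolding True
      by (intro exI[of _ n] exI[of _ \<phi>] exI[of _ p]) auto
  next
    case False
    then obtain v where v: "v \<in> W" "v \<notin> W'" using W'W by blast
    obtain cv where cv: "\<And>x. x \<in> X \<Longrightarrow> v x = (\<Sum>j\<in>insert j J. cv j * e j x)"
      using span[OF v(1)] by blast
    have cvj: "cv j \<noteq> 0"
    proof
      assume "cv j = 0"
      then have "\<forall>x\<in>X. v x = (\<Sum>j\<in>J. cv j * e j x)" using cv insert.hyps by simp
      then show False using v by (auto simp: W'_def)
    qed
    define q where "q = (\<lambda>x. \<Sum>i<n. v (p i) * \<phi> i x)"
    define w where "w = (\<lambda>x. v x - q x)"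
    have qW': "q \<in> W'" unfolding q_def by (rule fun_subspace_sum[OF W'sub]) (use phi in auto)
    have wW: "w \<in> W" unfolding w_def by (rule fun_subspace_diff[OF Wsub v(1)]) (use qW' W'W in blast)
    have wW': "w \<notin> W'"
    proof
      assume "w \<in> W'"
      from fun_subspace_add[OF W'sub this qW'] have "v \<in> W'" by (simp add: w_def)
      then show False using v by simp
    qed
    obtain y where y: "y \<in> X" "w y \<noteq> 0"
    proof -
      have "\<not> (\<forall>x\<in>X. w x = 0)"
        using wW' wW by (auto simp: W'_def dest!: spec[of _ "\<lambda>_. 0"])
      then show ?thesis using that by auto
    qed
    have wp: "w (p i) = 0" if "i < n" for i
    proof -
      have "q (p i) = (\<Sum>k<n. if k = i then v (p k) else 0)"
        unfolding q_def using delta that by (intro sum.cong) auto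
      then show ?thesis using that by (simp add: w_def)
    qed
    define \<psi> where "\<psi> = (\<lambda>x. (1 / w y) * w x)"
    have psiW: "\<psi> \<in> W" unfolding \<psi>_def by (rule fun_subspace_scale[OF Wsub wW])
    have psiy: "\<psi> y = 1" and psip: "\<And>i. i < n \<Longrightarrow> \<psi> (p i) = 0" using y wp by (auto simp: \<psi>_def)
    \<comment> \<open>The old basis functions are corrected to vanish at the new point
      \<open>y\<close>, which restores the Kronecker property.\<close>
    define \<phi>' where "\<phi>' = (\<lambda>i. if i < n then (\<lambda>x. \<phi> i x - \<phi> i y * \<psi> x) else \<psi>)"
    define p' where "p' = (\<lambda>i. if i < n then p i else y)"
    have expand': "u x = (\<Sum>i<Suc n. u (p' i) * \<phi>' i x)" if u: "u \<in> W" and x: "x \<in> X" for u x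
    proof -
      obtain cu where cu: "\<And>x. x \<in> X \<Longrightarrow> u x = (\<Sum>j\<in>insert j J. cu j * e j x)"
        using span[OF u] by blast
      define l where "l = cu j / cv j"
      have "(\<lambda>x. u x - l * v x) \<in> W'"
        unfolding W'_def
      proof (intro CollectI conjI exI ballI)
        show "(\<lambda>x. u x - l * v x) \<in> W"
          by (intro fun_subspace_diff[OF Wsub] fun_subspace_scale[OF Wsub] u v)
        fix x assume x: "x \<in> X"
        show "u x - l * v x = (\<Sum>j\<in>J. (cu j - l * cv j) * e j x)"
          using cu[OF x] cv[OF x] insert.hyps cvj
          by (simp add: l_def sum_subtractf sum_distrib_left algebra_simps)
      qed
      from fun_subspace_add[OF W'sub this fun_subspace_scale[OF W'sub qW', of l]]
      have "(\<lambda>x. u x - l * w x) \<in> W'" by (simp add: w_def algebra_simps)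
      then have mem: "(\<lambda>x. u x - (l * w y) * \<psi> x) \<in> W'" using y by (simp add: \<psi>_def)
      have eq: "u z - (l * w y) * \<psi> z = (\<Sum>i<n. u (p i) * \<phi> i z)" if "z \<in> X" for z
        using expand[OF mem that] psip by simp
      have ly: "l * w y = u y - (\<Sum>i<n. u (p i) * \<phi> i y)" using eq[OF y(1)] psiy by simp
      have "(\<Sum>i<Suc n. u (p' i) * \<phi>' i x)
          = (\<Sum>i<n. u (p i) * \<phi> i x) - (\<Sum>i<n. u (p i) * \<phi> i y) * \<psi> x + u y * \<psi> x"
        by (simp add: \<phi>'_def p'_def right_diff_distrib sum_subtractf sum_distrib_right mult.assoc)
      also have "\<dots> = u x" using eq[OF x] ly by (simp add: algebra_simps)
      finally show ?thesis by simp
    qed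
    have "\<phi>' i \<in> W" if "i < Suc n" for i
    proof (cases "i < n")
      case True
      have "\<phi> i \<in> W" using phi[OF True] W'W by blast
      from fun_subspace_diff[OF Wsub this fun_subspace_scale[OF Wsub psiW, of "\<phi> i y"]]
      show ?thesis using True by (simp add: \<phi>'_def)
    qed (use psiW in \<open>simp add: \<phi>'_def\<close>)
    moreover have "\<forall>i<Suc n. p' i \<in> X" using p y by (auto simp: p'_def)
    moreover have "\<forall>i<Suc n. \<forall>j<Suc n. \<phi>' i (p' j) = (if i = j then 1 else 0)"
      using delta psiy psip by (auto simp: \<phi>'_def p'_def)
    ultimately show ?thesis using expand'
      by (intro exI[of _ "Suc n"] exI[of _ \<phi>'] exI[of _ p'] conjI ballI) blast+
  qed
qed


section \<open>Piecewise continuous and piecewise smooth functions\<close>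

text \<open>Wide enough for \<open>deriv\<close> of a spline, whose value at a node is arbitrary,
  and closed under products, so that \<open>ip\<close> of two such functions is an ordinary
  integral.\<close>

definition pc :: "real set \<Rightarrow> (real \<Rightarrow> real) \<Rightarrow> bool" where
  "pc A g \<longleftrightarrow> bounded (g ` A) \<and> (\<exists>S. finite S \<and> continuous_on (A - S) g)"

lemma pc_continuous: "compact A \<Longrightarrow> continuous_on A g \<Longrightarrow> pc A g"
  unfolding pc_def by (auto intro!: compact_imp_bounded compact_continuous_image exI[of _ "{}"])

lemma pc_const [simp]: "pc A (\<lambda>x. c)"
  unfolding pc_def bounded_iff by (auto intro!: exI[of _ "{}"])

lemma pc_cong_finite:
  assumes "pc A f" "finite S" "\<And>x. x \<in> A - S \<Longrightarrow> f x = g x"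
  shows "pc A g"
proof -
  obtain S' where S': "finite S'" "continuous_on (A - S') f" and b: "bounded (f ` A)"
    using assms(1) by (auto simp: pc_def)
  have "g ` A \<subseteq> f ` A \<union> g ` S" using assms(3) by force
  then have "bounded (g ` A)" using b assms(2) by (meson bounded_Un bounded_subset finite_imageI finite_imp_bounded)
  moreover have "continuous_on (A - (S \<union> S')) g"
    by (rule continuous_on_eq[OF continuous_on_subset[OF S'(2)]]) (use assms(3) in auto)
  ultimately show ?thesis unfolding pc_def using S'(1) assms(2) by (intro conjI exI[of _ "S \<union> S'"]) auto
qed

lemma pc_add:
  assumes "pc A f" "pc A g" shows "pc A (\<lambda>x. f x + g x)"
proof -
  obtain S T where "finite S" "continuous_on (A - S) f" "finite T" "continuous_on (A - T) g"
    using assms by (auto simp: pc_def)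
  then have "finite (S \<union> T) \<and> continuous_on (A - (S \<union> T)) (\<lambda>x. f x + g x)"
    by (auto intro!: continuous_on_add elim!: continuous_on_subset)
  moreover have "bounded ((\<lambda>x. f x + g x) ` A)"
    using assms by (intro bounded_plus_comp) (auto simp: pc_def)
  ultimately show ?thesis unfolding pc_def by blast
qed

lemma pc_mult:
  assumes "pc A f" "pc A g" shows "pc A (\<lambda>x. f x * g x)"
proof -
  obtain S T where "finite S" "continuous_on (A - S) f" "finite T" "continuous_on (A - T) g"
    using assms by (auto simp: pc_def)
  then have "finite (S \<union> T) \<and> continuous_on (A - (S \<union> T)) (\<lambda>x. f x * g x)"
    by (auto intro!: continuous_on_mult elim!: continuous_on_subset)
  moreover obtain a b where ab: "\<And>x. x \<in> A \<Longrightarrow> \<bar>f x\<bar> \<le> a" "\<And>x. x \<in> A \<Longrightarrow> \<bar>g x\<bar> \<le> b"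
    using assms by (force simp: pc_def bounded_iff)
  have "\<bar>f x * g x\<bar> \<le> a * b" if "x \<in> A" for x
    unfolding abs_mult using ab[OF that] by (intro mult_mono) auto
  then have "bounded ((\<lambda>x. f x * g x) ` A)"
    unfolding bounded_iff by (auto intro!: exI[of _ "a * b"])
  ultimately show ?thesis unfolding pc_def by blast
qed

lemma pc_cmult: "pc A f \<Longrightarrow> pc A (\<lambda>x. c * f x)"
  by (rule pc_mult[OF pc_const])

lemma pc_diff: "pc A f \<Longrightarrow> pc A g \<Longrightarrow> pc A (\<lambda>x. f x - g x)"
  using pc_add[OF _ pc_cmult, of A f g "-1"] by simp

lemma pc_subspace: "fun_subspace {g. pc A g}"
  unfolding fun_subspace_def by (auto intro: pc_add pc_cmult)

lemma pc_set_integrable: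
  assumes "pc {a..b} g"
  shows "set_integrable lborel {a..b} g"
proof -
  obtain S where S: "finite S" "continuous_on ({a..b} - S) g" and b: "bounded (g ` {a..b})"
    using assms by (auto simp: pc_def)
  obtain c where c: "\<And>x. x \<in> {a..b} \<Longrightarrow> \<bar>g x\<bar> \<le> c" using b by (force simp: bounded_iff)
  have "(\<lambda>x. indicator ({a..b} - S) x *\<^sub>R g x) \<in> borel_measurable borel"
    using borel_measurable_continuous_on_indicator[OF _ S(2)] S(1) by (simp add: finite_imp_closed)
  then have "(\<lambda>x. indicator {a..b} x *\<^sub>R g x) \<in> borel_measurable borel"
    by (rule measurable_discrete_difference[OF _ countable_finite[OF S(1)]]) (auto split: split_indicator)
  then have m: "(\<lambda>x. indicator {a..b} x *\<^sub>R g x) \<in> borel_measurable lborel" by simp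
  show ?thesis unfolding set_integrable_def
    by (rule integrableI_bounded_set[of "{a..b}" _ _ c]) (use m c in \<open>auto split: split_indicator simp: emeasure_lborel_Icc_eq\<close>)
qed

lemma pc_integrable:
  assumes "pc {a..b} g"
  shows "g integrable_on {a..b}" and "(LINT x:{a..b}|lborel. g x) = integral {a..b} g"
  using set_borel_integral_eq_integral[OF pc_set_integrable[OF assms]] by auto

lemma ip_eq_integral:
  assumes "pc {-L..L} v" "pc {-L..L} w"
  shows "ip L v w = integral {-L..L} (\<lambda>x. v x * w x)"
  unfolding ip_def by (rule pc_integrable[OF pc_mult[OF assms]])

text \<open>The endpoints join the exceptional set because the two-sided \<open>deriv\<close> at
  \<open>-L\<close> and \<open>L\<close> depends on values outside the interval. For the same reason
  the later congruence rules compare functions on the open interval.\<close>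

lemma ip_cong_finite:
  assumes "finite S" "\<And>x. x \<in> {-L<..<L} - S \<Longrightarrow> v x = v' x"
    "\<And>x. x \<in> {-L<..<L} - S \<Longrightarrow> w x = w' x"
  shows "ip L v w = ip L v' w'"
  unfolding ip_def set_lebesgue_integral_def
proof (rule integral_discrete_difference[of "S \<union> {-L, L}"])
  fix x assume "x \<notin> S \<union> {-L, L}"
  then show "indicator {-L..L} x *\<^sub>R (v x * w x) = indicator {-L..L} x *\<^sub>R (v' x * w' x)"
    using assms(2,3)[of x] by (cases "x \<in> {-L..L}") auto
qed (use assms(1) in \<open>auto intro: countable_finite\<close>)

lemma ip_cong:
  assumes "\<And>x. x \<in> {-L<..<L} \<Longrightarrow> v x = v' x" "\<And>x. x \<in> {-L<..<L} \<Longrightarrow> w x = w' x"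
  shows "ip L v w = ip L v' w'"
  by (rule ip_cong_finite[of "{}"]) (use assms in auto)

lemma ip_psd: "psd_form {g. pc {-L..L} g} (ip L)"
proof
  show "fun_subspace {g. pc {-L..L} g}" by (rule pc_subspace)
next
  fix f g :: "real \<Rightarrow> real"
  show "ip L f g = ip L g f" unfolding ip_def by (simp add: mult.commute)
next
  fix f g h assume "f \<in> {g. pc {-L..L} g}" "g \<in> {g. pc {-L..L} g}" "h \<in> {g. pc {-L..L} g}"
  then show "ip L (\<lambda>x. f x + g x) h = ip L f h + ip L g h"
    by (simp add: ip_eq_integral pc_add distrib_right integral_add pc_integrable(1)[OF pc_mult])
next
  fix f g c assume "f \<in> {g. pc {-L..L} g}" "g \<in> {g. pc {-L..L} g}"
  then show "ip L (\<lambda>x. c * f x) g = c * ip L f g"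
    by (simp add: ip_eq_integral pc_cmult mult.assoc)
next
  fix f assume "f \<in> {g. pc {-L..L} g}"
  then show "0 \<le> ip L f f"
    by (auto simp: ip_eq_integral intro!: integral_nonneg pc_integrable(1)[OF pc_mult])
qed

text \<open>The working substitute for H1. It contains the splines and the continuously
  differentiable functions, and its finite exceptional sets let the fundamental theorem and
  integration by parts hold classically.\<close>

definition pw :: "real \<Rightarrow> (real \<Rightarrow> real) \<Rightarrow> bool" where
  "pw L f \<longleftrightarrow> continuous_on {-L..L} f \<and>
     (\<exists>S. finite S \<and> (\<forall>x\<in>{-L<..<L} - S. f differentiable (at x))) \<and> pc {-L..L} (deriv f)"

lemma pw_cont: "pw L f \<Longrightarrow> continuous_on {-L..L} f"
  and pw_pc_deriv: "pw L f \<Longrightarrow> pc {-L..L} (deriv f)"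
  and pw_pc: "pw L f \<Longrightarrow> pc {-L..L} f"
  unfolding pw_def by (auto intro: pc_continuous)

lemma pw_DERIV:
  assumes "pw L f"
  obtains S where "finite S" "\<And>x. x \<in> {-L<..<L} - S \<Longrightarrow> (f has_field_derivative deriv f x) (at x)"
  using assms unfolding pw_def by (metis DERIV_deriv_iff_real_differentiable)

lemma deriv_eq_on_interior:
  fixes f g :: "real \<Rightarrow> real"
  assumes "\<And>x. x \<in> {a<..<b} \<Longrightarrow> f x = g x" "x \<in> {a<..<b}"
  shows "deriv f x = deriv g x"
proof (rule deriv_cong_ev)
  have "eventually (\<lambda>y. y \<in> {a<..<b}) (nhds x)"
    by (rule eventually_nhds_in_open) (use assms(2) in auto)
  then show "\<forall>\<^sub>F y in nhds x. f y = g y" by eventually_elim (use assms(1) in auto)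
qed simp

lemma pwI:
  assumes "continuous_on {-L..L} f" "finite S" "pc {-L..L} g"
    and "\<And>x. x \<in> {-L<..<L} - S \<Longrightarrow> (f has_field_derivative g x) (at x)"
  shows "pw L f" and "\<And>x. x \<in> {-L<..<L} - S \<Longrightarrow> deriv f x = g x"
proof -
  show *: "deriv f x = g x" if "x \<in> {-L<..<L} - S" for x using assms(4)[OF that] by (rule DERIV_imp_deriv)
  have "pc {-L..L} (deriv f)"
    by (rule pc_cong_finite[OF assms(3), of "S \<union> {-L, L}"]) (use assms(2) * in force)+
  then show "pw L f" unfolding pw_def
    using assms(1,2,4) unfolding real_differentiable_def by blast
qed

lemma pw_cong:
  assumes "pw L f" "\<And>x. x \<in> {-L..L} \<Longrightarrow> f x = g x"
  shows "pw L g"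
proof -
  obtain S where S: "finite S" "\<And>x. x \<in> {-L<..<L} - S \<Longrightarrow> (f has_field_derivative deriv f x) (at x)"
    using pw_DERIV[OF assms(1)] by blast
  show ?thesis
  proof (rule pwI(1)[OF _ S(1) pw_pc_deriv[OF assms(1)]])
    show "continuous_on {-L..L} g" using continuous_on_eq[OF pw_cont[OF assms(1)]] assms(2) by blast
    fix x assume x: "x \<in> {-L<..<L} - S"
    show "(g has_field_derivative deriv f x) (at x)"
      by (rule has_field_derivative_transform_within_open[OF S(2)[OF x], of "{-L<..<L}"])
        (use x assms(2) in auto)
  qed
qed

lemma pw_add_deriv:
  assumes "pw L f" "pw L g"
  shows "pw L (\<lambda>x. f x + g x)"
    and "\<exists>S. finite S \<and> (\<forall>x\<in>{-L<..<L} - S. deriv (\<lambda>x. f x + g x) x = deriv f x + deriv g x)"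
proof -
  obtain S where S: "finite S" "\<And>x. x \<in> {-L<..<L} - S \<Longrightarrow> (f has_field_derivative deriv f x) (at x)"
    using pw_DERIV[OF assms(1)] by blast
  obtain T where T: "finite T" "\<And>x. x \<in> {-L<..<L} - T \<Longrightarrow> (g has_field_derivative deriv g x) (at x)"
    using pw_DERIV[OF assms(2)] by blast
  note * = pwI[of L "\<lambda>x. f x + g x" "S \<union> T" "\<lambda>x. deriv f x + deriv g x"]
  show "pw L (\<lambda>x. f x + g x)"
    by (rule *(1)) (use S T assms in \<open>auto intro!: continuous_on_add assms[THEN pw_cont] pc_add assms[THEN pw_pc_deriv] DERIV_add\<close>)
  have "\<forall>x\<in>{-L<..<L} - (S \<union> T). deriv (\<lambda>x. f x + g x) x = deriv f x + deriv g x"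
    by (intro ballI, rule *(2)) (use S T assms in \<open>auto intro!: continuous_on_add assms[THEN pw_cont] pc_add assms[THEN pw_pc_deriv] DERIV_add\<close>)
  then show "\<exists>S. finite S \<and> (\<forall>x\<in>{-L<..<L} - S. deriv (\<lambda>x. f x + g x) x = deriv f x + deriv g x)"
    using S T by blast
qed

lemma pw_mult_deriv:
  assumes "pw L f" "pw L g"
  shows "pw L (\<lambda>x. f x * g x)"
    and "\<exists>S. finite S \<and> (\<forall>x\<in>{-L<..<L} - S. deriv (\<lambda>x. f x * g x) x = deriv f x * g x + deriv g x * f x)"
proof -
  obtain S where S: "finite S" "\<And>x. x \<in> {-L<..<L} - S \<Longrightarrow> (f has_field_derivative deriv f x) (at x)"
    using pw_DERIV[OF assms(1)] by blast
  obtain T where T: "finite T" "\<And>x. x \<in> {-L<..<L} - T \<Longrightarrow> (g has_field_derivative deriv g x) (at x)"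
    using pw_DERIV[OF assms(2)] by blast
  note * = pwI[of L "\<lambda>x. f x * g x" "S \<union> T" "\<lambda>x. deriv f x * g x + deriv g x * f x"]
  show "pw L (\<lambda>x. f x * g x)"
    by (rule *(1)) (use S T assms in \<open>auto intro!: continuous_on_mult assms[THEN pw_cont] pc_add pc_mult assms[THEN pw_pc_deriv] assms[THEN pw_pc] DERIV_mult\<close>)
  have "\<forall>x\<in>{-L<..<L} - (S \<union> T). deriv (\<lambda>x. f x * g x) x = deriv f x * g x + deriv g x * f x"
    by (intro ballI, rule *(2)) (use S T assms in \<open>auto intro!: continuous_on_mult assms[THEN pw_cont] pc_add pc_mult assms[THEN pw_pc_deriv] assms[THEN pw_pc] DERIV_mult\<close>)
  then show "\<exists>S. finite S \<and> (\<forall>x\<in>{-L<..<L} - S. deriv (\<lambda>x. f x * g x) x = deriv f x * g x + deriv g x * f x)"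
    using S T by blast
qed

lemma pw_const [simp]: "pw L (\<lambda>x. c)"
  by (rule pwI(1)[of _ _ "{}" "\<lambda>x. 0"]) auto

lemmas pw_add = pw_add_deriv(1) and pw_mult = pw_mult_deriv(1)

lemma pw_cmult: "pw L f \<Longrightarrow> pw L (\<lambda>x. c * f x)"
  by (rule pw_mult[OF pw_const])

lemma pw_diff: "pw L f \<Longrightarrow> pw L g \<Longrightarrow> pw L (\<lambda>x. f x - g x)"
  using pw_add[OF _ pw_cmult, of L f g "-1"] by simp

lemma pw_subspace: "fun_subspace {f. pw L f}"
  unfolding fun_subspace_def by (auto intro: pw_add pw_cmult)

lemma ip_deriv_add:
  assumes "pw L f" "pw L g" "pc {-L..L} h"
  shows "ip L (deriv (\<lambda>x. f x + g x)) h = ip L (deriv f) h + ip L (deriv g) h"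
proof -
  obtain S where S: "finite S" "\<And>x. x \<in> {-L<..<L} - S \<Longrightarrow> deriv (\<lambda>x. f x + g x) x = deriv f x + deriv g x"
    using pw_add_deriv(2)[OF assms(1,2)] by blast
  have "ip L (deriv (\<lambda>x. f x + g x)) h = ip L (\<lambda>x. deriv f x + deriv g x) h"
    by (rule ip_cong_finite[OF S]) auto
  then show ?thesis using psd_form.add_left[OF ip_psd, of "deriv f" L "deriv g" h] assms by (simp add: pw_pc_deriv)
qed

lemma ip_deriv_cmult:
  assumes "pw L f" "pc {-L..L} h"
  shows "ip L (deriv (\<lambda>x. c * f x)) h = c * ip L (deriv f) h"
proof -
  obtain S where S: "finite S" "\<And>x. x \<in> {-L<..<L} - S \<Longrightarrow> deriv (\<lambda>x. c * f x) x = deriv (\<lambda>x. c) x * f x + deriv f x * c"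
    using pw_mult_deriv(2)[OF pw_const assms(1), of c] by blast
  have "ip L (deriv (\<lambda>x. c * f x)) h = ip L (\<lambda>x. c * deriv f x) h"
    by (rule ip_cong_finite[OF S(1)]) (use S(2) in auto)
  then show ?thesis using psd_form.scale_left[OF ip_psd, of "deriv f" L h c] assms by (simp add: pw_pc_deriv)
qed

section \<open>The forms A_q and the L2 and H1 norms\<close>

lemma ip_commute: "ip L f g = ip L g f"
  unfolding ip_def by (simp add: mult.commute)

lemma A_form_psd: "0 \<le> q \<Longrightarrow> psd_form {f. pw L f} (A_form L q)"
proof
  show "fun_subspace {f. pw L f}" by (rule pw_subspace)
next
  fix f g :: "real \<Rightarrow> real"
  show "A_form L q f g = A_form L q g f" unfolding A_form_def by (simp add: ip_commute)
next
  fix f g h assume "f \<in> {f. pw L f}" "g \<in> {f. pw L f}" "h \<in> {f. pw L f}"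
  then show "A_form L q (\<lambda>x. f x + g x) h = A_form L q f h + A_form L q g h"
    unfolding A_form_def using psd_form.add_left[OF ip_psd, of f L g h]
    by (simp add: ip_deriv_add pw_pc pw_pc_deriv algebra_simps)
next
  fix f g c assume "f \<in> {f. pw L f}" "g \<in> {f. pw L f}"
  then show "A_form L q (\<lambda>x. c * f x) g = c * A_form L q f g"
    unfolding A_form_def using psd_form.scale_left[OF ip_psd, of f L g c]
    by (simp add: ip_deriv_cmult pw_pc pw_pc_deriv algebra_simps)
next
  fix f assume "0 \<le> q" "f \<in> {f. pw L f}"
  then show "0 \<le> A_form L q f f"
    unfolding A_form_def using psd_form.nonneg[OF ip_psd, of f L] psd_form.nonneg[OF ip_psd, of "deriv f" L]
    by (simp add: pw_pc pw_pc_deriv)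
qed

lemma A_form_cong:
  assumes "\<And>x. x \<in> {-L<..<L} \<Longrightarrow> v x = v' x" "\<And>x. x \<in> {-L<..<L} \<Longrightarrow> w x = w' x"
  shows "A_form L q v w = A_form L q v' w'"
  unfolding A_form_def using assms deriv_eq_on_interior[of "-L" L v v'] deriv_eq_on_interior[of "-L" L w w']
  by (intro arg_cong2[where f="(+)"] arg_cong2[where f="(*)"] ip_cong) auto

lemma L2_norm_cong:
  assumes "\<And>x. x \<in> {-L<..<L} \<Longrightarrow> v x = v' x"
  shows "L2_norm L v = L2_norm L v'"
  unfolding L2_norm_def using ip_cong[of L v v' v v'] assms by simp

lemma H1_norm_cong:
  assumes "\<And>x. x \<in> {-L<..<L} \<Longrightarrow> v x = v' x"
  shows "H1_norm L v = H1_norm L v'"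
  unfolding H1_norm_def using L2_norm_cong[of L v v'] L2_norm_cong[of L "deriv v" "deriv v'"]
    deriv_eq_on_interior[of "-L" L v v'] assms by simp

lemma ip_self_nonneg: "0 \<le> ip L v v"
  unfolding ip_def set_lebesgue_integral_def by (rule integral_nonneg_AE) auto

lemma L2_norm_nonneg [simp]: "0 \<le> L2_norm L v"
  unfolding L2_norm_def by (simp add: ip_self_nonneg)

lemma L2_norm_sq: "(L2_norm L v)\<^sup>2 = ip L v v"
  unfolding L2_norm_def by (simp add: ip_self_nonneg)

lemma H1_norm_sq: "(H1_norm L v)\<^sup>2 = (L2_norm L v)\<^sup>2 + (L2_norm L (deriv v))\<^sup>2"
  unfolding H1_norm_def by simp

lemma H1_norm_eq_A: "H1_norm L v = sqrt (A_form L 1 v v)"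
  unfolding H1_norm_def A_form_def by (simp add: L2_norm_sq)

lemma H1_norm_nonneg [simp]: "0 \<le> H1_norm L v"
  unfolding H1_norm_def by simp

lemma L2_le_H1: "L2_norm L v \<le> H1_norm L v" and L2_deriv_le_H1: "L2_norm L (deriv v) \<le> H1_norm L v"
  unfolding H1_norm_def by (rule real_le_rsqrt; simp)+

lemma H1_le_add: "H1_norm L v \<le> L2_norm L v + L2_norm L (deriv v)"
  unfolding H1_norm_def by (rule real_le_lsqrt) (auto simp: power2_sum)

lemma ip_le: "pc {-L..L} f \<Longrightarrow> pc {-L..L} g \<Longrightarrow> \<bar>ip L f g\<bar> \<le> L2_norm L f * L2_norm L g"
  using psd_form.abs_le[OF ip_psd, of f L g] by (simp add: L2_norm_def)

lemma L2_add: "pc {-L..L} f \<Longrightarrow> pc {-L..L} g \<Longrightarrow> L2_norm L (\<lambda>x. f x + g x) \<le> L2_norm L f + L2_norm L g"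
  using psd_form.triangle_add[OF ip_psd, of f L g] by (simp add: L2_norm_def)

lemma L2_diff: "pc {-L..L} f \<Longrightarrow> pc {-L..L} g \<Longrightarrow> L2_norm L (\<lambda>x. f x - g x) \<le> L2_norm L f + L2_norm L g"
  using psd_form.triangle_diff[OF ip_psd, of f L g] by (simp add: L2_norm_def)

lemma L2_cmult: "pc {-L..L} f \<Longrightarrow> L2_norm L (\<lambda>x. c * f x) = \<bar>c\<bar> * L2_norm L f"
  using psd_form.sqrt_scale[OF ip_psd, of f L c] by (simp add: L2_norm_def)

lemma H1_add: "pw L f \<Longrightarrow> pw L g \<Longrightarrow> H1_norm L (\<lambda>x. f x + g x) \<le> H1_norm L f + H1_norm L g"
  using psd_form.triangle_add[OF A_form_psd[of 1], of f L g] by (simp add: H1_norm_eq_A)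

lemma H1_diff: "pw L f \<Longrightarrow> pw L g \<Longrightarrow> H1_norm L (\<lambda>x. f x - g x) \<le> H1_norm L f + H1_norm L g"
  using psd_form.triangle_diff[OF A_form_psd[of 1], of f L g] by (simp add: H1_norm_eq_A)

lemma H1_cmult: "pw L f \<Longrightarrow> H1_norm L (\<lambda>x. c * f x) = \<bar>c\<bar> * H1_norm L f"
  using psd_form.sqrt_scale[OF A_form_psd[of 1], of f L c] by (simp add: H1_norm_eq_A)

lemma L2_minus: "L2_norm L (\<lambda>x. f x - g x) = L2_norm L (\<lambda>x. g x - f x)"
  unfolding L2_norm_def ip_def by (simp add: algebra_simps)

lemma deriv_minus_pw:
  assumes "pw L f" "pw L g"
  shows "\<exists>S. finite S \<and> (\<forall>x\<in>{-L<..<L} - S. deriv (\<lambda>x. f x - g x) x = deriv f x - deriv g x)"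
proof -
  obtain S where S: "finite S" "\<And>x. x \<in> {-L<..<L} - S \<Longrightarrow> (f has_field_derivative deriv f x) (at x)"
    using pw_DERIV[OF assms(1)] by blast
  obtain T where T: "finite T" "\<And>x. x \<in> {-L<..<L} - T \<Longrightarrow> (g has_field_derivative deriv g x) (at x)"
    using pw_DERIV[OF assms(2)] by blast
  have "\<forall>x\<in>{-L<..<L} - (S \<union> T). deriv (\<lambda>x. f x - g x) x = deriv f x - deriv g x"
    using S T by (auto intro!: DERIV_imp_deriv DERIV_diff)
  then show ?thesis using S T by blast
qed

lemma L2_deriv_diff:
  assumes "pw L f" "pw L g"
  shows "L2_norm L (deriv (\<lambda>x. f x - g x)) = L2_norm L (\<lambda>x. deriv f x - deriv g x)"
proof -
  obtain S where "finite S" "\<And>x. x \<in> {-L<..<L} - S \<Longrightarrow> deriv (\<lambda>x. f x - g x) x = deriv f x - deriv g x"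
    using deriv_minus_pw[OF assms] by blast
  then show ?thesis unfolding L2_norm_def by (intro arg_cong[where f=sqrt] ip_cong_finite)
qed

section \<open>Integration by parts, increments and Sobolev's inequality\<close>

lemma pw_FTC:
  assumes "pw L f" "-L \<le> a" "a \<le> b" "b \<le> L"
  shows "(deriv f has_integral (f b - f a)) {a..b}"
proof -
  obtain S where S: "finite S" "\<And>x. x \<in> {-L<..<L} - S \<Longrightarrow> (f has_field_derivative deriv f x) (at x)"
    using pw_DERIV[OF assms(1)] by blast
  show ?thesis
  proof (rule fundamental_theorem_of_calculus_interior_strong[OF S(1) assms(3)])
    show "(f has_vector_derivative deriv f x) (at x)" if "x \<in> {a<..<b} - S" for x
      using S(2)[of x] that assms by (auto simp: has_real_derivative_iff_has_vector_derivative)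
    show "continuous_on {a..b} f" by (rule continuous_on_subset[OF pw_cont[OF assms(1)]]) (use assms in auto)
  qed
qed

lemma ip_parts:
  assumes "pw L f" "pw L g" "0 \<le> L"
  shows "ip L (deriv f) g = f L * g L - f (-L) * g (-L) - ip L f (deriv g)"
proof -
  obtain S where S: "finite S"
    "\<And>x. x \<in> {-L<..<L} - S \<Longrightarrow> deriv (\<lambda>x. f x * g x) x = deriv f x * g x + deriv g x * f x"
    using pw_mult_deriv(2)[OF assms(1,2)] by blast
  have i: "(\<lambda>x. deriv f x * g x) integrable_on {-L..L}" "(\<lambda>x. deriv g x * f x) integrable_on {-L..L}"
    using assms(1,2)[THEN pw_pc_deriv] assms(1,2)[THEN pw_pc] by (auto intro!: pc_integrable pc_mult)
  have "f L * g L - f (-L) * g (-L) = integral {-L..L} (deriv (\<lambda>x. f x * g x))"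
    using pw_FTC[OF pw_mult[OF assms(1,2)], of "-L" L] assms(3) by (simp add: integral_unique)
  also have "\<dots> = integral {-L..L} (\<lambda>x. deriv f x * g x + deriv g x * f x)"
    by (rule integral_spike[of "S \<union> {-L, L}"]) (use S in \<open>auto intro: negligible_finite\<close>)
  also have "\<dots> = ip L (deriv f) g + ip L f (deriv g)"
    using assms i by (simp add: integral_add ip_eq_integral pw_pc pw_pc_deriv mult.commute)
  finally show ?thesis by simp
qed

lemma L2_le_sup:
  assumes "pc {-L..L} f" "\<And>x. x \<in> {-L..L} \<Longrightarrow> \<bar>f x\<bar> \<le> M" "0 \<le> M" "0 \<le> L"
  shows "L2_norm L f \<le> M * sqrt (2 * L)"
proof -
  have "ip L f f \<le> integral {-L..L} (\<lambda>x. M\<^sup>2)"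
    unfolding ip_eq_integral[OF assms(1,1)]
  proof (rule integral_le)
    show "f x * f x \<le> M\<^sup>2" if "x \<in> {-L..L}" for x
      using assms(2)[OF that] assms(3) by (metis abs_le_square_iff abs_of_nonneg power2_eq_square)
  qed (use assms in \<open>auto intro: pc_integrable(1)[OF pc_mult]\<close>)
  also have "\<dots> = (M * sqrt (2 * L))\<^sup>2" using assms(4) by (simp add: power_mult_distrib)
  finally show ?thesis unfolding L2_norm_def using assms by (intro real_le_lsqrt) (auto simp: ip_self_nonneg)
qed

text \<open>The increment over \<open>{a..b}\<close> is the inner product of \<open>deriv f\<close>
  with the indicator \<open>g\<close> of \<open>{a..b}\<close>, whose L2 norm is at most
  \<open>sqrt (2 * L)\<close>.\<close>

lemma pw_increment:
  assumes "pw L f" "x \<in> {-L..L}" "y \<in> {-L..L}"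
  shows "\<bar>f x - f y\<bar> \<le> sqrt (2 * L) * L2_norm L (deriv f)"
proof -
  have *: "\<bar>f b - f a\<bar> \<le> sqrt (2 * L) * L2_norm L (deriv f)" if "-L \<le> a" "a \<le> b" "b \<le> L" for a b
  proof -
    define g where "g = (\<lambda>x. if x \<in> {a..b} then 1 else 0 :: real)"
    have "continuous_on ({-L..L} - {a, b}) g"
    proof -
      have "{-L..L} - {a, b} \<subseteq> {a<..<b} \<union> (- {a..b})" by auto
      moreover have "continuous_on ({a<..<b} \<union> (- {a..b})) g"
        unfolding g_def by (rule continuous_on_open_Un) (auto intro: continuous_on_eq[of _ "\<lambda>_. 1"] continuous_on_eq[of _ "\<lambda>_. 0"])
      ultimately show ?thesis by (rule continuous_on_subset[rotated])
    qed
    then have pg: "pc {-L..L} g" unfolding pc_def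
      by (intro conjI exI[of _ "{a,b}"]) (auto simp: g_def bounded_iff intro!: exI[of _ 1])
    have pd: "pc {-L..L} (deriv f)" by (rule pw_pc_deriv[OF assms(1)])
    have "f b - f a = integral {a..b} (deriv f)" using pw_FTC[OF assms(1) that] by (simp add: integral_unique)
    also have "\<dots> = integral ({a..b} \<inter> {-L..L}) (deriv f)"
      using that by (intro arg_cong2[where f=integral]) auto
    also have "\<dots> = integral {-L..L} (\<lambda>x. if x \<in> {a..b} then deriv f x else 0)"
      by (simp only: integral_restrict_Int)
    also have "\<dots> = integral {-L..L} (\<lambda>x. deriv f x * g x)"
      by (rule integral_cong) (simp add: g_def)
    also have "\<dots> = ip L (deriv f) g" using pd pg by (simp add: ip_eq_integral)
    finally have "\<bar>f b - f a\<bar> \<le> L2_norm L (deriv f) * L2_norm L g" using ip_le[OF pd pg] by simp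
    also have "\<dots> \<le> L2_norm L (deriv f) * (1 * sqrt (2 * L))"
      by (rule mult_left_mono[OF L2_le_sup[OF pg]]) (use that in \<open>auto simp: g_def\<close>)
    finally show ?thesis by (simp add: mult.commute)
  qed
  show ?thesis using *[of x y] *[of y x] assms by (cases "x \<le> y") (auto simp: abs_minus_commute)
qed

text \<open>Somewhere the modulus of \<open>f\<close> does not exceed its root mean square
  \<open>m\<close>, since otherwise its square would integrate to more than
  \<open>(L2_norm L f)\<^sup>2\<close>; \<open>pw_increment\<close> carries the bound to every other
  point.\<close>

lemma Sobolev:
  assumes "pw L f" "x \<in> {-L..L}" "0 < L"
  shows "\<bar>f x\<bar> \<le> (1 / sqrt (2 * L) + sqrt (2 * L)) * H1_norm L f"
proof -
  define m where "m = L2_norm L f / sqrt (2 * L)"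
  have "\<exists>y\<in>{-L..L}. \<bar>f y\<bar> \<le> m"
  proof (rule ccontr)
    assume n: "\<not> ?thesis"
    obtain y where y: "y \<in> {-L..L}" "\<And>z. z \<in> {-L..L} \<Longrightarrow> \<bar>f y\<bar> \<le> \<bar>f z\<bar>"
      using continuous_attains_inf[of "{-L..L}" "\<lambda>z. \<bar>f z\<bar>"] assms pw_cont[OF assms(1)]
      by (force intro!: continuous_on_rabs)
    have m0: "0 \<le> m" unfolding m_def using assms(3) by simp
    have lt: "m < \<bar>f y\<bar>" using n y(1) by force
    have "(L2_norm L f)\<^sup>2 = m\<^sup>2 * (2 * L)" unfolding m_def using assms(3) by (simp add: power_divide)
    also have "\<dots> < \<bar>f y\<bar>\<^sup>2 * (2 * L)" using power_strict_mono[OF lt m0, of 2] assms(3) by simp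
    also have "\<dots> = integral {-L..L} (\<lambda>x. \<bar>f y\<bar>\<^sup>2)" using assms(3) by simp
    also have "\<dots> \<le> ip L f f"
      unfolding ip_eq_integral[OF pw_pc[OF assms(1)] pw_pc[OF assms(1)]]
    proof (rule integral_le)
      show "\<bar>f y\<bar>\<^sup>2 \<le> f x * f x" if "x \<in> {-L..L}" for x
        using y(2)[OF that] by (metis abs_le_square_iff power2_abs power2_eq_square)
    qed (use assms in \<open>auto intro: pc_integrable(1)[OF pc_mult] pw_pc\<close>)
    finally show False by (simp add: L2_norm_sq)
  qed
  then obtain y where y: "y \<in> {-L..L}" "\<bar>f y\<bar> \<le> m" by blast
  have "\<bar>f x\<bar> \<le> \<bar>f y\<bar> + \<bar>f x - f y\<bar>" by simp
  also have "\<dots> \<le> m + sqrt (2 * L) * L2_norm L (deriv f)"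
    using y pw_increment[OF assms(1,2) y(1)] by simp
  also have "\<dots> \<le> H1_norm L f / sqrt (2 * L) + sqrt (2 * L) * H1_norm L f"
    unfolding m_def using L2_le_H1 L2_deriv_le_H1 assms(3)
    by (intro add_mono divide_right_mono mult_left_mono) auto
  finally show ?thesis by (simp add: algebra_simps)
qed

lemma pw_A_form_zero:
  assumes "pw L f" "A_form L q f f = 0" "0 < q" "0 < L" "x \<in> {-L..L}"
  shows "f x = 0"
proof -
  have "ip L f f = 0" "ip L (deriv f) (deriv f) = 0"
    using assms(2,3) ip_self_nonneg[of L f] ip_self_nonneg[of L "deriv f"]
      mult_nonneg_nonneg[of q "ip L (deriv f) (deriv f)"]
    unfolding A_form_def by (auto simp: add_nonneg_eq_0_iff)
  then have "H1_norm L f = 0" by (simp add: H1_norm_eq_A A_form_def)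
  then show ?thesis using Sobolev[OF assms(1,5,4)] by simp
qed


section \<open>Continuously differentiable functions\<close>

lemma continuous_on_poly' [simp]: "continuous_on A (poly p)" for p :: "real poly"
  using continuous_on_poly[OF continuous_on_id, of A p] by simp

lemma dx_eqI:
  assumes "0 < L" "x \<in> {-L..L}" "(f has_real_derivative D) (at x within {-L..L})"
  shows "dx L f x = D"
  unfolding dx_def using assms
  by (intro vector_derivative_within_closed_interval) (auto simp: has_real_derivative_iff_has_vector_derivative)

lemma dx_works:
  assumes "0 < L" "f differentiable_on {-L..L}" "x \<in> {-L..L}"
  shows "(f has_real_derivative dx L f x) (at x within {-L..L})"
proof -
  obtain D where "(f has_real_derivative D) (at x within {-L..L})"
    using assms(2,3) unfolding differentiable_on_def real_differentiable_def by blast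
  then show ?thesis using dx_eqI[OF assms(1,3)] by metis
qed

lemma has_real_derivative_cong_on:
  fixes f g :: "real \<Rightarrow> real"
  assumes "\<And>x. x \<in> S \<Longrightarrow> f x = g x" "x \<in> S"
  shows "(f has_real_derivative D) (at x within S) \<longleftrightarrow> (g has_real_derivative D) (at x within S)"
  unfolding has_real_derivative_iff_has_vector_derivative
  using has_vector_derivative_transform[of x S f g D] has_vector_derivative_transform[of x S g f D] assms by auto

lemma dx_cong:
  assumes "\<And>x. x \<in> {-L..L} \<Longrightarrow> f x = g x" "x \<in> {-L..L}"
  shows "dx L f x = dx L g x"
  unfolding dx_def vector_derivative_def
  using has_real_derivative_cong_on[OF assms] by (simp add: has_real_derivative_iff_has_vector_derivative)

lemma C_space_0: "f \<in> C_space L 0 \<longleftrightarrow> continuous_on {-L..L} f"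
  by (simp add: C_space_def)

lemma C_space_Suc:
  "f \<in> C_space L (Suc k) \<longleftrightarrow> continuous_on {-L..L} f \<and> f differentiable_on {-L..L} \<and> dx L f \<in> C_space L k"
  (is "?l \<longleftrightarrow> ?r")
proof
  assume l: ?l
  have "(dx L ^^ Suc j) f differentiable_on {-L..L}" if "j < k" for j
    using l that unfolding C_space_def by blast
  moreover have "continuous_on {-L..L} ((dx L ^^ Suc j) f)" if "j \<le> k" for j
    using l that unfolding C_space_def by blast
  moreover have "continuous_on {-L..L} ((dx L ^^ 0) f)" "(dx L ^^ 0) f differentiable_on {-L..L}"
    using l unfolding C_space_def by blast+
  ultimately show ?r by (simp add: C_space_def funpow_Suc_right del: funpow.simps)
next
  assume r: ?r
  have "(dx L ^^ j) f differentiable_on {-L..L}" if "j < Suc k" for j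
    using r that by (cases j) (auto simp: C_space_def funpow_Suc_right simp del: funpow.simps(2))
  moreover have "continuous_on {-L..L} ((dx L ^^ j) f)" if "j \<le> Suc k" for j
    using r that by (cases j) (auto simp: C_space_def funpow_Suc_right simp del: funpow.simps(2))
  ultimately show ?l by (simp add: C_space_def)
qed

lemma C_space_cong:
  assumes "f \<in> C_space L k" "\<And>x. x \<in> {-L..L} \<Longrightarrow> f x = g x"
  shows "g \<in> C_space L k"
  using assms
proof (induction k arbitrary: f g)
  case 0
  then show ?case using continuous_on_eq[of "{-L..L}" f g] by (simp add: C_space_0)
next
  case (Suc k)
  have "g differentiable_on {-L..L}"
    using Suc.prems unfolding C_space_Suc differentiable_on_def real_differentiable_def
    by (meson has_real_derivative_cong_on)
  moreover have "dx L g \<in> C_space L k"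
    using Suc.IH[of "dx L f" "dx L g"] Suc.prems dx_cong[of L f g] by (simp add: C_space_Suc)
  moreover have "continuous_on {-L..L} g"
    using Suc.prems continuous_on_eq[of "{-L..L}" f g] by (simp add: C_space_Suc)
  ultimately show ?case by (simp add: C_space_Suc)
qed

lemma C_space_mono: "f \<in> C_space L k \<Longrightarrow> j \<le> k \<Longrightarrow> f \<in> C_space L j"
  unfolding C_space_def by auto

lemma C_space_cont: "f \<in> C_space L k \<Longrightarrow> j \<le> k \<Longrightarrow> continuous_on {-L..L} ((dx L ^^ j) f)"
  unfolding C_space_def by auto

lemma C_space_dx: "f \<in> C_space L (Suc k) \<Longrightarrow> dx L f \<in> C_space L k"
  by (simp add: C_space_Suc)

lemma C_space_dx_pow: "f \<in> C_space L (k + j) \<Longrightarrow> (dx L ^^ j) f \<in> C_space L k"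
  by (induction j arbitrary: f) (auto simp: C_space_Suc funpow_Suc_right simp del: funpow.simps(2))

text \<open>Reduces membership in C^(k+1) to an explicit derivative in C^k; the closure properties
  below are inductions through it.\<close>

lemma C_space_antideriv:
  assumes "0 < L" "g \<in> C_space L k"
    and "\<And>x. x \<in> {-L..L} \<Longrightarrow> (f has_real_derivative g x) (at x within {-L..L})"
  shows "f \<in> C_space L (Suc k)"
proof -
  have "dx L f x = g x" if "x \<in> {-L..L}" for x using dx_eqI[OF assms(1) that assms(3)[OF that]] .
  then have "dx L f \<in> C_space L k" by (intro C_space_cong[OF assms(2)]) simp
  moreover have d: "f differentiable_on {-L..L}"
    unfolding differentiable_on_def real_differentiable_def using assms(3) by blast
  ultimately show ?thesis using differentiable_imp_continuous_on[OF d] by (simp add: C_space_Suc)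
qed

lemma C_space_const: "0 < L \<Longrightarrow> (\<lambda>x. c) \<in> C_space L k"
proof (induction k arbitrary: c)
  case (Suc k)
  show ?case by (rule C_space_antideriv[OF Suc.prems Suc.IH[of 0]]) (use Suc.prems in auto)
qed (simp add: C_space_0)

lemma C_space_add: "0 < L \<Longrightarrow> f \<in> C_space L k \<Longrightarrow> g \<in> C_space L k \<Longrightarrow> (\<lambda>x. f x + g x) \<in> C_space L k"
proof (induction k arbitrary: f g)
  case (Suc k)
  show ?case
    by (rule C_space_antideriv[OF Suc.prems(1) Suc.IH[of "dx L f" "dx L g"]])
      (use Suc.prems in \<open>auto simp: C_space_Suc intro!: DERIV_add dx_works\<close>)
qed (auto simp: C_space_0 intro: continuous_on_add)

lemma C_space_mult: "0 < L \<Longrightarrow> f \<in> C_space L k \<Longrightarrow> g \<in> C_space L k \<Longrightarrow> (\<lambda>x. f x * g x) \<in> C_space L k"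
proof (induction k arbitrary: f g)
  case (Suc k)
  have "(\<lambda>x. dx L f x * g x + dx L g x * f x) \<in> C_space L k"
    using Suc by (intro C_space_add Suc.IH) (auto simp: C_space_Suc intro: C_space_mono[of _ L "Suc k"])
  then show ?case
    by (rule C_space_antideriv[OF Suc.prems(1)])
      (use Suc.prems in \<open>auto simp: C_space_Suc intro!: DERIV_mult dx_works\<close>)
qed (auto simp: C_space_0 intro: continuous_on_mult)

lemma C_space_poly:
  assumes "0 < L" shows "poly p \<in> C_space L k"
proof (induction k arbitrary: p)
  case (Suc k)
  show ?case by (rule C_space_antideriv[OF assms Suc.IH[of "pderiv p"]])
    (auto intro: DERIV_subset[OF poly_DERIV])
qed (simp add: C_space_0)

lemma C_space_DERIV:
  assumes "0 < L" "f \<in> C_space L (Suc k)" "x \<in> {-L<..<L}"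
  shows "(f has_real_derivative dx L f x) (at x)"
proof -
  have "(f has_real_derivative dx L f x) (at x within {-L..L})"
    using dx_works[OF assms(1)] assms by (auto simp: C_space_Suc)
  then show ?thesis using assms(3) at_within_Icc_at[of "-L" x L] by simp
qed

lemma C1_pw:
  assumes "0 < L" "f \<in> C_space L (Suc k)"
  shows "pw L f" and "\<And>x. x \<in> {-L<..<L} \<Longrightarrow> deriv f x = dx L f x"
proof -
  note * = pwI[of L f "{}" "dx L f"]
  have c: "continuous_on {-L..L} f" "continuous_on {-L..L} (dx L f)"
    using assms C_space_cont[of "dx L f" L k 0] by (auto simp: C_space_Suc)
  show "pw L f" by (rule *(1)) (use c C_space_DERIV[OF assms] in \<open>auto intro: pc_continuous\<close>)
  fix x assume "x \<in> {-L<..<L}"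
  then show "deriv f x = dx L f x"
    by (intro *(2)) (use c C_space_DERIV[OF assms] in \<open>auto intro: pc_continuous\<close>)
qed

section \<open>Spline spaces\<close>

lemma mesh_pos: "0 < L \<Longrightarrow> 0 < N \<Longrightarrow> 0 < mesh L N"
  by (simp add: mesh_def)

lemma node_0 [simp]: "node L N 0 = -L"
  by (simp add: node_def)

lemma node_N: "0 < N \<Longrightarrow> node L N N = L"
  by (simp add: node_def mesh_def)

lemma node_Suc: "node L N (Suc i) = node L N i + mesh L N"
  by (simp add: node_def algebra_simps)

lemma node_mono: "0 < L \<Longrightarrow> i \<le> j \<Longrightarrow> node L N i \<le> node L N j"
  unfolding node_def mesh_def by (simp add: mult_right_mono divide_right_mono)

lemma node_bounds:
  assumes "0 < L" "0 < N" "i \<le> N"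
  shows "-L \<le> node L N i" "node L N i \<le> L"
  using node_mono[OF assms(1), of 0 i N] node_mono[OF assms(1,3), of N] node_N[OF assms(2)] by auto

lemma node_cell:
  assumes "0 < L" "0 < N" "x \<in> {-L..<L}"
  obtains i where "i < N" "node L N i \<le> x" "x < node L N (Suc i)"
proof -
  define P where "P = (\<lambda>i. x < node L N i)"
  have "P N" using assms node_N[of N L] by (simp add: P_def)
  define j where "j = (LEAST i. P i)"
  have Pj: "P j" unfolding j_def by (rule LeastI[of P, OF \<open>P N\<close>])
  have jN: "j \<le> N" unfolding j_def by (rule Least_le[of P, OF \<open>P N\<close>])
  have "j \<noteq> 0" using Pj assms by (cases j) (auto simp: P_def)
  then obtain i where i: "j = Suc i" by (cases j) auto
  have "\<not> P i" using not_less_Least[of i P] i by (auto simp: j_def)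
  then show ?thesis using that[of i] Pj jN i by (auto simp: P_def)
qed

lemma node_cell_closed:
  assumes "0 < L" "0 < N" "x \<in> {-L..L}"
  obtains i where "i < N" "x \<in> {node L N i..node L N (Suc i)}"
proof (cases "x = L")
  case True
  have "x \<in> {node L N (N - 1)..node L N (Suc (N - 1))}"
    using True assms node_N[of N L] node_mono[of L "N - 1" N N] by simp
  then show ?thesis using that[of "N - 1"] assms(2) by simp
next
  case False
  then obtain i where "i < N" "node L N i \<le> x" "x < node L N (Suc i)"
    using node_cell[OF assms(1,2), of x] assms(3) by auto
  then show ?thesis using that by auto
qed

lemma integral_cells:
  fixes g :: "real \<Rightarrow> real"
  assumes "0 < L" "0 < N" "g integrable_on {-L..L}"
  shows "integral {-L..L} g = (\<Sum>i<N. integral {node L N i..node L N (Suc i)} g)"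
proof -
  have "k \<le> N \<Longrightarrow> integral {-L..node L N k} g = (\<Sum>i<k. integral {node L N i..node L N (Suc i)} g)" for k
  proof (induction k)
    case (Suc k)
    have "g integrable_on {-L..node L N (Suc k)}"
      using node_bounds[OF assms(1,2) Suc.prems] by (intro Henstock_Kurzweil_Integration.integrable_on_subinterval[OF assms(3)]) auto
    then have "integral {-L..node L N k} g + integral {node L N k..node L N (Suc k)} g = integral {-L..node L N (Suc k)} g"
      using node_bounds[OF assms(1,2), of k] Suc.prems node_mono[OF assms(1), of k "Suc k" N]
      by (intro Henstock_Kurzweil_Integration.integral_combine) auto
    then show ?case using Suc by simp
  qed simp
  from this[of N] show ?thesis by (simp add: node_N[OF assms(2)])
qed

lemma Sh_cell:
  assumes "\<phi> \<in> Sh L N \<mu> r" "i < N"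
  obtains p where "degree p \<le> r - 1" "\<And>x. x \<in> {node L N i..node L N (Suc i)} \<Longrightarrow> \<phi> x = poly p x"
  using assms unfolding Sh_def by auto

lemma Sh_C_space: "\<phi> \<in> Sh L N \<mu> r \<Longrightarrow> \<phi> \<in> C_space L \<mu>"
  by (simp add: Sh_def)

lemma Sh_mono: "j \<le> k \<Longrightarrow> Sh L N k r \<subseteq> Sh L N j r"
  unfolding Sh_def using C_space_mono by auto

lemma Sh0_Sh: "\<phi> \<in> Sh0 L N \<mu> r \<Longrightarrow> \<phi> \<in> Sh L N \<mu> r"
  by (simp add: Sh0_def)

lemma Sh_subspace:
  assumes "0 < L"
  shows "fun_subspace (Sh L N \<mu> r)"
  unfolding fun_subspace_def
proof (intro conjI ballI allI)
  show "(\<lambda>x. 0) \<in> Sh L N \<mu> r"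
    unfolding Sh_def using C_space_const[OF assms] by (auto intro!: exI[of _ 0])
next
  fix f g assume f: "f \<in> Sh L N \<mu> r" and g: "g \<in> Sh L N \<mu> r"
  have "\<exists>p. degree p \<le> r - 1 \<and> (\<forall>x\<in>{node L N i..node L N (i + 1)}. f x + g x = poly p x)" if i: "i < N" for i
  proof -
    obtain p q where "degree p \<le> r - 1" "\<And>x. x \<in> {node L N i..node L N (Suc i)} \<Longrightarrow> f x = poly p x"
      "degree q \<le> r - 1" "\<And>x. x \<in> {node L N i..node L N (Suc i)} \<Longrightarrow> g x = poly q x"
      using Sh_cell[OF f i] Sh_cell[OF g i] by metis
    then show ?thesis by (intro exI[of _ "p + q"]) (auto intro: degree_add_le)
  qed
  then show "(\<lambda>x. f x + g x) \<in> Sh L N \<mu> r"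
    using C_space_add[OF assms] f g unfolding Sh_def by auto
next
  fix f c assume f: "f \<in> Sh L N \<mu> r"
  have "\<exists>p. degree p \<le> r - 1 \<and> (\<forall>x\<in>{node L N i..node L N (i + 1)}. c * f x = poly p x)" if i: "i < N" for i
  proof -
    obtain p where "degree p \<le> r - 1" "\<And>x. x \<in> {node L N i..node L N (Suc i)} \<Longrightarrow> f x = poly p x"
      using Sh_cell[OF f i] by metis
    then show ?thesis by (intro exI[of _ "smult c p"]) (auto intro: order_trans[OF degree_smult_le])
  qed
  then show "(\<lambda>x. c * f x) \<in> Sh L N \<mu> r"
    using C_space_mult[OF assms C_space_const[OF assms]] f unfolding Sh_def by auto
qed

lemma Sh0_subspace: "0 < L \<Longrightarrow> fun_subspace (Sh0 L N \<mu> r)"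
  using Sh_subspace[of L N \<mu> r] unfolding fun_subspace_def Sh0_def by auto

lemma Sh_poly: "0 < L \<Longrightarrow> degree p \<le> r - 1 \<Longrightarrow> poly p \<in> Sh L N \<mu> r"
  unfolding Sh_def using C_space_poly by blast

lemma Sh_cont: "\<phi> \<in> Sh L N \<mu> r \<Longrightarrow> continuous_on {-L..L} \<phi>"
  using C_space_mono[of \<phi> L \<mu> 0] by (auto simp: Sh_def C_space_0)

lemma Sh_DERIV:
  assumes "\<phi> \<in> Sh L N \<mu> r" "0 < L" "0 < N" "x \<in> {-L<..<L}" "x \<notin> node L N ` {..N}"
  shows "(\<phi> has_real_derivative deriv \<phi> x) (at x)"
    and "i < N \<Longrightarrow> x \<in> {node L N i..node L N (Suc i)} \<Longrightarrow>
      (\<And>y. y \<in> {node L N i..node L N (Suc i)} \<Longrightarrow> \<phi> y = poly p y) \<Longrightarrow> deriv \<phi> x = poly (pderiv p) x"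
proof -
  have *: "(\<phi> has_real_derivative poly (pderiv p) x) (at x)"
    if "i < N" "x \<in> {node L N i..node L N (Suc i)}" "\<And>y. y \<in> {node L N i..node L N (Suc i)} \<Longrightarrow> \<phi> y = poly p y" for i p
  proof (rule has_field_derivative_transform_within_open[OF poly_DERIV, of "{node L N i<..<node L N (Suc i)}"])
    show "x \<in> {node L N i<..<node L N (Suc i)}" using that(1,2) assms(5) by force
  qed (use that in auto)
  obtain i where i: "i < N" "x \<in> {node L N i..node L N (Suc i)}"
    using node_cell_closed[OF assms(2,3), of x] assms(4) by auto
  obtain p where "\<And>x. x \<in> {node L N i..node L N (Suc i)} \<Longrightarrow> \<phi> x = poly p x" using Sh_cell[OF assms(1) i(1)] by blast
  from *[OF i this] show "(\<phi> has_real_derivative deriv \<phi> x) (at x)" using DERIV_imp_deriv by metis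
  show "deriv \<phi> x = poly (pderiv p) x" if "i < N" "x \<in> {node L N i..node L N (Suc i)}"
    "\<And>y. y \<in> {node L N i..node L N (Suc i)} \<Longrightarrow> \<phi> y = poly p y" for i p
    using *[OF that] by (rule DERIV_imp_deriv)
qed

text \<open>Off the nodes the derivative is locally one of finitely many polynomials, each bounded
  on the compact interval; the nodes contribute a finite set of values.\<close>

lemma Sh_pw:
  assumes "\<phi> \<in> Sh L N \<mu> r" "0 < L" "0 < N"
  shows "pw L \<phi>"
proof (rule pwI(1)[OF Sh_cont[OF assms(1)], of "node L N ` {..N}" "deriv \<phi>"])
  show "finite (node L N ` {..N})" by simp
  show "\<And>x. x \<in> {-L<..<L} - node L N ` {..N} \<Longrightarrow> (\<phi> has_real_derivative deriv \<phi> x) (at x)"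
    using Sh_DERIV(1)[OF assms] by blast
  have "\<exists>p. degree p \<le> r - 1 \<and> (\<forall>x\<in>{node L N i..node L N (Suc i)}. \<phi> x = poly p x)" if i: "i < N" for i
    using Sh_cell[OF assms(1) i] by metis
  then obtain p where p: "\<And>i x. i < N \<Longrightarrow> x \<in> {node L N i..node L N (Suc i)} \<Longrightarrow> \<phi> x = poly (p i) x"
    by metis
  let ?A = "\<lambda>i. {node L N i<..<node L N (Suc i)}"
  define S where "S = node L N ` {..N}"
  have cover: "{-L..L} - S \<subseteq> (\<Union>i<N. ?A i)"
  proof
    fix x assume x: "x \<in> {-L..L} - S"
    then obtain i where i: "i < N" "x \<in> {node L N i..node L N (Suc i)}"
      using node_cell_closed[OF assms(2,3), of x] by auto
    then have "x \<noteq> node L N i" "x \<noteq> node L N (Suc i)" using x by (auto simp: S_def)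
    then show "x \<in> (\<Union>i<N. ?A i)" using i by (auto intro!: bexI[of _ i])
  qed
  have inner: "?A i \<subseteq> {-L<..<L}" "?A i \<inter> S = {}" if i: "i < N" for i
  proof -
    show "?A i \<subseteq> {-L<..<L}"
      using node_bounds[OF assms(2,3), of i] node_bounds[OF assms(2,3), of "Suc i"] that by auto
    show "?A i \<inter> S = {}"
    proof -
      have "node L N j \<notin> ?A i" for j
        using node_mono[OF assms(2), of j i N] node_mono[OF assms(2), of "Suc i" j N] by (cases "j \<le> i") auto
      then show ?thesis by (auto simp: S_def)
    qed
  qed
  have eq: "deriv \<phi> x = poly (pderiv (p i)) x" if "i < N" "x \<in> ?A i" for i x
  proof (rule Sh_DERIV(2)[OF assms])
    show "x \<in> {-L<..<L}" "x \<notin> node L N ` {..N}" using inner[OF that(1)] that(2) by (auto simp: S_def)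
    show "i < N" "x \<in> {node L N i..node L N (Suc i)}" using that by auto
    show "\<And>y. y \<in> {node L N i..node L N (Suc i)} \<Longrightarrow> \<phi> y = poly (p i) y" by (rule p[OF that(1)])
  qed
  have "continuous_on (\<Union>i<N. ?A i) (deriv \<phi>)"
  proof (rule continuous_on_open_UN)
    fix i assume "i \<in> {..<N}"
    then have "poly (pderiv (p i)) x = deriv \<phi> x" if "x \<in> ?A i" for x using eq[of i x] that by simp
    moreover have "continuous_on (?A i) (poly (pderiv (p i)))" by (intro continuous_intros)
    ultimately show "continuous_on (?A i) (deriv \<phi>)" using continuous_on_eq by blast
  qed auto
  then have c: "continuous_on ({-L..L} - S) (deriv \<phi>)" by (rule continuous_on_subset[OF _ cover])
  have b1: "bounded (poly (pderiv (p i)) ` {-L..L})" for i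
    by (intro compact_imp_bounded compact_continuous_image) auto
  have "deriv \<phi> ` {-L..L} \<subseteq> deriv \<phi> ` S \<union> (\<Union>i<N. poly (pderiv (p i)) ` {-L..L})"
  proof
    fix y assume "y \<in> deriv \<phi> ` {-L..L}"
    then obtain x where x: "x \<in> {-L..L}" "y = deriv \<phi> x" by blast
    show "y \<in> deriv \<phi> ` S \<union> (\<Union>i<N. poly (pderiv (p i)) ` {-L..L})"
    proof (cases "x \<in> S")
      case False
      then obtain i where "i < N" "x \<in> ?A i" using cover x by blast
      then have "y = poly (pderiv (p i)) x" using eq x by simp
      then show ?thesis using \<open>i < N\<close> x(1) by blast
    qed (use x in auto)
  qed
  moreover have "bounded (deriv \<phi> ` S \<union> (\<Union>i<N. poly (pderiv (p i)) ` {-L..L}))"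
    unfolding bounded_Un
    by (intro conjI finite_imp_bounded bounded_UN ballI b1) (auto simp: S_def)
  ultimately have "bounded (deriv \<phi> ` {-L..L})" by (rule bounded_subset[rotated])
  then show "pc {-L..L} (deriv \<phi>)" unfolding pc_def using c by (auto intro!: exI[of _ S] simp: S_def)
qed

lemma poly_eq_sum_lessThan:
  fixes p :: "real poly"
  assumes "degree p < n"
  shows "poly p x = (\<Sum>j<n. coeff p j * x ^ j)"
proof -
  have "poly p x = (\<Sum>j\<le>degree p. coeff p j * x ^ j)" by (rule poly_altdef)
  also have "\<dots> = (\<Sum>j<n. coeff p j * x ^ j)"
    by (rule sum.mono_neutral_left) (use assms in \<open>auto simp: coeff_eq_0\<close>)
  finally show ?thesis .
qed

text \<open>The spanning functions are monomials cut off to half-open cells, which overlap nowhere,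
  not even at the nodes.\<close>

lemma Sh_span:
  assumes "v \<in> Sh L N \<mu> r" "0 < L" "0 < N" "1 \<le> r"
  shows "\<exists>c. \<forall>x\<in>{-L..L}. v x = (\<Sum>k\<in>{..N}\<times>{..<r}. c k *
    (if node L N (fst k) \<le> x \<and> x < node L N (Suc (fst k)) then x ^ snd k else 0))"
proof -
  have "\<exists>p. degree p \<le> r - 1 \<and> (\<forall>x\<in>{node L N i..node L N (Suc i)}. v x = poly p x)" if i: "i < N" for i
    using Sh_cell[OF assms(1) i] by metis
  then obtain p where p: "\<And>i. i < N \<Longrightarrow> degree (p i) \<le> r - 1"
    "\<And>i x. i < N \<Longrightarrow> x \<in> {node L N i..node L N (Suc i)} \<Longrightarrow> v x = poly (p i) x"
    by metis
  \<comment> \<open>Cell \<open>N\<close> starts at \<open>L\<close> and meets the interval in that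
    point only. The half-open cells before it miss this point, and the pair \<open>(N, 0)\<close>
    supplies the value there.\<close>
  define c where "c = (\<lambda>k. if fst k < N then coeff (p (fst k)) (snd k) else if snd k = (0::nat) then v L else 0)"
  have h: "0 < mesh L N" by (rule mesh_pos[OF assms(2,3)])
  have "v x = (\<Sum>k\<in>{..N}\<times>{..<r}. c k *
    (if node L N (fst k) \<le> x \<and> x < node L N (Suc (fst k)) then x ^ snd k else 0))" if x: "x \<in> {-L..L}" for x
  proof -
    obtain i where i: "i \<le> N" "node L N i \<le> x" "x < node L N (Suc i)"
    proof (cases "x = L")
      case True
      then show ?thesis using that[of N] h node_N[OF assms(3)] by (simp add: node_Suc)
    next
      case False
      then show ?thesis using node_cell[OF assms(2,3), of x] x that by (metis atLeastAtMost_iff atLeastLessThan_iff less_eq_real_def less_imp_le_nat)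
    qed
    have uniq: "node L N j \<le> x \<and> x < node L N (Suc j) \<longleftrightarrow> j = i" for j
    proof
      assume j: "node L N j \<le> x \<and> x < node L N (Suc j)"
      show "j = i"
        using j i node_mono[OF assms(2), of "Suc j" i N] node_mono[OF assms(2), of "Suc i" j N]
        by (meson le_less_trans linorder_neqE_nat not_less_eq_eq not_less order.strict_trans1 Suc_leI)
    qed (use i in auto)
    have "(\<Sum>k\<in>{..N}\<times>{..<r}. c k *
      (if node L N (fst k) \<le> x \<and> x < node L N (Suc (fst k)) then x ^ snd k else 0))
      = (\<Sum>j\<le>N. \<Sum>l<r. c (j, l) * (if j = i then x ^ l else 0))"
      by (simp only: uniq sum.cartesian_product) (simp add: case_prod_beta)
    also have "\<dots> = (\<Sum>j\<le>N. if j = i then \<Sum>l<r. c (i, l) * x ^ l else 0)"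
      by (intro sum.cong) auto
    also have "\<dots> = (\<Sum>l<r. c (i, l) * x ^ l)" using i by simp
    also have "\<dots> = v x"
    proof (cases "i < N")
      case True
      then show ?thesis using p(2)[OF True, of x] i p(1)[OF True] poly_eq_sum_lessThan[of "p i" r x] assms(4)
        by (simp add: c_def)
    next
      case False
      then have "x = L" using i x node_N[OF assms(3)] by (auto intro: antisym)
      moreover have "(\<Sum>l<r. c (i, l) * x ^ l) = (\<Sum>l<r. if l = 0 then v L else 0)"
        using False by (intro sum.cong) (auto simp: c_def)
      ultimately show ?thesis using assms(4) by simp
    qed
    finally show ?thesis by simp
  qed
  then show ?thesis by blast
qed

lemma pderiv_sum: "pderiv (\<Sum>i\<in>A. f i) = (\<Sum>i\<in>A. pderiv (f i))"
  by (induction A rule: infinite_finite_induct) (auto simp: pderiv_add)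

lemma poly_antiderivative:
  fixes p :: "real poly"
  shows "\<exists>P. pderiv P = p \<and> degree P \<le> Suc (degree p)"
proof -
  define P where "P = (\<Sum>i\<le>degree p. monom (coeff p i / real (Suc i)) (Suc i))"
  have "pderiv P = (\<Sum>i\<le>degree p. monom (coeff p i) i)"
    unfolding P_def by (simp add: pderiv_sum pderiv_monom)
  also have "\<dots> = p" by (rule poly_as_sum_of_monoms)
  finally have "pderiv P = p" .
  moreover have "degree P \<le> Suc (degree p)"
    unfolding P_def by (rule degree_sum_le) (auto intro: order_trans[OF degree_monom_le])
  ultimately show ?thesis by blast
qed

text \<open>On a cell the difference from a polynomial antiderivative has zero derivative and is
  constant, so degree and smoothness both rise by one.\<close>

lemma Sh_antideriv:
  assumes "s \<in> Sh L N k q" "0 < L" "0 < N" "1 \<le> q"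
    and f: "\<And>x. x \<in> {-L..L} \<Longrightarrow> (f has_real_derivative s x) (at x within {-L..L})"
  shows "f \<in> Sh L N (Suc k) (Suc q)"
proof -
  have "f \<in> C_space L (Suc k)" by (rule C_space_antideriv[OF assms(2) Sh_C_space[OF assms(1)] f])
  moreover have "\<exists>p. degree p \<le> Suc q - 1 \<and> (\<forall>x\<in>{node L N i..node L N (i + 1)}. f x = poly p x)" if i: "i < N" for i
  proof -
    obtain p where p: "degree p \<le> q - 1" "\<And>x. x \<in> {node L N i..node L N (Suc i)} \<Longrightarrow> s x = poly p x"
      using Sh_cell[OF assms(1) i] by blast
    obtain P where P: "pderiv P = p" "degree P \<le> Suc (degree p)" using poly_antiderivative by blast
    let ?a = "node L N i"
    have sub: "{?a..node L N (Suc i)} \<subseteq> {-L..L}"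
      using node_bounds[OF assms(2,3), of i] node_bounds[OF assms(2,3), of "Suc i"] that by auto
    have "\<exists>c. \<forall>x\<in>{?a..node L N (Suc i)}. f x - poly P x = c"
    proof (rule has_field_derivative_zero_constant)
      fix x assume x: "x \<in> {?a..node L N (Suc i)}"
      have "(f has_real_derivative s x) (at x within {?a..node L N (Suc i)})"
        using DERIV_subset[OF f sub] x sub by blast
      moreover have "(poly P has_real_derivative s x) (at x within {?a..node L N (Suc i)})"
        using DERIV_subset[OF poly_DERIV[of P x], of "{?a..node L N (Suc i)}"] p(2)[OF x] P by simp
      ultimately show "((\<lambda>x. f x - poly P x) has_real_derivative 0) (at x within {?a..node L N (Suc i)})"
        using DERIV_diff by fastforce
    qed auto
    then obtain c where "\<And>x. x \<in> {?a..node L N (Suc i)} \<Longrightarrow> f x = poly (P + [:c:]) x"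
      by (force simp: algebra_simps)
    moreover have "degree (P + [:c:]) \<le> Suc q - 1"
      using P p(1) assms(4) by (intro degree_add_le) auto
    ultimately show ?thesis by (metis Suc_eq_plus1)
  qed
  ultimately show ?thesis unfolding Sh_def by blast
qed

section \<open>The inverse inequality\<close>

text \<open>A comparison of norms in finite dimension made explicit: in an L2-orthonormal basis the
  coefficients are bounded by the L2 norm, so the sum of bounds for the derivatives of the basis
  polynomials is a valid constant.\<close>

lemma poly_deriv_bound_reference:
  "\<exists>C\<ge>0. \<forall>p::real poly. degree p < r \<longrightarrow> (\<forall>s\<in>{-1..1}. \<bar>poly (pderiv p) s\<bar> \<le> C * L2_norm 1 (poly p))"
proof -
  interpret psd_form "{g. pc {-1..1} g}" "ip 1" using ip_psd[of 1] by simp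
  define W where "W = {poly p | p :: real poly. degree p < r \<or> p = 0}"
  have cont: "continuous_on {-1..1} v" if "v \<in> W" for v
    using that by (auto simp: W_def intro!: continuous_intros)
  have WV: "W \<subseteq> {g. pc {-1..1} g}" using cont by (auto intro: pc_continuous)
  have Wsub: "fun_subspace W"
    unfolding fun_subspace_def
  proof (intro conjI ballI allI)
    show "(\<lambda>x. 0) \<in> W" by (auto simp: W_def fun_eq_iff intro!: exI[of _ 0])
  next
    fix f g assume "f \<in> W" "g \<in> W"
    then obtain p q where "f = poly p" "g = poly q" "degree p < r \<or> p = 0" "degree q < r \<or> q = 0" by (auto simp: W_def)
    then show "(\<lambda>x. f x + g x) \<in> W"
      unfolding W_def by (intro CollectI exI[of _ "p + q"]) (auto intro: degree_add_less)
  next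
    fix f c assume "f \<in> W"
    then obtain p where "f = poly p" "degree p < r \<or> p = 0" by (auto simp: W_def)
    then show "(\<lambda>x. c * f x) \<in> W"
      unfolding W_def by (intro CollectI exI[of _ "smult c p"]) (auto simp: fun_eq_iff)
  qed
  have "\<exists>c. \<forall>x\<in>{-1..1}. v x = (\<Sum>j\<in>{..<r}. c j * x ^ j)" if v: "v \<in> W" for v
  proof -
    obtain p where p: "v = poly p" "degree p < r \<or> p = 0" using v by (auto simp: W_def)
    show ?thesis
    proof (cases "p = 0")
      case True
      then show ?thesis using p by (intro exI[of _ "\<lambda>_. 0"]) simp
    next
      case False
      then show ?thesis using p poly_eq_sum_lessThan[of p r] by blast
    qed
  qed
  moreover have "ip 1 v v = 0 \<longleftrightarrow> (\<forall>x\<in>{-1..1}. v x = 0)" if "v \<in> W" for v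
  proof -
    have "ip 1 v v = integral {-1..1} (\<lambda>x. v x * v x)" using ip_eq_integral[of 1 v v] WV that by auto
    also have "\<dots> = 0 \<longleftrightarrow> (\<forall>x\<in>{-1..1}. v x * v x = 0)"
      by (rule integral_eq_0_iff) (use cont[OF that] in \<open>auto intro: continuous_on_mult\<close>)
    finally show ?thesis by simp
  qed
  ultimately obtain n :: nat and \<phi> where phi: "\<forall>i<n. \<phi> i \<in> W"
    and ortho: "\<forall>i<n. \<forall>j<n. ip 1 (\<phi> i) (\<phi> j) = (if i = j then 1 else 0)"
    and ex: "\<forall>v\<in>W. \<forall>x\<in>{-1..1}. v x = (\<Sum>i<n. ip 1 v (\<phi> i) * \<phi> i x)"
    using orthonormal_basis[OF _ WV Wsub, of "{..<r}" "{-1..1}" "\<lambda>j x. x ^ j"] by blast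
  have "\<exists>q. \<forall>i<n. \<phi> i = poly (q i)" using phi unfolding W_def by simp metis
  then obtain q where q: "\<And>i. i < n \<Longrightarrow> \<phi> i = poly (q i)" by blast
  have "\<exists>M\<ge>0. \<forall>s\<in>{-1..1}. \<bar>poly (pderiv (q i)) s\<bar> \<le> M" for i
  proof -
    have "bounded (poly (pderiv (q i)) ` {-1..1})" by (intro compact_imp_bounded compact_continuous_image) auto
    then obtain M where "\<forall>x\<in>poly (pderiv (q i)) ` {-1..1}. norm x \<le> M" by (auto simp: bounded_iff)
    then show ?thesis by (intro exI[of _ "max M 0"]) force
  qed
  then obtain M where M: "\<And>i. 0 \<le> M i" "\<And>i s. s \<in> {-1..1} \<Longrightarrow> \<bar>poly (pderiv (q i)) s\<bar> \<le> M i" by metis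
  have "\<bar>poly (pderiv p) s\<bar> \<le> (\<Sum>i<n. M i) * L2_norm 1 (poly p)"
    if p: "degree p < r" and s: "s \<in> {-1..1}" for p s
  proof -
    have pW: "poly p \<in> W" using p by (auto simp: W_def)
    define P where "P = (\<Sum>i<n. smult (ip 1 (poly p) (\<phi> i)) (q i))"
    have eq: "poly p x = poly P x" if "x \<in> {-1..1}" for x
    proof -
      have "poly p x = (\<Sum>i<n. ip 1 (poly p) (\<phi> i) * \<phi> i x)" using ex pW that by blast
      also have "\<dots> = poly P x" by (simp add: P_def poly_sum q)
      finally show ?thesis .
    qed
    \<comment> \<open>Agreement on an interval makes the two polynomials equal; only then may the
      expansion be differentiated.\<close>
    have "poly (p - P) x = 0" if "x \<in> {-1..1}" for x using eq[OF that] by simp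
    then have "{-1..1} \<subseteq> {x. poly (p - P) x = 0}" by blast
    moreover have "\<not> finite {-1..1::real}" by (simp add: infinite_Icc)
    ultimately have "p - P = 0" using poly_roots_finite[of "p - P"] finite_subset by blast
    then have pP: "p = P" by simp
    have "poly (pderiv P) s = (\<Sum>i<n. ip 1 (poly p) (\<phi> i) * poly (pderiv (q i)) s)"
      by (simp add: P_def pderiv_sum pderiv_smult poly_sum)
    moreover have "pderiv p = pderiv P" by (rule arg_cong[OF pP])
    ultimately have "\<bar>poly (pderiv p) s\<bar> = \<bar>\<Sum>i<n. ip 1 (poly p) (\<phi> i) * poly (pderiv (q i)) s\<bar>"
      by simp
    also have "\<dots> \<le> (\<Sum>i<n. \<bar>ip 1 (poly p) (\<phi> i) * poly (pderiv (q i)) s\<bar>)" by (rule sum_abs)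
    also have "\<dots> \<le> (\<Sum>i<n. L2_norm 1 (poly p) * M i)"
    proof (rule sum_mono)
      fix i assume i: "i \<in> {..<n}"
      have "\<bar>ip 1 (poly p) (\<phi> i)\<bar> \<le> L2_norm 1 (poly p) * L2_norm 1 (\<phi> i)"
        using phi i pW WV by (intro ip_le) auto
      also have "L2_norm 1 (\<phi> i) = 1" using ortho i by (simp add: L2_norm_def)
      finally show "\<bar>ip 1 (poly p) (\<phi> i) * poly (pderiv (q i)) s\<bar> \<le> L2_norm 1 (poly p) * M i"
        unfolding abs_mult using M(2)[OF s] by (intro mult_mono) auto
    qed
    finally show ?thesis by (simp add: sum_distrib_left mult.commute)
  qed
  then show ?thesis using M(1) by (intro exI[of _ "\<Sum>i<n. M i"]) (auto intro: sum_nonneg)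
qed

text \<open>Each cell is mapped affinely to \<open>{-1..1}\<close>, so one constant depending on
  \<open>r\<close> alone serves all intervals, meshes and smoothness indices.\<close>

lemma inverse_inequality:
  "\<exists>C>0. \<forall>L N \<mu> v. 0 < L \<longrightarrow> 0 < N \<longrightarrow> v \<in> Sh L N \<mu> r \<longrightarrow> L2_norm L (deriv v) \<le> C / mesh L N * L2_norm L v"
proof -
  \<comment> \<open>For \<open>r = 0\<close> the bound \<open>degree p \<le> r - 1\<close> still
    admits constants; degrees below \<open>Suc r\<close> cover this case as well.\<close>
  obtain C where C: "0 \<le> C" "\<And>p s. degree p < Suc r \<Longrightarrow> s \<in> {-1..1} \<Longrightarrow> \<bar>poly (pderiv p) s\<bar> \<le> C * L2_norm 1 (poly p)"
    using poly_deriv_bound_reference[of "Suc r"] by blast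
  \<comment> \<open>With half-length \<open>m = h / 2\<close> a cell contributes the factor
    \<open>2 * (C / m)\<^sup>2 = 8 * C\<^sup>2 / h\<^sup>2\<close>, at most
    \<open>(4 * C / h)\<^sup>2\<close>; the added 1 makes the constant positive.\<close>
  define K where "K = 4 * C + 1"
  have "L2_norm L (deriv v) \<le> K / mesh L N * L2_norm L v"
    if L: "0 < L" and N: "0 < N" and v: "v \<in> Sh L N \<mu> r" for L N \<mu> v
  proof -
    define h where "h = mesh L N"
    have h: "0 < h" unfolding h_def by (rule mesh_pos[OF L N])
    have pw: "pw L v" by (rule Sh_pw[OF v L N])
    have int: "(\<lambda>x. v x * v x) integrable_on {-L..L}" "(\<lambda>x. deriv v x * deriv v x) integrable_on {-L..L}"
      using pw by (auto intro!: pc_integrable(1)[OF pc_mult] pw_pc pw_pc_deriv)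
    have cell: "integral {node L N i..node L N (Suc i)} (\<lambda>x. deriv v x * deriv v x)
       \<le> (K / h)\<^sup>2 * integral {node L N i..node L N (Suc i)} (\<lambda>x. v x * v x)" if i: "i < N" for i
    proof -
      let ?a = "node L N i"
      have sub: "{?a..node L N (Suc i)} \<subseteq> {-L..L}"
        using node_bounds[OF L N, of i] node_bounds[OF L N, of "Suc i"] that by auto
      obtain p where p: "degree p \<le> r - 1" "\<And>x. x \<in> {?a..node L N (Suc i)} \<Longrightarrow> v x = poly p x"
        using Sh_cell[OF v i] by blast
      define c where "c = ?a + h / 2"
      define m where "m = h / 2"
      have m: "0 < m" using h by (simp add: m_def)
      define q where "q = pcompose p [:c, m:]"
      have dq: "degree q < Suc r" using degree_pcompose_le[of p "[:c, m:]"] p(1) m by (simp add: q_def)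
      have pq: "poly q s = poly p (m * s + c)" for s by (simp add: q_def poly_pcompose algebra_simps)
      have I: "integral {?a..node L N (Suc i)} (\<lambda>x. v x * v x) = m * (L2_norm 1 (poly q))\<^sup>2"
      proof -
        have e1: "(cbox ?a (node L N (Suc i)) :: real set) = {?a..node L N (Suc i)}" by simp
        have "((\<lambda>x. v x * v x) has_integral integral {?a..node L N (Suc i)} (\<lambda>x. v x * v x)) (cbox ?a (node L N (Suc i)))"
          unfolding e1 by (intro integrable_integral Henstock_Kurzweil_Integration.integrable_on_subinterval[OF int(1) sub])
        then have "((\<lambda>x. poly p x * poly p x) has_integral integral {?a..node L N (Suc i)} (\<lambda>x. v x * v x)) (cbox ?a (node L N (Suc i)))"
          (is ?A) by (rule has_integral_eq[rotated]) (use p in auto)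
        have e2: "(?a - c) /\<^sub>R m = -1" "(node L N (Suc i) - c) /\<^sub>R m = 1"
          using h by (simp_all add: c_def m_def node_Suc flip: h_def)
        note e3 = box_real(2)[of "-1" "1::real"]
        from has_integral_affinity'[OF \<open>?A\<close> m, of c]
        have "((\<lambda>s. poly q s * poly q s) has_integral integral {?a..node L N (Suc i)} (\<lambda>x. v x * v x) / m) {-1..1}"
          unfolding pq e2 e3 by (simp add: divide_inverse mult.commute)
        then have "integral {-1..1} (\<lambda>s. poly q s * poly q s) = integral {?a..node L N (Suc i)} (\<lambda>x. v x * v x) / m"
          by (rule integral_unique)
        moreover have "(L2_norm 1 (poly q))\<^sup>2 = integral {-1..1} (\<lambda>s. poly q s * poly q s)"
          unfolding L2_norm_sq by (rule ip_eq_integral) (auto intro: pc_continuous)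
        ultimately show ?thesis using m by simp
      qed
      have D: "\<bar>deriv v x\<bar> \<le> C / m * L2_norm 1 (poly q)" if x: "x \<in> {?a..node L N (Suc i)} - (node L N ` {..N} \<union> {-L,L})" for x
      proof -
        have "deriv v x = poly (pderiv p) x"
          using Sh_DERIV(2)[OF v L N, of x i p] x p(2) i sub by (auto simp: subset_iff less_le)
        moreover have "poly (pderiv q) ((x - c) / m) = m * poly (pderiv p) x"
          using m by (simp add: q_def pderiv_pcompose poly_pcompose pderiv_pCons)
        moreover have "(x - c) / m \<in> {-1..1}" using x m by (auto simp: c_def m_def node_Suc h_def field_simps)
        ultimately show ?thesis using C(2)[OF dq, of "(x - c) / m"] m by (simp add: abs_mult field_simps)
      qed
      have "integral {?a..node L N (Suc i)} (\<lambda>x. deriv v x * deriv v x)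
        = integral {?a..node L N (Suc i)} (\<lambda>x. if x \<in> node L N ` {..N} \<union> {-L,L} then 0 else deriv v x * deriv v x)"
        by (rule integral_spike[of "node L N ` {..N} \<union> {-L,L}"]) (auto intro: negligible_finite)
      also have "\<dots> \<le> integral {?a..node L N (Suc i)} (\<lambda>x. (C / m * L2_norm 1 (poly q))\<^sup>2)"
      proof (rule integral_le)
        have "(\<lambda>x. deriv v x * deriv v x) integrable_on {?a..node L N (Suc i)}"
          by (rule Henstock_Kurzweil_Integration.integrable_on_subinterval[OF int(2) sub])
        then show "(\<lambda>x. if x \<in> node L N ` {..N} \<union> {-L,L} then 0 else deriv v x * deriv v x) integrable_on {?a..node L N (Suc i)}"
          by (rule integrable_spike[of _ _ "node L N ` {..N} \<union> {-L,L}"]) (auto intro: negligible_finite)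
        fix x assume x: "x \<in> {?a..node L N (Suc i)}"
        show "(if x \<in> node L N ` {..N} \<union> {-L,L} then 0 else deriv v x * deriv v x) \<le> (C / m * L2_norm 1 (poly q))\<^sup>2"
        proof (cases "x \<in> node L N ` {..N} \<union> {-L,L}")
          case False
          then have "\<bar>deriv v x\<bar> \<le> C / m * L2_norm 1 (poly q)" using D x by blast
          from power_mono[OF this, of 2] False show ?thesis by (simp add: power2_eq_square)
        qed auto
      qed auto
      also have "\<dots> = h * (C / m * L2_norm 1 (poly q))\<^sup>2" using h by (simp add: node_Suc h_def)
      also have "\<dots> = 2 * (C / m)\<^sup>2 * (m * (L2_norm 1 (poly q))\<^sup>2)"
        using h by (simp add: m_def power_mult_distrib power_divide field_simps)
      also have "\<dots> = 2 * (C / m)\<^sup>2 * integral {?a..node L N (Suc i)} (\<lambda>x. v x * v x)" by (simp only: I)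
      also have "\<dots> \<le> (K / h)\<^sup>2 * integral {?a..node L N (Suc i)} (\<lambda>x. v x * v x)"
      proof (rule mult_right_mono)
        have "2 * (C / m)\<^sup>2 = 8 * C\<^sup>2 / h\<^sup>2" by (simp add: m_def power_divide)
        also have "\<dots> \<le> K\<^sup>2 / h\<^sup>2"
          using C(1) by (intro divide_right_mono) (auto simp: K_def power2_eq_square algebra_simps)
        finally show "2 * (C / m)\<^sup>2 \<le> (K / h)\<^sup>2" by (simp add: power_divide)
        show "0 \<le> integral {?a..node L N (Suc i)} (\<lambda>x. v x * v x)" unfolding I using m by simp
      qed
      finally show ?thesis .
    qed
    have "ip L (deriv v) (deriv v) \<le> (K / h)\<^sup>2 * ip L v v"
      unfolding ip_eq_integral[OF pw_pc[OF pw] pw_pc[OF pw]] ip_eq_integral[OF pw_pc_deriv[OF pw] pw_pc_deriv[OF pw]]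
        integral_cells[OF L N int(1)] integral_cells[OF L N int(2)] sum_distrib_left
      by (intro sum_mono cell) simp
    then have "L2_norm L (deriv v) \<le> sqrt ((K / h)\<^sup>2 * ip L v v)" unfolding L2_norm_def by (rule real_sqrt_le_mono)
    also have "\<dots> = K / h * L2_norm L v" using h C(1) by (simp add: real_sqrt_mult L2_norm_def K_def)
    finally show ?thesis by (simp add: h_def)
  qed
  then show ?thesis using C(1) by (intro exI[of _ K]) (auto simp: K_def)
qed


section \<open>The dual boundary value problems\<close>

text \<open>Equivalent to the usual H^k norm on C^k functions; as a plain sum it is monotone in
  \<open>k\<close> and shifts under \<open>dx\<close> without constants.\<close>

definition Hs_norm :: "real \<Rightarrow> nat \<Rightarrow> (real \<Rightarrow> real) \<Rightarrow> real" where
  "Hs_norm L k g = (\<Sum>j\<le>k. L2_norm L ((dx L ^^ j) g))"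

lemma Hs_norm_nonneg [simp]: "0 \<le> Hs_norm L k g"
  by (simp add: Hs_norm_def sum_nonneg)

lemma L2_le_Hs: "j \<le> k \<Longrightarrow> L2_norm L ((dx L ^^ j) g) \<le> Hs_norm L k g"
  unfolding Hs_norm_def by (rule member_le_sum) auto

lemma Hs_norm_mono: "j \<le> k \<Longrightarrow> Hs_norm L j g \<le> Hs_norm L k g"
  unfolding Hs_norm_def by (rule sum_mono2) auto

lemma Hs_norm_dx: "Hs_norm L k (dx L g) \<le> Hs_norm L (Suc k) g"
proof -
  have "Hs_norm L k (dx L g) = (\<Sum>j\<le>k. L2_norm L ((dx L ^^ Suc j) g))"
    unfolding Hs_norm_def by (simp add: funpow_Suc_right del: funpow.simps)
  then show ?thesis unfolding Hs_norm_def by (simp add: sum.atMost_Suc_shift[of _ k] del: funpow.simps sum.atMost_Suc)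
qed

lemma L2_dx:
  assumes "0 < L" "g \<in> C_space L (Suc k)"
  shows "L2_norm L (deriv g) = L2_norm L (dx L g)"
  by (rule L2_norm_cong) (use C1_pw(2)[OF assms] in auto)

lemma H1_le_Hs:
  assumes "0 < L" "g \<in> C_space L (Suc k)"
  shows "H1_norm L g \<le> Hs_norm L (Suc k) g"
proof -
  have "H1_norm L g \<le> Hs_norm L 1 g"
    using H1_le_add[of L g] L2_dx[OF assms] by (simp add: Hs_norm_def)
  also have "\<dots> \<le> Hs_norm L (Suc k) g" by (rule Hs_norm_mono) simp
  finally show ?thesis .
qed

lemma ip_deriv_parts:
  assumes "0 < L" "\<Psi> \<in> C_space L 2" "pw L v"
  shows "ip L (deriv \<Psi>) (deriv v) = dx L \<Psi> L * v L - dx L \<Psi> (-L) * v (-L) - ip L ((dx L ^^ 2) \<Psi>) v"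
proof -
  have P: "\<Psi> \<in> C_space L (Suc 1)" "dx L \<Psi> \<in> C_space L (Suc 0)"
    using assms(2) C_space_dx[of \<Psi> L 1] by (auto simp: numeral_2_eq_2)
  have "ip L (deriv (dx L \<Psi>)) v = dx L \<Psi> L * v L - dx L \<Psi> (-L) * v (-L) - ip L (dx L \<Psi>) (deriv v)"
    by (rule ip_parts[OF C1_pw(1)[OF assms(1) P(2)] assms(3)]) (use assms in simp)
  moreover have "ip L (dx L \<Psi>) (deriv v) = ip L (deriv \<Psi>) (deriv v)"
    by (rule ip_cong) (use C1_pw(2)[OF assms(1) P(1)] in auto)
  moreover have "ip L (deriv (dx L \<Psi>)) v = ip L ((dx L ^^ 2) \<Psi>) v"
    by (rule ip_cong) (use C1_pw(2)[OF assms(1) P(2)] in \<open>auto simp: numeral_2_eq_2\<close>)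
  ultimately show ?thesis by simp
qed

text \<open>Variation of constants: \<open>p x\<close> is \<open>- k\<close> times the integral over
  \<open>{-L..x}\<close> of \<open>sinh (k * (x - y)) * f y\<close>, which has zero Cauchy data at
  \<open>-L\<close>. The addition theorem splits the kernel so that \<open>x\<close> leaves the
  integrands and the fundamental theorem applies directly.\<close>

lemma fundamental_particular_solution:
  assumes L: "0 < L" and q: "0 < q" and f: "continuous_on {-L..L} f"
  obtains p p' where "\<And>x. x \<in> {-L..L} \<Longrightarrow> (p has_real_derivative p' x) (at x within {-L..L})"
    "\<And>x. x \<in> {-L..L} \<Longrightarrow> (p' has_real_derivative (p x - f x) / q) (at x within {-L..L})"
    "p (-L) = 0" "p' (-L) = 0"
proof -
  define k where "k = 1 / sqrt q"
  have k: "0 < k" "k\<^sup>2 = 1 / q" using q by (auto simp: k_def power_divide)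
  define c where "c = (\<lambda>x. integral {-L..x} (\<lambda>y. cosh (k * y) * f y))"
  define s where "s = (\<lambda>x. integral {-L..x} (\<lambda>y. sinh (k * y) * f y))"
  define p where "p = (\<lambda>x. - k * (sinh (k * x) * c x - cosh (k * x) * s x))"
  define p' where "p' = (\<lambda>x. - k\<^sup>2 * (cosh (k * x) * c x - sinh (k * x) * s x))"
  have c: "(c has_real_derivative cosh (k * x) * f x) (at x within {-L..L})" if "x \<in> {-L..L}" for x
    unfolding c_def by (rule integral_has_real_derivative) (use that f in \<open>auto intro!: continuous_intros\<close>)
  have s: "(s has_real_derivative sinh (k * x) * f x) (at x within {-L..L})" if "x \<in> {-L..L}" for x
    unfolding s_def by (rule integral_has_real_derivative) (use that f in \<open>auto intro!: continuous_intros\<close>)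
  show ?thesis
  proof
    show "p (-L) = 0" "p' (-L) = 0" by (simp_all add: p_def p'_def c_def s_def)
    fix x assume x: "x \<in> {-L..L}"
    show "(p has_real_derivative p' x) (at x within {-L..L})"
      unfolding p_def p'_def
      by (rule derivative_eq_intros c[OF x] s[OF x] refl)+ (simp add: algebra_simps power2_eq_square)
    have "(p' has_real_derivative k\<^sup>2 * p x - k\<^sup>2 * f x * ((cosh (k * x))\<^sup>2 - (sinh (k * x))\<^sup>2)) (at x within {-L..L})"
      unfolding p_def p'_def
      by (rule derivative_eq_intros c[OF x] s[OF x] refl)+ (simp add: algebra_simps power2_eq_square)
    also have "(cosh (k * x))\<^sup>2 - (sinh (k * x))\<^sup>2 = 1" by (rule hyperbolic_pythagoras)
    finally show "(p' has_real_derivative (p x - f x) / q) (at x within {-L..L})"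
      using k by (simp add: diff_divide_distrib)
  qed
qed

lemma second_order_C_space:
  assumes L: "0 < L" and q: "0 < q" and f: "continuous_on {-L..L} f"
    and "\<And>x. x \<in> {-L..L} \<Longrightarrow> (p has_real_derivative p' x) (at x within {-L..L})"
    and "\<And>x. x \<in> {-L..L} \<Longrightarrow> (p' has_real_derivative (p x - f x) / q) (at x within {-L..L})"
  shows "p \<in> C_space L 2" "\<And>x. x \<in> {-L..L} \<Longrightarrow> dx L p x = p' x"
    "\<And>x. x \<in> {-L..L} \<Longrightarrow> p x - q * (dx L ^^ 2) p x = f x"
proof -
  have cp: "continuous_on {-L..L} p" using assms(4) by (metis DERIV_continuous_on)
  have "(\<lambda>x. (p x - f x) / q) \<in> C_space L 0"
    unfolding C_space_0 by (intro continuous_on_divide continuous_on_diff cp f) (use q in auto)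
  then have p': "p' \<in> C_space L (Suc 0)" using assms(5) by (rule C_space_antideriv[OF L])
  then show "p \<in> C_space L 2" using C_space_antideriv[OF L p' assms(4)] by (simp add: numeral_2_eq_2)
  show d: "dx L p x = p' x" if "x \<in> {-L..L}" for x using dx_eqI[OF L that assms(4)[OF that]] .
  fix x assume x: "x \<in> {-L..L}"
  have "dx L (dx L p) x = dx L p' x" by (rule dx_cong[OF d x])
  also have "\<dots> = (p x - f x) / q" using dx_eqI[OF L x assms(5)[OF x]] .
  finally show "p x - q * (dx L ^^ 2) p x = f x" using q by (simp add: numeral_2_eq_2)
qed

text \<open>\<open>cosh (k * (x + L))\<close> solves the homogeneous equation with zero slope at
  \<open>-L\<close>; a multiple of it corrects the slope at \<open>L\<close>, since
  \<open>sinh (k * (L + L))\<close> is nonzero. The Dirichlet problem is treated alike with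
  \<open>sinh (k * (x + L))\<close>.\<close>

lemma Neumann_problem:
  assumes L: "0 < L" and q: "0 < q" and f: "continuous_on {-L..L} f"
  obtains \<Psi> where "\<Psi> \<in> C_space L 2" "dx L \<Psi> (-L) = 0" "dx L \<Psi> L = 0"
    "\<And>x. x \<in> {-L..L} \<Longrightarrow> \<Psi> x - q * (dx L ^^ 2) \<Psi> x = f x"
proof -
  obtain p p' where p: "\<And>x. x \<in> {-L..L} \<Longrightarrow> (p has_real_derivative p' x) (at x within {-L..L})"
    "\<And>x. x \<in> {-L..L} \<Longrightarrow> (p' has_real_derivative (p x - f x) / q) (at x within {-L..L})"
    "p (-L) = 0" "p' (-L) = 0" using fundamental_particular_solution[OF assms] by blast
  define k where "k = 1 / sqrt q"
  have k: "0 < k" "k * k = 1 / q" using q by (auto simp: k_def)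
  define A where "A = - p' L / (k * sinh (k * (L + L)))"
  define \<Psi> where "\<Psi> = (\<lambda>x. p x + A * cosh (k * (x + L)))"
  define \<Psi>' where "\<Psi>' = (\<lambda>x. p' x + A * (k * sinh (k * (x + L))))"
  have d1: "(\<Psi> has_real_derivative \<Psi>' x) (at x within {-L..L})" if x: "x \<in> {-L..L}" for x
    unfolding \<Psi>_def \<Psi>'_def by (rule derivative_eq_intros p(1)[OF x] refl)+ simp
  have d2: "(\<Psi>' has_real_derivative (\<Psi> x - f x) / q) (at x within {-L..L})" if x: "x \<in> {-L..L}" for x
  proof -
    have "(\<Psi>' has_real_derivative (p x - f x) / q + A * cosh (k * (x + L)) * (k * k)) (at x within {-L..L})"
      unfolding \<Psi>'_def by (rule derivative_eq_intros p(2)[OF x] refl)+ simp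
    then show ?thesis unfolding k \<Psi>_def by (simp add: field_simps add_divide_distrib diff_divide_distrib)
  qed
  note C = second_order_C_space[OF L q f d1 d2]
  have "sinh (k * (L + L)) \<noteq> 0" using k L by simp
  then have "\<Psi>' L = 0" "\<Psi>' (-L) = 0" using p k by (simp_all add: \<Psi>'_def A_def)
  then show ?thesis using that[of \<Psi>] C L by auto
qed

lemma Dirichlet_problem:
  assumes L: "0 < L" and q: "0 < q" and f: "continuous_on {-L..L} f"
  obtains \<Psi> where "\<Psi> \<in> C_space L 2" "\<Psi> (-L) = 0" "\<Psi> L = 0"
    "\<And>x. x \<in> {-L..L} \<Longrightarrow> \<Psi> x - q * (dx L ^^ 2) \<Psi> x = f x"
proof -
  obtain p p' where p: "\<And>x. x \<in> {-L..L} \<Longrightarrow> (p has_real_derivative p' x) (at x within {-L..L})"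
    "\<And>x. x \<in> {-L..L} \<Longrightarrow> (p' has_real_derivative (p x - f x) / q) (at x within {-L..L})"
    "p (-L) = 0" "p' (-L) = 0" using fundamental_particular_solution[OF assms] by blast
  define k where "k = 1 / sqrt q"
  have k: "0 < k" "k * k = 1 / q" using q by (auto simp: k_def)
  define A where "A = - p L / sinh (k * (L + L))"
  define \<Psi> where "\<Psi> = (\<lambda>x. p x + A * sinh (k * (x + L)))"
  define \<Psi>' where "\<Psi>' = (\<lambda>x. p' x + A * (k * cosh (k * (x + L))))"
  have d1: "(\<Psi> has_real_derivative \<Psi>' x) (at x within {-L..L})" if x: "x \<in> {-L..L}" for x
    unfolding \<Psi>_def \<Psi>'_def by (rule derivative_eq_intros p(1)[OF x] refl)+ simp
  have d2: "(\<Psi>' has_real_derivative (\<Psi> x - f x) / q) (at x within {-L..L})" if x: "x \<in> {-L..L}" for x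
  proof -
    have "(\<Psi>' has_real_derivative (p x - f x) / q + A * sinh (k * (x + L)) * (k * k)) (at x within {-L..L})"
      unfolding \<Psi>'_def by (rule derivative_eq_intros p(2)[OF x] refl)+ simp
    then show ?thesis unfolding k \<Psi>_def by (simp add: field_simps add_divide_distrib diff_divide_distrib)
  qed
  note C = second_order_C_space[OF L q f d1 d2]
  have "sinh (k * (L + L)) \<noteq> 0" using k L by simp
  then have "\<Psi> L = 0" "\<Psi> (-L) = 0" using p k by (simp_all add: \<Psi>_def A_def)
  then show ?thesis using that[of \<Psi>] C L by auto
qed

lemma A_form_H1:
  assumes "0 < q"
  shows "min 1 q * (H1_norm L v)\<^sup>2 \<le> A_form L q v v" "A_form L q v v \<le> max 1 q * (H1_norm L v)\<^sup>2"
proof -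
  have "min 1 q * ip L v v \<le> ip L v v" "min 1 q * ip L (deriv v) (deriv v) \<le> q * ip L (deriv v) (deriv v)"
    using assms ip_self_nonneg[of L v] ip_self_nonneg[of L "deriv v"] by (auto intro!: mult_left_le_one_le mult_right_mono)
  then show "min 1 q * (H1_norm L v)\<^sup>2 \<le> A_form L q v v"
    unfolding H1_norm_sq A_form_def L2_norm_sq by (simp add: algebra_simps)
  have "1 * ip L v v \<le> max 1 q * ip L v v" "q * ip L (deriv v) (deriv v) \<le> max 1 q * ip L (deriv v) (deriv v)"
    using mult_right_mono[of 1 "max 1 q" "ip L v v"] ip_self_nonneg[of L v] ip_self_nonneg[of L "deriv v"]
    by (auto intro!: mult_right_mono)
  then show "A_form L q v v \<le> max 1 q * (H1_norm L v)\<^sup>2"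
    unfolding H1_norm_sq A_form_def L2_norm_sq by (simp add: algebra_simps)
qed

lemma A_form_le:
  assumes "0 < q" "pw L v" "pw L w"
  shows "\<bar>A_form L q v w\<bar> \<le> max 1 q * (H1_norm L v * H1_norm L w)"
proof -
  have s: "sqrt (A_form L q f f) \<le> sqrt (max 1 q) * H1_norm L f" for f
    using real_sqrt_le_mono[OF A_form_H1(2)[OF assms(1), of L f]] by (simp add: real_sqrt_mult)
  have nn: "0 \<le> A_form L q f f" for f
    using ip_self_nonneg[of L f] ip_self_nonneg[of L "deriv f"] assms(1) by (simp add: A_form_def)
  have "\<bar>A_form L q v w\<bar> \<le> sqrt (A_form L q v v) * sqrt (A_form L q w w)"
    using psd_form.abs_le[OF A_form_psd, of q v L w] assms by simp
  also have "\<dots> \<le> (sqrt (max 1 q) * H1_norm L v) * (sqrt (max 1 q) * H1_norm L w)"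
    by (intro mult_mono s) (auto simp: nn)
  also have "\<dots> = max 1 q * (H1_norm L v * H1_norm L w)" using assms(1) by simp
  finally show ?thesis .
qed

text \<open>Testing with \<open>\<Psi>\<close> itself bounds its H1 norm; the second derivative is
  then read off the differential equation, which accounts for the division by
  \<open>q\<close>.\<close>

lemma dual_regularity:
  assumes L: "0 < L" and q: "0 < q" and f: "continuous_on {-L..L} f"
    and P: "\<Psi> \<in> C_space L 2" and eq: "\<And>x. x \<in> {-L..L} \<Longrightarrow> \<Psi> x - q * (dx L ^^ 2) \<Psi> x = f x"
    and A: "A_form L q \<Psi> \<Psi> = ip L f \<Psi>"
  shows "Hs_norm L 2 \<Psi> \<le> (2 / min 1 q + (1 / min 1 q + 1) / q) * L2_norm L f"
proof -
  define m where "m = min 1 q"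
  have m: "0 < m" using q by (simp add: m_def)
  have P1: "\<Psi> \<in> C_space L (Suc 1)" using P by (simp add: numeral_2_eq_2)
  have pw: "pw L \<Psi>" by (rule C1_pw(1)[OF L P1])
  have pcf: "pc {-L..L} f" using f by (intro pc_continuous) auto
  have "m * (H1_norm L \<Psi>)\<^sup>2 \<le> ip L f \<Psi>" using A_form_H1(1)[OF q, of L \<Psi>] A by (simp add: m_def)
  also have "\<dots> \<le> L2_norm L f * L2_norm L \<Psi>" using ip_le[OF pcf pw_pc[OF pw]] by simp
  also have "\<dots> \<le> L2_norm L f * H1_norm L \<Psi>" by (intro mult_left_mono L2_le_H1) auto
  finally have *: "m * H1_norm L \<Psi> * H1_norm L \<Psi> \<le> L2_norm L f * H1_norm L \<Psi>" by (simp add: power2_eq_square)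
  have "m * H1_norm L \<Psi> \<le> L2_norm L f"
    using * H1_norm_nonneg[of L \<Psi>] L2_norm_nonneg[of L f] by (cases "H1_norm L \<Psi> = 0") auto
  then have H1: "H1_norm L \<Psi> \<le> L2_norm L f / m" using m by (simp add: field_simps)
  have "L2_norm L ((dx L ^^ 2) \<Psi>) = L2_norm L (\<lambda>x. (1 / q) * (\<Psi> x - f x))"
  proof (rule L2_norm_cong)
    fix x assume "x \<in> {-L<..<L}"
    then show "(dx L ^^ 2) \<Psi> x = (1 / q) * (\<Psi> x - f x)" using eq[of x] q by (auto simp: field_simps)
  qed
  also have "\<dots> = (1 / q) * L2_norm L (\<lambda>x. \<Psi> x - f x)"
    using L2_cmult[OF pc_diff[OF pw_pc[OF pw] pcf], of "1/q"] q by simp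
  also have "\<dots> \<le> (1 / q) * (L2_norm L \<Psi> + L2_norm L f)"
    using q by (intro mult_left_mono L2_diff pw_pc[OF pw] pcf) auto
  also have "\<dots> \<le> (1 / q) * (L2_norm L f / m + L2_norm L f)"
    using q H1 L2_le_H1[of L \<Psi>] by (intro mult_left_mono) auto
  finally have d2: "L2_norm L ((dx L ^^ 2) \<Psi>) \<le> (1 / q) * (L2_norm L f / m + L2_norm L f)" .
  have "Hs_norm L 2 \<Psi> = L2_norm L \<Psi> + L2_norm L (dx L \<Psi>) + L2_norm L ((dx L ^^ 2) \<Psi>)"
    by (simp add: Hs_norm_def numeral_2_eq_2)
  also have "\<dots> \<le> L2_norm L f / m + L2_norm L f / m + (1 / q) * (L2_norm L f / m + L2_norm L f)"
    using H1 L2_le_H1[of L \<Psi>] L2_deriv_le_H1[of L \<Psi>] L2_dx[OF L P1] d2 by (intro add_mono) auto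
  also have "\<dots> = (2 / m + (1 / m + 1) / q) * L2_norm L f" by (simp add: algebra_simps add_divide_distrib)
  finally show ?thesis by (simp add: m_def)
qed

text \<open>The boundary terms are asked to vanish as products, so that either factor may achieve
  it: the slope of \<open>\<Psi>\<close> under Neumann conditions, or \<open>v\<close> under
  Dirichlet conditions. It is applied to the exact solution as well as to the dual problems.\<close>

lemma weak_form_of_strong:
  assumes L: "0 < L" and f: "continuous_on {-L..L} f" and P: "\<Psi> \<in> C_space L 2"
    and eq: "\<And>x. x \<in> {-L..L} \<Longrightarrow> \<Psi> x - q * (dx L ^^ 2) \<Psi> x = f x" and v: "pw L v"
    and bd: "dx L \<Psi> L * v L = 0" "dx L \<Psi> (-L) * v (-L) = 0"
  shows "A_form L q \<Psi> v = ip L f v"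
proof -
  have c: "pc {-L..L} ((dx L ^^ 2) \<Psi>)" "pc {-L..L} \<Psi>"
    using C_space_cont[OF P, of 2] C_space_cont[OF P, of 0] by (auto intro: pc_continuous)
  have "ip L f v = ip L (\<lambda>x. \<Psi> x - q * (dx L ^^ 2) \<Psi> x) v"
    by (rule ip_cong) (use eq in auto)
  also have "\<dots> = ip L \<Psi> v - q * ip L ((dx L ^^ 2) \<Psi>) v"
    using psd_form.diff_left[OF ip_psd, of \<Psi> L "\<lambda>x. q * (dx L ^^ 2) \<Psi> x" v]
      psd_form.scale_left[OF ip_psd, of "(dx L ^^ 2) \<Psi>" L v q] c v by (simp add: pc_cmult pw_pc)
  finally show ?thesis using ip_deriv_parts[OF L P v] bd by (simp add: A_form_def)
qed

lemma Neumann_dual: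
  assumes L: "0 < L" and q: "0 < q"
  obtains C where "0 \<le> C" "\<And>f. continuous_on {-L..L} f \<Longrightarrow> \<exists>\<Psi>\<in>C_space L 2.
    dx L \<Psi> (-L) = 0 \<and> dx L \<Psi> L = 0 \<and> Hs_norm L 2 \<Psi> \<le> C * L2_norm L f \<and>
    (\<forall>v. pw L v \<longrightarrow> A_form L q \<Psi> v = ip L f v)"
proof
  show "0 \<le> 2 / min 1 q + (1 / min 1 q + 1) / q" using q by simp
  fix f :: "real \<Rightarrow> real" assume f: "continuous_on {-L..L} f"
  obtain \<Psi> where P: "\<Psi> \<in> C_space L 2" "dx L \<Psi> (-L) = 0" "dx L \<Psi> L = 0"
    "\<And>x. x \<in> {-L..L} \<Longrightarrow> \<Psi> x - q * (dx L ^^ 2) \<Psi> x = f x"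
    using Neumann_problem[OF L q f] by blast
  have "A_form L q \<Psi> v = ip L f v" if "pw L v" for v
    using weak_form_of_strong[OF L f P(1,4) that] P by simp
  moreover from this have "Hs_norm L 2 \<Psi> \<le> (2 / min 1 q + (1 / min 1 q + 1) / q) * L2_norm L f"
    using dual_regularity[OF L q f P(1,4)] C1_pw(1)[OF L, of \<Psi> 1] P(1) by (simp add: numeral_2_eq_2)
  ultimately show "\<exists>\<Psi>\<in>C_space L 2. dx L \<Psi> (-L) = 0 \<and> dx L \<Psi> L = 0 \<and>
    Hs_norm L 2 \<Psi> \<le> (2 / min 1 q + (1 / min 1 q + 1) / q) * L2_norm L f \<and>
    (\<forall>v. pw L v \<longrightarrow> A_form L q \<Psi> v = ip L f v)" using P by blast
qed

lemma Dirichlet_dual: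
  assumes L: "0 < L" and q: "0 < q"
  obtains C where "0 \<le> C" "\<And>f. continuous_on {-L..L} f \<Longrightarrow> \<exists>\<Psi>\<in>C_space L 2.
    \<Psi> (-L) = 0 \<and> \<Psi> L = 0 \<and> Hs_norm L 2 \<Psi> \<le> C * L2_norm L f \<and>
    (\<forall>v. pw L v \<longrightarrow> v (-L) = 0 \<longrightarrow> v L = 0 \<longrightarrow> A_form L q \<Psi> v = ip L f v)"
proof
  show "0 \<le> 2 / min 1 q + (1 / min 1 q + 1) / q" using q by simp
  fix f :: "real \<Rightarrow> real" assume f: "continuous_on {-L..L} f"
  obtain \<Psi> where P: "\<Psi> \<in> C_space L 2" "\<Psi> (-L) = 0" "\<Psi> L = 0"
    "\<And>x. x \<in> {-L..L} \<Longrightarrow> \<Psi> x - q * (dx L ^^ 2) \<Psi> x = f x"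
    using Dirichlet_problem[OF L q f] by blast
  have "A_form L q \<Psi> v = ip L f v" if "pw L v" "v (-L) = 0" "v L = 0" for v
    using weak_form_of_strong[OF L f P(1,4) that(1)] that by simp
  moreover from this have "Hs_norm L 2 \<Psi> \<le> (2 / min 1 q + (1 / min 1 q + 1) / q) * L2_norm L f"
    using dual_regularity[OF L q f P(1,4)] C1_pw(1)[OF L, of \<Psi> 1] P by (simp add: numeral_2_eq_2)
  ultimately show "\<exists>\<Psi>\<in>C_space L 2. \<Psi> (-L) = 0 \<and> \<Psi> L = 0 \<and>
    Hs_norm L 2 \<Psi> \<le> (2 / min 1 q + (1 / min 1 q + 1) / q) * L2_norm L f \<and>
    (\<forall>v. pw L v \<longrightarrow> v (-L) = 0 \<longrightarrow> v L = 0 \<longrightarrow> A_form L q \<Psi> v = ip L f v)" using P by blast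
qed

section \<open>Elliptic projections\<close>

text \<open>The representer is the sum of \<open>l (\<phi> i) * \<phi> i\<close> over an orthonormal
  basis. \<open>l_cong\<close> lets \<open>l\<close> see the expansion of \<open>v\<close>, which is
  an identity on \<open>X\<close> only.\<close>

lemma (in psd_form) Riesz:
  assumes "finite J" "W \<subseteq> V" "fun_subspace W"
    and "\<And>v. v \<in> W \<Longrightarrow> \<exists>c. \<forall>x\<in>X. v x = (\<Sum>j\<in>J. c j * e j x)"
    and "\<And>v. v \<in> W \<Longrightarrow> B v v = 0 \<longleftrightarrow> (\<forall>x\<in>X. v x = 0)"
    and l_add: "\<And>v w. v \<in> W \<Longrightarrow> w \<in> W \<Longrightarrow> l (\<lambda>x. v x + w x) = l v + l w"
    and l_scale: "\<And>v c. v \<in> W \<Longrightarrow> l (\<lambda>x. c * v x) = c * l v"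
    and l_cong: "\<And>v w. v \<in> W \<Longrightarrow> w \<in> W \<Longrightarrow> (\<And>x. x \<in> X \<Longrightarrow> v x = w x) \<Longrightarrow> l v = l w"
  shows "\<exists>z\<in>W. \<forall>v\<in>W. B z v = l v"
proof -
  obtain n :: nat and \<phi> where phi: "\<forall>i<n. \<phi> i \<in> W"
    and ex: "\<forall>v\<in>W. \<forall>x\<in>X. v x = (\<Sum>i<n. B v (\<phi> i) * \<phi> i x)"
    using orthonormal_basis[OF assms(1-5)] by blast
  define z where "z = (\<lambda>x. \<Sum>i<n. l (\<phi> i) * \<phi> i x)"
  have z: "z \<in> W" unfolding z_def by (rule fun_subspace_sum[OF assms(3)]) (use phi in auto)
  have l_sum: "l (\<lambda>x. \<Sum>i\<in>A. c i * \<phi> i x) = (\<Sum>i\<in>A. c i * l (\<phi> i))" if "A \<subseteq> {..<n}" for c A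
    using finite_subset[OF that finite_lessThan] that
  proof (induction A rule: finite_induct)
    case empty
    show ?case using l_scale[OF fun_subspace_zero[OF assms(3)], of 0] by simp
  next
    case (insert a A)
    have 1: "(\<lambda>x. c a * \<phi> a x) \<in> W" "\<phi> a \<in> W" using phi insert by (auto intro: fun_subspace_scale[OF assms(3)])
    have 2: "(\<lambda>x. \<Sum>i\<in>A. c i * \<phi> i x) \<in> W"
      by (rule fun_subspace_sum[OF assms(3)]) (use phi insert in auto)
    show ?case using l_add[OF 1(1) 2] l_scale[OF 1(2), of "c a"] insert by simp
  qed
  have "B z v = l v" if v: "v \<in> W" for v
  proof -
    have "B z v = (\<Sum>i<n. l (\<phi> i) * B (\<phi> i) v)"
      unfolding z_def by (rule sum_left) (use phi v assms(2) in auto)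
    also have "\<dots> = (\<Sum>i<n. B v (\<phi> i) * l (\<phi> i))"
    proof (intro sum.cong refl)
      fix i assume "i \<in> {..<n}"
      then have "B (\<phi> i) v = B v (\<phi> i)" using phi v assms(2) by (intro sym) auto
      then show "l (\<phi> i) * B (\<phi> i) v = B v (\<phi> i) * l (\<phi> i)" by simp
    qed
    also have "\<dots> = l (\<lambda>x. \<Sum>i<n. B v (\<phi> i) * \<phi> i x)" by (rule l_sum[symmetric]) simp
    also have "\<dots> = l v"
    proof (rule l_cong[OF _ v])
      show "(\<lambda>x. \<Sum>i<n. B v (\<phi> i) * \<phi> i x) \<in> W"
        by (rule fun_subspace_sum[OF assms(3)]) (use phi in auto)
      show "(\<Sum>i<n. B v (\<phi> i) * \<phi> i x) = v x" if "x \<in> X" for x using ex v that by metis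
    qed
    finally show ?thesis .
  qed
  then show ?thesis using z by blast
qed

text \<open>What a spline space contributes to the linear algebra. Indices are pairs because
  \<open>Sh_span\<close> labels its functions by cell and power; the subspace \<open>Sh0\<close>
  inherits the representation.\<close>

definition fe_space :: "real \<Rightarrow> (real \<Rightarrow> real) set \<Rightarrow> bool" where
  "fe_space L W \<longleftrightarrow> fun_subspace W \<and> (\<forall>v\<in>W. pw L v) \<and>
     (\<exists>(J :: (nat \<times> nat) set) e. finite J \<and> (\<forall>v\<in>W. \<exists>c. \<forall>x\<in>{-L..L}. v x = (\<Sum>j\<in>J. c j * e j x)))"

lemma fe_space_Sh:
  assumes "0 < L" "0 < N" "1 \<le> r"
  shows "fe_space L (Sh L N \<mu> r)"
  unfolding fe_space_def
proof (intro conjI)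
  show "\<exists>(J :: (nat \<times> nat) set) e. finite J \<and> (\<forall>v\<in>Sh L N \<mu> r. \<exists>c. \<forall>x\<in>{-L..L}. v x = (\<Sum>j\<in>J. c j * e j x))"
    by (intro exI[of _ "{..N}\<times>{..<r}"] exI[of _ "\<lambda>k x. if node L N (fst k) \<le> x \<and> x < node L N (Suc (fst k))
      then x ^ snd k else 0"] conjI ballI Sh_span) (use assms in auto)
qed (use Sh_subspace[OF assms(1)] Sh_pw assms in auto)

lemma fe_space_Sh0:
  assumes "0 < L" "0 < N" "1 \<le> r"
  shows "fe_space L (Sh0 L N \<mu> r)"
proof -
  have "Sh0 L N \<mu> r \<subseteq> Sh L N \<mu> r" using Sh0_Sh by blast
  with fe_space_Sh[OF assms, of \<mu>] Sh0_subspace[OF assms(1)] show ?thesis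
    unfolding fe_space_def by blast
qed

lemma ip_definite:
  assumes "pw L v" "0 < L"
  shows "ip L v v = 0 \<longleftrightarrow> (\<forall>x\<in>{-L..L}. v x = 0)"
proof -
  have "ip L v v = integral {-L..L} (\<lambda>x. v x * v x)" by (rule ip_eq_integral) (use pw_pc assms in auto)
  also have "\<dots> = 0 \<longleftrightarrow> (\<forall>x\<in>{-L..L}. v x * v x = 0)"
    by (rule integral_eq_0_iff) (use assms pw_cont in \<open>auto intro: continuous_on_mult\<close>)
  finally show ?thesis by simp
qed

lemma A_form_definite:
  assumes "pw L v" "0 < L" "0 < q"
  shows "A_form L q v v = 0 \<longleftrightarrow> (\<forall>x\<in>{-L..L}. v x = 0)"
proof
  assume "\<forall>x\<in>{-L..L}. v x = 0"
  then have "A_form L q v v = A_form L q (\<lambda>x. 0) (\<lambda>x. 0)" by (intro A_form_cong) auto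
  also have "\<dots> = 0" using psd_form.zero_left[OF A_form_psd[of q], of "\<lambda>x. 0" L] assms by simp
  finally show "A_form L q v v = 0" .
qed (use pw_A_form_zero[OF assms(1) _ assms(3,2)] in blast)

lemma fe_orthonormal_basis:
  assumes "fe_space L W" "0 < L" "0 < q"
  obtains n :: nat and \<phi> where "\<And>i. i < n \<Longrightarrow> \<phi> i \<in> W"
    "\<And>i j. i < n \<Longrightarrow> j < n \<Longrightarrow> A_form L q (\<phi> i) (\<phi> j) = (if i = j then 1 else 0)"
    "\<And>v x. v \<in> W \<Longrightarrow> x \<in> {-L..L} \<Longrightarrow> v x = (\<Sum>i<n. A_form L q v (\<phi> i) * \<phi> i x)"
proof -
  obtain J :: "(nat \<times> nat) set" and e where *: "finite J"
    "\<And>v. v \<in> W \<Longrightarrow> \<exists>c. \<forall>x\<in>{-L..L}. v x = (\<Sum>j\<in>J. c j * e j x)"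
    using assms(1) unfolding fe_space_def by blast
  have W: "fun_subspace W" "W \<subseteq> {f. pw L f}" using assms(1) unfolding fe_space_def by auto
  have d: "A_form L q v v = 0 \<longleftrightarrow> (\<forall>x\<in>{-L..L}. v x = 0)" if "v \<in> W" for v
    using A_form_definite[OF _ assms(2,3)] W(2) that by blast
  have "psd_form {f. pw L f} (A_form L q)" using A_form_psd assms(3) by simp
  from psd_form.orthonormal_basis[OF this *(1) W(2,1) *(2) d] show ?thesis using that by blast
qed

text \<open>Stated for both forms at once: \<open>ip\<close> yields the discrete Laplacian,
  \<open>A_form\<close> the elliptic projections.\<close>

lemma fe_Riesz:
  assumes "fe_space L W" "0 < L" "B = ip L \<or> B = A_form L q \<and> 0 < q"
    and "\<And>v w. v \<in> W \<Longrightarrow> w \<in> W \<Longrightarrow> l (\<lambda>x. v x + w x) = l v + l w"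
    and "\<And>v c. v \<in> W \<Longrightarrow> l (\<lambda>x. c * v x) = c * l v"
    and "\<And>v w. v \<in> W \<Longrightarrow> w \<in> W \<Longrightarrow> (\<And>x. x \<in> {-L..L} \<Longrightarrow> v x = w x) \<Longrightarrow> l v = l w"
  shows "\<exists>z\<in>W. \<forall>v\<in>W. B z v = l v"
proof -
  obtain J :: "(nat \<times> nat) set" and e where *: "finite J"
    "\<And>v. v \<in> W \<Longrightarrow> \<exists>c. \<forall>x\<in>{-L..L}. v x = (\<Sum>j\<in>J. c j * e j x)"
    using assms(1) unfolding fe_space_def by blast
  have W: "fun_subspace W" "W \<subseteq> {f. pw L f}" using assms(1) unfolding fe_space_def by auto
  have d: "B v v = 0 \<longleftrightarrow> (\<forall>x\<in>{-L..L}. v x = 0)" if "v \<in> W" for v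
    using A_form_definite[OF _ assms(2)] ip_definite[OF _ assms(2)] assms(3) W(2) that by auto
  have B: "psd_form {g. pc {-L..L} g} B \<or> psd_form {f. pw L f} B"
    using assms(3) ip_psd A_form_psd[of q L] by auto
  have W': "W \<subseteq> {g. pc {-L..L} g}" using W(2) pw_pc by auto
  from B show ?thesis
  proof
    assume "psd_form {g. pc {-L..L} g} B"
    then show ?thesis by (rule psd_form.Riesz[where X = "{-L..L}" and e = e]) (use * W' W(1) d assms(4-6) in blast)+
  next
    assume "psd_form {f. pw L f} B"
    then show ?thesis by (rule psd_form.Riesz[where X = "{-L..L}" and e = e]) (use * W d assms(4-6) in blast)+
  qed
qed

lemma elliptic_projection_exists:
  assumes "fe_space L W" "0 < L" "0 < q" "pw L w"
  shows "\<exists>z. z \<in> W \<and> (\<forall>v\<in>W. A_form L q z v = A_form L q w v)"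
proof -
  interpret psd_form "{f. pw L f}" "A_form L q" by (rule A_form_psd) (use assms in simp)
  have W: "W \<subseteq> {f. pw L f}" using assms(1) unfolding fe_space_def by auto
  have "\<exists>z\<in>W. \<forall>v\<in>W. A_form L q z v = A_form L q w v"
  proof (rule fe_Riesz[OF assms(1,2), of "A_form L q" q])
    show "A_form L q w v = A_form L q w v'" if "\<And>x. x \<in> {-L..L} \<Longrightarrow> v x = v' x" for v v'
      by (rule A_form_cong) (use that in auto)
    show "A_form L q w (\<lambda>x. v x + v' x) = A_form L q w v + A_form L q w v'" if "v \<in> W" "v' \<in> W" for v v'
      by (rule add_right) (use that W assms in auto)
    show "A_form L q w (\<lambda>x. c * v x) = c * A_form L q w v" if "v \<in> W" for v c
      by (rule scale_right) (use that W assms in auto)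
  qed (use assms in auto)
  then show ?thesis by blast
qed

lemma Rh_spec:
  assumes "0 < L" "0 < N" "1 \<le> r" "0 < q" "pw L w"
  shows "Rh L N \<mu> r q w \<in> Sh L N \<mu> r" "\<psi> \<in> Sh L N \<mu> r \<Longrightarrow> A_form L q (Rh L N \<mu> r q w) \<psi> = A_form L q w \<psi>"
  using someI_ex[OF elliptic_projection_exists[OF fe_space_Sh[OF assms(1-3)] assms(1,4,5)]]
  unfolding Rh_def by blast+

lemma Rh0_spec:
  assumes "0 < L" "0 < N" "1 \<le> r" "0 < q" "pw L w"
  shows "Rh0 L N \<mu> r q w \<in> Sh0 L N \<mu> r" "\<psi> \<in> Sh0 L N \<mu> r \<Longrightarrow> A_form L q (Rh0 L N \<mu> r q w) \<psi> = A_form L q w \<psi>"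
  using someI_ex[OF elliptic_projection_exists[OF fe_space_Sh0[OF assms(1-3)] assms(1,4,5)]]
  unfolding Rh0_def by blast+

text \<open>The error is orthogonal to the spline \<open>\<zeta> - z\<close> in the sense of
  \<open>A_form\<close>, so in its energy one argument may be exchanged for
  \<open>w - \<zeta>\<close>. Coercivity and continuity contribute the quotient of
  constants.\<close>

lemma Cea:
  assumes "fun_subspace W" "\<And>v. v \<in> W \<Longrightarrow> pw L v" "0 < q" "pw L w" "z \<in> W" "\<zeta> \<in> W"
    and orth: "\<And>v. v \<in> W \<Longrightarrow> A_form L q z v = A_form L q w v"
  shows "H1_norm L (\<lambda>x. w x - z x) \<le> (max 1 q / min 1 q) * H1_norm L (\<lambda>x. w x - \<zeta> x)"
proof -
  interpret psd_form "{f. pw L f}" "A_form L q" by (rule A_form_psd) (use assms in simp)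
  let ?e = "\<lambda>x. w x - z x" and ?d = "\<lambda>x. w x - \<zeta> x" and ?f = "\<lambda>x. \<zeta> x - z x"
  have pw: "pw L z" "pw L \<zeta>" "pw L ?e" "pw L ?d" "pw L ?f" using assms by (auto intro: pw_diff)
  have f: "?f \<in> W" by (rule fun_subspace_diff[OF assms(1,6,5)])
  have "A_form L q ?e ?f = A_form L q w ?f - A_form L q z ?f" by (rule diff_left) (use pw assms in auto)
  then have 0: "A_form L q ?e ?f = 0" using orth[OF f] by simp
  have "A_form L q ?e ?e = A_form L q ?e (\<lambda>x. ?d x + ?f x)" by simp
  also have "\<dots> = A_form L q ?e ?d" using add_right[of ?d ?f ?e] pw 0 by simp
  finally have "min 1 q * (H1_norm L ?e)\<^sup>2 \<le> max 1 q * (H1_norm L ?e * H1_norm L ?d)"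
    using A_form_H1(1)[OF assms(3), of L ?e] A_form_le[OF assms(3) pw(3,4)] by simp
  then have *: "H1_norm L ?e * (min 1 q * H1_norm L ?e) \<le> H1_norm L ?e * (max 1 q * H1_norm L ?d)"
    by (simp add: power2_eq_square mult_ac)
  have m: "0 < min 1 q" using assms(3) by simp
  show ?thesis
  proof (cases "H1_norm L ?e = 0")
    case True
    then show ?thesis using m assms(3) by simp
  next
    case False
    then have "0 < H1_norm L ?e" using H1_norm_nonneg[of L ?e] by linarith
    with * have "min 1 q * H1_norm L ?e \<le> max 1 q * H1_norm L ?d" by simp
    then show ?thesis using m by (simp add: field_simps)
  qed
qed

text \<open>The squared L2 norm of the error is its pairing with the dual solution, from which the
  spline \<open>\<zeta>\<close> may be subtracted by Galerkin orthogonality. In the application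
  \<open>K\<close> is of order h.\<close>

lemma Aubin_Nitsche:
  assumes "\<And>v. v \<in> W \<Longrightarrow> pw L v" "0 < q" "pw L w" "z \<in> W" "\<zeta> \<in> W" "pw L \<Psi>"
    and orth: "\<And>v. v \<in> W \<Longrightarrow> A_form L q z v = A_form L q w v"
    and dual: "A_form L q \<Psi> (\<lambda>x. w x - z x) = ip L (\<lambda>x. w x - z x) (\<lambda>x. w x - z x)"
    and approx: "H1_norm L (\<lambda>x. \<Psi> x - \<zeta> x) \<le> K * L2_norm L (\<lambda>x. w x - z x)" "0 \<le> K"
  shows "L2_norm L (\<lambda>x. w x - z x) \<le> max 1 q * K * H1_norm L (\<lambda>x. w x - z x)"
proof -
  interpret psd_form "{f. pw L f}" "A_form L q" by (rule A_form_psd) (use assms in simp)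
  let ?e = "\<lambda>x. w x - z x"
  have pw: "pw L z" "pw L \<zeta>" "pw L ?e" "pw L (\<lambda>x. \<Psi> x - \<zeta> x)" using assms by (auto intro: pw_diff)
  have "A_form L q \<zeta> ?e = A_form L q \<zeta> w - A_form L q \<zeta> z" by (rule diff_right) (use pw assms in auto)
  also have "\<dots> = 0" using orth[OF assms(5)] sym[of \<zeta> z] sym[of \<zeta> w] pw assms by simp
  finally have "(L2_norm L ?e)\<^sup>2 = A_form L q (\<lambda>x. \<Psi> x - \<zeta> x) ?e"
    using dual diff_left[of \<Psi> \<zeta> ?e] pw assms by (simp add: L2_norm_sq)
  also have "\<dots> \<le> max 1 q * (H1_norm L (\<lambda>x. \<Psi> x - \<zeta> x) * H1_norm L ?e)"
    using A_form_le[OF assms(2) pw(4,3)] by simp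
  also have "\<dots> \<le> max 1 q * ((K * L2_norm L ?e) * H1_norm L ?e)"
    using approx assms(2) by (intro mult_left_mono mult_right_mono) auto
  finally have *: "L2_norm L ?e * L2_norm L ?e \<le> L2_norm L ?e * (max 1 q * K * H1_norm L ?e)"
    by (simp add: power2_eq_square mult_ac)
  show ?thesis
  proof (cases "L2_norm L ?e = 0")
    case True
    then show ?thesis using approx(2) by simp
  next
    case False
    then have "0 < L2_norm L ?e" using L2_norm_nonneg[of L ?e] by linarith
    with * show ?thesis by simp
  qed
qed


section \<open>Approximation by splines\<close>

text \<open>Cauchy-Schwarz against the constant 1, obtained from the nonnegative integral of
  \<open>(\<bar>F x\<bar> - l)\<^sup>2\<close> with \<open>l\<close> the mean of
  \<open>\<bar>F x\<bar>\<close>.\<close>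

lemma integral_square_ge:
  fixes F :: "real \<Rightarrow> real"
  assumes "a \<le> b" "continuous_on {a..b} F"
  shows "(integral {a..b} (\<lambda>x. \<bar>F x\<bar>))\<^sup>2 \<le> (b - a) * integral {a..b} (\<lambda>x. (F x)\<^sup>2)"
proof (cases "a = b")
  case False
  then have ab: "a < b" using assms(1) by simp
  define l where "l = integral {a..b} (\<lambda>x. \<bar>F x\<bar>) / (b - a)"
  have i: "(\<lambda>x. \<bar>F x\<bar>) integrable_on {a..b}" "(\<lambda>x. (F x)\<^sup>2) integrable_on {a..b}"
    using assms(2) by (auto intro!: integrable_continuous_interval continuous_intros)
  have "0 \<le> integral {a..b} (\<lambda>x. (\<bar>F x\<bar> - l)\<^sup>2)"
    using assms(2) by (intro integral_nonneg integrable_continuous_interval continuous_intros) auto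
  also have "(\<lambda>x. (\<bar>F x\<bar> - l)\<^sup>2) = (\<lambda>x. ((F x)\<^sup>2 - (2 * l) * \<bar>F x\<bar>) + l\<^sup>2)"
    by (simp add: power2_diff fun_eq_iff algebra_simps)
  also have "integral {a..b} \<dots> = integral {a..b} (\<lambda>x. (F x)\<^sup>2) - 2 * l * integral {a..b} (\<lambda>x. \<bar>F x\<bar>) + (b - a) * l\<^sup>2"
    using i ab by (subst integral_add) (auto intro!: integrable_diff integrable_on_mult_right simp: integral_diff integrable_on_mult_right)
  also have "integral {a..b} (\<lambda>x. \<bar>F x\<bar>) = (b - a) * l" using ab by (simp add: l_def)
  finally have "(b - a) * l\<^sup>2 \<le> integral {a..b} (\<lambda>x. (F x)\<^sup>2)" by (simp add: power2_eq_square algebra_simps)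
  then have "(b - a) * ((b - a) * l\<^sup>2) \<le> (b - a) * integral {a..b} (\<lambda>x. (F x)\<^sup>2)" using ab by simp
  moreover have "integral {a..b} (\<lambda>x. \<bar>F x\<bar>) = (b - a) * l" using ab by (simp add: l_def)
  ultimately show ?thesis by (simp add: power_mult_distrib power2_eq_square mult_ac)
qed simp

text \<open>Friedrichs' inequality with a zero at the left end, the point where the interpolants and
  integrated splines below agree with the function they approximate.\<close>

lemma L2_le_deriv:
  assumes "pw L e" "e (-L) = 0" "0 < L"
  shows "L2_norm L e \<le> 2 * L * L2_norm L (deriv e)"
proof -
  have "L2_norm L e \<le> (sqrt (2 * L) * L2_norm L (deriv e)) * sqrt (2 * L)"
    using pw_increment[OF assms(1), of _ "-L"] assms by (intro L2_le_sup pw_pc[OF assms(1)]) auto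
  then show ?thesis using assms(3) by (simp add: mult_ac)
qed

text \<open>A sum of ramps: the i-th is zero left of node i, climbs across cell i and stays constant
  afterwards. Continuity is immediate and no choice of a cell enters.\<close>

definition linear_interpolant :: "real \<Rightarrow> nat \<Rightarrow> (real \<Rightarrow> real) \<Rightarrow> real \<Rightarrow> real" where
  "linear_interpolant L N g x = g (-L) + (\<Sum>i<N. (g (node L N (Suc i)) - g (node L N i)) / mesh L N *
     max 0 (min (mesh L N) (x - node L N i)))"

lemma linear_interpolant_cell:
  assumes "0 < L" "0 < N" "j < N" "x \<in> {node L N j..node L N (Suc j)}"
  shows "linear_interpolant L N g x = g (node L N j) +
    (g (node L N (Suc j)) - g (node L N j)) / mesh L N * (x - node L N j)"
proof -
  have h: "0 < mesh L N" by (rule mesh_pos[OF assms(1,2)])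
  define t where "t = (\<lambda>i. (g (node L N (Suc i)) - g (node L N i)) / mesh L N * max 0 (min (mesh L N) (x - node L N i)))"
  have "(\<Sum>i<N. t i) = (\<Sum>i<Suc j. t i)"
  proof (rule sum.mono_neutral_right)
    show "\<forall>i\<in>{..<N} - {..<Suc j}. t i = 0"
    proof
      fix i assume "i \<in> {..<N} - {..<Suc j}"
      then have "x \<le> node L N i" using assms(4) node_mono[OF assms(1), of "Suc j" i N] by auto
      then show "t i = 0" by (simp add: t_def)
    qed
  qed (use assms in auto)
  also have "\<dots> = (\<Sum>i<j. g (node L N (Suc i)) - g (node L N i)) + t j"
  proof -
    have "t i = g (node L N (Suc i)) - g (node L N i)" if "i < j" for i
    proof -
      have "mesh L N \<le> x - node L N i" using assms(4) node_mono[OF assms(1), of "Suc i" j N] that by (auto simp: node_Suc)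
      then show ?thesis using h by (simp add: t_def)
    qed
    then show ?thesis by simp
  qed
  also have "(\<Sum>i<j. g (node L N (Suc i)) - g (node L N i)) = g (node L N j) - g (-L)"
    using sum_lessThan_telescope[of "\<lambda>i. g (node L N i)" j] by simp
  also have "t j = (g (node L N (Suc j)) - g (node L N j)) / mesh L N * (x - node L N j)"
    using assms(4) by (auto simp: t_def node_Suc)
  finally show ?thesis by (simp add: linear_interpolant_def t_def)
qed

lemma linear_interpolant_Sh:
  assumes "0 < L" "0 < N"
  shows "linear_interpolant L N g \<in> Sh L N 0 2"
proof -
  have "continuous_on {-L..L} (linear_interpolant L N g)"
    unfolding linear_interpolant_def by (intro continuous_intros)
  moreover have "\<exists>p. degree p \<le> 2 - 1 \<and> (\<forall>x\<in>{node L N i..node L N (i + 1)}. linear_interpolant L N g x = poly p x)"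
    if "i < N" for i
  proof -
    define m where "m = (g (node L N (Suc i)) - g (node L N i)) / mesh L N"
    have "\<forall>x\<in>{node L N i..node L N (i + 1)}. linear_interpolant L N g x = poly [:g (node L N i) - m * node L N i, m:] x"
      using linear_interpolant_cell[OF assms that, of _ g] by (auto simp: m_def[symmetric] algebra_simps)
    then show ?thesis by (intro exI[of _ "[:g (node L N i) - m * node L N i, m:]"]) auto
  qed
  ultimately show ?thesis unfolding Sh_def C_space_0 by blast
qed

text \<open>Only the derivative is estimated cell by cell. By the mean value theorem the slope of
  the interpolant is a value of \<open>g1\<close> in the cell, so the two differ by at most the
  integral of \<open>\<bar>g2 x\<bar>\<close>; Cauchy-Schwarz and summation give the factor h. The
  L2 part follows from the zero at \<open>-L\<close>, and its missing order is recovered later by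
  duality.\<close>

lemma linear_interpolant_error:
  assumes L: "0 < L" and N: "0 < N" and g: "g \<in> C_space L 2"
  shows "H1_norm L (\<lambda>x. g x - linear_interpolant L N g x) \<le> (1 + 2 * L) * mesh L N * Hs_norm L 2 g"
proof -
  define h where "h = mesh L N"
  have h: "0 < h" unfolding h_def by (rule mesh_pos[OF L N])
  define s where "s = linear_interpolant L N g"
  define g1 where "g1 = dx L g"
  define g2 where "g2 = (dx L ^^ 2) g"
  have g': "g \<in> C_space L (Suc 1)" "g1 \<in> C_space L (Suc 0)"
    using g C_space_dx[of g L 1] by (auto simp: numeral_2_eq_2 g1_def)
  have g2: "g2 = dx L g1" by (simp add: g1_def g2_def numeral_2_eq_2)
  have d1: "(g has_real_derivative g1 x) (at x within {-L..L})" if "x \<in> {-L..L}" for x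
    unfolding g1_def using dx_works[OF L _ that] g'(1) by (simp add: C_space_Suc)
  have d2: "(g1 has_real_derivative g2 x) (at x within {-L..L})" if "x \<in> {-L..L}" for x
    unfolding g2 using dx_works[OF L _ that] g'(2) by (simp add: C_space_Suc)
  have c2: "continuous_on {-L..L} g2" unfolding g2_def using C_space_cont[OF g, of 2] by simp
  have sS: "s \<in> Sh L N 0 2" unfolding s_def by (rule linear_interpolant_Sh[OF L N])
  have pws: "pw L s" by (rule Sh_pw[OF sS L N])
  have pwg: "pw L g" by (rule C1_pw(1)[OF L g'(1)])
  let ?e = "\<lambda>x. g x - s x"
  have pwe: "pw L ?e" by (rule pw_diff[OF pwg pws])
  have int: "(\<lambda>x. deriv ?e x * deriv ?e x) integrable_on {-L..L}" "(\<lambda>x. (g2 x)\<^sup>2) integrable_on {-L..L}"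
    using pc_integrable(1)[OF pc_mult[OF pw_pc_deriv[OF pwe] pw_pc_deriv[OF pwe]]] c2
    by (auto intro!: integrable_continuous_interval continuous_intros)
  have cell: "integral {node L N i..node L N (Suc i)} (\<lambda>x. deriv ?e x * deriv ?e x)
       \<le> h\<^sup>2 * integral {node L N i..node L N (Suc i)} (\<lambda>x. (g2 x)\<^sup>2)" if i: "i < N" for i
  proof -
    define p where "p = node L N i"
    define p' where "p' = node L N (Suc i)"
    have pp: "p' = p + h" by (simp add: p_def p'_def h_def node_Suc)
    have sub: "{p..p'} \<subseteq> {-L..L}"
      using node_bounds[OF L N, of i] node_bounds[OF L N, of "Suc i"] i by (auto simp: p_def p'_def)
    define m where "m = (g p' - g p) / h"
    have sx: "s x = g p + m * (x - p)" if "x \<in> {p..p'}" for x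
      unfolding s_def m_def p_def p'_def h_def by (rule linear_interpolant_cell[OF L N i]) (use that in \<open>simp add: p_def p'_def\<close>)
    define M where "M = integral {p..p'} (\<lambda>x. \<bar>g2 x\<bar>)"
    have d1': "(g has_derivative (*) (g1 x)) (at x within {p..p'})" if "p \<le> x" "x \<le> p'" for x
      using DERIV_subset[OF d1 sub, of x] that sub by (auto simp: has_field_derivative_def subset_iff)
    have "p < p'" using h pp by simp
    from mvt_simple[OF this d1'] obtain y where y: "y \<in> {p<..<p'}" "g1 y = m"
      using h pp by (auto simp: m_def)
    have M: "\<bar>g1 x - m\<bar> \<le> M" if x: "x \<in> {p..p'}" for x
    proof -
      have *: "\<bar>g1 v - g1 u\<bar> \<le> M" if uv: "p \<le> u" "u \<le> v" "v \<le> p'" for u v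
      proof -
        have sub': "{u..v} \<subseteq> {-L..L}" using sub uv by auto
        have "(g2 has_integral (g1 v - g1 u)) {u..v}"
          by (rule fundamental_theorem_of_calculus[OF uv(2)])
            (use DERIV_subset[OF d2 sub'] sub' in \<open>auto simp: has_real_derivative_iff_has_vector_derivative[symmetric]\<close>)
        then have eq: "g1 v - g1 u = integral {u..v} g2" by (simp add: integral_unique)
        have ci: "continuous_on {u..v} g2" "continuous_on {p..p'} g2"
          by (rule continuous_on_subset[OF c2]; use sub sub' in auto)+
        have "norm (integral {u..v} g2) \<le> integral {u..v} (\<lambda>x. \<bar>g2 x\<bar>)"
          using ci by (intro integral_norm_bound_integral integrable_continuous_interval continuous_intros) auto
        also have "\<dots> \<le> M" unfolding M_def
          using ci uv by (intro integral_subset_le integrable_continuous_interval continuous_intros) auto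
        finally show ?thesis using eq by simp
      qed
      show ?thesis using *[of x y] *[of y x] x y by (cases "x \<le> y") (auto simp: abs_minus_commute)
    qed
    let ?S = "node L N ` {..N} \<union> {-L, L}"
    have D: "deriv ?e x = g1 x - m" if x: "x \<in> {p..p'} - ?S" for x
    proof (rule DERIV_imp_deriv, rule DERIV_diff)
      have xi: "x \<in> {-L<..<L}" using x sub by (auto simp: less_le subset_iff)
      show "(g has_real_derivative g1 x) (at x)" unfolding g1_def by (rule C_space_DERIV[OF L g'(1) xi])
      have "deriv s x = poly (pderiv [:g p - m * p, m:]) x"
        by (rule Sh_DERIV(2)[OF sS L N xi _ i]) (use x sx in \<open>auto simp: p_def p'_def algebra_simps\<close>)
      then show "(s has_real_derivative m) (at x)"
        using Sh_DERIV(1)[OF sS L N xi] x by (simp add: pderiv_pCons)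
    qed
    have "integral {p..p'} (\<lambda>x. deriv ?e x * deriv ?e x)
        = integral {p..p'} (\<lambda>x. if x \<in> ?S then 0 else deriv ?e x * deriv ?e x)"
      by (rule integral_spike[of ?S]) (auto intro: negligible_finite)
    also have "\<dots> \<le> integral {p..p'} (\<lambda>x. M\<^sup>2)"
    proof (rule integral_le)
      have "(\<lambda>x. deriv ?e x * deriv ?e x) integrable_on {p..p'}"
        by (rule Henstock_Kurzweil_Integration.integrable_on_subinterval[OF int(1) sub])
      then show "(\<lambda>x. if x \<in> ?S then 0 else deriv ?e x * deriv ?e x) integrable_on {p..p'}"
        by (rule integrable_spike[of _ _ ?S]) (auto intro: negligible_finite)
      fix x assume x: "x \<in> {p..p'}"
      show "(if x \<in> ?S then 0 else deriv ?e x * deriv ?e x) \<le> M\<^sup>2"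
      proof (cases "x \<in> ?S")
        case False
        then have "deriv ?e x = g1 x - m" using D[of x] x by simp
        then show ?thesis using power_mono[OF M[OF x], of 2] False by (simp add: power2_eq_square)
      qed auto
    qed auto
    also have "\<dots> = h * M\<^sup>2" using h pp by simp
    also have "\<dots> \<le> h * (h * integral {p..p'} (\<lambda>x. (g2 x)\<^sup>2))"
      using integral_square_ge[of p p' g2] continuous_on_subset[OF c2 sub] h pp
      by (intro mult_left_mono) (auto simp: M_def)
    finally show ?thesis by (simp add: p_def p'_def power2_eq_square)
  qed
  have "ip L (deriv ?e) (deriv ?e) = integral {-L..L} (\<lambda>x. deriv ?e x * deriv ?e x)"
    by (rule ip_eq_integral) (rule pw_pc_deriv[OF pwe])+
  also have "\<dots> \<le> h\<^sup>2 * integral {-L..L} (\<lambda>x. (g2 x)\<^sup>2)"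
    unfolding integral_cells[OF L N int(1)] integral_cells[OF L N int(2)] sum_distrib_left
    by (intro sum_mono cell) simp
  also have "integral {-L..L} (\<lambda>x. (g2 x)\<^sup>2) = (L2_norm L g2)\<^sup>2"
    using c2 unfolding L2_norm_sq by (subst ip_eq_integral) (auto simp: power2_eq_square intro: pc_continuous)
  finally have "(L2_norm L (deriv ?e))\<^sup>2 \<le> (h * L2_norm L g2)\<^sup>2" by (simp add: L2_norm_sq power_mult_distrib)
  then have d: "L2_norm L (deriv ?e) \<le> h * L2_norm L g2" by (rule power2_le_imp_le) (use h in simp)
  have e0: "?e (-L) = 0"
    unfolding s_def using linear_interpolant_cell[OF L N N, of "-L" g] node_Suc[of L N 0] h by (simp add: h_def)
  have "H1_norm L ?e \<le> L2_norm L ?e + L2_norm L (deriv ?e)" by (rule H1_le_add)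
  also have "\<dots> \<le> (1 + 2 * L) * L2_norm L (deriv ?e)" using L2_le_deriv[OF pwe e0 L] by (simp add: algebra_simps)
  also have "\<dots> \<le> (1 + 2 * L) * (h * L2_norm L g2)" using d L by (intro mult_left_mono) auto
  also have "\<dots> \<le> (1 + 2 * L) * (h * Hs_norm L 2 g)"
    using L h L2_le_Hs[of 2 2 L g] by (intro mult_left_mono) (auto simp: g2_def)
  finally show ?thesis by (simp add: h_def s_def mult.assoc)
qed

section \<open>Orders of approximation and of the elliptic projections\<close>

definition zero_at_ends :: "real \<Rightarrow> (real \<Rightarrow> real) \<Rightarrow> bool" where
  "zero_at_ends L f \<longleftrightarrow> f (-L) = 0 \<and> f L = 0"

text \<open>\<open>W N\<close> is the spline space on the mesh with \<open>N\<close> cells, and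
  \<open>Z\<close> the essential boundary condition of the approximated functions: vacuous for
  \<open>Sh\<close>, zero ends for \<open>Sh0\<close>.\<close>

definition H1_approx :: "real \<Rightarrow> ((real \<Rightarrow> real) \<Rightarrow> bool) \<Rightarrow> (nat \<Rightarrow> (real \<Rightarrow> real) set) \<Rightarrow> nat \<Rightarrow> bool" where
  "H1_approx L Z W k \<longleftrightarrow> (\<exists>C\<ge>0. \<forall>N>0. \<forall>g\<in>C_space L k. Z g \<longrightarrow> (\<exists>s\<in>W N.
     H1_norm L (\<lambda>x. g x - s x) \<le> C * mesh L N ^ (k - 1) * Hs_norm L k g))"

text \<open>\<open>Cea\<close> gives the H1 order, \<open>Aubin_Nitsche\<close> the L2 order. The
  dual solution is only C^2, hence the approximation property of order 2 beside that of order
  \<open>k\<close>: it supplies the extra factor h.\<close>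

lemma projection_error:
  assumes L: "0 < L" and q: "0 < q" and k: "1 \<le> k"
    and W: "\<And>N. 0 < N \<Longrightarrow> fun_subspace (W N)" "\<And>N v. 0 < N \<Longrightarrow> v \<in> W N \<Longrightarrow> pw L v" "\<And>N v. v \<in> W N \<Longrightarrow> Z v"
    and Z: "\<And>f g. Z f \<Longrightarrow> Z g \<Longrightarrow> Z (\<lambda>x. f x - g x)"
    and D: "0 \<le> D" "\<And>f. continuous_on {-L..L} f \<Longrightarrow> \<exists>\<Psi>\<in>C_space L 2. Z \<Psi> \<and>
      Hs_norm L 2 \<Psi> \<le> D * L2_norm L f \<and> (\<forall>v. pw L v \<longrightarrow> Z v \<longrightarrow> A_form L q \<Psi> v = ip L f v)"
    and 2: "H1_approx L Z W 2" and ak: "H1_approx L Z W k"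
  shows "\<exists>C\<ge>0. \<forall>N>0. \<forall>g\<in>C_space L k. \<forall>z\<in>W N. Z g \<longrightarrow>
    (\<forall>v\<in>W N. A_form L q z v = A_form L q g v) \<longrightarrow>
    H1_norm L (\<lambda>x. g x - z x) \<le> C * mesh L N ^ (k - 1) * Hs_norm L k g \<and>
    L2_norm L (\<lambda>x. g x - z x) \<le> C * mesh L N ^ k * Hs_norm L k g"
proof -
  obtain C2 where C2: "0 \<le> C2" "\<And>N g. 0 < N \<Longrightarrow> g \<in> C_space L 2 \<Longrightarrow> Z g \<Longrightarrow> \<exists>s\<in>W N.
     H1_norm L (\<lambda>x. g x - s x) \<le> C2 * mesh L N * Hs_norm L 2 g"
    using 2 by (auto simp: H1_approx_def)
  obtain Ck where Ck: "0 \<le> Ck" "\<And>N g. 0 < N \<Longrightarrow> g \<in> C_space L k \<Longrightarrow> Z g \<Longrightarrow> \<exists>s\<in>W N.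
     H1_norm L (\<lambda>x. g x - s x) \<le> Ck * mesh L N ^ (k - 1) * Hs_norm L k g"
    using ak by (auto simp: H1_approx_def)
  define C1 where "C1 = max 1 q / min 1 q * Ck"
  define C0 where "C0 = max 1 q * (C2 * D) * C1"
  have C1: "0 \<le> C1" "0 \<le> C0" using Ck(1) q C2 D by (auto simp: C1_def C0_def)
  have "H1_norm L (\<lambda>x. g x - z x) \<le> max C0 C1 * mesh L N ^ (k - 1) * Hs_norm L k g \<and>
    L2_norm L (\<lambda>x. g x - z x) \<le> max C0 C1 * mesh L N ^ k * Hs_norm L k g"
    if N: "0 < N" and g: "g \<in> C_space L k" and z: "z \<in> W N" and Zg: "Z g"
      and orth: "\<And>v. v \<in> W N \<Longrightarrow> A_form L q z v = A_form L q g v" for N g z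
  proof -
    let ?e = "\<lambda>x. g x - z x"
    have h: "0 < mesh L N" by (rule mesh_pos[OF L N])
    obtain k' where k': "k = Suc k'" using k by (cases k) auto
    have pwg: "pw L g" using C1_pw(1)[OF L] g k' by auto
    have pwe: "pw L ?e" by (rule pw_diff[OF pwg W(2)[OF N z]])
    obtain s where s: "s \<in> W N" "H1_norm L (\<lambda>x. g x - s x) \<le> Ck * mesh L N ^ (k - 1) * Hs_norm L k g"
      using Ck(2)[OF N g Zg] by blast
    have "H1_norm L ?e \<le> max 1 q / min 1 q * H1_norm L (\<lambda>x. g x - s x)"
      by (rule Cea[OF W(1)[OF N] W(2)[OF N] q pwg z s(1) orth])
    also have "\<dots> \<le> max 1 q / min 1 q * (Ck * mesh L N ^ (k - 1) * Hs_norm L k g)"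
      by (rule mult_left_mono[OF s(2)]) (use q in auto)
    finally have H1: "H1_norm L ?e \<le> C1 * mesh L N ^ (k - 1) * Hs_norm L k g" by (simp add: C1_def mult_ac)
    obtain \<Psi> where P: "\<Psi> \<in> C_space L 2" "Z \<Psi>" "Hs_norm L 2 \<Psi> \<le> D * L2_norm L ?e"
      "A_form L q \<Psi> ?e = ip L ?e ?e" using D(2)[OF pw_cont[OF pwe]] pwe Z[OF Zg W(3)[OF z]] by blast
    obtain \<zeta> where Z: "\<zeta> \<in> W N" "H1_norm L (\<lambda>x. \<Psi> x - \<zeta> x) \<le> C2 * mesh L N * Hs_norm L 2 \<Psi>"
      using C2(2)[OF N P(1,2)] by blast
    have "C2 * mesh L N * Hs_norm L 2 \<Psi> \<le> C2 * mesh L N * (D * L2_norm L ?e)"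
      using P(3) C2(1) h by (intro mult_left_mono) auto
    with Z(2) have Z2: "H1_norm L (\<lambda>x. \<Psi> x - \<zeta> x) \<le> (C2 * mesh L N * D) * L2_norm L ?e" by (simp add: mult_ac)
    have "L2_norm L ?e \<le> max 1 q * (C2 * mesh L N * D) * H1_norm L ?e"
      by (rule Aubin_Nitsche[OF W(2)[OF N] q pwg z Z(1) C1_pw(1)[OF L] orth P(4) Z2])
        (use P(1) C2(1) D(1) h in \<open>auto simp: numeral_2_eq_2\<close>)
    also have "\<dots> \<le> max 1 q * (C2 * mesh L N * D) * (C1 * mesh L N ^ (k - 1) * Hs_norm L k g)"
      by (rule mult_left_mono[OF H1]) (use q C2(1) D(1) h in auto)
    also have "\<dots> = C0 * mesh L N ^ k * Hs_norm L k g" by (simp add: C0_def k' mult_ac)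
    finally have L2: "L2_norm L ?e \<le> C0 * mesh L N ^ k * Hs_norm L k g" .
    have "C1 * mesh L N ^ (k - 1) * Hs_norm L k g \<le> max C0 C1 * mesh L N ^ (k - 1) * Hs_norm L k g"
      "C0 * mesh L N ^ k * Hs_norm L k g \<le> max C0 C1 * mesh L N ^ k * Hs_norm L k g"
      using h by (auto intro!: mult_right_mono)
    then show ?thesis using H1 L2 by linarith
  qed
  then show ?thesis using C1 by (intro exI[of _ "max C0 C1"]) auto
qed

text \<open>Without essential boundary conditions the test functions are free at the ends, and the
  Neumann problem is the right dual. The version for \<open>Sh0\<close> uses the Dirichlet
  problem.\<close>

lemma projection_error_Sh:
  assumes L: "0 < L" and q: "0 < q" and k: "1 \<le> k"
    and "H1_approx L (\<lambda>_. True) (\<lambda>N. Sh L N \<mu> r) 2" "H1_approx L (\<lambda>_. True) (\<lambda>N. Sh L N \<mu> r) k"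
  obtains C where "0 \<le> C" "\<And>N g z. 0 < N \<Longrightarrow> g \<in> C_space L k \<Longrightarrow> z \<in> Sh L N \<mu> r \<Longrightarrow>
    (\<And>v. v \<in> Sh L N \<mu> r \<Longrightarrow> A_form L q z v = A_form L q g v) \<Longrightarrow>
    H1_norm L (\<lambda>x. g x - z x) \<le> C * mesh L N ^ (k - 1) * Hs_norm L k g \<and>
    L2_norm L (\<lambda>x. g x - z x) \<le> C * mesh L N ^ k * Hs_norm L k g"
proof -
  obtain D where D: "0 \<le> D" "\<And>f. continuous_on {-L..L} f \<Longrightarrow> \<exists>\<Psi>\<in>C_space L 2.
    dx L \<Psi> (-L) = 0 \<and> dx L \<Psi> L = 0 \<and> Hs_norm L 2 \<Psi> \<le> D * L2_norm L f \<and>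
    (\<forall>v. pw L v \<longrightarrow> A_form L q \<Psi> v = ip L f v)"
    using Neumann_dual[OF L q] by blast
  have "\<exists>C\<ge>0. \<forall>N>0. \<forall>g\<in>C_space L k. \<forall>z\<in>Sh L N \<mu> r. True \<longrightarrow>
    (\<forall>v\<in>Sh L N \<mu> r. A_form L q z v = A_form L q g v) \<longrightarrow>
    H1_norm L (\<lambda>x. g x - z x) \<le> C * mesh L N ^ (k - 1) * Hs_norm L k g \<and>
    L2_norm L (\<lambda>x. g x - z x) \<le> C * mesh L N ^ k * Hs_norm L k g"
  proof (rule projection_error[where Z = "\<lambda>_. True", OF L q k _ _ _ _ D(1) _ assms(4,5)])
    show "\<exists>\<Psi>\<in>C_space L 2. True \<and> Hs_norm L 2 \<Psi> \<le> D * L2_norm L f \<and>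
      (\<forall>v. pw L v \<longrightarrow> True \<longrightarrow> A_form L q \<Psi> v = ip L f v)" if "continuous_on {-L..L} f" for f
      using D(2)[OF that] by blast
  qed (use Sh_subspace[OF L] Sh_pw[OF _ L] in auto)
  then obtain C where C: "0 \<le> C" and *: "\<forall>N>0. \<forall>g\<in>C_space L k. \<forall>z\<in>Sh L N \<mu> r. True \<longrightarrow>
    (\<forall>v\<in>Sh L N \<mu> r. A_form L q z v = A_form L q g v) \<longrightarrow>
    H1_norm L (\<lambda>x. g x - z x) \<le> C * mesh L N ^ (k - 1) * Hs_norm L k g \<and>
    L2_norm L (\<lambda>x. g x - z x) \<le> C * mesh L N ^ k * Hs_norm L k g" by (elim exE conjE)
  show ?thesis
  proof (rule that[OF C])
    fix N g z assume "(0::nat) < N" "g \<in> C_space L k" "z \<in> Sh L N \<mu> r"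
      "\<And>v. v \<in> Sh L N \<mu> r \<Longrightarrow> A_form L q z v = A_form L q g v"
    then show "H1_norm L (\<lambda>x. g x - z x) \<le> C * mesh L N ^ (k - 1) * Hs_norm L k g \<and>
      L2_norm L (\<lambda>x. g x - z x) \<le> C * mesh L N ^ k * Hs_norm L k g"
      using *[rule_format, of N g z] by simp
  qed
qed

lemma projection_error_Sh0:
  assumes L: "0 < L" and q: "0 < q" and k: "1 \<le> k"
    and "H1_approx L (zero_at_ends L) (\<lambda>N. Sh0 L N \<mu> r) 2" "H1_approx L (zero_at_ends L) (\<lambda>N. Sh0 L N \<mu> r) k"
  obtains C where "0 \<le> C" "\<And>N g z. 0 < N \<Longrightarrow> g \<in> C_space L k \<Longrightarrow> z \<in> Sh0 L N \<mu> r \<Longrightarrow> zero_at_ends L g \<Longrightarrow>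
    (\<And>v. v \<in> Sh0 L N \<mu> r \<Longrightarrow> A_form L q z v = A_form L q g v) \<Longrightarrow>
    H1_norm L (\<lambda>x. g x - z x) \<le> C * mesh L N ^ (k - 1) * Hs_norm L k g \<and>
    L2_norm L (\<lambda>x. g x - z x) \<le> C * mesh L N ^ k * Hs_norm L k g"
proof -
  obtain D where D: "0 \<le> D" "\<And>f. continuous_on {-L..L} f \<Longrightarrow> \<exists>\<Psi>\<in>C_space L 2.
    \<Psi> (-L) = 0 \<and> \<Psi> L = 0 \<and> Hs_norm L 2 \<Psi> \<le> D * L2_norm L f \<and>
    (\<forall>v. pw L v \<longrightarrow> v (-L) = 0 \<longrightarrow> v L = 0 \<longrightarrow> A_form L q \<Psi> v = ip L f v)"
    using Dirichlet_dual[OF L q] by blast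
  have "\<exists>C\<ge>0. \<forall>N>0. \<forall>g\<in>C_space L k. \<forall>z\<in>Sh0 L N \<mu> r. zero_at_ends L g \<longrightarrow>
    (\<forall>v\<in>Sh0 L N \<mu> r. A_form L q z v = A_form L q g v) \<longrightarrow>
    H1_norm L (\<lambda>x. g x - z x) \<le> C * mesh L N ^ (k - 1) * Hs_norm L k g \<and>
    L2_norm L (\<lambda>x. g x - z x) \<le> C * mesh L N ^ k * Hs_norm L k g"
  proof (rule projection_error[OF L q k _ _ _ _ D(1) _ assms(4,5)])
    show "\<exists>\<Psi>\<in>C_space L 2. zero_at_ends L \<Psi> \<and> Hs_norm L 2 \<Psi> \<le> D * L2_norm L f \<and>
      (\<forall>v. pw L v \<longrightarrow> zero_at_ends L v \<longrightarrow> A_form L q \<Psi> v = ip L f v)" if "continuous_on {-L..L} f" for f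
      unfolding zero_at_ends_def using D(2)[OF that] by blast
  qed (use Sh0_subspace[OF L] Sh_pw[OF Sh0_Sh L] in \<open>auto simp: zero_at_ends_def Sh0_def\<close>)
  then obtain C where C: "0 \<le> C" and *: "\<forall>N>0. \<forall>g\<in>C_space L k. \<forall>z\<in>Sh0 L N \<mu> r. zero_at_ends L g \<longrightarrow>
    (\<forall>v\<in>Sh0 L N \<mu> r. A_form L q z v = A_form L q g v) \<longrightarrow>
    H1_norm L (\<lambda>x. g x - z x) \<le> C * mesh L N ^ (k - 1) * Hs_norm L k g \<and>
    L2_norm L (\<lambda>x. g x - z x) \<le> C * mesh L N ^ k * Hs_norm L k g" by (elim exE conjE)
  show ?thesis
  proof (rule that[OF C])
    fix N g z assume "(0::nat) < N" "g \<in> C_space L k" "z \<in> Sh0 L N \<mu> r" "zero_at_ends L g"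
      "\<And>v. v \<in> Sh0 L N \<mu> r \<Longrightarrow> A_form L q z v = A_form L q g v"
    then show "H1_norm L (\<lambda>x. g x - z x) \<le> C * mesh L N ^ (k - 1) * Hs_norm L k g \<and>
      L2_norm L (\<lambda>x. g x - z x) \<le> C * mesh L N ^ k * Hs_norm L k g"
      using *[rule_format, of N g z] by simp
  qed
qed

lemma H1_approx_1:
  assumes "0 < L" "\<And>N. fun_subspace (W N)"
  shows "H1_approx L Z W 1"
  unfolding H1_approx_def
proof (intro exI[of _ 1] conjI allI impI ballI bexI)
  fix N g assume "g \<in> C_space L 1"
  then show "H1_norm L (\<lambda>x. g x - (\<lambda>x. 0) x) \<le> 1 * mesh L N ^ (1 - 1) * Hs_norm L 1 g"
    using H1_le_Hs[OF assms(1), of g 0] by simp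
qed (use fun_subspace_zero[OF assms(2)] in auto)

text \<open>Induction on the order: an optimal \<open>L\<^sup>2\<close> approximation of \<open>g\<^sub>x\<close> by splines of order \<open>r\<close> is
  integrated to an optimal \<open>H\<^sup>1\<close> approximation of \<open>g\<close> by splines of order \<open>r + 1\<close>.\<close>

lemma H1_approx_max_smooth:
  assumes L: "0 < L"
  shows "2 \<le> r \<Longrightarrow> 1 \<le> k \<Longrightarrow> k \<le> r \<Longrightarrow> H1_approx L (\<lambda>_. True) (\<lambda>N. Sh L N (r - 2) r) k"
proof (induction r arbitrary: k rule: nat_induct_at_least)
  case base
  have "H1_approx L (\<lambda>_. True) (\<lambda>N. Sh L N 0 2) 2"
    unfolding H1_approx_def
  proof (intro exI[of _ "1 + 2 * L"] conjI allI impI ballI bexI)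
    fix N g assume "(0::nat) < N" "g \<in> C_space L 2"
    then show "H1_norm L (\<lambda>x. g x - linear_interpolant L N g x) \<le> (1 + 2 * L) * mesh L N ^ (2 - 1) * Hs_norm L 2 g"
      "linear_interpolant L N g \<in> Sh L N 0 2"
      using linear_interpolant_error[OF L] linear_interpolant_Sh[OF L] by auto
  qed (use L in simp)
  moreover have "k = 1 \<or> k = 2" using base by auto
  ultimately show ?case using H1_approx_1[OF L Sh_subspace[OF L]] by auto
next
  case (Suc r)
  show ?case
  proof (cases "k = 1")
    case True
    then show ?thesis using H1_approx_1[OF L Sh_subspace[OF L]] by simp
  next
    case False
    then obtain l where l: "k = Suc l" "1 \<le> l" "l \<le> r" using Suc.prems by (cases k) auto
    \<comment> \<open>Duality for the projection of \<open>dx L g\<close> requires order 2 in this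
      space, which is available because the induction starts at \<open>r = 2\<close>.\<close>
    have "H1_approx L (\<lambda>_. True) (\<lambda>N. Sh L N (r - 2) r) 2" by (rule Suc.IH) (use Suc.hyps in auto)
    from projection_error_Sh[OF L zero_less_one l(2) this Suc.IH[OF l(2,3)]]
    obtain C where C: "0 \<le> C" "\<And>N g z. 0 < N \<Longrightarrow> g \<in> C_space L l \<Longrightarrow> z \<in> Sh L N (r - 2) r \<Longrightarrow>
      (\<And>v. v \<in> Sh L N (r - 2) r \<Longrightarrow> A_form L 1 z v = A_form L 1 g v) \<Longrightarrow>
      H1_norm L (\<lambda>x. g x - z x) \<le> C * mesh L N ^ (l - 1) * Hs_norm L l g \<and>
      L2_norm L (\<lambda>x. g x - z x) \<le> C * mesh L N ^ l * Hs_norm L l g"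
      by blast
    show ?thesis unfolding H1_approx_def
    proof (intro exI[of _ "(1 + 2 * L) * C"] conjI allI impI ballI)
      fix N g assume N: "(0::nat) < N" and g: "g \<in> C_space L k"
      have gl: "g \<in> C_space L (Suc l)" "dx L g \<in> C_space L l" using g l C_space_dx by auto
      obtain l' where l': "l = Suc l'" using l(2) by (cases l) auto
      have "pw L (dx L g)" using C1_pw(1)[OF L] gl(2) l' by auto
      from elliptic_projection_exists[OF fe_space_Sh[OF L N] L _ this, of r 1 "r - 2"] Suc.hyps
      obtain z where z: "z \<in> Sh L N (r - 2) r" "\<forall>v\<in>Sh L N (r - 2) r. A_form L 1 z v = A_form L 1 (dx L g) v" by auto
      \<comment> \<open>Integration starts from \<open>g (-L)\<close>, so the error vanishes at
        \<open>-L\<close> and is controlled by its derivative, the L2 error of the projection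
        \<open>z\<close>.\<close>
      define s where "s = (\<lambda>x. g (-L) + integral {-L..x} z)"
      have ds: "(s has_real_derivative z x) (at x within {-L..L})" if "x \<in> {-L..L}" for x
        unfolding s_def using integral_has_real_derivative[OF Sh_cont[OF z(1)] that]
        by (auto intro!: derivative_eq_intros)
      have "s \<in> Sh L N (Suc (r - 2)) (Suc r)"
        by (rule Sh_antideriv[OF z(1) L N _ ds]) (use Suc.hyps in auto)
      moreover have "Suc (r - 2) = Suc r - 2" using Suc.hyps by simp
      ultimately have sS: "s \<in> Sh L N (Suc r - 2) (Suc r)" by metis
      have pwg: "pw L g" by (rule C1_pw(1)[OF L gl(1)])
      have pws: "pw L s" by (rule Sh_pw[OF sS L N])
      have pwe: "pw L (\<lambda>x. g x - s x)" by (rule pw_diff[OF pwg pws])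
      have "L2_norm L (deriv (\<lambda>x. g x - s x)) = L2_norm L (\<lambda>x. dx L g x - z x)"
      proof (rule L2_norm_cong)
        fix x assume x: "x \<in> {-L<..<L}"
        have "(s has_real_derivative z x) (at x)" using ds[of x] x at_within_Icc_at[of "-L" x L] by simp
        with C_space_DERIV[OF L gl(1) x] show "deriv (\<lambda>x. g x - s x) x = dx L g x - z x"
          by (intro DERIV_imp_deriv DERIV_diff)
      qed
      also have "\<dots> \<le> C * mesh L N ^ l * Hs_norm L l (dx L g)" using C(2)[OF N gl(2) z(1)] z(2) by blast
      also have "\<dots> \<le> C * mesh L N ^ l * Hs_norm L k g"
        unfolding l(1) using C(1) mesh_pos[OF L N] by (intro mult_left_mono Hs_norm_dx) auto
      finally have d: "L2_norm L (deriv (\<lambda>x. g x - s x)) \<le> C * mesh L N ^ l * Hs_norm L k g" .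
      have "H1_norm L (\<lambda>x. g x - s x) \<le> (1 + 2 * L) * L2_norm L (deriv (\<lambda>x. g x - s x))"
        using H1_le_add[of L "\<lambda>x. g x - s x"] L2_le_deriv[OF pwe _ L] by (simp add: s_def algebra_simps)
      also have "\<dots> \<le> (1 + 2 * L) * (C * mesh L N ^ l * Hs_norm L k g)" using d L by (intro mult_left_mono) auto
      finally show "\<exists>s\<in>Sh L N (Suc r - 2) (Suc r). H1_norm L (\<lambda>x. g x - s x)
          \<le> (1 + 2 * L) * C * mesh L N ^ (k - 1) * Hs_norm L k g"
        using sS l by (intro bexI[of _ s]) (auto simp: mult_ac)
    qed (use C(1) L in simp)
  qed
qed

text \<open>Lowering the smoothness enlarges the spline space, so the estimate for the maximal
  smoothness \<open>r - 2\<close> carries over.\<close>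

lemma H1_approx_Sh:
  assumes "0 < L" "2 \<le> r" "\<mu> \<le> r - 2" "1 \<le> k" "k \<le> r"
  shows "H1_approx L (\<lambda>_. True) (\<lambda>N. Sh L N \<mu> r) k"
  using H1_approx_max_smooth[OF assms(1,2,4,5)] Sh_mono[OF assms(3), of L _ r]
  unfolding H1_approx_def by (meson subset_iff)

text \<open>Since \<open>g\<close> vanishes at the ends, the end values of an approximation
  \<open>s\<close> are errors, and \<open>Sobolev\<close> bounds them by the H1 error. Subtracting
  the linear polynomial with these end values, a spline because \<open>2 \<le> r\<close>, restores
  the boundary condition at the price of the factor \<open>K\<close>.\<close>

lemma H1_approx_Sh0:
  assumes L: "0 < L" and r: "2 \<le> r" and "\<mu> \<le> r - 2" "1 \<le> k" "k \<le> r"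
  shows "H1_approx L (zero_at_ends L) (\<lambda>N. Sh0 L N \<mu> r) k"
proof -
  obtain C where C: "0 \<le> C" "\<And>N g. 0 < N \<Longrightarrow> g \<in> C_space L k \<Longrightarrow> \<exists>s\<in>Sh L N \<mu> r.
     H1_norm L (\<lambda>x. g x - s x) \<le> C * mesh L N ^ (k - 1) * Hs_norm L k g"
    using H1_approx_Sh[OF assms] unfolding H1_approx_def by blast
  define c where "c = 1 / sqrt (2 * L) + sqrt (2 * L)"
  have c: "0 \<le> c" using L by (simp add: c_def)
  define K where "K = 1 + (c * H1_norm L (\<lambda>x. 1) + c / L * H1_norm L (\<lambda>x. x))"
  have K: "0 \<le> K" using c L by (auto simp: K_def intro!: add_nonneg_nonneg)
  show ?thesis unfolding H1_approx_def zero_at_ends_def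
  proof (intro exI[of _ "K * C"] conjI allI impI ballI)
    fix N g assume N: "(0::nat) < N" and g: "g \<in> C_space L k" and "g (-L) = 0 \<and> g L = 0"
    then have g0: "g (-L) = 0" "g L = 0" by auto
    obtain s where s: "s \<in> Sh L N \<mu> r" "H1_norm L (\<lambda>x. g x - s x) \<le> C * mesh L N ^ (k - 1) * Hs_norm L k g"
      using C(2)[OF N g] by blast
    let ?e = "\<lambda>x. g x - s x"
    obtain k' where k': "k = Suc k'" using assms(4) by (cases k) auto
    have pwg: "pw L g" using C1_pw(1)[OF L] g k' by auto
    have pwe: "pw L ?e" by (rule pw_diff[OF pwg Sh_pw[OF s(1) L N]])
    define E where "E = H1_norm L ?e"
    have sup: "\<bar>s L\<bar> \<le> c * E" "\<bar>s (-L)\<bar> \<le> c * E"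
      using Sobolev[OF pwe _ L, of L] Sobolev[OF pwe _ L, of "-L"] L g0 by (auto simp: c_def E_def)
    define \<alpha> where "\<alpha> = (s L + s (-L)) / 2"
    define \<beta> where "\<beta> = (s L - s (-L)) / (2 * L)"
    have ab: "\<bar>\<alpha>\<bar> \<le> c * E" "\<bar>\<beta>\<bar> \<le> c / L * E"
    proof -
      have "\<bar>s L + s (-L)\<bar> \<le> 2 * (c * E)" using sup by linarith
      then show "\<bar>\<alpha>\<bar> \<le> c * E" by (simp add: \<alpha>_def)
      have "\<bar>s L - s (-L)\<bar> / (2 * L) \<le> (2 * (c * E)) / (2 * L)"
        using sup L by (intro divide_right_mono) auto
      then show "\<bar>\<beta>\<bar> \<le> c / L * E" using L by (simp add: \<beta>_def)
    qed
    have idpw: "pw L (\<lambda>x. x)" 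
    proof (rule C1_pw(1)[OF L, of _ 0])
      have "poly [:0, 1:] = (\<lambda>x::real. x)" by (simp add: fun_eq_iff)
      then show "(\<lambda>x. x) \<in> C_space L (Suc 0)" using C_space_poly[OF L, of "[:0, 1:]" "Suc 0"] by simp
    qed
    have lS: "poly [:\<alpha>, \<beta>:] \<in> Sh L N \<mu> r" by (rule Sh_poly[OF L]) (use r in auto)
    define s0 where "s0 = (\<lambda>x. s x - poly [:\<alpha>, \<beta>:] x)"
    have "s0 \<in> Sh L N \<mu> r" unfolding s0_def by (rule fun_subspace_diff[OF Sh_subspace[OF L] s(1) lS])
    moreover have "s0 L = 0" "s0 (-L) = 0" using L by (auto simp: s0_def \<alpha>_def \<beta>_def field_simps)
    ultimately have s0: "s0 \<in> Sh0 L N \<mu> r" by (simp add: Sh0_def)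
    have "H1_norm L (\<lambda>x. g x - s0 x) = H1_norm L (\<lambda>x. ?e x + (\<alpha> * 1 + \<beta> * x))"
      by (simp add: s0_def algebra_simps)
    also have "\<dots> \<le> H1_norm L ?e + H1_norm L (\<lambda>x. \<alpha> * 1 + \<beta> * x)"
      by (intro H1_add pwe pw_add pw_cmult idpw pw_const)
    also have "H1_norm L (\<lambda>x. \<alpha> * 1 + \<beta> * x) \<le> H1_norm L (\<lambda>x. \<alpha> * 1) + H1_norm L (\<lambda>x. \<beta> * x)"
      by (intro H1_add pw_cmult idpw pw_const)
    also have "\<dots> = \<bar>\<alpha>\<bar> * H1_norm L (\<lambda>x. 1) + \<bar>\<beta>\<bar> * H1_norm L (\<lambda>x. x)"
      using H1_cmult[OF pw_const, of L \<alpha> 1] H1_cmult[OF idpw, of \<beta>] by simp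
    also have "\<dots> \<le> (c * E) * H1_norm L (\<lambda>x. 1) + (c / L * E) * H1_norm L (\<lambda>x. x)"
      using ab by (intro add_mono mult_right_mono) auto
    finally have "H1_norm L (\<lambda>x. g x - s0 x) \<le> K * E" by (simp add: K_def E_def algebra_simps)
    also have "\<dots> \<le> K * (C * mesh L N ^ (k - 1) * Hs_norm L k g)"
      using s(2) K by (intro mult_left_mono) (auto simp: E_def)
    finally show "\<exists>s\<in>Sh0 L N \<mu> r. H1_norm L (\<lambda>x. g x - s x) \<le> K * C * mesh L N ^ (k - 1) * Hs_norm L k g"
      using s0 by (intro bexI[of _ s0]) (auto simp: mult_ac)
  qed (use C(1) K in simp)
qed

lemma Rh_error:
  assumes L: "0 < L" and q: "0 < q" and r: "2 \<le> r" and mu: "\<mu> \<le> r - 2" and k: "1 \<le> k" "k \<le> r"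
  obtains C where "0 \<le> C" "\<And>N g. 0 < N \<Longrightarrow> g \<in> C_space L k \<Longrightarrow>
    H1_norm L (\<lambda>x. g x - Rh L N \<mu> r q g x) \<le> C * mesh L N ^ (k - 1) * Hs_norm L k g \<and>
    L2_norm L (\<lambda>x. g x - Rh L N \<mu> r q g x) \<le> C * mesh L N ^ k * Hs_norm L k g"
proof -
  have two: "1 \<le> (2::nat)" by simp
  from projection_error_Sh[OF L q k(1) H1_approx_Sh[OF L r mu two r] H1_approx_Sh[OF L r mu k]]
  obtain C where C: "0 \<le> C" "\<And>N g z. 0 < N \<Longrightarrow> g \<in> C_space L k \<Longrightarrow> z \<in> Sh L N \<mu> r \<Longrightarrow>
    (\<And>v. v \<in> Sh L N \<mu> r \<Longrightarrow> A_form L q z v = A_form L q g v) \<Longrightarrow>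
    H1_norm L (\<lambda>x. g x - z x) \<le> C * mesh L N ^ (k - 1) * Hs_norm L k g \<and>
    L2_norm L (\<lambda>x. g x - z x) \<le> C * mesh L N ^ k * Hs_norm L k g" by blast
  show ?thesis
  proof (rule that[OF C(1)])
    fix N g assume N: "(0::nat) < N" and g: "g \<in> C_space L k"
    have "pw L g" using C1_pw(1)[OF L, of g "k - 1"] g k by simp
    note R = Rh_spec[OF L N _ q this, of r]
    show "H1_norm L (\<lambda>x. g x - Rh L N \<mu> r q g x) \<le> C * mesh L N ^ (k - 1) * Hs_norm L k g \<and>
      L2_norm L (\<lambda>x. g x - Rh L N \<mu> r q g x) \<le> C * mesh L N ^ k * Hs_norm L k g"
      by (rule C(2)[OF N g]) (use R r in auto)
  qed
qed

lemma Rh0_error: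
  assumes L: "0 < L" and q: "0 < q" and r: "2 \<le> r" and mu: "\<mu> \<le> r - 2" and k: "1 \<le> k" "k \<le> r"
  obtains C where "0 \<le> C" "\<And>N g. 0 < N \<Longrightarrow> g \<in> C_space L k \<Longrightarrow> g (-L) = 0 \<Longrightarrow> g L = 0 \<Longrightarrow>
    H1_norm L (\<lambda>x. g x - Rh0 L N \<mu> r q g x) \<le> C * mesh L N ^ (k - 1) * Hs_norm L k g \<and>
    L2_norm L (\<lambda>x. g x - Rh0 L N \<mu> r q g x) \<le> C * mesh L N ^ k * Hs_norm L k g"
proof -
  have two: "1 \<le> (2::nat)" by simp
  from projection_error_Sh0[OF L q k(1) H1_approx_Sh0[OF L r mu two r] H1_approx_Sh0[OF L r mu k]]
  obtain C where C: "0 \<le> C" "\<And>N g z. 0 < N \<Longrightarrow> g \<in> C_space L k \<Longrightarrow> z \<in> Sh0 L N \<mu> r \<Longrightarrow> zero_at_ends L g \<Longrightarrow>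
    (\<And>v. v \<in> Sh0 L N \<mu> r \<Longrightarrow> A_form L q z v = A_form L q g v) \<Longrightarrow>
    H1_norm L (\<lambda>x. g x - z x) \<le> C * mesh L N ^ (k - 1) * Hs_norm L k g \<and>
    L2_norm L (\<lambda>x. g x - z x) \<le> C * mesh L N ^ k * Hs_norm L k g" by blast
  show ?thesis
  proof (rule that[OF C(1)])
    fix N g assume N: "(0::nat) < N" and g: "g \<in> C_space L k" "g (-L) = 0" "g L = 0"
    have "pw L g" using C1_pw(1)[OF L, of g "k - 1"] g k by simp
    note R = Rh0_spec[OF L N _ q this, of r]
    show "H1_norm L (\<lambda>x. g x - Rh0 L N \<mu> r q g x) \<le> C * mesh L N ^ (k - 1) * Hs_norm L k g \<and>
      L2_norm L (\<lambda>x. g x - Rh0 L N \<mu> r q g x) \<le> C * mesh L N ^ k * Hs_norm L k g"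
      by (rule C(2)[OF N g(1)]) (use R r g in \<open>auto simp: zero_at_ends_def\<close>)
  qed
qed


section \<open>Ordinary differential equations\<close>

lemma continuous_on_Lipschitz:
  fixes G :: "(nat \<Rightarrow> real) \<Rightarrow> real"
  assumes lip: "\<And>y z. \<bar>G y - G z\<bar> \<le> K * (\<Sum>j<n. \<bar>y j - z j\<bar>)"
    and c: "\<And>j. j < n \<Longrightarrow> continuous_on S (\<lambda>s. y s j)"
  shows "continuous_on S (\<lambda>s. G (y s))"
  unfolding continuous_on_def
proof
  fix t assume t: "t \<in> S"
  have "((\<lambda>s. K * (\<Sum>j<n. \<bar>y s j - y t j\<bar>)) \<longlongrightarrow> K * (\<Sum>j<n. \<bar>y t j - y t j\<bar>)) (at t within S)"
    using c t by (intro tendsto_intros) (auto simp: continuous_on_def)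
  then have lim: "((\<lambda>s. K * (\<Sum>j<n. \<bar>y s j - y t j\<bar>)) \<longlongrightarrow> 0) (at t within S)" by simp
  have "norm (G (y s) - G (y t)) \<le> K * (\<Sum>j<n. \<bar>y s j - y t j\<bar>)" for s using lip by simp
  then have "((\<lambda>s. G (y s) - G (y t)) \<longlongrightarrow> 0) (at t within S)"
    by (intro Lim_null_comparison[OF always_eventually lim] allI)
  then show "((\<lambda>s. G (y s)) \<longlongrightarrow> G (y t)) (at t within S)" by (rule LIM_zero_cancel)
qed

lemma integral_monomial:
  fixes t :: real
  assumes "0 \<le> t"
  shows "((\<lambda>s. c * s ^ k) has_integral c * t ^ Suc k / real (Suc k)) {0..t}"
proof -
  have "((\<lambda>s. c * s ^ k) has_integral (c * t ^ Suc k / real (Suc k) - c * 0 ^ Suc k / real (Suc k))) {0..t}"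
  proof (rule fundamental_theorem_of_calculus[OF assms])
    fix s assume "s \<in> {0..t}"
    have "((\<lambda>s. s ^ Suc k) has_real_derivative (real (Suc k)) * s ^ k) (at s within {0..t})"
      using DERIV_pow[of "Suc k" s "{0..t}"] by (simp del: of_nat_Suc)
    from DERIV_cdivide[OF DERIV_cmult[OF this, of c], of "real (Suc k)"]
    show "((\<lambda>s. c * s ^ Suc k / real (Suc k)) has_vector_derivative c * s ^ k) (at s within {0..t})"
      by (simp add: has_real_derivative_iff_has_vector_derivative[symmetric] del: of_nat_Suc power_Suc)
  qed
  then show ?thesis by simp
qed

text \<open>A global Lipschitz constant makes the iterates converge on all of \<open>{0..T}\<close>
  at once: summed over the components, the k-th increment is at most
  \<open>M * (n * K * T) ^ k / fact k\<close>. Vectors are functions on the indices below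
  \<open>n\<close>, because the dimension varies with the mesh.\<close>

lemma Picard_global:
  fixes G :: "nat \<Rightarrow> (nat \<Rightarrow> real) \<Rightarrow> real" and y0 :: "nat \<Rightarrow> real"
  assumes T: "0 < T" and K: "0 \<le> K"
    and lip: "\<And>i y z. i < n \<Longrightarrow> \<bar>G i y - G i z\<bar> \<le> K * (\<Sum>j<n. \<bar>y j - z j\<bar>)"
  obtains y where "\<And>i. i < n \<Longrightarrow> y 0 i = y0 i"
    "\<And>i t. i < n \<Longrightarrow> t \<in> {0..T} \<Longrightarrow> ((\<lambda>t. y t i) has_real_derivative G i (y t)) (at t within {0..T})"
proof -
  define Y :: "nat \<Rightarrow> real \<Rightarrow> nat \<Rightarrow> real" where "Y = rec_nat (\<lambda>t i. y0 i) (\<lambda>k Yk t i. y0 i + integral {0..t} (\<lambda>s. G i (Yk s)))"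
  have Y0: "Y 0 t i = y0 i" and YS: "Y (Suc k) t i = y0 i + integral {0..t} (\<lambda>s. G i (Y k s))" for k t i
    by (simp_all add: Y_def)
  have cY: "i < n \<Longrightarrow> continuous_on {0..T} (\<lambda>s. Y k s i)" for k i
  proof (induction k arbitrary: i)
    case (Suc k)
    have "continuous_on {0..T} (\<lambda>s. G i (Y k s))"
      by (rule continuous_on_Lipschitz[OF lip[OF Suc.prems] Suc.IH])
    then show ?case unfolding YS
      by (intro continuous_intros indefinite_integral_continuous_1 integrable_continuous_interval)
  qed (simp add: Y0)
  have cG: "continuous_on {0..T} (\<lambda>s. G i (Y k s))" if "i < n" for i k
    by (rule continuous_on_Lipschitz[OF lip[OF that] cY])
  define D where "D = (\<lambda>k t. \<Sum>i<n. \<bar>Y (Suc k) t i - Y k t i\<bar>)"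
  have cD: "continuous_on {0..T} (D k)" for k
    unfolding D_def by (intro continuous_intros cY) auto
  obtain M where M: "\<And>t. t \<in> {0..T} \<Longrightarrow> D 0 t \<le> M"
  proof -
    have "bounded (D 0 ` {0..T})" by (intro compact_imp_bounded compact_continuous_image cD) auto
    then obtain M where "\<forall>x\<in>D 0 ` {0..T}. norm x \<le> M" by (auto simp: bounded_iff)
    then show ?thesis by (intro that[of M]) force
  qed
  have M0: "0 \<le> M" 
  proof -
    have "0 \<le> D 0 0" by (simp add: D_def sum_nonneg)
    then show ?thesis using M[of 0] T by simp
  qed
  have bound: "t \<in> {0..T} \<Longrightarrow> D k t \<le> M * (n * K) ^ k / fact k * t ^ k" for k t
  proof (induction k arbitrary: t)
    case 0
    then show ?case using M by simp
  next
    case (Suc k)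
    have sub: "{0..t} \<subseteq> {0..T}" using Suc.prems by auto
    have each: "\<bar>Y (Suc (Suc k)) t i - Y (Suc k) t i\<bar> \<le> K * (M * (n * K) ^ k / fact k * t ^ Suc k / real (Suc k))" if i: "i < n" for i
    proof -
      have ci: "continuous_on {0..t} (\<lambda>s. G i (Y k s))" for k by (rule continuous_on_subset[OF cG[OF i] sub])
      have "Y (Suc (Suc k)) t i - Y (Suc k) t i = integral {0..t} (\<lambda>s. G i (Y (Suc k) s) - G i (Y k s))"
        using YS[of "Suc k" t i] YS[of k t i]
        by (subst integral_diff) (auto intro: integrable_continuous_interval ci)
      moreover have "norm (integral {0..t} (\<lambda>s. G i (Y (Suc k) s) - G i (Y k s)))
        \<le> integral {0..t} (\<lambda>s. K * (M * (n * K) ^ k / fact k) * s ^ k)"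
      proof (rule integral_norm_bound_integral)
        show "norm (G i (Y (Suc k) s) - G i (Y k s)) \<le> K * (M * (n * K) ^ k / fact k) * s ^ k" if s: "s \<in> {0..t}" for s
        proof -
          have "norm (G i (Y (Suc k) s) - G i (Y k s)) \<le> K * D k s" unfolding D_def using lip[OF i] by simp
          also have "\<dots> \<le> K * (M * (n * K) ^ k / fact k * s ^ k)" using Suc.IH[of s] s sub K by (intro mult_left_mono) auto
          finally show ?thesis by (simp add: mult.assoc)
        qed
      qed (auto intro!: integrable_continuous_interval continuous_intros ci)
      moreover have "integral {0..t} (\<lambda>s. K * (M * (n * K) ^ k / fact k) * s ^ k)
        = K * (M * (n * K) ^ k / fact k) * t ^ Suc k / real (Suc k)"
        by (rule integral_unique[OF integral_monomial]) (use Suc.prems in auto)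
      ultimately show ?thesis by (simp add: mult.assoc)
    qed
    have "D (Suc k) t \<le> (\<Sum>i<n. K * (M * (n * K) ^ k / fact k * t ^ Suc k / real (Suc k)))"
      unfolding D_def by (intro sum_mono each) simp
    also have "\<dots> = M * (n * K) ^ Suc k / fact (Suc k) * t ^ Suc k" by (simp add: field_simps)
    finally show ?case .
  qed
  define f where "f = (\<lambda>i k t. Y (Suc k) t i - Y k t i)"
  define y where "y = (\<lambda>t i. y0 i + suminf (\<lambda>k. f i k t))"
  have tel: "Y m t i = y0 i + (\<Sum>k<m. f i k t)" for m t i
    unfolding f_def using sum_lessThan_telescope[of "\<lambda>k. Y k t i" m] by (simp add: Y0)
  have ul: "uniform_limit {0..T} (\<lambda>m t. Y m t i) (\<lambda>t. y t i) sequentially" if i: "i < n" for i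
  proof -
    have "uniform_limit {0..T} (\<lambda>m t. \<Sum>k<m. f i k t) (\<lambda>t. suminf (\<lambda>k. f i k t)) sequentially"
    proof (rule Weierstrass_m_test)
      show "norm (f i k t) \<le> M * (n * K * T) ^ k / fact k" if t: "t \<in> {0..T}" for k t
      proof -
        have "norm (f i k t) \<le> D k t" unfolding D_def f_def using i by (auto intro!: member_le_sum)
        also have "\<dots> \<le> M * (n * K) ^ k / fact k * t ^ k" by (rule bound[OF t])
        also have "\<dots> \<le> M * (n * K) ^ k / fact k * T ^ k"
          using t M0 K by (intro mult_left_mono power_mono) auto
        finally show ?thesis by (simp add: power_mult_distrib)
      qed
      have "summable (\<lambda>k. M * ((n * K * T) ^ k /\<^sub>R fact k))" by (intro summable_mult summable_exp_generic)
      then show "summable (\<lambda>k. M * (n * K * T) ^ k / fact k)" by (simp add: field_simps)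
    qed
    then show ?thesis unfolding tel y_def by (intro uniform_limit_intros)
  qed
  have cy: "continuous_on {0..T} (\<lambda>t. y t i)" if "i < n" for i
    by (rule uniform_limit_theorem[OF _ ul[OF that]]) (use cY[OF that] in auto)
  have cGy: "continuous_on {0..T} (\<lambda>s. G i (y s))" if "i < n" for i
    by (rule continuous_on_Lipschitz[OF lip[OF that] cy])
  have eq: "y t i = y0 i + integral {0..t} (\<lambda>s. G i (y s))" if i: "i < n" and t: "t \<in> {0..T}" for t i
  proof -
    have sub: "{0..t} \<subseteq> {0..T}" using t by auto
    have "uniform_limit {0..T} (\<lambda>m s. K * (\<Sum>j<n. norm (Y m s j - y s j))) (\<lambda>s. K * (\<Sum>j<n. norm (y s j - y s j))) sequentially"
    proof -
      have *: "uniform_limit {0..T} (\<lambda>m s. norm (Y m s j - y s j)) (\<lambda>s. 0) sequentially" if "j < n" for j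
        using ul[OF that] unfolding uniform_limit_iff dist_norm by simp
      have "k \<le> n \<Longrightarrow> uniform_limit {0..T} (\<lambda>m s. \<Sum>j<k. norm (Y m s j - y s j)) (\<lambda>s. 0) sequentially" for k
      proof (induction k)
        case (Suc k)
        then have "uniform_limit {0..T} (\<lambda>m s. (\<Sum>j<k. norm (Y m s j - y s j)) + norm (Y m s k - y s k)) (\<lambda>s. 0 + 0) sequentially"
          by (intro uniform_limit_add *) auto
        then show ?case by simp
      qed (simp add: uniform_limit_const)
      then have "uniform_limit {0..T} (\<lambda>m s. \<Sum>j<n. norm (Y m s j - y s j)) (\<lambda>s. 0) sequentially" by simp
      then have "uniform_limit {0..T} (\<lambda>m s. K * (\<Sum>j<n. norm (Y m s j - y s j))) (\<lambda>s. K * 0) sequentially"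
        by (rule bounded_linear.uniform_limit[OF bounded_linear_mult_right])
      then show ?thesis by simp
    qed
    then have lim: "uniform_limit {0..T} (\<lambda>m s. K * (\<Sum>j<n. norm (Y m s j - y s j))) (\<lambda>s. 0) sequentially" by simp
    have "norm (G i (Y m s) - G i (y s)) \<le> K * (\<Sum>j<n. norm (Y m s j - y s j))" for m s using lip[OF i] by simp
    then have "uniform_limit {0..T} (\<lambda>m s. G i (Y m s) - G i (y s)) (\<lambda>s. 0) sequentially"
      by (intro uniform_limit_null_comparison[OF always_eventually lim] allI ballI)
    then have "uniform_limit {0..T} (\<lambda>m s. G i (Y m s)) (\<lambda>s. G i (y s)) sequentially"
      unfolding uniform_limit_iff dist_norm by simp
    then have u: "uniform_limit {0..t} (\<lambda>m s. G i (Y m s)) (\<lambda>s. G i (y s)) sequentially"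
      using sub by (rule uniform_limit_on_subset)
    have ct: "continuous_on {0..t} (\<lambda>s. G i (Y m s))" for m by (rule continuous_on_subset[OF cG[OF i] sub])
    obtain I J where IJ: "\<And>m. ((\<lambda>s. G i (Y m s)) has_integral I m) {0..t}"
      "((\<lambda>s. G i (y s)) has_integral J) {0..t}" "I \<longlonglongrightarrow> J"
      using uniform_limit_integral[OF u ct] by auto
    have "(\<lambda>m. Y (Suc m) t i) \<longlonglongrightarrow> y0 i + J"
      unfolding YS using IJ by (auto simp: integral_unique[OF IJ(1)] intro!: tendsto_intros)
    moreover have "(\<lambda>m. Y (Suc m) t i) \<longlonglongrightarrow> y t i"
      using tendsto_uniform_limitI[OF ul[OF i] t] by (rule LIMSEQ_Suc)
    ultimately have "y t i = y0 i + J" using LIMSEQ_unique by blast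
    then show ?thesis using integral_unique[OF IJ(2)] by simp
  qed
  show ?thesis
  proof
    show "y 0 i = y0 i" if "i < n" for i using eq[OF that, of 0] T by simp
    fix i t assume i: "i < n" and t: "t \<in> {0..T}"
    have "((\<lambda>t. y0 i + integral {0..t} (\<lambda>s. G i (y s))) has_real_derivative 0 + G i (y t)) (at t within {0..T})"
      by (intro derivative_intros integral_has_real_derivative cGy i t)
    then show "((\<lambda>t. y t i) has_real_derivative G i (y t)) (at t within {0..T})"
      using has_real_derivative_cong_on[of "{0..T}" "\<lambda>t. y t i" "\<lambda>t. y0 i + integral {0..t} (\<lambda>s. G i (y s))" t] eq[OF i] t
      by simp
  qed
qed

lemma nondecreasing_from_DERIV:
  fixes H :: "real \<Rightarrow> real"
  assumes "0 \<le> t" "continuous_on {0..t} H"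
    and "\<And>s. 0 < s \<Longrightarrow> s < t \<Longrightarrow> \<exists>D\<ge>0. (H has_real_derivative D) (at s)"
  shows "H 0 \<le> H t"
proof (rule DERIV_nonneg_imp_increasing_open[OF assms(1) _ assms(2)])
  fix s assume "0 < s" "s < t"
  then show "\<exists>y. (H has_real_derivative y) (at s) \<and> 0 \<le> y" using assms(3) by blast
qed

text \<open>\<open>\<delta>\<close> stands under the integral because the consistency error enters
  the fluxes at every time, together with \<open>E\<close>. The value \<open>\<delta> = 0\<close>
  yields uniqueness.\<close>

lemma Gronwall_integral:
  fixes E :: "real \<Rightarrow> real"
  assumes c: "continuous_on {0..T} E" and C: "0 \<le> C" and d: "0 \<le> \<delta>"
    and le: "\<And>t. t \<in> {0..T} \<Longrightarrow> E t \<le> C * integral {0..t} (\<lambda>s. E s + \<delta>)" and t: "t \<in> {0..T}"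
  shows "E t \<le> C * (\<delta> * T * exp (C * T))"
proof -
  define F where "F = (\<lambda>t. integral {0..t} (\<lambda>s. E s + \<delta>))"
  have cE: "continuous_on {0..T} (\<lambda>s. E s + \<delta>)" by (intro continuous_intros c)
  have dF: "(F has_real_derivative E s + \<delta>) (at s within {0..T})" if "s \<in> {0..T}" for s
    unfolding F_def by (rule integral_has_real_derivative[OF cE that])
  \<comment> \<open>The hypothesis reads \<open>F' \<le> C * F + \<delta>\<close>, and the
    integrating factor \<open>exp (- C * t)\<close> turns it into monotonicity of
    \<open>H\<close>.\<close>
  define H where "H = (\<lambda>t. \<delta> * t - F t * exp (- C * t))"
  have cF: "continuous_on {0..T} F" by (rule DERIV_continuous_on[OF dF])
  have "H 0 \<le> H t"
  proof (rule nondecreasing_from_DERIV)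
    show "continuous_on {0..t} H" unfolding H_def
      by (intro continuous_intros continuous_on_subset[OF cF]) (use t in auto)
    fix s assume s: "0 < s" "s < t"
    have sT: "s \<in> {0..T}" "s \<in> {0<..<T}" using s t by auto
    have "(F has_real_derivative E s + \<delta>) (at s)" using dF[OF sT(1)] sT(2) at_within_Icc_at[of 0 s T] by simp
    then have "(H has_real_derivative \<delta> - ((E s + \<delta>) * exp (- C * s) + F s * (exp (- C * s) * (- C)))) (at s)"
      unfolding H_def by (auto intro!: derivative_eq_intros)
    moreover have "0 \<le> \<delta> - ((E s + \<delta>) * exp (- C * s) + F s * (exp (- C * s) * (- C)))"
    proof -
      have "((E s + \<delta>) * exp (- C * s) + F s * (exp (- C * s) * (- C))) = (E s - C * F s + \<delta>) * exp (- C * s)"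
        by (simp add: algebra_simps)
      also have "\<dots> \<le> \<delta> * exp (- C * s)" using le[OF sT(1)] by (intro mult_right_mono) (auto simp: F_def)
      also have "\<dots> \<le> \<delta> * 1" using C s d by (intro mult_left_mono) auto
      finally show ?thesis by simp
    qed
    ultimately show "\<exists>D\<ge>0. (H has_real_derivative D) (at s)" by blast
  qed (use t in auto)
  then have "F t * exp (- C * t) \<le> \<delta> * t" by (simp add: H_def F_def)
  then have "F t * exp (- C * t) * exp (C * t) \<le> \<delta> * t * exp (C * t)" by (rule mult_right_mono) simp
  then have "F t \<le> \<delta> * t * exp (C * t)" by (simp add: mult.assoc flip: exp_add)
  also have "\<dots> \<le> \<delta> * T * exp (C * T)" using t d C by (intro mult_mono) (auto intro!: mult_left_mono)
  finally have "C * F t \<le> C * (\<delta> * T * exp (C * T))" using C by (rule mult_left_mono)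
  then show ?thesis using le[OF t] by (simp add: F_def)
qed


section \<open>Continuity in time with values in \<open>H\<^sup>1\<close>\<close>

definition H1_continuous :: "real \<Rightarrow> real \<Rightarrow> (real \<Rightarrow> real \<Rightarrow> real) \<Rightarrow> bool" where
  "H1_continuous L T v \<longleftrightarrow> (\<forall>t\<in>{0..T}. pw L (v t) \<and>
     ((\<lambda>s. H1_norm L (\<lambda>x. v s x - v t x)) \<longlongrightarrow> 0) (at t within {0..T}))"

lemma H1_continuous_pw: "H1_continuous L T v \<Longrightarrow> t \<in> {0..T} \<Longrightarrow> pw L (v t)"
  by (simp add: H1_continuous_def)

lemma continuous_on_H1_dominated:
  fixes g :: "real \<Rightarrow> real"
  assumes v: "H1_continuous L T v" and w: "H1_continuous L T w"
    and le: "\<And>s t. s \<in> {0..T} \<Longrightarrow> t \<in> {0..T} \<Longrightarrow> \<bar>g s - g t\<bar> \<le>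
      K * (H1_norm L (\<lambda>x. v s x - v t x) + H1_norm L (\<lambda>x. w s x - w t x))"
  shows "continuous_on {0..T} g"
  unfolding continuous_on_def
proof
  fix t assume t: "t \<in> {0..T}"
  have "((\<lambda>s. K * (H1_norm L (\<lambda>x. v s x - v t x) + H1_norm L (\<lambda>x. w s x - w t x))) \<longlongrightarrow> K * (0 + 0)) (at t within {0..T})"
    using v w t unfolding H1_continuous_def by (intro tendsto_intros) auto
  then have lim: "((\<lambda>s. K * (H1_norm L (\<lambda>x. v s x - v t x) + H1_norm L (\<lambda>x. w s x - w t x))) \<longlongrightarrow> 0) (at t within {0..T})"
    by simp
  have "\<forall>\<^sub>F s in at t within {0..T}. s \<in> {0..T}" by (auto simp: eventually_at_filter)
  then have "\<forall>\<^sub>F s in at t within {0..T}. norm (g s - g t) \<le>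
      K * (H1_norm L (\<lambda>x. v s x - v t x) + H1_norm L (\<lambda>x. w s x - w t x))"
    by eventually_elim (use le t in auto)
  then have "((\<lambda>s. g s - g t) \<longlongrightarrow> 0) (at t within {0..T})" by (rule Lim_null_comparison[OF _ lim])
  then show "(g \<longlongrightarrow> g t) (at t within {0..T})" by (rule LIM_zero_cancel)
qed

lemma H1_minus: "H1_norm L (\<lambda>x. f x - g x) = H1_norm L (\<lambda>x. g x - f x)" if "pw L f" "pw L g"
proof -
  have "H1_norm L (\<lambda>x. f x - g x) = H1_norm L (\<lambda>x. -1 * (g x - f x))" by simp
  also have "\<dots> = H1_norm L (\<lambda>x. g x - f x)" using H1_cmult[OF pw_diff[OF that(2,1)], of "-1"] by simp
  finally show ?thesis .
qed

lemma H1_reverse_triangle: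
  assumes "pw L f" "pw L g"
  shows "\<bar>H1_norm L f - H1_norm L g\<bar> \<le> H1_norm L (\<lambda>x. f x - g x)"
  using H1_add[OF pw_diff[OF assms] assms(2)] H1_add[OF pw_diff[OF assms(2,1)] assms(1)] H1_minus[OF assms] by simp

lemma L2_reverse_triangle:
  assumes "pc {-L..L} f" "pc {-L..L} g"
  shows "\<bar>L2_norm L f - L2_norm L g\<bar> \<le> L2_norm L (\<lambda>x. f x - g x)"
  using L2_add[OF pc_diff[OF assms] assms(2)] L2_add[OF pc_diff[OF assms(2,1)] assms(1)] L2_minus[of L f g] by simp

lemma H1_continuous_norms:
  assumes "H1_continuous L T v"
  shows "continuous_on {0..T} (\<lambda>t. H1_norm L (v t))" "continuous_on {0..T} (\<lambda>t. L2_norm L (v t))"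
proof -
  show "continuous_on {0..T} (\<lambda>t. H1_norm L (v t))"
  proof (rule continuous_on_H1_dominated[OF assms assms, of _ 1])
    fix s t assume "s \<in> {0..T}" "t \<in> {0..T}"
    then have "\<bar>H1_norm L (v s) - H1_norm L (v t)\<bar> \<le> H1_norm L (\<lambda>x. v s x - v t x)"
      by (intro H1_reverse_triangle H1_continuous_pw[OF assms])
    then show "\<bar>H1_norm L (v s) - H1_norm L (v t)\<bar> \<le> 1 * (H1_norm L (\<lambda>x. v s x - v t x) + H1_norm L (\<lambda>x. v s x - v t x))"
      by (simp add: add_increasing)
  qed
  show "continuous_on {0..T} (\<lambda>t. L2_norm L (v t))"
  proof (rule continuous_on_H1_dominated[OF assms assms, of _ 1])
    fix s t assume "s \<in> {0..T}" "t \<in> {0..T}"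
    then have "\<bar>L2_norm L (v s) - L2_norm L (v t)\<bar> \<le> L2_norm L (\<lambda>x. v s x - v t x)"
      by (intro L2_reverse_triangle pw_pc H1_continuous_pw[OF assms])
    also have "\<dots> \<le> H1_norm L (\<lambda>x. v s x - v t x)" by (rule L2_le_H1)
    finally show "\<bar>L2_norm L (v s) - L2_norm L (v t)\<bar> \<le> 1 * (H1_norm L (\<lambda>x. v s x - v t x) + H1_norm L (\<lambda>x. v s x - v t x))"
      by (simp add: add_increasing)
  qed
qed

lemma H1_continuous_diff:
  assumes "H1_continuous L T v" "H1_continuous L T w"
  shows "H1_continuous L T (\<lambda>t x. v t x - w t x)"
  unfolding H1_continuous_def
proof (intro ballI conjI)
  fix t assume t: "t \<in> {0..T}"
  show "pw L (\<lambda>x. v t x - w t x)" using assms t by (intro pw_diff H1_continuous_pw)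
  have lim: "((\<lambda>s. H1_norm L (\<lambda>x. v s x - v t x) + H1_norm L (\<lambda>x. w s x - w t x)) \<longlongrightarrow> 0) (at t within {0..T})"
    using tendsto_add[of "\<lambda>s. H1_norm L (\<lambda>x. v s x - v t x)" 0 _ "\<lambda>s. H1_norm L (\<lambda>x. w s x - w t x)" 0] assms t
    unfolding H1_continuous_def by auto
  have "\<forall>\<^sub>F s in at t within {0..T}. s \<in> {0..T}" by (auto simp: eventually_at_filter)
  then have "\<forall>\<^sub>F s in at t within {0..T}. norm (H1_norm L (\<lambda>x. v s x - w s x - (v t x - w t x))) \<le>
      H1_norm L (\<lambda>x. v s x - v t x) + H1_norm L (\<lambda>x. w s x - w t x)"
  proof eventually_elim
    case (elim s)
    then show ?case
      using H1_diff[OF pw_diff[OF H1_continuous_pw[OF assms(1) elim] H1_continuous_pw[OF assms(1) t]]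
        pw_diff[OF H1_continuous_pw[OF assms(2) elim] H1_continuous_pw[OF assms(2) t]]]
      by (simp add: algebra_simps)
  qed
  then show "((\<lambda>s. H1_norm L (\<lambda>x. v s x - w s x - (v t x - w t x))) \<longlongrightarrow> 0) (at t within {0..T})"
    by (rule Lim_null_comparison[OF _ lim])
qed

lemma H1_continuous_bounded:
  assumes "H1_continuous L T v" "0 < L"
  obtains M where "0 \<le> M" "\<And>t. t \<in> {0..T} \<Longrightarrow> H1_norm L (v t) \<le> M"
    "\<And>t x. t \<in> {0..T} \<Longrightarrow> x \<in> {-L..L} \<Longrightarrow> \<bar>v t x\<bar> \<le> M"
proof -
  have "bounded ((\<lambda>t. H1_norm L (v t)) ` {0..T})"
    by (intro compact_imp_bounded compact_continuous_image H1_continuous_norms assms) auto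
  then obtain B where B: "\<And>t. t \<in> {0..T} \<Longrightarrow> H1_norm L (v t) \<le> B" by (force simp: bounded_iff)
  define c where "c = 1 / sqrt (2 * L) + sqrt (2 * L)"
  have c: "0 \<le> c" using assms(2) by (simp add: c_def)
  show ?thesis
  proof
    show "0 \<le> (1 + c) * max B 0" using c by simp
    fix t assume t: "t \<in> {0..T}"
    have "1 * H1_norm L (v t) \<le> (1 + c) * max B 0" using B[OF t] c by (intro mult_mono) auto
    then show "H1_norm L (v t) \<le> (1 + c) * max B 0" by simp
    fix x assume x: "x \<in> {-L..L}"
    have "\<bar>v t x\<bar> \<le> c * H1_norm L (v t)"
      unfolding c_def by (rule Sobolev[OF H1_continuous_pw[OF assms(1) t] x assms(2)])
    also have "\<dots> \<le> (1 + c) * max B 0" using B[OF t] c by (intro mult_mono) auto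
    finally show "\<bar>v t x\<bar> \<le> (1 + c) * max B 0" .
  qed
qed

lemma pw_sum: "finite A \<Longrightarrow> (\<And>i. i \<in> A \<Longrightarrow> pw L (\<phi> i)) \<Longrightarrow> pw L (\<lambda>x. \<Sum>i\<in>A. c i * \<phi> i x)"
  using fun_subspace_sum[OF pw_subspace, of A \<phi> L c] by simp

lemma H1_sum:
  assumes "finite A" "\<And>i. i \<in> A \<Longrightarrow> pw L (\<phi> i)"
  shows "H1_norm L (\<lambda>x. \<Sum>i\<in>A. c i * \<phi> i x) \<le> (\<Sum>i\<in>A. \<bar>c i\<bar> * H1_norm L (\<phi> i))"
  using assms
proof (induction A rule: finite_induct)
  case empty
  show ?case using H1_cmult[OF pw_const, of L 0 0] by simp
next
  case (insert j A)
  have "H1_norm L (\<lambda>x. \<Sum>i\<in>insert j A. c i * \<phi> i x) = H1_norm L (\<lambda>x. c j * \<phi> j x + (\<Sum>i\<in>A. c i * \<phi> i x))"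
    using insert by simp
  also have "\<dots> \<le> H1_norm L (\<lambda>x. c j * \<phi> j x) + H1_norm L (\<lambda>x. \<Sum>i\<in>A. c i * \<phi> i x)"
    using insert by (intro H1_add pw_sum pw_cmult) auto
  also have "\<dots> \<le> \<bar>c j\<bar> * H1_norm L (\<phi> j) + (\<Sum>i\<in>A. \<bar>c i\<bar> * H1_norm L (\<phi> i))"
    using insert by (intro add_mono) (auto simp: H1_cmult)
  finally show ?case using insert by simp
qed

lemma fe_pw: "fe_space L W \<Longrightarrow> v \<in> W \<Longrightarrow> pw L v"
  and fe_subspace: "fe_space L W \<Longrightarrow> fun_subspace W"
  by (auto simp: fe_space_def)

lemma fe_nodal_basis:
  assumes "fe_space L W"
  obtains n :: nat and \<phi> p where "\<And>i. i < n \<Longrightarrow> \<phi> i \<in> W" "\<And>i. i < n \<Longrightarrow> p i \<in> {-L..L}"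
    "\<And>v x. v \<in> W \<Longrightarrow> x \<in> {-L..L} \<Longrightarrow> v x = (\<Sum>i<n. v (p i) * \<phi> i x)"
proof -
  obtain J :: "(nat \<times> nat) set" and e where *: "finite J"
    "\<And>v. v \<in> W \<Longrightarrow> \<exists>c. \<forall>x\<in>{-L..L}. v x = (\<Sum>j\<in>J. c j * e j x)"
    using assms unfolding fe_space_def by blast
  from nodal_basis[OF *(1) fe_subspace[OF assms] *(2)] show ?thesis using that by blast
qed

text \<open>Values at finitely many points are coordinates in a fixed spline space, so the H1 norm
  of a time increment is bounded by a finite sum of pointwise increments.\<close>

lemma pointwise_imp_H1_continuous:
  assumes W: "fe_space L W" and v: "\<And>t. t \<in> {0..T} \<Longrightarrow> v t \<in> W"
    and c: "\<And>x. x \<in> {-L..L} \<Longrightarrow> continuous_on {0..T} (\<lambda>t. v t x)"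
  shows "H1_continuous L T v"
  unfolding H1_continuous_def
proof (intro ballI conjI)
  fix t assume t: "t \<in> {0..T}"
  show "pw L (v t)" by (rule fe_pw[OF W v[OF t]])
  obtain n :: nat and \<phi> p where phi: "\<And>i. i < n \<Longrightarrow> \<phi> i \<in> W" and p: "\<And>i. i < n \<Longrightarrow> p i \<in> {-L..L}"
    and ex: "\<And>v x. v \<in> W \<Longrightarrow> x \<in> {-L..L} \<Longrightarrow> v x = (\<Sum>i<n. v (p i) * \<phi> i x)"
    using fe_nodal_basis[OF W] by blast
  have "((\<lambda>s. \<Sum>i<n. \<bar>v s (p i) - v t (p i)\<bar> * H1_norm L (\<phi> i)) \<longlongrightarrow> (\<Sum>i<n. \<bar>v t (p i) - v t (p i)\<bar> * H1_norm L (\<phi> i)))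
    (at t within {0..T})"
    using c p t by (intro tendsto_intros) (auto simp: continuous_on_def)
  then have lim: "((\<lambda>s. \<Sum>i<n. \<bar>v s (p i) - v t (p i)\<bar> * H1_norm L (\<phi> i)) \<longlongrightarrow> 0) (at t within {0..T})" by simp
  have "\<forall>\<^sub>F s in at t within {0..T}. s \<in> {0..T}" by (auto simp: eventually_at_filter)
  then have "\<forall>\<^sub>F s in at t within {0..T}. norm (H1_norm L (\<lambda>x. v s x - v t x))
    \<le> (\<Sum>i<n. \<bar>v s (p i) - v t (p i)\<bar> * H1_norm L (\<phi> i))"
  proof eventually_elim
    case (elim s)
    have "H1_norm L (\<lambda>x. v s x - v t x) = H1_norm L (\<lambda>x. \<Sum>i<n. (v s (p i) - v t (p i)) * \<phi> i x)"
    proof (rule H1_norm_cong)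
      fix x assume x: "x \<in> {-L<..<L}"
      have "v s x = (\<Sum>i<n. v s (p i) * \<phi> i x)" "v t x = (\<Sum>i<n. v t (p i) * \<phi> i x)"
        by (rule ex[OF v]; use elim t x in simp)+
      then show "v s x - v t x = (\<Sum>i<n. (v s (p i) - v t (p i)) * \<phi> i x)"
        by (simp only: left_diff_distrib sum_subtractf)
    qed
    also have "\<dots> \<le> (\<Sum>i<n. \<bar>v s (p i) - v t (p i)\<bar> * H1_norm L (\<phi> i))"
      by (rule H1_sum) (use phi fe_pw[OF W] in auto)
    finally show ?case by simp
  qed
  then show "((\<lambda>s. H1_norm L (\<lambda>x. v s x - v t x)) \<longlongrightarrow> 0) (at t within {0..T})"
    by (rule Lim_null_comparison[OF _ lim])
qed

section \<open>The truncated semidiscrete problem\<close>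

text \<open>Clamping is 1-Lipschitz but has kinks. It is applied only inside fluxes whose derivative
  sits on the test function, and so is never differentiated.\<close>

definition cl :: "real \<Rightarrow> real \<Rightarrow> real" where
  "cl M x = max (- M) (min M x)"

lemma cl_abs: "0 \<le> M \<Longrightarrow> \<bar>cl M x\<bar> \<le> M"
  and cl_id: "\<bar>x\<bar> \<le> M \<Longrightarrow> cl M x = x"
  and cl_lip: "\<bar>cl M x - cl M y\<bar> \<le> \<bar>x - y\<bar>"
  by (auto simp: cl_def)

lemma continuous_on_cl [continuous_intros]: "continuous_on A f \<Longrightarrow> continuous_on A (\<lambda>x. cl M (f x))"
  unfolding cl_def by (intro continuous_intros)

lemma L2_dominated:
  assumes "pc {-L..L} f" "pc {-L..L} g" "pc {-L..L} k" "0 \<le> \<alpha>" "0 \<le> \<beta>"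
    and le: "\<And>x. x \<in> {-L..L} \<Longrightarrow> \<bar>f x\<bar> \<le> \<alpha> * \<bar>g x\<bar> + \<beta> * \<bar>k x\<bar>"
  shows "L2_norm L f \<le> \<alpha> * L2_norm L g + \<beta> * L2_norm L k"
proof -
  have pabs: "pc {-L..L} (\<lambda>x. \<bar>f x\<bar>)" if "pc {-L..L} f" for f
    using that unfolding pc_def bounded_iff by (auto intro!: continuous_intros)
  have nabs: "L2_norm L (\<lambda>x. \<bar>f x\<bar>) = L2_norm L f" for f by (simp add: L2_norm_def ip_def)
  let ?F = "\<lambda>x. \<alpha> * \<bar>g x\<bar> + \<beta> * \<bar>k x\<bar>"
  have pF: "pc {-L..L} ?F" using assms by (intro pc_add pc_cmult pabs)
  have "ip L f f \<le> ip L ?F ?F"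
    unfolding ip_eq_integral[OF assms(1,1)] ip_eq_integral[OF pF pF]
  proof (rule integral_le)
    fix x assume "x \<in> {-L..L}"
    from power_mono[OF le[OF this], of 2] show "f x * f x \<le> ?F x * ?F x" by (simp add: power2_eq_square)
  qed (use assms pF in \<open>auto intro!: pc_integrable(1)[OF pc_mult]\<close>)
  then have "L2_norm L f \<le> L2_norm L ?F" unfolding L2_norm_def by (rule real_sqrt_le_mono)
  also have "\<dots> \<le> L2_norm L (\<lambda>x. \<alpha> * \<bar>g x\<bar>) + L2_norm L (\<lambda>x. \<beta> * \<bar>k x\<bar>)"
    using assms by (intro L2_add pc_cmult pabs)
  also have "\<dots> = \<alpha> * L2_norm L g + \<beta> * L2_norm L k"
    using assms by (simp add: L2_cmult pabs nabs)
  finally show ?thesis .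
qed

text \<open>Clamped factors are bounded by \<open>M\<close>, so the difference of products is
  controlled in L2 alone. This matters because the error analysis controls the \<eta> component in
  L2 only.\<close>

lemma truncated_product_diff:
  assumes "0 \<le> M" "pw L u" "pw L \<eta>" "pw L u'" "pw L \<eta>'"
  shows "L2_norm L (\<lambda>x. (u x + cl M (\<eta> x) * cl M (u x)) - (u' x + cl M (\<eta>' x) * cl M (u' x)))
    \<le> (1 + M) * L2_norm L (\<lambda>x. u x - u' x) + M * L2_norm L (\<lambda>x. \<eta> x - \<eta>' x)"
proof (rule L2_dominated)
  show "pc {-L..L} (\<lambda>x. (u x + cl M (\<eta> x) * cl M (u x)) - (u' x + cl M (\<eta>' x) * cl M (u' x)))"
    using assms by (intro pc_continuous continuous_intros pw_cont) auto
  show "pc {-L..L} (\<lambda>x. u x - u' x)" "pc {-L..L} (\<lambda>x. \<eta> x - \<eta>' x)"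
    using assms by (auto intro: pc_diff pw_pc)
  fix x
  have "cl M (\<eta> x) * cl M (u x) - cl M (\<eta>' x) * cl M (u' x)
     = cl M (\<eta> x) * (cl M (u x) - cl M (u' x)) + cl M (u' x) * (cl M (\<eta> x) - cl M (\<eta>' x))"
    by (simp add: algebra_simps)
  also have "\<bar>\<dots>\<bar> \<le> \<bar>cl M (\<eta> x)\<bar> * \<bar>cl M (u x) - cl M (u' x)\<bar> + \<bar>cl M (u' x)\<bar> * \<bar>cl M (\<eta> x) - cl M (\<eta>' x)\<bar>"
    by (simp only: abs_mult[symmetric] abs_triangle_ineq)
  also have "\<dots> \<le> M * \<bar>u x - u' x\<bar> + M * \<bar>\<eta> x - \<eta>' x\<bar>"
    using assms(1) by (intro add_mono mult_mono cl_abs cl_lip) auto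
  finally show "\<bar>(u x + cl M (\<eta> x) * cl M (u x)) - (u' x + cl M (\<eta>' x) * cl M (u' x))\<bar>
    \<le> (1 + M) * \<bar>u x - u' x\<bar> + M * \<bar>\<eta> x - \<eta>' x\<bar>" by (simp add: algebra_simps)
qed (use assms in auto)

lemma truncated_square_diff:
  assumes "0 \<le> M" "pw L u" "pw L \<eta>" "pw L u'" "pw L \<eta>'"
  shows "L2_norm L (\<lambda>x. (\<eta> x + (1/2) * (cl M (u x))\<^sup>2) - (\<eta>' x + (1/2) * (cl M (u' x))\<^sup>2))
    \<le> M * L2_norm L (\<lambda>x. u x - u' x) + 1 * L2_norm L (\<lambda>x. \<eta> x - \<eta>' x)"
proof (rule L2_dominated)
  show "pc {-L..L} (\<lambda>x. (\<eta> x + (1/2) * (cl M (u x))\<^sup>2) - (\<eta>' x + (1/2) * (cl M (u' x))\<^sup>2))"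
    using assms by (intro pc_continuous continuous_intros pw_cont) auto
  show "pc {-L..L} (\<lambda>x. u x - u' x)" "pc {-L..L} (\<lambda>x. \<eta> x - \<eta>' x)"
    using assms by (auto intro: pc_diff pw_pc)
  fix x
  have "(1/2) * (cl M (u x))\<^sup>2 - (1/2) * (cl M (u' x))\<^sup>2 = ((cl M (u x) + cl M (u' x)) / 2) * (cl M (u x) - cl M (u' x))"
    by (simp add: field_simps power2_eq_square)
  also have "\<bar>\<dots>\<bar> \<le> M * \<bar>u x - u' x\<bar>"
    unfolding abs_mult using cl_abs[OF assms(1), of "u x"] cl_abs[OF assms(1), of "u' x"] assms(1)
    by (intro mult_mono cl_lip) auto
  finally show "\<bar>(\<eta> x + (1/2) * (cl M (u x))\<^sup>2) - (\<eta>' x + (1/2) * (cl M (u' x))\<^sup>2)\<bar>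
    \<le> M * \<bar>u x - u' x\<bar> + 1 * \<bar>\<eta> x - \<eta>' x\<bar>"
    using abs_triangle_ineq[of "\<eta> x - \<eta>' x" "1 / 2 * (cl M (u x))\<^sup>2 - 1 / 2 * (cl M (u' x))\<^sup>2"]
    by (simp add: algebra_simps)
qed (use assms in auto)

lemma ip_diff_le:
  assumes "pc {-L..L} f" "pc {-L..L} g" "pc {-L..L} k"
  shows "\<bar>ip L f k - ip L g k\<bar> \<le> L2_norm L (\<lambda>x. f x - g x) * L2_norm L k"
  using psd_form.diff_left[OF ip_psd, of f L g k] ip_le[OF pc_diff[OF assms(1,2)] assms(3)] assms by simp

section \<open>Discrete Laplacian and truncated fluxes on a fixed mesh\<close>

locale fem =
  fixes L :: real and N \<mu> r :: nat
  assumes L: "0 < L" and N: "0 < N" and r: "2 \<le> r"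
begin

abbreviation "S \<equiv> Sh L N \<mu> r"
abbreviation "S0 \<equiv> Sh0 L N \<mu> r"
abbreviation "lap \<equiv> discrete_laplacian L N \<mu> r"

lemma feS: "fe_space L S" and feS0: "fe_space L S0"
  using fe_space_Sh[OF L N] fe_space_Sh0[OF L N] r by auto

lemma S_pw: "v \<in> S \<Longrightarrow> pw L v" and S0_pw: "v \<in> S0 \<Longrightarrow> pw L v" and S0_S: "v \<in> S0 \<Longrightarrow> v \<in> S"
  using fe_pw[OF feS] fe_pw[OF feS0] Sh0_Sh by auto

lemma S0_bd: "v \<in> S0 \<Longrightarrow> v L = 0" "v \<in> S0 \<Longrightarrow> v (-L) = 0"
  by (auto simp: Sh0_def)

lemma lap_spec:
  assumes "pw L v"
  shows "lap v \<in> S0" "\<And>\<phi>. \<phi> \<in> S0 \<Longrightarrow> ip L (lap v) \<phi> = - ip L (deriv v) (deriv \<phi>)"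
proof -
  have "\<exists>z\<in>S0. \<forall>\<phi>\<in>S0. ip L z \<phi> = - ip L (deriv v) (deriv \<phi>)"
  proof (rule fe_Riesz[OF feS0 L])
    have pv: "pc {-L..L} (deriv v)" by (rule pw_pc_deriv[OF assms])
    show "- ip L (deriv v) (deriv (\<lambda>x. f x + g x)) = - ip L (deriv v) (deriv f) + - ip L (deriv v) (deriv g)"
      if "f \<in> S0" "g \<in> S0" for f g
      using ip_deriv_add[OF S0_pw[OF that(1)] S0_pw[OF that(2)] pv] ip_commute[of L "deriv v"] by simp
    show "- ip L (deriv v) (deriv (\<lambda>x. c * f x)) = c * - ip L (deriv v) (deriv f)" if "f \<in> S0" for f c
      using ip_deriv_cmult[OF S0_pw[OF that] pv] ip_commute[of L "deriv v"] by simp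
    show "- ip L (deriv v) (deriv f) = - ip L (deriv v) (deriv g)"
      if "\<And>x. x \<in> {-L..L} \<Longrightarrow> f x = g x" for f g
      using ip_cong[of L "deriv v" "deriv v" "deriv f" "deriv g"] deriv_eq_on_interior[of "-L" L f g] that by auto
  qed auto
  then have "\<exists>w. w \<in> S0 \<and> (\<forall>\<phi>\<in>S0. ip L w \<phi> = - ip L (deriv v) (deriv \<phi>))" by blast
  from someI_ex[OF this] show "lap v \<in> S0" "\<And>\<phi>. \<phi> \<in> S0 \<Longrightarrow> ip L (lap v) \<phi> = - ip L (deriv v) (deriv \<phi>)"
    unfolding discrete_laplacian_def by auto
qed

lemma ip_unique:
  assumes "z \<in> S0" "z' \<in> S0" "\<And>\<phi>. \<phi> \<in> S0 \<Longrightarrow> ip L z \<phi> = ip L z' \<phi>" "x \<in> {-L..L}"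
  shows "z x = z' x"
proof -
  let ?d = "\<lambda>x. z x - z' x"
  have d: "?d \<in> S0" by (rule fun_subspace_diff[OF Sh0_subspace[OF L] assms(1,2)])
  have "ip L ?d ?d = ip L z ?d - ip L z' ?d"
    using psd_form.diff_left[OF ip_psd, of z L z' ?d] S0_pw d assms(1,2) by (simp add: pw_pc)
  then have "ip L ?d ?d = 0" using assms(3)[OF d] by simp
  then show ?thesis using ip_definite[OF S0_pw[OF d] L] assms(4) by simp
qed

lemma lap_diff:
  assumes "pw L v" "pw L w" "x \<in> {-L..L}"
  shows "lap (\<lambda>x. v x - w x) x = lap v x - lap w x"
proof (rule ip_unique[where z = "lap (\<lambda>x. v x - w x)" and z' = "\<lambda>x. lap v x - lap w x"])
  show "lap (\<lambda>x. v x - w x) \<in> S0" by (rule lap_spec(1)[OF pw_diff[OF assms(1,2)]])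
  show "(\<lambda>x. lap v x - lap w x) \<in> S0"
    by (intro fun_subspace_diff[OF Sh0_subspace[OF L]] lap_spec(1) assms)
  fix \<phi> assume p: "\<phi> \<in> S0"
  have pd: "pc {-L..L} (deriv \<phi>)" using S0_pw[OF p] by (rule pw_pc_deriv)
  have "ip L (deriv (\<lambda>x. v x - w x)) (deriv \<phi>) = ip L (deriv v) (deriv \<phi>) - ip L (deriv w) (deriv \<phi>)"
    using ip_deriv_add[OF assms(1) pw_cmult[OF assms(2), of "-1"] pd] ip_deriv_cmult[OF assms(2) pd, of "-1"] by simp
  moreover have "ip L (\<lambda>x. lap v x - lap w x) \<phi> = ip L (lap v) \<phi> - ip L (lap w) \<phi>"
    using psd_form.diff_left[OF ip_psd, of "lap v" L "lap w" \<phi>] S0_pw lap_spec(1) assms p by (simp add: pw_pc)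
  ultimately show "ip L (lap (\<lambda>x. v x - w x)) \<phi> = ip L (\<lambda>x. lap v x - lap w x) \<phi>"
    using lap_spec(2)[OF pw_diff[OF assms(1,2)] p] lap_spec(2)[OF assms(1) p] lap_spec(2)[OF assms(2) p] by simp
qed (use assms in simp)

text \<open>Testing with \<open>lap v\<close> itself leaves one derivative on that spline, which the
  inverse inequality removes; \<open>K\<close> will be of order \<open>1 / mesh L N\<close>.\<close>

lemma lap_bound:
  assumes inv: "\<And>v. v \<in> S \<Longrightarrow> L2_norm L (deriv v) \<le> K * L2_norm L v" and v: "pw L v"
  shows "L2_norm L (lap v) \<le> K * L2_norm L (deriv v)"
proof -
  have w: "lap v \<in> S0" "pw L (lap v)" using lap_spec(1)[OF v] S0_pw by auto
  have "(L2_norm L (lap v))\<^sup>2 = - ip L (deriv v) (deriv (lap v))" using lap_spec(2)[OF v w(1)] by (simp add: L2_norm_sq)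
  also have "\<dots> \<le> L2_norm L (deriv v) * L2_norm L (deriv (lap v))"
    using ip_le[OF pw_pc_deriv[OF v] pw_pc_deriv[OF w(2)]] by simp
  also have "\<dots> \<le> L2_norm L (deriv v) * (K * L2_norm L (lap v))"
    using inv[OF S0_S[OF w(1)]] by (intro mult_left_mono) auto
  finally have *: "L2_norm L (lap v) * L2_norm L (lap v) \<le> (K * L2_norm L (deriv v)) * L2_norm L (lap v)"
    by (simp add: power2_eq_square mult_ac)
  show ?thesis
  proof (cases "L2_norm L (lap v) = 0")
    case True
    have "0 \<le> K * L2_norm L (deriv v) \<or> L2_norm L (deriv v) = 0 \<or> K < 0"
      using mult_nonneg_nonneg[of K "L2_norm L (deriv v)"] by fastforce
    \<comment> \<open>The sign of \<open>K\<close> follows by applying the inverse inequality to the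
      identity function, a spline of positive L2 norm.\<close>
    moreover have "0 \<le> K"
    proof -
      have "poly [:0, 1:] \<in> S" using r by (intro Sh_poly[OF L]) auto
      from inv[OF this] have "0 \<le> K * L2_norm L (poly [:0, 1:])" using L2_norm_nonneg order_trans by blast
      moreover have "L2_norm L (poly [:0, 1:]) \<noteq> 0"
      proof
        assume "L2_norm L (poly [:0, 1:]) = 0"
        then have "ip L (poly [:0, 1:]) (poly [:0, 1:]) = 0" using L2_norm_sq[of L "poly [:0, 1:]"] by simp
        with ip_definite[OF S_pw[OF \<open>poly [:0, 1:] \<in> S\<close>] L] have "poly [:0, 1:] L = 0" using L by simp
        then show False using L by simp
      qed
      ultimately show ?thesis using L2_norm_nonneg[of L "poly [:0, 1:]"] by (simp add: zero_le_mult_iff)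
    qed
    ultimately show ?thesis using True by auto
  next
    case False
    then have "0 < L2_norm L (lap v)" using L2_norm_nonneg[of L "lap v"] by linarith
    with * show ?thesis by simp
  qed
qed

text \<open>The flux of the first equation after integration by parts, with the sign it has on the
  right-hand side; \<open>F2\<close> does the same for the second equation, reading u u_x as the
  derivative of u^2/2.\<close>

definition F1 :: "real \<Rightarrow> real \<Rightarrow> (real \<Rightarrow> real) \<Rightarrow> (real \<Rightarrow> real) \<Rightarrow> (real \<Rightarrow> real) \<Rightarrow> real" where
  "F1 a M \<eta> u \<psi> = ip L (\<lambda>x. (u x + cl M (\<eta> x) * cl M (u x)) + a * lap u x) (deriv \<psi>)"

definition F2 :: "real \<Rightarrow> (real \<Rightarrow> real) \<Rightarrow> (real \<Rightarrow> real) \<Rightarrow> (real \<Rightarrow> real) \<Rightarrow> real" where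
  "F2 M \<eta> u \<phi> = ip L (\<lambda>x. \<eta> x + (1/2) * (cl M (u x))\<^sup>2) (deriv \<phi>)"

lemma flux_pc:
  assumes "pw L \<eta>" "pw L u"
  shows "pc {-L..L} (\<lambda>x. u x + cl M (\<eta> x) * cl M (u x))"
    "pc {-L..L} (\<lambda>x. (u x + cl M (\<eta> x) * cl M (u x)) + a * lap u x)"
    "pc {-L..L} (\<lambda>x. \<eta> x + (1/2) * (cl M (u x))\<^sup>2)"
  using pw_cont[OF assms(1)] pw_cont[OF assms(2)] pw_cont[OF S0_pw[OF lap_spec(1)[OF assms(2)]]]
  by (auto intro!: pc_continuous continuous_intros)

text \<open>A qualitative tool for existence, uniqueness and continuity on one mesh: the
  \<open>K\<close> found below contains the factor \<open>1 / mesh L N\<close> of the inverse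
  inequality, so error estimates have to proceed differently.\<close>

definition flux_Lipschitz :: "real \<Rightarrow> real \<Rightarrow> real \<Rightarrow> bool" where
  "flux_Lipschitz a M K \<longleftrightarrow> 0 \<le> K \<and> (\<forall>\<eta> u \<eta>' u' \<psi>. pw L \<eta> \<longrightarrow> pw L u \<longrightarrow> pw L \<eta>' \<longrightarrow> pw L u' \<longrightarrow> pw L \<psi> \<longrightarrow>
     (let D = K * (H1_norm L (\<lambda>x. \<eta> x - \<eta>' x) + H1_norm L (\<lambda>x. u x - u' x)) * H1_norm L \<psi>
      in \<bar>F1 a M \<eta> u \<psi> - F1 a M \<eta>' u' \<psi>\<bar> \<le> D \<and> \<bar>F2 M \<eta> u \<psi> - F2 M \<eta>' u' \<psi>\<bar> \<le> D))"

lemma flux_LipschitzD: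
  assumes "flux_Lipschitz a M K"
  shows "0 \<le> K"
    and "pw L \<eta> \<Longrightarrow> pw L u \<Longrightarrow> pw L \<eta>' \<Longrightarrow> pw L u' \<Longrightarrow> pw L \<psi> \<Longrightarrow>
      \<bar>F1 a M \<eta> u \<psi> - F1 a M \<eta>' u' \<psi>\<bar> \<le>
        K * (H1_norm L (\<lambda>x. \<eta> x - \<eta>' x) + H1_norm L (\<lambda>x. u x - u' x)) * H1_norm L \<psi>"
    and "pw L \<eta> \<Longrightarrow> pw L u \<Longrightarrow> pw L \<eta>' \<Longrightarrow> pw L u' \<Longrightarrow> pw L \<psi> \<Longrightarrow>
      \<bar>F2 M \<eta> u \<psi> - F2 M \<eta>' u' \<psi>\<bar> \<le>
        K * (H1_norm L (\<lambda>x. \<eta> x - \<eta>' x) + H1_norm L (\<lambda>x. u x - u' x)) * H1_norm L \<psi>"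
  using assms unfolding flux_Lipschitz_def Let_def by blast+

lemma flux_Lipschitz_exists:
  assumes M: "0 \<le> M"
  obtains K where "flux_Lipschitz a M K"
proof -
  obtain C where C: "0 < C" "\<And>v. v \<in> S \<Longrightarrow> L2_norm L (deriv v) \<le> C / mesh L N * L2_norm L v"
    using inverse_inequality[of r] L N by blast
  define k where "k = C / mesh L N"
  have k: "0 \<le> k" using C mesh_pos[OF L N] by (simp add: k_def)
  define K where "K = 1 + M + \<bar>a\<bar> * k"
  have K: "0 \<le> K" "M \<le> K" "1 \<le> K" using M k by (auto simp: K_def)
  have "flux_Lipschitz a M K" unfolding flux_Lipschitz_def Let_def
  proof (intro conjI allI impI K(1))
    fix \<eta> u \<eta>' u' \<psi> assume pw: "pw L \<eta>" "pw L u" "pw L \<eta>'" "pw L u'" "pw L \<psi>"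
    let ?A = "H1_norm L (\<lambda>x. \<eta> x - \<eta>' x)" and ?B = "H1_norm L (\<lambda>x. u x - u' x)"
    have pd: "pc {-L..L} (deriv \<psi>)" by (rule pw_pc_deriv[OF pw(5)])
    let ?p = "\<lambda>x. (u x + cl M (\<eta> x) * cl M (u x)) - (u' x + cl M (\<eta>' x) * cl M (u' x))"
    have "L2_norm L (\<lambda>x. ((u x + cl M (\<eta> x) * cl M (u x)) + a * lap u x) - ((u' x + cl M (\<eta>' x) * cl M (u' x)) + a * lap u' x))
      = L2_norm L (\<lambda>x. ?p x + a * lap (\<lambda>x. u x - u' x) x)"
      by (rule L2_norm_cong) (simp add: lap_diff[OF pw(2,4)] right_diff_distrib)
    also have "\<dots> \<le> L2_norm L ?p + L2_norm L (\<lambda>x. a * lap (\<lambda>x. u x - u' x) x)"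
      using pw by (intro L2_add pc_diff flux_pc pc_cmult pw_pc[OF S0_pw[OF lap_spec(1)]] pw_diff)
    also have "L2_norm L (\<lambda>x. a * lap (\<lambda>x. u x - u' x) x) = \<bar>a\<bar> * L2_norm L (lap (\<lambda>x. u x - u' x))"
      using pw by (intro L2_cmult pw_pc[OF S0_pw[OF lap_spec(1)]] pw_diff)
    also have "L2_norm L (lap (\<lambda>x. u x - u' x)) \<le> k * L2_norm L (deriv (\<lambda>x. u x - u' x))"
      using pw C(2) by (intro lap_bound pw_diff) (auto simp: k_def)
    also have "\<dots> \<le> k * ?B" using k by (intro mult_left_mono L2_deriv_le_H1)
    also have "L2_norm L ?p \<le> (1 + M) * ?B + M * ?A"
    proof -
      have "L2_norm L ?p \<le> (1 + M) * L2_norm L (\<lambda>x. u x - u' x) + M * L2_norm L (\<lambda>x. \<eta> x - \<eta>' x)"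
        using pw by (intro truncated_product_diff M)
      also have "\<dots> \<le> (1 + M) * ?B + M * ?A" using M by (intro add_mono mult_left_mono L2_le_H1) auto
      finally show ?thesis .
    qed
    finally have n: "L2_norm L (\<lambda>x. ((u x + cl M (\<eta> x) * cl M (u x)) + a * lap u x) - ((u' x + cl M (\<eta>' x) * cl M (u' x)) + a * lap u' x))
       \<le> (1 + M) * ?B + M * ?A + \<bar>a\<bar> * (k * ?B)" by (simp add: mult_left_mono)
    also have "\<dots> = K * ?B + M * ?A" by (simp add: K_def algebra_simps)
    also have "\<dots> \<le> K * (?A + ?B)" using mult_right_mono[OF K(2), of ?A] by (simp add: algebra_simps)
    finally have n: "L2_norm L (\<lambda>x. ((u x + cl M (\<eta> x) * cl M (u x)) + a * lap u x) - ((u' x + cl M (\<eta>' x) * cl M (u' x)) + a * lap u' x))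
       \<le> K * (?A + ?B)" .
    have "\<bar>F1 a M \<eta> u \<psi> - F1 a M \<eta>' u' \<psi>\<bar> \<le> L2_norm L (\<lambda>x. ((u x + cl M (\<eta> x) * cl M (u x)) + a * lap u x) -
       ((u' x + cl M (\<eta>' x) * cl M (u' x)) + a * lap u' x)) * L2_norm L (deriv \<psi>)"
      unfolding F1_def using pw by (intro ip_diff_le flux_pc pd)
    also have "\<dots> \<le> K * (?A + ?B) * H1_norm L \<psi>" using n L2_deriv_le_H1 K by (intro mult_mono) auto
    finally show "\<bar>F1 a M \<eta> u \<psi> - F1 a M \<eta>' u' \<psi>\<bar> \<le> K * (?A + ?B) * H1_norm L \<psi>" .
    have n: "L2_norm L (\<lambda>x. (\<eta> x + (1/2) * (cl M (u x))\<^sup>2) - (\<eta>' x + (1/2) * (cl M (u' x))\<^sup>2)) \<le> K * (?A + ?B)"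
    proof -
      have "L2_norm L (\<lambda>x. (\<eta> x + (1/2) * (cl M (u x))\<^sup>2) - (\<eta>' x + (1/2) * (cl M (u' x))\<^sup>2))
        \<le> M * L2_norm L (\<lambda>x. u x - u' x) + 1 * L2_norm L (\<lambda>x. \<eta> x - \<eta>' x)"
        using pw by (intro truncated_square_diff M)
      also have "\<dots> \<le> K * ?B + K * ?A" using K by (intro add_mono mult_mono L2_le_H1) auto
      finally show ?thesis by (simp add: algebra_simps)
    qed
    have "\<bar>F2 M \<eta> u \<psi> - F2 M \<eta>' u' \<psi>\<bar> \<le> L2_norm L (\<lambda>x. (\<eta> x + (1/2) * (cl M (u x))\<^sup>2) - (\<eta>' x + (1/2) * (cl M (u' x))\<^sup>2))
        * L2_norm L (deriv \<psi>)"
      unfolding F2_def using pw by (intro ip_diff_le flux_pc pd)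
    also have "\<dots> \<le> K * (?A + ?B) * H1_norm L \<psi>" using n L2_deriv_le_H1 K by (intro mult_mono) auto
    finally show "\<bar>F2 M \<eta> u \<psi> - F2 M \<eta>' u' \<psi>\<bar> \<le> K * (?A + ?B) * H1_norm L \<psi>" .
  qed
  then show ?thesis by (rule that)
qed

lemma F_linear:
  assumes "pw L \<eta>" "pw L u" "finite A" "\<And>i. i \<in> A \<Longrightarrow> pw L (\<phi> i)"
  shows "F1 a M \<eta> u (\<lambda>x. \<Sum>i\<in>A. c i * \<phi> i x) = (\<Sum>i\<in>A. c i * F1 a M \<eta> u (\<phi> i))"
    "F2 M \<eta> u (\<lambda>x. \<Sum>i\<in>A. c i * \<phi> i x) = (\<Sum>i\<in>A. c i * F2 M \<eta> u (\<phi> i))"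
proof -
  have *: "ip L f (deriv (\<lambda>x. \<Sum>i\<in>A. c i * \<phi> i x)) = (\<Sum>i\<in>A. c i * ip L f (deriv (\<phi> i)))" if f: "pc {-L..L} f" for f
    using assms(3,4)
  proof (induction A rule: finite_induct)
    case empty
    have "ip L f (deriv (\<lambda>x. 0)) = ip L (deriv (\<lambda>x. 0 * 0)) f" by (simp add: ip_commute[of L f])
    also have "\<dots> = 0" by (subst ip_deriv_cmult[OF pw_const f]) simp
    finally show ?case by simp
  next
    case (insert j A)
    have 1: "pw L (\<lambda>x. \<Sum>i\<in>A. c i * \<phi> i x)" "pw L (\<phi> j)" using insert by (auto intro: pw_sum)
    have "ip L f (deriv (\<lambda>x. \<Sum>i\<in>insert j A. c i * \<phi> i x)) = ip L (deriv (\<lambda>x. c j * \<phi> j x + (\<Sum>i\<in>A. c i * \<phi> i x))) f"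
      using insert by (simp add: ip_commute[of L f])
    also have "\<dots> = c j * ip L (deriv (\<phi> j)) f + ip L (deriv (\<lambda>x. \<Sum>i\<in>A. c i * \<phi> i x)) f"
      using ip_deriv_add[OF pw_cmult[OF 1(2)] 1(1) f] ip_deriv_cmult[OF 1(2) f] by simp
    finally show ?case using insert by (simp add: ip_commute[of L f])
  qed
  show "F1 a M \<eta> u (\<lambda>x. \<Sum>i\<in>A. c i * \<phi> i x) = (\<Sum>i\<in>A. c i * F1 a M \<eta> u (\<phi> i))"
    "F2 M \<eta> u (\<lambda>x. \<Sum>i\<in>A. c i * \<phi> i x) = (\<Sum>i\<in>A. c i * F2 M \<eta> u (\<phi> i))"
    unfolding F1_def F2_def by (rule *[OF flux_pc(2)[OF assms(1,2)]] *[OF flux_pc(3)[OF assms(1,2)]])+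
qed

lemma F_cong:
  assumes "\<And>x. x \<in> {-L..L} \<Longrightarrow> \<psi> x = \<psi>' x"
  shows "F1 a M \<eta> u \<psi> = F1 a M \<eta> u \<psi>'" "F2 M \<eta> u \<psi> = F2 M \<eta> u \<psi>'"
  unfolding F1_def F2_def using assms by (auto intro!: ip_cong deriv_eq_on_interior[of "-L" L])

text \<open>The time-integrated truncated problem. The exact solution obeys identities of the same
  shape, so that the two can be subtracted without differentiating in time.\<close>

definition weak_solution where
  "weak_solution T a b d M \<eta>h uh \<longleftrightarrow>
     (\<forall>t\<in>{0..T}. \<eta>h t \<in> S \<and> uh t \<in> S0) \<and> H1_continuous L T \<eta>h \<and> H1_continuous L T uh \<and>
     (\<forall>t\<in>{0..T}. \<forall>\<psi>\<in>S. A_form L b (\<eta>h t) \<psi> = A_form L b (\<eta>h 0) \<psi> + integral {0..t} (\<lambda>s. F1 a M (\<eta>h s) (uh s) \<psi>)) \<and>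
     (\<forall>t\<in>{0..T}. \<forall>\<phi>\<in>S0. A_form L d (uh t) \<phi> = A_form L d (uh 0) \<phi> + integral {0..t} (\<lambda>s. F2 M (\<eta>h s) (uh s) \<phi>))"

lemma F_continuous:
  assumes "0 \<le> M" "H1_continuous L T \<eta>h" "H1_continuous L T uh" "pw L \<psi>"
  shows "continuous_on {0..T} (\<lambda>s. F1 a M (\<eta>h s) (uh s) \<psi>)" "continuous_on {0..T} (\<lambda>s. F2 M (\<eta>h s) (uh s) \<psi>)"
proof -
  obtain K where KL: "flux_Lipschitz a M K" using flux_Lipschitz_exists[OF assms(1)] by blast
  note K = flux_LipschitzD[OF KL]
  note p = H1_continuous_pw[OF assms(2)] H1_continuous_pw[OF assms(3)]
  show "continuous_on {0..T} (\<lambda>s. F1 a M (\<eta>h s) (uh s) \<psi>)"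
  proof (rule continuous_on_H1_dominated[OF assms(2,3), of _ "K * H1_norm L \<psi>"])
    fix s t assume st: "s \<in> {0..T}" "t \<in> {0..T}"
    from K(2)[OF p(1)[OF st(1)] p(2)[OF st(1)] p(1)[OF st(2)] p(2)[OF st(2)] assms(4)]
    show "\<bar>F1 a M (\<eta>h s) (uh s) \<psi> - F1 a M (\<eta>h t) (uh t) \<psi>\<bar> \<le>
      K * H1_norm L \<psi> * (H1_norm L (\<lambda>x. \<eta>h s x - \<eta>h t x) + H1_norm L (\<lambda>x. uh s x - uh t x))" by (simp add: mult_ac)
  qed
  show "continuous_on {0..T} (\<lambda>s. F2 M (\<eta>h s) (uh s) \<psi>)"
  proof (rule continuous_on_H1_dominated[OF assms(2,3), of _ "K * H1_norm L \<psi>"])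
    fix s t assume st: "s \<in> {0..T}" "t \<in> {0..T}"
    from K(3)[OF p(1)[OF st(1)] p(2)[OF st(1)] p(1)[OF st(2)] p(2)[OF st(2)] assms(4)]
    show "\<bar>F2 M (\<eta>h s) (uh s) \<psi> - F2 M (\<eta>h t) (uh t) \<psi>\<bar> \<le>
      K * H1_norm L \<psi> * (H1_norm L (\<lambda>x. \<eta>h s x - \<eta>h t x) + H1_norm L (\<lambda>x. uh s x - uh t x))" by (simp add: mult_ac)
  qed
qed

end


lemma A_form_commute: "A_form L q f g = A_form L q g f"
  unfolding A_form_def by (simp add: ip_commute)

lemma le_of_square_le:
  fixes X :: real
  assumes "m * X\<^sup>2 \<le> B * X" "0 < m" "0 \<le> X" "0 \<le> B"
  shows "X \<le> B / m"
proof (cases "X = 0")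
  case False
  then have "0 < X" using assms by simp
  moreover have "(m * X) * X \<le> B * X" using assms(1) by (simp add: power2_eq_square mult.assoc)
  ultimately have "m * X \<le> B" by simp
  then show ?thesis using assms(2) by (simp add: field_simps)
qed (use assms in simp)

text \<open>Through a nodal basis the form becomes a fixed linear combination of finitely many point
  values of \<open>v\<close>, each differentiable in time.\<close>

lemma A_form_dt:
  assumes W: "fe_space L W" and T: "0 < T" and q: "0 < q" and psi: "pw L \<psi>"
    and v: "\<And>t. t \<in> {0..T} \<Longrightarrow> v t \<in> W" and t: "t \<in> {0..T}"
    and diff: "\<And>x. x \<in> {-L..L} \<Longrightarrow> (\<lambda>s. v s x) differentiable (at t within {0..T})"
  shows "((\<lambda>s. A_form L q (v s) \<psi>) has_real_derivative A_form L q (dt T v t) \<psi>) (at t within {0..T})"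
proof -
  interpret psd_form "{f. pw L f}" "A_form L q" by (rule A_form_psd) (use q in simp)
  obtain n :: nat and \<phi> p where phi: "\<And>i. i < n \<Longrightarrow> \<phi> i \<in> W" and p: "\<And>i. i < n \<Longrightarrow> p i \<in> {-L..L}"
    and ex: "\<And>v x. v \<in> W \<Longrightarrow> x \<in> {-L..L} \<Longrightarrow> v x = (\<Sum>i<n. v (p i) * \<phi> i x)"
    using fe_nodal_basis[OF W] by blast
  have phipw: "\<And>i. i < n \<Longrightarrow> pw L (\<phi> i)" using phi fe_pw[OF W] by blast
  have d: "((\<lambda>s. v s x) has_real_derivative dt T v t x) (at t within {0..T})" if "x \<in> {-L..L}" for x
    using diff[OF that] unfolding dt_def
    by (simp add: vector_derivative_works has_real_derivative_iff_has_vector_derivative)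
  have A: "A_form L q (v s) \<psi> = (\<Sum>i<n. v s (p i) * A_form L q (\<phi> i) \<psi>)" if s: "s \<in> {0..T}" for s
  proof -
    have "A_form L q (v s) \<psi> = A_form L q (\<lambda>x. \<Sum>i<n. v s (p i) * \<phi> i x) \<psi>"
      by (rule A_form_cong) (use ex[OF v[OF s]] in auto)
    also have "\<dots> = (\<Sum>i<n. v s (p i) * A_form L q (\<phi> i) \<psi>)" by (rule sum_left) (use phipw psi in auto)
    finally show ?thesis .
  qed
  have "A_form L q (dt T v t) \<psi> = A_form L q (\<lambda>x. \<Sum>i<n. dt T v t (p i) * \<phi> i x) \<psi>"
  proof (rule A_form_cong)
    fix x assume x: "x \<in> {-L<..<L}"
    have "((\<lambda>s. \<Sum>i<n. v s (p i) * \<phi> i x) has_real_derivative (\<Sum>i<n. dt T v t (p i) * \<phi> i x)) (at t within {0..T})"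
      by (intro DERIV_sum DERIV_cmult_right d p) simp
    moreover have "v s x = (\<Sum>i<n. v s (p i) * \<phi> i x)" if "s \<in> {0..T}" for s by (rule ex[OF v[OF that]]) (use x in simp)
    ultimately have "((\<lambda>s. v s x) has_real_derivative (\<Sum>i<n. dt T v t (p i) * \<phi> i x)) (at t within {0..T})"
      using has_real_derivative_cong_on[of "{0..T}" "\<lambda>s. v s x" "\<lambda>s. \<Sum>i<n. v s (p i) * \<phi> i x" t] t by blast
    then show "dt T v t x = (\<Sum>i<n. dt T v t (p i) * \<phi> i x)"
      unfolding dt_def using T t vector_derivative_within_closed_interval[of 0 T t "\<lambda>s. v s x"]
      by (simp add: has_real_derivative_iff_has_vector_derivative)
  qed simp
  also have "\<dots> = (\<Sum>i<n. dt T v t (p i) * A_form L q (\<phi> i) \<psi>)" by (rule sum_left) (use phipw psi in auto)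
  finally have eq: "A_form L q (dt T v t) \<psi> = (\<Sum>i<n. dt T v t (p i) * A_form L q (\<phi> i) \<psi>)" .
  have "((\<lambda>s. \<Sum>i<n. v s (p i) * A_form L q (\<phi> i) \<psi>) has_real_derivative (\<Sum>i<n. dt T v t (p i) * A_form L q (\<phi> i) \<psi>)) (at t within {0..T})"
    by (intro DERIV_sum DERIV_cmult_right d p) simp
  then show ?thesis
    unfolding eq using has_real_derivative_cong_on[of "{0..T}" "\<lambda>s. A_form L q (v s) \<psi>"
        "\<lambda>s. \<Sum>i<n. v s (p i) * A_form L q (\<phi> i) \<psi>" t] A t by blast
qed

text \<open>The equation holds for \<open>0 < t\<close> only; continuity of the form down to 0
  closes the gap in the fundamental theorem.\<close>

lemma integrated_A_form:
  assumes W: "fe_space L W" and T: "0 < T" and q: "0 < q" and psi: "pw L \<psi>"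
    and v: "\<And>t. t \<in> {0..T} \<Longrightarrow> v t \<in> W" and t: "t \<in> {0..T}"
    and c: "\<And>x. x \<in> {-L..L} \<Longrightarrow> continuous_on {0..T} (\<lambda>t. v t x)"
    and diff: "\<And>x t. x \<in> {-L..L} \<Longrightarrow> t \<in> {0<..T} \<Longrightarrow> (\<lambda>s. v s x) differentiable (at t within {0..T})"
    and eq: "\<And>t. t \<in> {0<..T} \<Longrightarrow> A_form L q (dt T v t) \<psi> = \<Phi> t"
  shows "A_form L q (v t) \<psi> = A_form L q (v 0) \<psi> + integral {0..t} \<Phi>"
proof -
  interpret psd_form "{f. pw L f}" "A_form L q" by (rule A_form_psd) (use q in simp)
  have Hc: "H1_continuous L T v" by (rule pointwise_imp_H1_continuous[OF W v c])
  have cont: "continuous_on {0..T} (\<lambda>s. A_form L q (v s) \<psi>)"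
  proof (rule continuous_on_H1_dominated[OF Hc Hc, of _ "max 1 q * H1_norm L \<psi>"])
    fix s t assume st: "s \<in> {0..T}" "t \<in> {0..T}"
    have pw: "pw L (v s)" "pw L (v t)" using H1_continuous_pw[OF Hc] st by auto
    have "\<bar>A_form L q (v s) \<psi> - A_form L q (v t) \<psi>\<bar> = \<bar>A_form L q (\<lambda>x. v s x - v t x) \<psi>\<bar>"
      using diff_left[of "v s" "v t" \<psi>] pw psi by simp
    also have "\<dots> \<le> max 1 q * (H1_norm L (\<lambda>x. v s x - v t x) * H1_norm L \<psi>)"
      by (rule A_form_le[OF q pw_diff[OF pw] psi])
    also have "\<dots> \<le> max 1 q * H1_norm L \<psi> * (H1_norm L (\<lambda>x. v s x - v t x) + H1_norm L (\<lambda>x. v s x - v t x))"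
      using q by (simp add: algebra_simps)
    finally show "\<bar>A_form L q (v s) \<psi> - A_form L q (v t) \<psi>\<bar> \<le>
      max 1 q * H1_norm L \<psi> * (H1_norm L (\<lambda>x. v s x - v t x) + H1_norm L (\<lambda>x. v s x - v t x))" .
  qed
  have "(\<Phi> has_integral (A_form L q (v t) \<psi> - A_form L q (v 0) \<psi>)) {0..t}"
  proof (rule fundamental_theorem_of_calculus_interior)
    show "continuous_on {0..t} (\<lambda>s. A_form L q (v s) \<psi>)" by (rule continuous_on_subset[OF cont]) (use t in auto)
    fix s assume s: "s \<in> {0<..<t}"
    have sT: "s \<in> {0..T}" "s \<in> {0<..T}" "0 < s" "s < T" using s t by auto
    have "((\<lambda>s. A_form L q (v s) \<psi>) has_real_derivative A_form L q (dt T v s) \<psi>) (at s within {0..T})"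
      by (rule A_form_dt[OF W T q psi v sT(1) diff[OF _ sT(2)]])
    then show "((\<lambda>s. A_form L q (v s) \<psi>) has_vector_derivative \<Phi> s) (at s)"
      using eq[OF sT(2)] at_within_Icc_at[OF sT(3,4)] by (simp add: has_real_derivative_iff_has_vector_derivative)
  qed (use t in auto)
  then show ?thesis by (simp add: integral_unique)
qed

section \<open>Uniqueness and existence for the truncated problem\<close>

context fem
begin

text \<open>Each component of the difference at time \<open>t\<close> lies in the spline space and
  serves as its own test function. Coercivity bounds its H1 norm by the integral of
  \<open>E\<close>, and Gronwall with \<open>\<delta> = 0\<close> concludes, with constants that
  depend on the mesh.\<close>

lemma weak_unique:
  assumes w: "weak_solution T a b d M \<eta> u" and w': "weak_solution T a b d M \<eta>' u'"
    and M: "0 \<le> M" and b: "0 < b" and d: "0 < d"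
    and init: "\<And>x. x \<in> {-L..L} \<Longrightarrow> \<eta> 0 x = \<eta>' 0 x" "\<And>x. x \<in> {-L..L} \<Longrightarrow> u 0 x = u' 0 x"
    and t: "t \<in> {0..T}" and x: "x \<in> {-L..L}"
  shows "\<eta> t x = \<eta>' t x \<and> u t x = u' t x"
proof -
  obtain K where KL: "flux_Lipschitz a M K" using flux_Lipschitz_exists[OF M] by blast
  note K = flux_LipschitzD[OF KL]
  have H: "H1_continuous L T \<eta>" "H1_continuous L T \<eta>'" "H1_continuous L T u" "H1_continuous L T u'"
    using w w' by (auto simp: weak_solution_def)
  define e1 where "e1 = (\<lambda>t x. \<eta> t x - \<eta>' t x)"
  define e2 where "e2 = (\<lambda>t x. u t x - u' t x)"
  have He: "H1_continuous L T e1" "H1_continuous L T e2"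
    unfolding e1_def e2_def using H by (auto intro: H1_continuous_diff)
  define E where "E = (\<lambda>t. H1_norm L (e1 t) + H1_norm L (e2 t))"
  have cE: "continuous_on {0..T} E" unfolding E_def by (intro continuous_intros H1_continuous_norms He)
  have E0: "0 \<le> E t" for t by (simp add: E_def)
  have iE: "integral {0..t} E \<ge> 0" for t
    by (cases "E integrable_on {0..t}") (auto intro!: integral_nonneg E0 simp: not_integrable_integral)
  have b1: "H1_norm L (e1 t) \<le> (K * integral {0..t} E) / min 1 b" if t: "t \<in> {0..T}" for t
  proof (rule le_of_square_le)
    interpret psd_form "{f. pw L f}" "A_form L b" by (rule A_form_psd) (use b in simp)
    have m: "\<eta> t \<in> S" "\<eta>' t \<in> S" using w w' t by (auto simp: weak_solution_def)
    have eS: "e1 t \<in> S" unfolding e1_def by (rule fun_subspace_diff[OF Sh_subspace[OF L] m])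
    have epw: "pw L (e1 t)" by (rule S_pw[OF eS])
    have sub: "{0..t} \<subseteq> {0..T}" using t by auto
    have "A_form L b (\<eta> 0) (e1 t) = A_form L b (\<eta>' 0) (e1 t)" by (rule A_form_cong) (use init in auto)
    then have "A_form L b (e1 t) (e1 t) = integral {0..t} (\<lambda>s. F1 a M (\<eta> s) (u s) (e1 t)) - integral {0..t} (\<lambda>s. F1 a M (\<eta>' s) (u' s) (e1 t))"
    proof -
      have "A_form L b (e1 t) (e1 t) = A_form L b (\<eta> t) (e1 t) - A_form L b (\<eta>' t) (e1 t)"
        using diff_left[of "\<eta> t" "\<eta>' t" "e1 t"] S_pw m epw by (simp add: e1_def)
      moreover have "A_form L b (\<eta> t) (e1 t) = A_form L b (\<eta> 0) (e1 t) + integral {0..t} (\<lambda>s. F1 a M (\<eta> s) (u s) (e1 t))"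
        "A_form L b (\<eta>' t) (e1 t) = A_form L b (\<eta>' 0) (e1 t) + integral {0..t} (\<lambda>s. F1 a M (\<eta>' s) (u' s) (e1 t))"
        using w w' t eS unfolding weak_solution_def by blast+
      ultimately show ?thesis using \<open>A_form L b (\<eta> 0) (e1 t) = _\<close> by linarith
    qed
    also have "\<dots> = integral {0..t} (\<lambda>s. F1 a M (\<eta> s) (u s) (e1 t) - F1 a M (\<eta>' s) (u' s) (e1 t))"
      using H epw by (intro integral_diff[symmetric] integrable_continuous_interval continuous_on_subset[OF F_continuous(1)[OF M] sub])
    also have "\<dots> \<le> norm \<dots>" by simp
    also have "\<dots> \<le> integral {0..t} (\<lambda>s. (K * H1_norm L (e1 t)) * E s)"
    proof (rule integral_norm_bound_integral)
      show "(\<lambda>s. F1 a M (\<eta> s) (u s) (e1 t) - F1 a M (\<eta>' s) (u' s) (e1 t)) integrable_on {0..t}"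
        using H epw by (intro integrable_continuous_interval continuous_on_diff continuous_on_subset[OF F_continuous(1)[OF M] sub])
      show "(\<lambda>s. (K * H1_norm L (e1 t)) * E s) integrable_on {0..t}"
        by (intro integrable_continuous_interval continuous_intros continuous_on_subset[OF cE sub])
      fix s assume "s \<in> {0..t}"
      then have "s \<in> {0..T}" using sub by blast
      then show "norm (F1 a M (\<eta> s) (u s) (e1 t) - F1 a M (\<eta>' s) (u' s) (e1 t)) \<le> K * H1_norm L (e1 t) * E s"
        using K(2)[OF H1_continuous_pw[OF H(1)] H1_continuous_pw[OF H(3)] H1_continuous_pw[OF H(2)] H1_continuous_pw[OF H(4)] epw]
        by (simp add: E_def e1_def e2_def mult_ac)
    qed
    finally have "A_form L b (e1 t) (e1 t) \<le> K * integral {0..t} E * H1_norm L (e1 t)" by (simp add: mult_ac)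
    then show "min 1 b * (H1_norm L (e1 t))\<^sup>2 \<le> K * integral {0..t} E * H1_norm L (e1 t)"
      using A_form_H1(1)[OF b, of L "e1 t"] by simp
  qed (use b K(1) iE in auto)
  have b2: "H1_norm L (e2 t) \<le> (K * integral {0..t} E) / min 1 d" if t: "t \<in> {0..T}" for t
  proof (rule le_of_square_le)
    interpret psd_form "{f. pw L f}" "A_form L d" by (rule A_form_psd) (use d in simp)
    have m: "u t \<in> S0" "u' t \<in> S0" using w w' t by (auto simp: weak_solution_def)
    have eS: "e2 t \<in> S0" unfolding e2_def by (rule fun_subspace_diff[OF Sh0_subspace[OF L] m])
    have epw: "pw L (e2 t)" by (rule S0_pw[OF eS])
    have sub: "{0..t} \<subseteq> {0..T}" using t by auto
    have "A_form L d (u 0) (e2 t) = A_form L d (u' 0) (e2 t)" by (rule A_form_cong) (use init in auto)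
    then have "A_form L d (e2 t) (e2 t) = integral {0..t} (\<lambda>s. F2 M (\<eta> s) (u s) (e2 t)) - integral {0..t} (\<lambda>s. F2 M (\<eta>' s) (u' s) (e2 t))"
    proof -
      have "A_form L d (e2 t) (e2 t) = A_form L d (u t) (e2 t) - A_form L d (u' t) (e2 t)"
        using diff_left[of "u t" "u' t" "e2 t"] S0_pw m epw by (simp add: e2_def)
      moreover have "A_form L d (u t) (e2 t) = A_form L d (u 0) (e2 t) + integral {0..t} (\<lambda>s. F2 M (\<eta> s) (u s) (e2 t))"
        "A_form L d (u' t) (e2 t) = A_form L d (u' 0) (e2 t) + integral {0..t} (\<lambda>s. F2 M (\<eta>' s) (u' s) (e2 t))"
        using w w' t eS unfolding weak_solution_def by blast+
      ultimately show ?thesis using \<open>A_form L d (u 0) (e2 t) = _\<close> by linarith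
    qed
    also have "\<dots> = integral {0..t} (\<lambda>s. F2 M (\<eta> s) (u s) (e2 t) - F2 M (\<eta>' s) (u' s) (e2 t))"
      using H epw by (intro integral_diff[symmetric] integrable_continuous_interval continuous_on_subset[OF F_continuous(2)[OF M] sub])
    also have "\<dots> \<le> norm \<dots>" by simp
    also have "\<dots> \<le> integral {0..t} (\<lambda>s. (K * H1_norm L (e2 t)) * E s)"
    proof (rule integral_norm_bound_integral)
      show "(\<lambda>s. F2 M (\<eta> s) (u s) (e2 t) - F2 M (\<eta>' s) (u' s) (e2 t)) integrable_on {0..t}"
        using H epw by (intro integrable_continuous_interval continuous_on_diff continuous_on_subset[OF F_continuous(2)[OF M] sub])
      show "(\<lambda>s. (K * H1_norm L (e2 t)) * E s) integrable_on {0..t}"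
        by (intro integrable_continuous_interval continuous_intros continuous_on_subset[OF cE sub])
      fix s assume "s \<in> {0..t}"
      then have "s \<in> {0..T}" using sub by blast
      then show "norm (F2 M (\<eta> s) (u s) (e2 t) - F2 M (\<eta>' s) (u' s) (e2 t)) \<le> K * H1_norm L (e2 t) * E s"
        using K(3)[OF H1_continuous_pw[OF H(1)] H1_continuous_pw[OF H(3)] H1_continuous_pw[OF H(2)] H1_continuous_pw[OF H(4)] epw]
        by (simp add: E_def e1_def e2_def mult_ac)
    qed
    finally have "A_form L d (e2 t) (e2 t) \<le> K * integral {0..t} E * H1_norm L (e2 t)" by (simp add: mult_ac)
    then show "min 1 d * (H1_norm L (e2 t))\<^sup>2 \<le> K * integral {0..t} E * H1_norm L (e2 t)"
      using A_form_H1(1)[OF d, of L "e2 t"] by simp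
  qed (use d K(1) iE in auto)
  define C where "C = K / min 1 b + K / min 1 d"
  have "E t \<le> C * (0 * T * exp (C * T))"
  proof (rule Gronwall_integral[OF cE _ _ _ t])
    show "0 \<le> C" using K(1) b d by (simp add: C_def)
    fix t assume "t \<in> {0..T}"
    from b1[OF this] b2[OF this] show "E t \<le> C * integral {0..t} (\<lambda>s. E s + 0)"
      by (simp add: E_def C_def distrib_right)
  qed simp
  then have "H1_norm L (e1 t) = 0" "H1_norm L (e2 t) = 0"
    using H1_norm_nonneg[of L "e1 t"] H1_norm_nonneg[of L "e2 t"] by (simp_all add: E_def del: H1_norm_nonneg)
  then show ?thesis
    using Sobolev[OF H1_continuous_pw[OF He(1) t] x L] Sobolev[OF H1_continuous_pw[OF He(2) t] x L]
    by (simp add: e1_def e2_def)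
qed

text \<open>Below the level \<open>M\<close> clamping is the identity. Boundary terms vanish in the
  first equation because \<open>u\<close> and \<open>lap u\<close> are zero at the ends, in the
  second because \<open>\<phi>\<close> is.\<close>

lemma strong_form:
  assumes eta: "\<eta> \<in> S" and u: "u \<in> S0"
    and M: "\<And>x. x \<in> {-L..L} \<Longrightarrow> \<bar>\<eta> x\<bar> \<le> M" "\<And>x. x \<in> {-L..L} \<Longrightarrow> \<bar>u x\<bar> \<le> M"
  shows "\<psi> \<in> S \<Longrightarrow> ip L (deriv (\<lambda>x. u x + \<eta> x * u x + a * lap u x)) \<psi> = - F1 a M \<eta> u \<psi>"
    "\<phi> \<in> S0 \<Longrightarrow> ip L (\<lambda>x. deriv \<eta> x + u x * deriv u x) \<phi> = - F2 M \<eta> u \<phi>"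
proof -
  have pw: "pw L \<eta>" "pw L u" "pw L (lap u)" using S_pw S0_pw eta u lap_spec(1) by auto
  assume psi: "\<psi> \<in> S"
  let ?f = "\<lambda>x. u x + \<eta> x * u x + a * lap u x"
  have f: "pw L ?f" using pw by (intro pw_add pw_mult pw_cmult)
  have bd: "?f L = 0" "?f (-L) = 0" using S0_bd[OF u] S0_bd[OF lap_spec(1)[OF pw(2)]] by auto
  have "ip L (deriv ?f) \<psi> = - ip L ?f (deriv \<psi>)" using ip_parts[OF f S_pw[OF psi]] bd L by simp
  also have "ip L ?f (deriv \<psi>) = F1 a M \<eta> u \<psi>"
    unfolding F1_def by (rule ip_cong) (use M in \<open>auto simp: cl_id\<close>)
  finally show "ip L (deriv ?f) \<psi> = - F1 a M \<eta> u \<psi>" .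
next
  have pw: "pw L \<eta>" "pw L u" using S_pw S0_pw eta u by auto
  assume phi: "\<phi> \<in> S0"
  let ?f = "\<lambda>x. \<eta> x + (1/2) * (u x * u x)"
  have pu: "pw L (\<lambda>x. u x * u x)" by (rule pw_mult[OF pw(2,2)])
  have p: "pc {-L..L} \<phi>" by (rule pw_pc[OF S0_pw[OF phi]])
  have f: "pw L ?f" by (rule pw_add[OF pw(1) pw_cmult[OF pu]])
  obtain S' where S': "finite S'" "\<And>x. x \<in> {-L<..<L} - S' \<Longrightarrow> deriv (\<lambda>x. u x * u x) x = deriv u x * u x + deriv u x * u x"
    using pw_mult_deriv(2)[OF pw(2,2)] by blast
  have "ip L (deriv ?f) \<phi> = ip L (deriv \<eta>) \<phi> + (1/2) * ip L (deriv (\<lambda>x. u x * u x)) \<phi>"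
    by (simp only: ip_deriv_add[OF pw(1) pw_cmult[OF pu] p] ip_deriv_cmult[OF pu p])
  also have "ip L (deriv (\<lambda>x. u x * u x)) \<phi> = ip L (\<lambda>x. 2 * (u x * deriv u x)) \<phi>"
    by (rule ip_cong_finite[OF S'(1)]) (use S'(2) in auto)
  also have "\<dots> = 2 * ip L (\<lambda>x. u x * deriv u x) \<phi>"
    using psd_form.scale_left[OF ip_psd, of "\<lambda>x. u x * deriv u x" L \<phi> 2] pw p by (simp add: pc_mult pw_pc pw_pc_deriv)
  finally have "ip L (\<lambda>x. deriv \<eta> x + u x * deriv u x) \<phi> = ip L (deriv ?f) \<phi>"
    using psd_form.add_left[OF ip_psd, of "deriv \<eta>" L "\<lambda>x. u x * deriv u x" \<phi>] pw p by (simp add: pc_mult pw_pc pw_pc_deriv)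
  also have "\<dots> = - ip L ?f (deriv \<phi>)" using ip_parts[OF f S0_pw[OF phi]] S0_bd[OF phi] L by simp
  also have "ip L ?f (deriv \<phi>) = F2 M \<eta> u \<phi>"
    unfolding F2_def by (rule ip_cong) (use M in \<open>auto simp: cl_id power2_eq_square\<close>)
  finally show "ip L (\<lambda>x. deriv \<eta> x + u x * deriv u x) \<phi> = - F2 M \<eta> u \<phi>" .
qed

text \<open>Continuity in H1 on a compact time interval bounds the solution, so truncation above
  that bound does not touch it. The freedom to raise \<open>M\<close> lets two solutions be compared
  at a common level.\<close>

lemma semidiscrete_imp_weak:
  assumes s: "semidiscrete_solution L N \<mu> r T a b d \<eta>0 u0 \<eta>h uh" and T: "0 < T" and b: "0 < b" and d: "0 < d"
  obtains M0 where "0 \<le> M0" "\<And>M. M0 \<le> M \<Longrightarrow> weak_solution T a b d M \<eta>h uh"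
proof -
  have mem: "\<And>t. t \<in> {0..T} \<Longrightarrow> \<eta>h t \<in> S" "\<And>t. t \<in> {0..T} \<Longrightarrow> uh t \<in> S0"
    and c: "\<And>x. x \<in> {-L..L} \<Longrightarrow> continuous_on {0..T} (\<lambda>t. \<eta>h t x)" "\<And>x. x \<in> {-L..L} \<Longrightarrow> continuous_on {0..T} (\<lambda>t. uh t x)"
    and df: "\<And>x t. x \<in> {-L..L} \<Longrightarrow> t \<in> {0<..T} \<Longrightarrow> (\<lambda>s. \<eta>h s x) differentiable (at t within {0..T})"
      "\<And>x t. x \<in> {-L..L} \<Longrightarrow> t \<in> {0<..T} \<Longrightarrow> (\<lambda>s. uh s x) differentiable (at t within {0..T})"
    and e1: "\<And>t \<psi>. t \<in> {0<..T} \<Longrightarrow> \<psi> \<in> S \<Longrightarrow> A_form L b (dt T \<eta>h t) \<psi>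
        + ip L (deriv (\<lambda>x. uh t x + \<eta>h t x * uh t x + a * lap (uh t) x)) \<psi> = 0"
    and e2: "\<And>t \<phi>. t \<in> {0<..T} \<Longrightarrow> \<phi> \<in> S0 \<Longrightarrow> A_form L d (dt T uh t) \<phi>
        + ip L (\<lambda>x. deriv (\<eta>h t) x + uh t x * deriv (uh t) x) \<phi> = 0"
    using s unfolding semidiscrete_solution_def by blast+
  have H: "H1_continuous L T \<eta>h" "H1_continuous L T uh"
    by (rule pointwise_imp_H1_continuous[OF feS mem(1) c(1)], assumption+)
      (rule pointwise_imp_H1_continuous[OF feS0 mem(2) c(2)])
  obtain M1 where M1: "0 \<le> M1" "\<And>t x. t \<in> {0..T} \<Longrightarrow> x \<in> {-L..L} \<Longrightarrow> \<bar>\<eta>h t x\<bar> \<le> M1"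
    using H1_continuous_bounded[OF H(1) L] by metis
  obtain M2 where M2: "0 \<le> M2" "\<And>t x. t \<in> {0..T} \<Longrightarrow> x \<in> {-L..L} \<Longrightarrow> \<bar>uh t x\<bar> \<le> M2"
    using H1_continuous_bounded[OF H(2) L] by metis
  show ?thesis
  proof (rule that[of "M1 + M2"])
    show "0 \<le> M1 + M2" using M1 M2 by simp
    fix M assume M: "M1 + M2 \<le> M"
    have bd: "\<bar>\<eta>h t x\<bar> \<le> M" "\<bar>uh t x\<bar> \<le> M" if "t \<in> {0..T}" "x \<in> {-L..L}" for t x
      using M1(2)[OF that] M2(2)[OF that] M M1(1) M2(1) by auto
    have A1: "A_form L b (dt T \<eta>h t) \<psi> = F1 a M (\<eta>h t) (uh t) \<psi>" if t: "t \<in> {0<..T}" and p: "\<psi> \<in> S" for t \<psi>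
    proof -
      have t': "t \<in> {0..T}" using t by auto
      show ?thesis using e1[OF t p] strong_form(1)[OF mem(1)[OF t'] mem(2)[OF t'] bd(1)[OF t'] bd(2)[OF t'] p, where a = a] by simp
    qed
    have A2: "A_form L d (dt T uh t) \<phi> = F2 M (\<eta>h t) (uh t) \<phi>" if t: "t \<in> {0<..T}" and p: "\<phi> \<in> S0" for t \<phi>
    proof -
      have t': "t \<in> {0..T}" using t by auto
      show ?thesis using e2[OF t p] strong_form(2)[OF mem(1)[OF t'] mem(2)[OF t'] bd(1)[OF t'] bd(2)[OF t'] p] by simp
    qed
    show "weak_solution T a b d M \<eta>h uh"
      unfolding weak_solution_def
    proof (intro conjI ballI)
      fix t \<psi> assume "t \<in> {0..T}" "\<psi> \<in> S"
      then show "A_form L b (\<eta>h t) \<psi> = A_form L b (\<eta>h 0) \<psi> + integral {0..t} (\<lambda>s. F1 a M (\<eta>h s) (uh s) \<psi>)"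
        using integrated_A_form[OF feS T b S_pw mem(1) _ c(1) df(1), of \<psi> t "\<lambda>s. F1 a M (\<eta>h s) (uh s) \<psi>"] A1 by blast
    next
      fix t \<phi> assume "t \<in> {0..T}" "\<phi> \<in> S0"
      then show "A_form L d (uh t) \<phi> = A_form L d (uh 0) \<phi> + integral {0..t} (\<lambda>s. F2 M (\<eta>h s) (uh s) \<phi>)"
        using integrated_A_form[OF feS0 T d S0_pw mem(2) _ c(2) df(2), of \<phi> t "\<lambda>s. F2 M (\<eta>h s) (uh s) \<phi>"] A2 by blast
    qed (use mem H in auto)
  qed
qed

text \<open>In bases orthonormal for \<open>A_form L b\<close> and \<open>A_form L d\<close> the
  mass matrices are identities, so the Galerkin system is already an explicit differential equation
  for the coefficients.\<close>

lemma weak_exists: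
  assumes T: "0 < T" and b: "0 < b" and d: "0 < d" and M: "0 \<le> M" and z: "z \<in> S" and z0: "z0 \<in> S0"
  obtains \<eta>h uh where "weak_solution T a b d M \<eta>h uh"
    "\<And>x. x \<in> {-L..L} \<Longrightarrow> \<eta>h 0 x = z x" "\<And>x. x \<in> {-L..L} \<Longrightarrow> uh 0 x = z0 x"
    "\<And>x t. t \<in> {0..T} \<Longrightarrow> (\<lambda>s. \<eta>h s x) differentiable (at t within {0..T})"
    "\<And>x t. t \<in> {0..T} \<Longrightarrow> (\<lambda>s. uh s x) differentiable (at t within {0..T})"
    "\<And>t \<psi>. t \<in> {0..T} \<Longrightarrow> \<psi> \<in> S \<Longrightarrow> A_form L b (dt T \<eta>h t) \<psi> = F1 a M (\<eta>h t) (uh t) \<psi>"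
    "\<And>t \<phi>. t \<in> {0..T} \<Longrightarrow> \<phi> \<in> S0 \<Longrightarrow> A_form L d (dt T uh t) \<phi> = F2 M (\<eta>h t) (uh t) \<phi>"
proof -
  obtain n :: nat and \<phi> where phi: "\<And>i. i < n \<Longrightarrow> \<phi> i \<in> S"
    and "\<And>i j. i < n \<Longrightarrow> j < n \<Longrightarrow> A_form L b (\<phi> i) (\<phi> j) = (if i = j then 1 else 0)"
    and exS: "\<And>v x. v \<in> S \<Longrightarrow> x \<in> {-L..L} \<Longrightarrow> v x = (\<Sum>i<n. A_form L b v (\<phi> i) * \<phi> i x)"
    using fe_orthonormal_basis[OF feS L b] by blast
  obtain k :: nat and \<omega> where om: "\<And>i. i < k \<Longrightarrow> \<omega> i \<in> S0"
    and "\<And>i j. i < k \<Longrightarrow> j < k \<Longrightarrow> A_form L d (\<omega> i) (\<omega> j) = (if i = j then 1 else 0)"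
    and exS0: "\<And>v x. v \<in> S0 \<Longrightarrow> x \<in> {-L..L} \<Longrightarrow> v x = (\<Sum>i<k. A_form L d v (\<omega> i) * \<omega> i x)"
    using fe_orthonormal_basis[OF feS0 L d] by blast
  have ppw: "\<And>i. i < n \<Longrightarrow> pw L (\<phi> i)" and opw: "\<And>i. i < k \<Longrightarrow> pw L (\<omega> i)" using phi om S_pw S0_pw by auto
  define H where "H = (\<lambda>y x. \<Sum>i<n. y i * \<phi> i x)"
  define U where "U = (\<lambda>y x. \<Sum>j<k. y (n + j) * \<omega> j x)"
  have HS: "H y \<in> S" for y unfolding H_def by (rule fun_subspace_sum[OF Sh_subspace[OF L]]) (use phi in auto)
  have US: "U y \<in> S0" for y unfolding U_def by (rule fun_subspace_sum[OF Sh0_subspace[OF L]]) (use om in auto)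
  \<comment> \<open>Components below \<open>n\<close> belong to the \<eta> part, those from
    \<open>n\<close> up to \<open>n + k - 1\<close> to the u part.\<close>
  define G where "G = (\<lambda>i y. if i < n then F1 a M (H y) (U y) (\<phi> i) else F2 M (H y) (U y) (\<omega> (i - n)))"
  obtain K where KL: "flux_Lipschitz a M K" using flux_Lipschitz_exists[OF M] by blast
  note K = flux_LipschitzD[OF KL]
  define B where "B = (\<Sum>i<n. H1_norm L (\<phi> i)) + (\<Sum>j<k. H1_norm L (\<omega> j))"
  have sB: "0 \<le> (\<Sum>i<n. H1_norm L (\<phi> i))" "0 \<le> (\<Sum>j<k. H1_norm L (\<omega> j))" by (auto intro: sum_nonneg)
  have B: "0 \<le> B" "\<And>i. i < n \<Longrightarrow> H1_norm L (\<phi> i) \<le> B" "\<And>i. i < k \<Longrightarrow> H1_norm L (\<omega> i) \<le> B"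
  proof -
    show "0 \<le> B" using sB by (simp add: B_def)
    show "H1_norm L (\<phi> i) \<le> B" if "i < n" for i
      using member_le_sum[of i "{..<n}" "\<lambda>i. H1_norm L (\<phi> i)"] that sB by (simp add: B_def)
    show "H1_norm L (\<omega> i) \<le> B" if "i < k" for i
      using member_le_sum[of i "{..<k}" "\<lambda>i. H1_norm L (\<omega> i)"] that sB by (simp add: B_def)
  qed
  have lip: "\<bar>G i y - G i w\<bar> \<le> (K * B * B) * (\<Sum>j<n+k. \<bar>y j - w j\<bar>)" if i: "i < n + k" for i y w
  proof -
    define D where "D = (\<Sum>j<n+k. \<bar>y j - w j\<bar>)"
    have D: "\<bar>y j - w j\<bar> \<le> D" if "j < n + k" for j
      unfolding D_def using that by (intro member_le_sum) auto
    have "H1_norm L (\<lambda>x. H y x - H w x) = H1_norm L (\<lambda>x. \<Sum>i<n. (y i - w i) * \<phi> i x)"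
      by (simp add: H_def sum_subtractf left_diff_distrib)
    also have "\<dots> \<le> (\<Sum>i<n. \<bar>y i - w i\<bar> * H1_norm L (\<phi> i))" by (rule H1_sum) (use ppw in auto)
    also have "\<dots> \<le> (\<Sum>i<n. D * H1_norm L (\<phi> i))" using D by (intro sum_mono mult_right_mono) auto
    finally have 1: "H1_norm L (\<lambda>x. H y x - H w x) \<le> D * (\<Sum>i<n. H1_norm L (\<phi> i))" by (simp add: sum_distrib_left)
    have "H1_norm L (\<lambda>x. U y x - U w x) = H1_norm L (\<lambda>x. \<Sum>j<k. (y (n + j) - w (n + j)) * \<omega> j x)"
      by (simp add: U_def sum_subtractf left_diff_distrib)
    also have "\<dots> \<le> (\<Sum>j<k. \<bar>y (n + j) - w (n + j)\<bar> * H1_norm L (\<omega> j))" by (rule H1_sum) (use opw in auto)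
    also have "\<dots> \<le> (\<Sum>j<k. D * H1_norm L (\<omega> j))" using D by (intro sum_mono mult_right_mono) auto
    finally have 2: "H1_norm L (\<lambda>x. U y x - U w x) \<le> D * (\<Sum>j<k. H1_norm L (\<omega> j))" by (simp add: sum_distrib_left)
    have 12: "H1_norm L (\<lambda>x. H y x - H w x) + H1_norm L (\<lambda>x. U y x - U w x) \<le> D * B"
      using 1 2 by (simp add: B_def distrib_left)
    have D0: "0 \<le> D" unfolding D_def by (intro sum_nonneg) auto
    have "\<bar>G i y - G i w\<bar> \<le> K * (H1_norm L (\<lambda>x. H y x - H w x) + H1_norm L (\<lambda>x. U y x - U w x)) * B"
    proof (cases "i < n")
      case True
      have "\<bar>G i y - G i w\<bar> \<le> K * (H1_norm L (\<lambda>x. H y x - H w x) + H1_norm L (\<lambda>x. U y x - U w x)) * H1_norm L (\<phi> i)"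
        using K(2)[OF S_pw[OF HS] S0_pw[OF US] S_pw[OF HS] S0_pw[OF US] ppw[OF True]] True by (simp add: G_def)
      also have "\<dots> \<le> K * (H1_norm L (\<lambda>x. H y x - H w x) + H1_norm L (\<lambda>x. U y x - U w x)) * B"
        using B(2)[OF True] K(1) by (intro mult_left_mono) auto
      finally show ?thesis .
    next
      case False
      then have ik: "i - n < k" using i by simp
      have "\<bar>G i y - G i w\<bar> \<le> K * (H1_norm L (\<lambda>x. H y x - H w x) + H1_norm L (\<lambda>x. U y x - U w x)) * H1_norm L (\<omega> (i - n))"
        using K(3)[OF S_pw[OF HS] S0_pw[OF US] S_pw[OF HS] S0_pw[OF US] opw[OF ik]] False by (simp add: G_def)
      also have "\<dots> \<le> K * (H1_norm L (\<lambda>x. H y x - H w x) + H1_norm L (\<lambda>x. U y x - U w x)) * B"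
        using B(3)[OF ik] K(1) by (intro mult_left_mono) auto
      finally show ?thesis .
    qed
    also have "\<dots> \<le> K * (D * B) * B" using 12 K(1) B(1) by (intro mult_right_mono mult_left_mono) auto
    finally show ?thesis by (simp add: D_def mult_ac)
  qed
  have KB: "0 \<le> K * B * B" using K B by simp
  define y0 where "y0 = (\<lambda>i. if i < n then A_form L b z (\<phi> i) else A_form L d z0 (\<omega> (i - n)))"
  obtain y where y0: "\<And>i. i < n + k \<Longrightarrow> y 0 i = y0 i"
    and y: "\<And>i t. i < n + k \<Longrightarrow> t \<in> {0..T} \<Longrightarrow> ((\<lambda>t. y t i) has_real_derivative G i (y t)) (at t within {0..T})"
    using Picard_global[where G = G and n = "n + k" and ?y0.0 = y0, OF T KB lip] by blast
  define \<eta>h where "\<eta>h = (\<lambda>t. H (y t))"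
  define uh where "uh = (\<lambda>t. U (y t))"
  have d1: "((\<lambda>s. \<eta>h s x) has_real_derivative (\<Sum>i<n. F1 a M (\<eta>h t) (uh t) (\<phi> i) * \<phi> i x)) (at t within {0..T})"
    if "t \<in> {0..T}" for t x
  proof -
    have "((\<lambda>s. \<eta>h s x) has_real_derivative (\<Sum>i<n. G i (y t) * \<phi> i x)) (at t within {0..T})"
      unfolding \<eta>h_def H_def by (intro DERIV_sum DERIV_cmult_right y that) simp
    then show ?thesis by (simp add: G_def \<eta>h_def uh_def)
  qed
  have d2: "((\<lambda>s. uh s x) has_real_derivative (\<Sum>j<k. F2 M (\<eta>h t) (uh t) (\<omega> j) * \<omega> j x)) (at t within {0..T})"
    if "t \<in> {0..T}" for t x
  proof -
    have "((\<lambda>s. uh s x) has_real_derivative (\<Sum>j<k. G (n + j) (y t) * \<omega> j x)) (at t within {0..T})"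
      unfolding uh_def U_def by (intro DERIV_sum DERIV_cmult_right y that) simp
    then show ?thesis by (simp add: G_def \<eta>h_def uh_def)
  qed
  have mem: "\<eta>h t \<in> S" "uh t \<in> S0" for t unfolding \<eta>h_def uh_def by (rule HS US)+
  have pw: "pw L (\<eta>h t)" "pw L (uh t)" for t using mem S_pw S0_pw by auto
  have dt1: "dt T \<eta>h t x = (\<Sum>i<n. F1 a M (\<eta>h t) (uh t) (\<phi> i) * \<phi> i x)" if "t \<in> {0..T}" for t x
    unfolding dt_def using d1[OF that, of x] T that
    by (intro vector_derivative_within_closed_interval) (auto simp: has_real_derivative_iff_has_vector_derivative)
  have dt2: "dt T uh t x = (\<Sum>j<k. F2 M (\<eta>h t) (uh t) (\<omega> j) * \<omega> j x)" if "t \<in> {0..T}" for t x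
    unfolding dt_def using d2[OF that, of x] T that
    by (intro vector_derivative_within_closed_interval) (auto simp: has_real_derivative_iff_has_vector_derivative)
  have A1: "A_form L b (dt T \<eta>h t) \<psi> = F1 a M (\<eta>h t) (uh t) \<psi>" if t: "t \<in> {0..T}" and p: "\<psi> \<in> S" for t \<psi>
  proof -
    interpret psd_form "{f. pw L f}" "A_form L b" by (rule A_form_psd) (use b in simp)
    have "A_form L b (dt T \<eta>h t) \<psi> = A_form L b (\<lambda>x. \<Sum>i<n. F1 a M (\<eta>h t) (uh t) (\<phi> i) * \<phi> i x) \<psi>"
      by (rule A_form_cong) (use dt1[OF t] in auto)
    also have "\<dots> = (\<Sum>i<n. F1 a M (\<eta>h t) (uh t) (\<phi> i) * A_form L b (\<phi> i) \<psi>)"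
      by (rule sum_left) (use ppw S_pw[OF p] in auto)
    also have "\<dots> = (\<Sum>i<n. A_form L b \<psi> (\<phi> i) * F1 a M (\<eta>h t) (uh t) (\<phi> i))"
      by (simp add: A_form_commute[of L b \<psi>] mult.commute)
    also have "\<dots> = F1 a M (\<eta>h t) (uh t) (\<lambda>x. \<Sum>i<n. A_form L b \<psi> (\<phi> i) * \<phi> i x)"
      by (rule F_linear(1)[symmetric]) (use pw ppw in auto)
    also have "\<dots> = F1 a M (\<eta>h t) (uh t) \<psi>" by (rule F_cong(1)) (use exS[OF p] in metis)
    finally show ?thesis .
  qed
  have A2: "A_form L d (dt T uh t) \<psi> = F2 M (\<eta>h t) (uh t) \<psi>" if t: "t \<in> {0..T}" and p: "\<psi> \<in> S0" for t \<psi>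
  proof -
    interpret psd_form "{f. pw L f}" "A_form L d" by (rule A_form_psd) (use d in simp)
    have "A_form L d (dt T uh t) \<psi> = A_form L d (\<lambda>x. \<Sum>i<k. F2 M (\<eta>h t) (uh t) (\<omega> i) * \<omega> i x) \<psi>"
      by (rule A_form_cong) (use dt2[OF t] in auto)
    also have "\<dots> = (\<Sum>i<k. F2 M (\<eta>h t) (uh t) (\<omega> i) * A_form L d (\<omega> i) \<psi>)"
      by (rule sum_left) (use opw S0_pw[OF p] in auto)
    also have "\<dots> = (\<Sum>i<k. A_form L d \<psi> (\<omega> i) * F2 M (\<eta>h t) (uh t) (\<omega> i))"
      by (simp add: A_form_commute[of L d \<psi>] mult.commute)
    also have "\<dots> = F2 M (\<eta>h t) (uh t) (\<lambda>x. \<Sum>i<k. A_form L d \<psi> (\<omega> i) * \<omega> i x)"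
      by (rule F_linear(2)[symmetric]) (use pw opw in auto)
    also have "\<dots> = F2 M (\<eta>h t) (uh t) \<psi>" by (rule F_cong(2)) (use exS0[OF p] in metis)
    finally show ?thesis .
  qed
  have c: "continuous_on {0..T} (\<lambda>t. \<eta>h t x)" "continuous_on {0..T} (\<lambda>t. uh t x)" for x
    using DERIV_continuous_on[OF d1] DERIV_continuous_on[OF d2] by auto
  have df: "(\<lambda>s. \<eta>h s x) differentiable (at t within {0..T})" "(\<lambda>s. uh s x) differentiable (at t within {0..T})"
    if "t \<in> {0..T}" for t x
    using d1[OF that] d2[OF that] unfolding real_differentiable_def by blast+
  have "weak_solution T a b d M \<eta>h uh"
    unfolding weak_solution_def
  proof (intro conjI ballI)
    fix t \<psi> assume "t \<in> {0..T}" "\<psi> \<in> S"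
    then show "A_form L b (\<eta>h t) \<psi> = A_form L b (\<eta>h 0) \<psi> + integral {0..t} (\<lambda>s. F1 a M (\<eta>h s) (uh s) \<psi>)"
      by (intro integrated_A_form[OF feS T b S_pw mem(1) _ c(1)] df A1) auto
  next
    fix t \<phi> assume "t \<in> {0..T}" "\<phi> \<in> S0"
    then show "A_form L d (uh t) \<phi> = A_form L d (uh 0) \<phi> + integral {0..t} (\<lambda>s. F2 M (\<eta>h s) (uh s) \<phi>)"
      by (intro integrated_A_form[OF feS0 T d S0_pw mem(2) _ c(2)] df A2) auto
  next
    show "H1_continuous L T \<eta>h" by (rule pointwise_imp_H1_continuous[OF feS mem(1) c(1)])
    show "H1_continuous L T uh" by (rule pointwise_imp_H1_continuous[OF feS0 mem(2) c(2)])
  qed (use mem in auto)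
  moreover have "\<eta>h 0 x = z x" if "x \<in> {-L..L}" for x
  proof -
    have "\<eta>h 0 x = (\<Sum>i<n. A_form L b z (\<phi> i) * \<phi> i x)" by (simp add: \<eta>h_def H_def y0 y0_def)
    then show ?thesis using exS[OF z that] by simp
  qed
  moreover have "uh 0 x = z0 x" if "x \<in> {-L..L}" for x
  proof -
    have "uh 0 x = (\<Sum>i<k. A_form L d z0 (\<omega> i) * \<omega> i x)" by (simp add: uh_def U_def y0 y0_def)
    then show ?thesis using exS0[OF z0 that] by simp
  qed
  ultimately show ?thesis using that df A1 A2 by blast
qed

end


section \<open>The exact solution\<close>

text \<open>The limit in time is uniform in \<open>x\<close>; combined with continuity in
  \<open>x\<close> at the limiting time this is an epsilon/2 argument. Compactness of the space-time
  rectangle then provides the bounds for the exact solution.\<close>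

lemma continuous_in_C_joint:
  assumes c: "continuous_in_C L T k f" and f: "\<And>t. t \<in> {0..T} \<Longrightarrow> f t \<in> C_space L k" and j: "j \<le> k"
  shows "continuous_on ({0..T} \<times> {-L..L}) (\<lambda>(t, x). (dx L ^^ j) (f t) x)"
proof -
  define g where "g = (\<lambda>t. (dx L ^^ j) (f t))"
  have "\<exists>\<delta>>0. \<forall>p'\<in>{0..T} \<times> {-L..L}. dist p' p < \<delta> \<longrightarrow> dist (g (fst p') (snd p')) (g (fst p) (snd p)) < e"
    if p: "p \<in> {0..T} \<times> {-L..L}" and e: "0 < e" for p e
  proof -
    obtain t x where px: "p = (t, x)" "t \<in> {0..T}" "x \<in> {-L..L}" using p by auto
    have "uniform_limit {-L..L} g (g t) (at t within {0..T})"
      using c px(2) j unfolding continuous_in_C_def g_def by blast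
    then have "\<forall>\<^sub>F s in at t within {0..T}. \<forall>y\<in>{-L..L}. dist (g s y) (g t y) < e / 2"
      unfolding uniform_limit_iff using half_gt_zero[OF e] by blast
    then obtain d1 where d1: "0 < d1" "\<And>s y. s \<in> {0..T} \<Longrightarrow> s \<noteq> t \<Longrightarrow> dist s t < d1 \<Longrightarrow> y \<in> {-L..L} \<Longrightarrow> dist (g s y) (g t y) < e / 2"
      unfolding eventually_at by blast
    have "continuous_on {-L..L} (g t)" unfolding g_def by (rule C_space_cont[OF f[OF px(2)] j])
    then obtain d2 where d2: "0 < d2" "\<And>y. y \<in> {-L..L} \<Longrightarrow> dist y x < d2 \<Longrightarrow> dist (g t y) (g t x) < e / 2"
      using px(3) e unfolding continuous_on_iff by (metis half_gt_zero)
    show ?thesis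
    proof (intro exI[of _ "min d1 d2"] conjI ballI impI)
      fix p' assume p': "p' \<in> {0..T} \<times> {-L..L}" "dist p' p < min d1 d2"
      obtain s y where sy: "p' = (s, y)" "s \<in> {0..T}" "y \<in> {-L..L}" using p'(1) by auto
      have ds: "dist s t < d1" "dist y x < d2"
        using p'(2) dist_fst_le[of p' p] dist_snd_le[of p' p] by (auto simp: sy px)
      have "dist (g s y) (g t y) < e / 2" using d1(2)[OF sy(2) _ ds(1) sy(3)] e by (cases "s = t") auto
      moreover have "dist (g t y) (g t x) < e / 2" by (rule d2(2)[OF sy(3) ds(2)])
      ultimately show "dist (g (fst p') (snd p')) (g (fst p) (snd p)) < e"
        using dist_triangle_half_l[of "g s y" "g t y" e "g t x"] by (simp add: sy px dist_commute)
    qed (use d1 d2 in simp)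
  qed
  then show ?thesis unfolding continuous_on_iff g_def[symmetric] by (simp add: case_prod_beta)
qed

lemma joint_section:
  fixes g :: "real \<Rightarrow> real \<Rightarrow> real"
  assumes "continuous_on ({0..T} \<times> A) (\<lambda>(t, x). g t x)"
  shows "t \<in> {0..T} \<Longrightarrow> continuous_on A (g t)" "x \<in> A \<Longrightarrow> continuous_on {0..T} (\<lambda>t. g t x)"
proof -
  show "continuous_on A (g t)" if "t \<in> {0..T}"
  proof -
    have "Pair t ` A \<subseteq> {0..T} \<times> A" using that by auto
    then show ?thesis
    using continuous_on_compose2[OF assms, of A "\<lambda>x. (t, x)"] continuous_on_Pair[OF continuous_on_const continuous_on_id, of A t]
      by auto
  qed
  show "continuous_on {0..T} (\<lambda>t. g t x)" if "x \<in> A"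
    using continuous_on_compose2[OF assms, of "{0..T}" "\<lambda>t. (t, x)"] that continuous_on_Pair[OF continuous_on_id continuous_on_const, of "{0..T}" x]
    by auto
qed

lemma joint_bounded:
  fixes g :: "real \<Rightarrow> real \<Rightarrow> real"
  assumes "continuous_on ({0..T} \<times> {-L..L}) (\<lambda>(t, x). g t x)"
  obtains B where "0 \<le> B" "\<And>t x. t \<in> {0..T} \<Longrightarrow> x \<in> {-L..L} \<Longrightarrow> \<bar>g t x\<bar> \<le> B"
proof -
  have "bounded ((\<lambda>(t, x). g t x) ` ({0..T} \<times> {-L..L}))"
    by (intro compact_imp_bounded compact_continuous_image assms compact_Times) auto
  then obtain B where B: "\<forall>y\<in>(\<lambda>(t, x). g t x) ` ({0..T} \<times> {-L..L}). norm y \<le> B" by (auto simp: bounded_iff)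
  have "\<bar>g t x\<bar> \<le> max B 0" if "t \<in> {0..T}" "x \<in> {-L..L}" for t x
  proof -
    have "norm (g t x) \<le> B" using B that by force
    then show ?thesis by simp
  qed
  then show ?thesis using that[of "max B 0"] by simp
qed

lemma Hs_norm_bounded_in_time:
  assumes c: "continuous_in_C L T k f" and f: "\<And>t. t \<in> {0..T} \<Longrightarrow> f t \<in> C_space L k" and l: "l \<le> k" and L: "0 < L"
  obtains B where "0 \<le> B" "\<And>t. t \<in> {0..T} \<Longrightarrow> Hs_norm L l (f t) \<le> B"
proof -
  have "\<exists>B\<ge>0. \<forall>t\<in>{0..T}. \<forall>x\<in>{-L..L}. \<bar>(dx L ^^ j) (f t) x\<bar> \<le> B" if "j \<le> k" for j
    using joint_bounded[OF continuous_in_C_joint[OF c f that]] by metis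
  then obtain B where B: "\<And>j. j \<le> k \<Longrightarrow> 0 \<le> B j" "\<And>j t x. j \<le> k \<Longrightarrow> t \<in> {0..T} \<Longrightarrow> x \<in> {-L..L} \<Longrightarrow> \<bar>(dx L ^^ j) (f t) x\<bar> \<le> B j"
    by metis
  show ?thesis
  proof (rule that[of "\<Sum>j\<le>l. B j * sqrt (2 * L)"])
    show "0 \<le> (\<Sum>j\<le>l. B j * sqrt (2 * L))" using B(1) l L by (intro sum_nonneg) auto
    fix t assume t: "t \<in> {0..T}"
    show "Hs_norm L l (f t) \<le> (\<Sum>j\<le>l. B j * sqrt (2 * L))"
      unfolding Hs_norm_def
    proof (intro sum_mono L2_le_sup pc_continuous)
      fix j assume "j \<in> {..l}"
      then have j: "j \<le> k" using l by simp
      show "continuous_on {-L..L} ((dx L ^^ j) (f t))" by (rule C_space_cont[OF f[OF t] j])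
      show "\<And>x. x \<in> {-L..L} \<Longrightarrow> \<bar>(dx L ^^ j) (f t) x\<bar> \<le> B j" "0 \<le> B j" using B t j by auto
    qed (use L in auto)
  qed
qed

lemma continuous_in_C_H1:
  assumes c: "continuous_in_C L T (Suc k) f" and f: "\<And>t. t \<in> {0..T} \<Longrightarrow> f t \<in> C_space L (Suc k)" and L: "0 < L"
  shows "H1_continuous L T f"
  unfolding H1_continuous_def
proof (intro ballI conjI)
  fix t assume t: "t \<in> {0..T}"
  have pw: "pw L (f s)" if "s \<in> {0..T}" for s by (rule C1_pw(1)[OF L f[OF that]])
  show "pw L (f t)" by (rule pw[OF t])
  show "((\<lambda>s. H1_norm L (\<lambda>x. f s x - f t x)) \<longlongrightarrow> 0) (at t within {0..T})"
  proof (rule tendstoI)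
    fix e :: real assume e: "0 < e"
    \<comment> \<open>The function and its derivative contribute at most \<open>e / 3\<close> each,
      which leaves room for the strict inequality.\<close>
    define \<epsilon> where "\<epsilon> = e / (3 * sqrt (2 * L))"
    have ep: "0 < \<epsilon>" using e L by (simp add: \<epsilon>_def)
    have u: "\<forall>\<^sub>F s in at t within {0..T}. \<forall>x\<in>{-L..L}. dist ((dx L ^^ j) (f s) x) ((dx L ^^ j) (f t) x) < \<epsilon>" if "j \<le> Suc k" for j
      using c t that ep unfolding continuous_in_C_def uniform_limit_iff by blast
    have "\<forall>\<^sub>F s in at t within {0..T}. s \<in> {0..T}" by (auto simp: eventually_at_filter)
    moreover have "\<forall>\<^sub>F s in at t within {0..T}. \<forall>x\<in>{-L..L}. dist (f s x) (f t x) < \<epsilon>" using u[of 0] by simp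
    moreover have "\<forall>\<^sub>F s in at t within {0..T}. \<forall>x\<in>{-L..L}. dist (dx L (f s) x) (dx L (f t) x) < \<epsilon>" using u[of 1] by simp
    ultimately show "\<forall>\<^sub>F s in at t within {0..T}. dist (H1_norm L (\<lambda>x. f s x - f t x)) 0 < e"
    proof eventually_elim
      case (elim s)
      have pd: "pw L (\<lambda>x. f s x - f t x)" by (rule pw_diff[OF pw[OF elim(1)] pw[OF t]])
      have "L2_norm L (\<lambda>x. f s x - f t x) \<le> \<epsilon> * sqrt (2 * L)"
        using elim(2) ep L by (intro L2_le_sup pw_pc[OF pd]) (auto simp: dist_real_def less_imp_le)
      moreover have "L2_norm L (deriv (\<lambda>x. f s x - f t x)) \<le> \<epsilon> * sqrt (2 * L)"
      proof -
        have "L2_norm L (deriv (\<lambda>x. f s x - f t x)) = L2_norm L (\<lambda>x. dx L (f s) x - dx L (f t) x)"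
          
        proof (rule L2_norm_cong)
          fix x assume x: "x \<in> {-L<..<L}"
          show "deriv (\<lambda>x. f s x - f t x) x = dx L (f s) x - dx L (f t) x"
            by (intro DERIV_imp_deriv DERIV_diff C_space_DERIV[OF L f x] elim(1) t)
        qed
        also have "\<dots> \<le> \<epsilon> * sqrt (2 * L)"
        proof (rule L2_le_sup)
          show "pc {-L..L} (\<lambda>x. dx L (f s) x - dx L (f t) x)"
            using C_space_cont[OF f[OF elim(1)], of 1] C_space_cont[OF f[OF t], of 1]
            by (intro pc_diff pc_continuous) simp_all
          show "\<bar>dx L (f s) x - dx L (f t) x\<bar> \<le> \<epsilon>" if "x \<in> {-L..L}" for x
            using elim(3) that by (fastforce simp: dist_real_def)
        qed (use ep L in auto)
        finally show ?thesis .
      qed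
      ultimately have "H1_norm L (\<lambda>x. f s x - f t x) \<le> 2 * (\<epsilon> * sqrt (2 * L))"
        using H1_le_add[of L "\<lambda>x. f s x - f t x"] by simp
      also have "\<dots> < e" using e L by (simp add: \<epsilon>_def field_simps)
      finally show ?case by simp
    qed
  qed
qed

text \<open>Continuity on the compact rectangle is uniform, so \<open>g s\<close> tends to
  \<open>g t\<close> uniformly and hence in L2.\<close>

lemma ip_continuous_in_time:
  fixes g :: "real \<Rightarrow> real \<Rightarrow> real"
  assumes g: "continuous_on ({0..T} \<times> {-L..L}) (\<lambda>(t, x). g t x)" and k: "pc {-L..L} k" and L: "0 < L"
  shows "continuous_on {0..T} (\<lambda>s. ip L (g s) k)"
  unfolding continuous_on_iff
proof (intro ballI allI impI)
  fix t and e :: real assume t: "t \<in> {0..T}" and e: "0 < e"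
  define c where "c = sqrt (2 * L) * L2_norm L k + 1"
  have c: "0 < c" using L by (simp add: c_def add_nonneg_pos)
  have uc: "uniformly_continuous_on ({0..T} \<times> {-L..L}) (\<lambda>(t, x). g t x)"
    by (intro compact_uniformly_continuous g compact_Times) auto
  have "0 < e / c" using e c by simp
  from uc[unfolded uniformly_continuous_on_def, rule_format, OF this] obtain \<delta> where \<delta>: "0 < \<delta>" "\<And>p p'. p \<in> {0..T} \<times> {-L..L} \<Longrightarrow> p' \<in> {0..T} \<times> {-L..L} \<Longrightarrow> dist p' p < \<delta> \<Longrightarrow>
     dist ((\<lambda>(t, x). g t x) p') ((\<lambda>(t, x). g t x) p) < e / c"
    by blast
  have pcg: "pc {-L..L} (g s)" if "s \<in> {0..T}" for s using joint_section(1)[OF g that] by (intro pc_continuous) auto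
  show "\<exists>d>0. \<forall>s\<in>{0..T}. dist s t < d \<longrightarrow> dist (ip L (g s) k) (ip L (g t) k) < e"
  proof (intro exI[of _ \<delta>] conjI ballI impI \<delta>(1))
    fix s assume s: "s \<in> {0..T}" and d: "dist s t < \<delta>"
    have "\<bar>ip L (g s) k - ip L (g t) k\<bar> \<le> L2_norm L (\<lambda>x. g s x - g t x) * L2_norm L k"
      by (rule ip_diff_le[OF pcg[OF s] pcg[OF t] k])
    also have "\<dots> \<le> (e / c * sqrt (2 * L)) * L2_norm L k"
    proof (intro mult_right_mono L2_le_sup pc_diff pcg s t)
      show "\<bar>g s x - g t x\<bar> \<le> e / c" if "x \<in> {-L..L}" for x
        using \<delta>(2)[of "(t, x)" "(s, x)"] that s t d by (simp add: dist_Pair_Pair dist_real_def)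
    qed (use e c L in auto)
    also have "\<dots> = e / c * (sqrt (2 * L) * L2_norm L k)" by simp
    also have "\<dots> < e / c * c" using e c by (intro mult_strict_left_mono) (auto simp: c_def)
    finally show "dist (ip L (g s) k) (ip L (g t) k) < e" using c by (simp add: dist_real_def)
  qed
qed

text \<open>The time derivative is known pointwise in the open rectangle only. It is first
  integrated in time for each \<open>x\<close>, then tested with \<open>\<psi>\<close>, and joint
  continuity of \<open>F\<close> permits the exchange of the two integrals.\<close>

lemma time_integrated:
  fixes f F :: "real \<Rightarrow> real \<Rightarrow> real"
  assumes f: "continuous_on ({0..T} \<times> {-L..L}) (\<lambda>(t, x). f t x)"
    and F: "continuous_on ({0..T} \<times> {-L..L}) (\<lambda>(t, x). F t x)"
    and d: "\<And>t x. t \<in> {0<..<T} \<Longrightarrow> x \<in> {-L<..<L} \<Longrightarrow> ((\<lambda>s. f s x) has_real_derivative F t x) (at t)"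
    and psi: "continuous_on {-L..L} \<psi>" and t: "t \<in> {0..T}"
  shows "ip L (f t) \<psi> = ip L (f 0) \<psi> + integral {0..t} (\<lambda>s. ip L (F s) \<psi>)"
proof -
  have T0: "0 \<in> {0..T}" using t by auto
  have pc: "pc {-L..L} (f s)" "pc {-L..L} (F s)" if "s \<in> {0..T}" for s
    using joint_section(1)[OF f that] joint_section(1)[OF F that] by (auto intro: pc_continuous)
  have pp: "pc {-L..L} \<psi>" using psi by (auto intro: pc_continuous)
  have sub: "{0..t} \<times> {-L..L} \<subseteq> {0..T} \<times> {-L..L}" using t by auto
  have inc: "f t x - f 0 x = integral {0..t} (\<lambda>s. F s x)" if x: "x \<in> {-L<..<L}" for x
  proof -
    have xI: "x \<in> {-L..L}" using x by auto
    have "((\<lambda>s. F s x) has_integral (f t x - f 0 x)) {0..t}"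
    proof (rule fundamental_theorem_of_calculus_interior)
      show "continuous_on {0..t} (\<lambda>s. f s x)" by (rule continuous_on_subset[OF joint_section(2)[OF f xI]]) (use t in auto)
      show "((\<lambda>s. f s x) has_vector_derivative F s x) (at s)" if "s \<in> {0<..<t}" for s
        using d[of s x] that t x by (auto simp: has_real_derivative_iff_has_vector_derivative)
    qed (use t in auto)
    then show ?thesis by (simp add: integral_unique)
  qed
  have cF: "continuous_on (cbox (0, -L) (t, L)) (\<lambda>(s, x). F s x * \<psi> x)"
  proof -
    have "continuous_on ({0..t} \<times> {-L..L}) (\<lambda>p. (\<lambda>(s, x). F s x) p * \<psi> (snd p))"
      by (intro continuous_on_mult continuous_on_subset[OF F sub] continuous_on_compose2[OF psi continuous_on_snd[OF continuous_on_id]]) auto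
    then show ?thesis by (simp add: case_prod_beta cbox_Pair_eq)
  qed
  have "ip L (f t) \<psi> - ip L (f 0) \<psi> = ip L (\<lambda>x. f t x - f 0 x) \<psi>"
    using psd_form.diff_left[OF ip_psd, of "f t" L "f 0" \<psi>] pc[OF t] pc[OF T0] pp by simp
  also have "\<dots> = integral {-L..L} (\<lambda>x. (f t x - f 0 x) * \<psi> x)"
    by (rule ip_eq_integral[OF pc_diff[OF pc(1)[OF t] pc(1)[OF T0]] pp])
  also have "\<dots> = integral {-L..L} (\<lambda>x. integral {0..t} (\<lambda>s. F s x * \<psi> x))"
    by (rule integral_spike[of "{-L, L}"]) (use inc in \<open>auto intro: negligible_finite\<close>)
  also have "\<dots> = integral {0..t} (\<lambda>s. integral {-L..L} (\<lambda>x. F s x * \<psi> x))"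
    using integral_swap_continuous[OF cF] by simp
  also have "\<dots> = integral {0..t} (\<lambda>s. ip L (F s) \<psi>)"
    by (rule integral_cong) (use t in \<open>auto simp: ip_eq_integral[OF pc(2) pp]\<close>)
  finally show ?thesis by simp
qed

section \<open>Time-integrated weak form of the exact solution\<close>

locale exact =
  fixes m :: nat and L T a b d :: real and \<eta>0 u0 :: "real \<Rightarrow> real" and \<eta> u :: "real \<Rightarrow> real \<Rightarrow> real"
  assumes sol: "smooth_solution m L T a b d \<eta>0 u0 \<eta> u" and m2: "2 \<le> m" and L: "0 < L" and T: "0 < T"
begin

lemma eta_C: "t \<in> {0..T} \<Longrightarrow> \<eta> t \<in> C_space L m" and u_C: "t \<in> {0..T} \<Longrightarrow> u t \<in> C_space L (m + 1)"
  and eta_bd: "t \<in> {0..T} \<Longrightarrow> dx L (\<eta> t) (-L) = 0" "t \<in> {0..T} \<Longrightarrow> dx L (\<eta> t) L = 0"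
  and u_bd: "t \<in> {0..T} \<Longrightarrow> u t (-L) = 0" "t \<in> {0..T} \<Longrightarrow> u t L = 0"
  and uxx_bd: "t \<in> {0..T} \<Longrightarrow> (dx L ^^ 2) (u t) (-L) = 0" "t \<in> {0..T} \<Longrightarrow> (dx L ^^ 2) (u t) L = 0"
  and eta_cont: "continuous_in_C L T m \<eta>" and u_cont: "continuous_in_C L T (m + 1) u"
  and init: "x \<in> {-L..L} \<Longrightarrow> \<eta> 0 x = \<eta>0 x" "x \<in> {-L..L} \<Longrightarrow> u 0 x = u0 x"
  using sol unfolding smooth_solution_def C0_space_def C0_tilde_space_def by blast+

lemma eta_joint: "j \<le> m \<Longrightarrow> continuous_on ({0..T} \<times> {-L..L}) (\<lambda>(t, x). (dx L ^^ j) (\<eta> t) x)"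
  and u_joint: "j \<le> m + 1 \<Longrightarrow> continuous_on ({0..T} \<times> {-L..L}) (\<lambda>(t, x). (dx L ^^ j) (u t) x)"
  by (rule continuous_in_C_joint[OF eta_cont eta_C]; assumption) (rule continuous_in_C_joint[OF u_cont u_C]; assumption)

lemmas joint0 = eta_joint[of 0, simplified] u_joint[of 0, simplified]

lemma eta_C1: "t \<in> {0..T} \<Longrightarrow> \<eta> t \<in> C_space L (Suc 0)" and eta_C2: "t \<in> {0..T} \<Longrightarrow> \<eta> t \<in> C_space L 2"
  and u_C1: "t \<in> {0..T} \<Longrightarrow> u t \<in> C_space L (Suc 0)" and u_C2: "t \<in> {0..T} \<Longrightarrow> u t \<in> C_space L 2"
  and uxx_C1: "t \<in> {0..T} \<Longrightarrow> (dx L ^^ 2) (u t) \<in> C_space L (Suc 0)"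
proof -
  assume t: "t \<in> {0..T}"
  show "\<eta> t \<in> C_space L (Suc 0)" "\<eta> t \<in> C_space L 2" using C_space_mono[OF eta_C[OF t]] m2 by auto
  show "u t \<in> C_space L (Suc 0)" "u t \<in> C_space L 2" using C_space_mono[OF u_C[OF t]] m2 by auto
  have "u t \<in> C_space L (Suc 0 + 2)" using C_space_mono[OF u_C[OF t]] m2 by auto
  then show "(dx L ^^ 2) (u t) \<in> C_space L (Suc 0)" by (rule C_space_dx_pow)
qed

lemma pw_eta: "t \<in> {0..T} \<Longrightarrow> pw L (\<eta> t)" and pw_u: "t \<in> {0..T} \<Longrightarrow> pw L (u t)"
  using C1_pw(1)[OF L eta_C1] C1_pw(1)[OF L u_C1] by auto

text \<open>The time derivatives of these two combinations equal expressions in space derivatives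
  that are jointly continuous up to the boundary; the mixed derivatives taken separately are merely
  known to exist.\<close>

lemma equations:
  assumes "t \<in> {0<..<T}" "x \<in> {-L<..<L}"
  shows "((\<lambda>s. \<eta> s x - b * (dx L ^^ 2) (\<eta> s) x) has_real_derivative
      - (dx L (u t) x + (dx L (\<eta> t) x * u t x + dx L (u t) x * \<eta> t x) + a * (dx L ^^ 3) (u t) x)) (at t)"
    "((\<lambda>s. u s x - d * (dx L ^^ 2) (u s) x) has_real_derivative
      - (dx L (\<eta> t) x + u t x * dx L (u t) x)) (at t)"
proof -
  have t: "t \<in> {0..T}" and x: "x \<in> {-L..L}" using assms by auto
  have df: "(\<lambda>s. \<eta> s x) differentiable (at t)" "(\<lambda>s. (dx L ^^ 2) (\<eta> s) x) differentiable (at t)"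
    "(\<lambda>s. u s x) differentiable (at t)" "(\<lambda>s. (dx L ^^ 2) (u s) x) differentiable (at t)"
    and e1: "deriv (\<lambda>s. \<eta> s x) t + dx L (u t) x + dx L (\<lambda>y. \<eta> t y * u t y) x
          + a * (dx L ^^ 3) (u t) x - b * deriv (\<lambda>s. (dx L ^^ 2) (\<eta> s) x) t = 0"
    and e2: "deriv (\<lambda>s. u s x) t + dx L (\<eta> t) x + u t x * dx L (u t) x
          - d * deriv (\<lambda>s. (dx L ^^ 2) (u s) x) t = 0"
    using sol assms unfolding smooth_solution_def by blast+
  have "((\<lambda>y. \<eta> t y * u t y) has_real_derivative dx L (\<eta> t) x * u t x + dx L (u t) x * \<eta> t x) (at x within {-L..L})"
    using eta_C1[OF t] u_C1[OF t] by (intro DERIV_mult dx_works L x) (auto simp: C_space_Suc)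
  then have p: "dx L (\<lambda>y. \<eta> t y * u t y) x = dx L (\<eta> t) x * u t x + dx L (u t) x * \<eta> t x" by (rule dx_eqI[OF L x])
  have "((\<lambda>s. \<eta> s x - b * (dx L ^^ 2) (\<eta> s) x) has_real_derivative
    deriv (\<lambda>s. \<eta> s x) t - b * deriv (\<lambda>s. (dx L ^^ 2) (\<eta> s) x) t) (at t)"
    using df by (intro DERIV_diff DERIV_cmult) (simp_all add: DERIV_deriv_iff_real_differentiable)
  moreover have "deriv (\<lambda>s. \<eta> s x) t - b * deriv (\<lambda>s. (dx L ^^ 2) (\<eta> s) x) t
    = - (dx L (u t) x + (dx L (\<eta> t) x * u t x + dx L (u t) x * \<eta> t x) + a * (dx L ^^ 3) (u t) x)"
    using e1 p by linarith
  ultimately show "((\<lambda>s. \<eta> s x - b * (dx L ^^ 2) (\<eta> s) x) has_real_derivative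
      - (dx L (u t) x + (dx L (\<eta> t) x * u t x + dx L (u t) x * \<eta> t x) + a * (dx L ^^ 3) (u t) x)) (at t)" by simp
  have "((\<lambda>s. u s x - d * (dx L ^^ 2) (u s) x) has_real_derivative
    deriv (\<lambda>s. u s x) t - d * deriv (\<lambda>s. (dx L ^^ 2) (u s) x) t) (at t)"
    using df by (intro DERIV_diff DERIV_cmult) (simp_all add: DERIV_deriv_iff_real_differentiable)
  moreover have "deriv (\<lambda>s. u s x) t - d * deriv (\<lambda>s. (dx L ^^ 2) (u s) x) t = - (dx L (\<eta> t) x + u t x * dx L (u t) x)"
    using e2 by linarith
  ultimately show "((\<lambda>s. u s x - d * (dx L ^^ 2) (u s) x) has_real_derivative
      - (dx L (\<eta> t) x + u t x * dx L (u t) x)) (at t)" by simp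
qed

lemma continuous_on_joint_add:
  assumes "continuous_on A (\<lambda>(t, x). f t x)" "continuous_on A (\<lambda>(t, x). g t x)"
  shows "continuous_on A (\<lambda>(t, x). f t x + g t x :: real)"
  using continuous_on_add[OF assms] by (simp add: case_prod_beta)

lemma continuous_on_joint_mult:
  assumes "continuous_on A (\<lambda>(t, x). f t x)" "continuous_on A (\<lambda>(t, x). g t x)"
  shows "continuous_on A (\<lambda>(t, x). f t x * g t x :: real)"
  using continuous_on_mult[OF assms] by (simp add: case_prod_beta)

lemma continuous_on_joint_cmult:
  assumes "continuous_on A (\<lambda>(t, x). f t x)"
  shows "continuous_on A (\<lambda>(t, x). c * f t x :: real)"
  using continuous_on_mult[OF continuous_on_const assms, of c] by (simp add: case_prod_beta)

lemmas joint_intros = continuous_on_joint_add continuous_on_joint_mult continuous_on_joint_cmult joint0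

text \<open>The exact flux corresponding to \<open>F1\<close>, with u_xx in place of the discrete
  Laplacian and without clamping; \<open>X2\<close> corresponds to \<open>F2\<close>.\<close>

definition X1 :: "real \<Rightarrow> real \<Rightarrow> real" where
  "X1 s x = (u s x + \<eta> s x * u s x) + a * (dx L ^^ 2) (u s) x"

definition X2 :: "real \<Rightarrow> real \<Rightarrow> real" where
  "X2 s x = \<eta> s x + (1/2) * (u s x * u s x)"

lemma X_joint: "continuous_on ({0..T} \<times> {-L..L}) (\<lambda>(t, x). X1 t x)" "continuous_on ({0..T} \<times> {-L..L}) (\<lambda>(t, x). X2 t x)"
  unfolding X1_def X2_def using m2 by (intro joint_intros u_joint; simp)+

lemma X_continuous:
  assumes "pw L \<psi>"
  shows "continuous_on {0..T} (\<lambda>s. ip L (X1 s) (deriv \<psi>))" "continuous_on {0..T} (\<lambda>s. ip L (X2 s) (deriv \<psi>))"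
  by (rule ip_continuous_in_time[OF X_joint(1) pw_pc_deriv[OF assms] L] ip_continuous_in_time[OF X_joint(2) pw_pc_deriv[OF assms] L])+

text \<open>The test function is free at the ends, since the data remove all boundary terms: those
  of \<open>A_form\<close> because \<open>\<eta>\<^sub>x = 0\<close> there, those of the flux
  because \<open>u = u\<^sub>x\<^sub>x = 0\<close>. In \<open>weak_u\<close> it is the test function
  that vanishes instead.\<close>

lemma weak_eta:
  assumes psi: "pw L \<psi>" and t: "t \<in> {0..T}"
  shows "A_form L b (\<eta> t) \<psi> = A_form L b (\<eta> 0) \<psi> + integral {0..t} (\<lambda>s. ip L (X1 s) (deriv \<psi>))"
proof -
  define f where "f = (\<lambda>t x. \<eta> t x + (- b) * (dx L ^^ 2) (\<eta> t) x)"
  define F where "F = (\<lambda>t x. (-1) * ((dx L (u t) x + (dx L (\<eta> t) x * u t x + dx L (u t) x * \<eta> t x)) + a * (dx L ^^ 3) (u t) x))"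
  have d1: "continuous_on ({0..T} \<times> {-L..L}) (\<lambda>(t, x). dx L (u t) x)" "continuous_on ({0..T} \<times> {-L..L}) (\<lambda>(t, x). dx L (\<eta> t) x)"
    using u_joint[of 1] eta_joint[of 1] m2 by simp_all
  have fc: "continuous_on ({0..T} \<times> {-L..L}) (\<lambda>(t, x). f t x)" unfolding f_def
    using m2 by (intro joint_intros eta_joint)
  have Fc: "continuous_on ({0..T} \<times> {-L..L}) (\<lambda>(t, x). F t x)" unfolding F_def
    using m2 by (intro joint_intros u_joint d1) simp
  have A: "A_form L b (\<eta> s) \<psi> = ip L (f s) \<psi>" if s: "s \<in> {0..T}" for s
    using eta_bd[OF s] s joint_section(1)[OF fc s] eta_C2[OF s]
    by (intro weak_form_of_strong[OF L _ _ _ psi]) (auto simp: f_def)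
  have ipF: "ip L (F s) \<psi> = ip L (X1 s) (deriv \<psi>)" if s: "s \<in> {0..T}" for s
  proof -
    let ?g = "\<lambda>x. (u s x + \<eta> s x * u s x) + a * (dx L ^^ 2) (u s) x"
    have g: "?g \<in> C_space L (Suc 0)"
      by (intro C_space_add[OF L] C_space_mult[OF L] C_space_const[OF L] uxx_C1 u_C1 eta_C1 s)
    have dg: "deriv ?g x = - F s x" if x: "x \<in> {-L<..<L}" for x
    proof -
      have "(?g has_real_derivative (dx L (u s) x + (dx L (\<eta> s) x * u s x + dx L (u s) x * \<eta> s x)) + a * dx L ((dx L ^^ 2) (u s)) x) (at x)"
        by (intro DERIV_add DERIV_mult DERIV_cmult C_space_DERIV[OF L uxx_C1 x] C_space_DERIV[OF L u_C1 x] C_space_DERIV[OF L eta_C1 x] s)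
      moreover have "dx L ((dx L ^^ 2) (u s)) x = (dx L ^^ 3) (u s) x" by (simp add: numeral_3_eq_3 numeral_2_eq_2)
      ultimately show ?thesis by (auto simp: F_def dest: DERIV_imp_deriv)
    qed
    have "ip L (deriv ?g) \<psi> = - ip L ?g (deriv \<psi>)"
      using ip_parts[OF C1_pw(1)[OF L g] psi] L u_bd[OF s] uxx_bd[OF s] by simp
    moreover have "ip L (deriv ?g) \<psi> = ip L (\<lambda>x. (-1) * F s x) \<psi>" by (rule ip_cong) (use dg in auto)
    moreover have "\<dots> = - ip L (F s) \<psi>"
      using psd_form.scale_left[OF ip_psd, of "F s" L \<psi> "-1"] joint_section(1)[OF Fc s] pw_pc[OF psi] by (simp add: pc_continuous)
    moreover have "X1 s = ?g" by (simp add: X1_def fun_eq_iff)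
    ultimately show ?thesis by simp
  qed
  have "ip L (f t) \<psi> = ip L (f 0) \<psi> + integral {0..t} (\<lambda>s. ip L (F s) \<psi>)"
  proof (rule time_integrated[OF fc Fc _ pw_cont[OF psi] t])
    fix t x assume "t \<in> {0<..<T}" "x \<in> {-L<..<L}"
    from equations(1)[OF this] show "((\<lambda>s. f s x) has_real_derivative F t x) (at t)" by (simp add: f_def F_def)
  qed
  also have "integral {0..t} (\<lambda>s. ip L (F s) \<psi>) = integral {0..t} (\<lambda>s. ip L (X1 s) (deriv \<psi>))"
    by (rule integral_cong) (use ipF t in auto)
  finally show ?thesis using A[OF t] A[of 0] T by simp
qed

lemma weak_u:
  assumes psi: "pw L \<psi>" "\<psi> (-L) = 0" "\<psi> L = 0" and t: "t \<in> {0..T}"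
  shows "A_form L d (u t) \<psi> = A_form L d (u 0) \<psi> + integral {0..t} (\<lambda>s. ip L (X2 s) (deriv \<psi>))"
proof -
  define f where "f = (\<lambda>t x. u t x + (- d) * (dx L ^^ 2) (u t) x)"
  define F where "F = (\<lambda>t x. (-1) * (dx L (\<eta> t) x + u t x * dx L (u t) x))"
  have d1: "continuous_on ({0..T} \<times> {-L..L}) (\<lambda>(t, x). dx L (u t) x)" "continuous_on ({0..T} \<times> {-L..L}) (\<lambda>(t, x). dx L (\<eta> t) x)"
    using u_joint[of 1] eta_joint[of 1] m2 by simp_all
  have fc: "continuous_on ({0..T} \<times> {-L..L}) (\<lambda>(t, x). f t x)" unfolding f_def
    using m2 by (intro joint_intros u_joint) simp
  have Fc: "continuous_on ({0..T} \<times> {-L..L}) (\<lambda>(t, x). F t x)" unfolding F_def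
    by (intro joint_intros d1)
  have A: "A_form L d (u s) \<psi> = ip L (f s) \<psi>" if s: "s \<in> {0..T}" for s
    using psi s joint_section(1)[OF fc s] u_C2[OF s]
    by (intro weak_form_of_strong[OF L _ _ _ psi(1)]) (auto simp: f_def)
  have ipF: "ip L (F s) \<psi> = ip L (X2 s) (deriv \<psi>)" if s: "s \<in> {0..T}" for s
  proof -
    let ?g = "\<lambda>x. \<eta> s x + (1/2) * (u s x * u s x)"
    have g: "?g \<in> C_space L (Suc 0)"
      by (intro C_space_add[OF L] C_space_mult[OF L] C_space_const[OF L] u_C1 eta_C1 s)
    have dg: "deriv ?g x = - F s x" if x: "x \<in> {-L<..<L}" for x
    proof -
      have "(?g has_real_derivative (dx L (\<eta> s) x + (1/2) * (dx L (u s) x * u s x + dx L (u s) x * u s x))) (at x)"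
        by (intro DERIV_add DERIV_mult DERIV_cmult C_space_DERIV[OF L u_C1 x] C_space_DERIV[OF L eta_C1 x] s)
      then have "deriv ?g x = dx L (\<eta> s) x + (1/2) * (dx L (u s) x * u s x + dx L (u s) x * u s x)" by (rule DERIV_imp_deriv)
      then show ?thesis by (simp add: F_def algebra_simps)
    qed
    have "ip L (deriv ?g) \<psi> = - ip L ?g (deriv \<psi>)"
      using ip_parts[OF C1_pw(1)[OF L g] psi(1)] L psi by simp
    moreover have "ip L (deriv ?g) \<psi> = ip L (\<lambda>x. (-1) * F s x) \<psi>" by (rule ip_cong) (use dg in auto)
    moreover have "\<dots> = - ip L (F s) \<psi>"
      using psd_form.scale_left[OF ip_psd, of "F s" L \<psi> "-1"] joint_section(1)[OF Fc s] pw_pc[OF psi(1)] by (simp add: pc_continuous)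
    moreover have "X2 s = ?g" by (simp add: X2_def fun_eq_iff)
    ultimately show ?thesis by simp
  qed
  have "ip L (f t) \<psi> = ip L (f 0) \<psi> + integral {0..t} (\<lambda>s. ip L (F s) \<psi>)"
  proof (rule time_integrated[OF fc Fc _ pw_cont[OF psi(1)] t])
    fix t x assume "t \<in> {0<..<T}" "x \<in> {-L<..<L}"
    from equations(2)[OF this] show "((\<lambda>s. f s x) has_real_derivative F t x) (at t)" by (simp add: f_def F_def)
  qed
  also have "integral {0..t} (\<lambda>s. ip L (F s) \<psi>) = integral {0..t} (\<lambda>s. ip L (X2 s) (deriv \<psi>))"
    by (rule integral_cong) (use ipF t in auto)
  finally show ?thesis using A[OF t] A[of 0] T by simp
qed

end


section \<open>Error estimates\<close>

text \<open>Orthogonality is asked for against \<open>z\<close> alone, so the estimate also applies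
  to time increments of a projection.\<close>

lemma projection_stable:
  assumes q: "0 < q" and w: "pw L w" and z: "pw L z" and eq: "A_form L q z z = A_form L q w z"
  shows "H1_norm L z \<le> max 1 q / min 1 q * H1_norm L w"
proof -
  have "min 1 q * (H1_norm L z)\<^sup>2 \<le> (max 1 q * H1_norm L w) * H1_norm L z"
    using A_form_H1(1)[OF q, of L z] A_form_le[OF q w z] eq by (simp add: mult.assoc)
  then have "H1_norm L z \<le> (max 1 q * H1_norm L w) / min 1 q" by (rule le_of_square_le) (use q in auto)
  then show ?thesis by simp
qed

lemma projection_H1_continuous:
  assumes q: "0 < q" and v: "H1_continuous L T v" and W: "fun_subspace W" "\<And>z. z \<in> W \<Longrightarrow> pw L z"
    and z: "\<And>t. t \<in> {0..T} \<Longrightarrow> z t \<in> W" "\<And>t \<psi>. t \<in> {0..T} \<Longrightarrow> \<psi> \<in> W \<Longrightarrow> A_form L q (z t) \<psi> = A_form L q (v t) \<psi>"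
  shows "H1_continuous L T z"
  unfolding H1_continuous_def
proof (intro ballI conjI)
  interpret psd_form "{f. pw L f}" "A_form L q" by (rule A_form_psd) (use q in simp)
  fix t assume t: "t \<in> {0..T}"
  show "pw L (z t)" by (rule W(2)[OF z(1)[OF t]])
  have "((\<lambda>s. max 1 q / min 1 q * H1_norm L (\<lambda>x. v s x - v t x)) \<longlongrightarrow> max 1 q / min 1 q * 0) (at t within {0..T})"
    using v t unfolding H1_continuous_def by (intro tendsto_mult_left) blast
  then have lim: "((\<lambda>s. max 1 q / min 1 q * H1_norm L (\<lambda>x. v s x - v t x)) \<longlongrightarrow> 0) (at t within {0..T})" by simp
  have "\<forall>\<^sub>F s in at t within {0..T}. s \<in> {0..T}" by (auto simp: eventually_at_filter)
  then have "\<forall>\<^sub>F s in at t within {0..T}. norm (H1_norm L (\<lambda>x. z s x - z t x)) \<le> max 1 q / min 1 q * H1_norm L (\<lambda>x. v s x - v t x)"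
  proof eventually_elim
    case (elim s)
    let ?d = "\<lambda>x. z s x - z t x"
    have d: "?d \<in> W" by (rule fun_subspace_diff[OF W(1) z(1)[OF elim] z(1)[OF t]])
    have pw: "pw L (z s)" "pw L (z t)" "pw L (v s)" "pw L (v t)" "pw L ?d"
      using W(2) z(1) H1_continuous_pw[OF v] elim t d by auto
    have "A_form L q ?d ?d = A_form L q (\<lambda>x. v s x - v t x) ?d"
      using diff_left[of "z s" "z t" ?d] diff_left[of "v s" "v t" ?d] pw z(2)[OF elim d] z(2)[OF t d] by simp
    then show ?case using projection_stable[OF q pw_diff[OF pw(3,4)] pw(5)] by simp
  qed
  then show "((\<lambda>s. H1_norm L (\<lambda>x. z s x - z t x)) \<longlongrightarrow> 0) (at t within {0..T})" by (rule Lim_null_comparison[OF _ lim])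
qed

text \<open>The key estimate: only \<open>\<parallel>\<xi>\<parallel>\<^sub>1\<close> is controlled, so the discrete Laplacian of \<open>\<xi>\<close> costs a factor \<open>1/h\<close>;
  it is recovered from \<open>\<Psi> - R\<^sub>h \<Psi>\<close> and from \<open>\<Psi>\<^sub>x - R\<^sub>h\<^sup>0 \<Psi>\<^sub>x\<close>, where \<open>\<Psi>\<^sub>x\<close> vanishes at \<open>\<plusminus>L\<close>.\<close>

lemma discrete_laplacian_test:
  assumes L: "0 < L" and r: "2 \<le> r" and mu: "\<mu> \<le> r - 2" and b: "0 < b"
  obtains C where "0 \<le> C" "\<And>N \<Psi> \<xi>. 0 < N \<Longrightarrow> \<Psi> \<in> C_space L 2 \<Longrightarrow> dx L \<Psi> (-L) = 0 \<Longrightarrow> dx L \<Psi> L = 0 \<Longrightarrow> \<xi> \<in> Sh0 L N \<mu> r \<Longrightarrow>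
     \<bar>ip L (discrete_laplacian L N \<mu> r \<xi>) (deriv (Rh L N \<mu> r b \<Psi>))\<bar> \<le> C * H1_norm L \<xi> * Hs_norm L 2 \<Psi>"
proof -
  obtain Ci where Ci: "0 < Ci" "\<And>N v. 0 < N \<Longrightarrow> v \<in> Sh L N \<mu> r \<Longrightarrow> L2_norm L (deriv v) \<le> Ci / mesh L N * L2_norm L v"
    using inverse_inequality[of r] L by blast
  obtain C2 where C2: "0 \<le> C2" "\<And>N g. 0 < N \<Longrightarrow> g \<in> C_space L 2 \<Longrightarrow>
    H1_norm L (\<lambda>x. g x - Rh L N \<mu> r b g x) \<le> C2 * mesh L N ^ (2 - 1) * Hs_norm L 2 g \<and>
    L2_norm L (\<lambda>x. g x - Rh L N \<mu> r b g x) \<le> C2 * mesh L N ^ 2 * Hs_norm L 2 g"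
    using Rh_error[OF L b r mu, of 2] r by auto
  \<comment> \<open>\<open>\<Psi>\<^sub>x\<close> is just C^1, hence order 1: a factor h in L2, and
    in H1 mere boundedness.\<close>
  obtain C1 where C1: "0 \<le> C1" "\<And>N g. 0 < N \<Longrightarrow> g \<in> C_space L 1 \<Longrightarrow> g (-L) = 0 \<Longrightarrow> g L = 0 \<Longrightarrow>
    H1_norm L (\<lambda>x. g x - Rh0 L N \<mu> r 1 g x) \<le> C1 * mesh L N ^ (1 - 1) * Hs_norm L 1 g \<and>
    L2_norm L (\<lambda>x. g x - Rh0 L N \<mu> r 1 g x) \<le> C1 * mesh L N ^ 1 * Hs_norm L 1 g"
    using Rh0_error[OF L zero_less_one r mu, of 1] r by auto
  show ?thesis
  proof (rule that[of "Ci * C2 + Ci * C1 + (1 + C1)"])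
    show "0 \<le> Ci * C2 + Ci * C1 + (1 + C1)" using Ci(1) C1(1) C2(1) by simp
    fix N :: nat and \<Psi> \<xi> assume N: "0 < N" and P: "\<Psi> \<in> C_space L 2" "dx L \<Psi> (-L) = 0" "dx L \<Psi> L = 0"
      and xi: "\<xi> \<in> Sh0 L N \<mu> r"
    interpret fem L N \<mu> r by unfold_locales (use L N r in auto)
    have h: "0 < mesh L N" by (rule mesh_pos[OF L N])
    have P1: "\<Psi> \<in> C_space L (Suc 1)" using P(1) by (simp add: numeral_2_eq_2)
    define g where "g = dx L \<Psi>"
    have g: "g \<in> C_space L 1" "g (-L) = 0" "g L = 0" using C_space_dx[OF P1] P by (auto simp: g_def)
    have pwg: "pw L g" by (rule C1_pw(1)[OF L, of g 0]) (use g in simp)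
    have pwP: "pw L \<Psi>" by (rule C1_pw(1)[OF L P1])
    have pwxi: "pw L \<xi>" by (rule S0_pw[OF xi])
    define w where "w = lap \<xi>"
    have w: "w \<in> S0" unfolding w_def by (rule lap_spec(1)[OF pwxi])
    have pcw: "pc {-L..L} w" by (rule pw_pc[OF S0_pw[OF w]])
    define X where "X = H1_norm L \<xi>"
    define Y where "Y = Hs_norm L 2 \<Psi>"
    have X0: "0 \<le> X" "0 \<le> Y" by (simp_all add: X_def Y_def)
    have "L2_norm L w \<le> Ci / mesh L N * L2_norm L (deriv \<xi>)" unfolding w_def by (rule lap_bound[OF Ci(2)[OF N] pwxi])
    also have "\<dots> \<le> Ci / mesh L N * X" unfolding X_def using Ci(1) h by (intro mult_left_mono L2_deriv_le_H1) auto
    finally have wn: "L2_norm L w \<le> Ci / mesh L N * X" .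
    have gY: "Hs_norm L 1 g \<le> Y" unfolding g_def Y_def using Hs_norm_dx[of L 1 \<Psi>] by (simp add: numeral_2_eq_2)
    define R where "R = Rh L N \<mu> r b \<Psi>"
    have R: "R \<in> S" "pw L R" unfolding R_def using Rh_spec(1)[OF L N _ b pwP] r S_pw by auto
    define z where "z = Rh0 L N \<mu> r 1 g"
    have z: "z \<in> S0" "pw L z" unfolding z_def using Rh0_spec(1)[OF L N _ zero_less_one pwg] r S0_pw by auto
    have e1: "H1_norm L (\<lambda>x. \<Psi> x - R x) \<le> C2 * mesh L N * Y" using C2(2)[OF N P(1)] by (simp add: R_def Y_def)
    have e2: "H1_norm L (\<lambda>x. g x - z x) \<le> C1 * Y" "L2_norm L (\<lambda>x. g x - z x) \<le> C1 * mesh L N * Y"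
    proof -
      have "H1_norm L (\<lambda>x. g x - z x) \<le> C1 * Hs_norm L 1 g" "L2_norm L (\<lambda>x. g x - z x) \<le> C1 * mesh L N * Hs_norm L 1 g"
        using C1(2)[OF N g] by (auto simp: z_def)
      moreover have "C1 * Hs_norm L 1 g \<le> C1 * Y" "C1 * mesh L N * Hs_norm L 1 g \<le> C1 * mesh L N * Y"
        using C1(1) h gY by (auto intro: mult_left_mono)
      ultimately show "H1_norm L (\<lambda>x. g x - z x) \<le> C1 * Y" "L2_norm L (\<lambda>x. g x - z x) \<le> C1 * mesh L N * Y" by linarith+
    qed
    have t1: "\<bar>ip L (deriv \<Psi>) w - ip L (deriv R) w\<bar> \<le> (Ci * C2) * X * Y"
    proof -
      have "\<bar>ip L (deriv \<Psi>) w - ip L (deriv R) w\<bar> \<le> L2_norm L (\<lambda>x. deriv \<Psi> x - deriv R x) * L2_norm L w"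
        by (rule ip_diff_le[OF pw_pc_deriv[OF pwP] pw_pc_deriv[OF R(2)] pcw])
      also have "L2_norm L (\<lambda>x. deriv \<Psi> x - deriv R x) = L2_norm L (deriv (\<lambda>x. \<Psi> x - R x))"
        by (rule L2_deriv_diff[OF pwP R(2), symmetric])
      also have "\<dots> * L2_norm L w \<le> (C2 * mesh L N * Y) * (Ci / mesh L N * X)"
        by (intro mult_mono order_trans[OF L2_deriv_le_H1 e1] wn) (use C2(1) h X0 in auto)
      also have "\<dots> = (Ci * C2) * X * Y" using h by simp
      finally show ?thesis .
    qed
    have t2: "\<bar>ip L g w - ip L z w\<bar> \<le> (Ci * C1) * X * Y"
    proof -
      have "\<bar>ip L g w - ip L z w\<bar> \<le> L2_norm L (\<lambda>x. g x - z x) * L2_norm L w"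
        by (rule ip_diff_le[OF pw_pc[OF pwg] pw_pc[OF z(2)] pcw])
      also have "\<dots> \<le> (C1 * mesh L N * Y) * (Ci / mesh L N * X)"
        by (intro mult_mono e2(2) wn) (use C1(1) h X0 in auto)
      also have "\<dots> = (Ci * C1) * X * Y" using h by simp
      finally show ?thesis .
    qed
    \<comment> \<open>\<open>z\<close> lies in \<open>S0\<close>, so the definition of the discrete
      Laplacian applies and returns the derivative to \<open>\<xi>\<close>.\<close>
    have t3: "\<bar>ip L z w\<bar> \<le> (1 + C1) * X * Y"
    proof -
      have "ip L z w = - ip L (deriv \<xi>) (deriv z)" using lap_spec(2)[OF pwxi z(1)] by (simp add: w_def ip_commute[of L z])
      then have "\<bar>ip L z w\<bar> \<le> L2_norm L (deriv \<xi>) * L2_norm L (deriv z)"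
        using ip_le[OF pw_pc_deriv[OF pwxi] pw_pc_deriv[OF z(2)]] by simp
      also have "\<dots> \<le> X * H1_norm L z" unfolding X_def by (intro mult_mono L2_deriv_le_H1) auto
      also have "H1_norm L z \<le> H1_norm L g + H1_norm L (\<lambda>x. g x - z x)"
        using H1_diff[OF pwg pw_diff[OF pwg z(2)]] by simp
      also have "\<dots> \<le> Y + C1 * Y" using H1_le_Hs[OF L, of g 0] g(1) gY e2(1) by (intro add_mono) auto
      finally have "\<bar>ip L z w\<bar> \<le> X * (Y + C1 * Y)" using X0 by (simp add: mult_left_mono)
      then show ?thesis by (simp add: algebra_simps)
    qed
    have eq: "ip L (deriv \<Psi>) w = ip L g w" by (rule ip_cong) (use C1_pw(2)[OF L P1] in \<open>auto simp: g_def\<close>)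
    have "\<bar>ip L w (deriv R)\<bar> \<le> (Ci * C2) * X * Y + (Ci * C1) * X * Y + (1 + C1) * X * Y"
      using t1 t2 t3 eq ip_commute[of L w "deriv R"] by linarith
    then show "\<bar>ip L (lap \<xi>) (deriv (Rh L N \<mu> r b \<Psi>))\<bar> \<le> (Ci * C2 + Ci * C1 + (1 + C1)) * H1_norm L \<xi> * Hs_norm L 2 \<Psi>"
      by (simp add: w_def R_def X_def Y_def algebra_simps)
  qed
qed

text \<open>By the definition of the projection, tested against \<open>S0\<close> the discrete
  Laplacian of \<open>Rh0\<close> applied to \<open>g\<close> is g_xx minus \<open>1 / d\<close>
  times the projection error, which is of order r in L2 with no derivative lost. The remaining
  comparison approximates g_xx itself in \<open>S0\<close>; this is where its zero boundary values
  and two further derivatives of \<open>g\<close> enter.\<close>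

lemma discrete_laplacian_consistency:
  assumes L: "0 < L" and r: "2 \<le> r" and mu: "\<mu> \<le> r - 2" and d: "0 < d"
  obtains C where "0 \<le> C" "\<And>N g. 0 < N \<Longrightarrow> g \<in> C_space L (r + 2) \<Longrightarrow> g (-L) = 0 \<Longrightarrow> g L = 0 \<Longrightarrow>
     (dx L ^^ 2) g (-L) = 0 \<Longrightarrow> (dx L ^^ 2) g L = 0 \<Longrightarrow>
     L2_norm L (\<lambda>x. discrete_laplacian L N \<mu> r (Rh0 L N \<mu> r d g) x - (dx L ^^ 2) g x) \<le> C * mesh L N ^ r * Hs_norm L (r + 2) g"
proof -
  obtain Cd where Cd: "0 \<le> Cd" "\<And>N g. 0 < N \<Longrightarrow> g \<in> C_space L r \<Longrightarrow> g (-L) = 0 \<Longrightarrow> g L = 0 \<Longrightarrow>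
    H1_norm L (\<lambda>x. g x - Rh0 L N \<mu> r d g x) \<le> Cd * mesh L N ^ (r - 1) * Hs_norm L r g \<and>
    L2_norm L (\<lambda>x. g x - Rh0 L N \<mu> r d g x) \<le> Cd * mesh L N ^ r * Hs_norm L r g"
    using Rh0_error[OF L d r mu, of r] r by auto
  obtain C1 where C1: "0 \<le> C1" "\<And>N g. 0 < N \<Longrightarrow> g \<in> C_space L r \<Longrightarrow> g (-L) = 0 \<Longrightarrow> g L = 0 \<Longrightarrow>
    H1_norm L (\<lambda>x. g x - Rh0 L N \<mu> r 1 g x) \<le> C1 * mesh L N ^ (r - 1) * Hs_norm L r g \<and>
    L2_norm L (\<lambda>x. g x - Rh0 L N \<mu> r 1 g x) \<le> C1 * mesh L N ^ r * Hs_norm L r g"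
    using Rh0_error[OF L zero_less_one r mu, of r] r by auto
  show ?thesis
  proof (rule that[of "2 * C1 + Cd / d"])
    show "0 \<le> 2 * C1 + Cd / d" using C1(1) Cd(1) d by simp
    fix N :: nat and g assume N: "0 < N" and g: "g \<in> C_space L (r + 2)" "g (-L) = 0" "g L = 0"
      "(dx L ^^ 2) g (-L) = 0" "(dx L ^^ 2) g L = 0"
    interpret fem L N \<mu> r by unfold_locales (use L N r in auto)
    have gr: "g \<in> C_space L r" "g \<in> C_space L 2" "g \<in> C_space L (Suc 0)" using C_space_mono[OF g(1)] r by auto
    define v where "v = (dx L ^^ 2) g"
    have v: "v \<in> C_space L r" "v (-L) = 0" "v L = 0" unfolding v_def using C_space_dx_pow[OF g(1)] g by auto
    have pwv: "pw L v" by (rule C1_pw(1)[OF L, of v "r - 1"]) (use v(1) r in simp)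
    have pwg: "pw L g" by (rule C1_pw(1)[OF L gr(3)])
    define B where "B = mesh L N ^ r * Hs_norm L (r + 2) g"
    have h: "0 < mesh L N" by (rule mesh_pos[OF L N])
    have B0: "0 \<le> B" using h by (simp add: B_def)
    define R where "R = Rh0 L N \<mu> r d g"
    have R: "R \<in> S0" "pw L R" unfolding R_def using Rh0_spec(1)[OF L N _ d pwg] r S0_pw by auto
    define z where "z = Rh0 L N \<mu> r 1 v"
    have z: "z \<in> S0" "pw L z" unfolding z_def using Rh0_spec(1)[OF L N _ zero_less_one pwv] r S0_pw by auto
    define w where "w = lap R"
    have w: "w \<in> S0" "pw L w" unfolding w_def using lap_spec(1)[OF R(2)] S0_pw by auto
    have Hv: "Hs_norm L r v \<le> Hs_norm L (r + 2) g"
      using Hs_norm_dx[of L r "dx L g"] Hs_norm_dx[of L "Suc r" g] by (simp add: v_def numeral_2_eq_2)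
    have eg: "L2_norm L (\<lambda>x. g x - R x) \<le> Cd * B"
    proof -
      have "L2_norm L (\<lambda>x. g x - R x) \<le> Cd * mesh L N ^ r * Hs_norm L r g" using Cd(2)[OF N gr(1) g(2,3)] by (simp add: R_def)
      also have "\<dots> \<le> Cd * mesh L N ^ r * Hs_norm L (r + 2) g" using Cd(1) h by (intro mult_left_mono Hs_norm_mono) auto
      finally show ?thesis by (simp add: B_def mult.assoc)
    qed
    have ev: "L2_norm L (\<lambda>x. v x - z x) \<le> C1 * B"
    proof -
      have "L2_norm L (\<lambda>x. v x - z x) \<le> C1 * mesh L N ^ r * Hs_norm L r v" using C1(2)[OF N v] by (simp add: z_def)
      also have "\<dots> \<le> C1 * mesh L N ^ r * Hs_norm L (r + 2) g" using C1(1) h Hv by (intro mult_left_mono) auto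
      finally show ?thesis by (simp add: B_def mult.assoc)
    qed
    have ipw: "ip L w \<phi> = ip L v \<phi> - (1 / d) * (ip L g \<phi> - ip L R \<phi>)" if p: "\<phi> \<in> S0" for \<phi>
    proof -
      have "A_form L d R \<phi> = A_form L d g \<phi>" unfolding R_def using Rh0_spec(2)[OF L N _ d pwg p] r by simp
      then have "d * ip L (deriv R) (deriv \<phi>) = d * ip L (deriv g) (deriv \<phi>) + (ip L g \<phi> - ip L R \<phi>)" by (simp add: A_form_def)
      then have "ip L (deriv R) (deriv \<phi>) = ip L (deriv g) (deriv \<phi>) + (1 / d) * (ip L g \<phi> - ip L R \<phi>)"
        using d by (simp add: field_simps)
      moreover have "ip L (deriv g) (deriv \<phi>) = - ip L v \<phi>"
        using ip_deriv_parts[OF L gr(2) S0_pw[OF p]] S0_bd[OF p] by (simp add: v_def)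
      ultimately show ?thesis using lap_spec(2)[OF R(2) p] by (simp add: w_def)
    qed
    let ?e = "\<lambda>x. w x - z x"
    have e: "?e \<in> S0" by (rule fun_subspace_diff[OF Sh0_subspace[OF L] w(1) z(1)])
    have pce: "pc {-L..L} ?e" by (rule pw_pc[OF S0_pw[OF e]])
    have "ip L ?e ?e = ip L w ?e - ip L z ?e"
      using psd_form.diff_left[OF ip_psd, of w L z ?e] w z pce by (simp add: pw_pc)
    then have "(L2_norm L ?e)\<^sup>2 = (ip L v ?e - ip L z ?e) - (1 / d) * (ip L g ?e - ip L R ?e)"
      using ipw[OF e] by (simp add: L2_norm_sq)
    also have "\<dots> \<le> \<bar>ip L v ?e - ip L z ?e\<bar> + (1 / d) * \<bar>ip L g ?e - ip L R ?e\<bar>"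
    proof -
      have "- ((1 / d) * (ip L g ?e - ip L R ?e)) \<le> \<bar>(1 / d) * (ip L g ?e - ip L R ?e)\<bar>" by (rule abs_ge_minus_self)
      also have "\<dots> = (1 / d) * \<bar>ip L g ?e - ip L R ?e\<bar>" unfolding abs_mult using d by simp
      finally show ?thesis using abs_ge_self[of "ip L v ?e - ip L z ?e"] by linarith
    qed
    also have "\<dots> \<le> (C1 * B) * L2_norm L ?e + (1 / d) * ((Cd * B) * L2_norm L ?e)"
      using d by (intro add_mono mult_left_mono order_trans[OF ip_diff_le] mult_right_mono eg ev pce pw_pc pwv pwg R z) auto
    also have "\<dots> = ((C1 + Cd / d) * B) * L2_norm L ?e" by (simp add: algebra_simps)
    finally have "1 * (L2_norm L ?e)\<^sup>2 \<le> ((C1 + Cd / d) * B) * L2_norm L ?e" by simp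
    then have "L2_norm L ?e \<le> ((C1 + Cd / d) * B) / 1"
      by (rule le_of_square_le) (use C1(1) Cd(1) d B0 in auto)
    moreover have "L2_norm L (\<lambda>x. w x - v x) \<le> L2_norm L ?e + L2_norm L (\<lambda>x. v x - z x)"
      using L2_diff[OF pce pc_diff[OF pw_pc[OF pwv] pw_pc[OF z(2)]]] by simp
    ultimately have "L2_norm L (\<lambda>x. w x - v x) \<le> (2 * C1 + Cd / d) * B" using ev by (simp add: algebra_simps)
    then show "L2_norm L (\<lambda>x. lap (Rh0 L N \<mu> r d g) x - (dx L ^^ 2) g x) \<le> (2 * C1 + Cd / d) * mesh L N ^ r * Hs_norm L (r + 2) g"
      by (simp add: w_def R_def v_def B_def mult.assoc)
  qed
qed

section \<open>Error estimate for the truncated problem\<close>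

context exact
begin

definition error_bound where
  "error_bound r N K \<eta>h uh \<longleftrightarrow> (\<forall>t\<in>{0..T}.
    L2_norm L (\<lambda>x. \<eta>h t x - \<eta> t x) + L2_norm L (\<lambda>x. uh t x - u t x) \<le> K * mesh L N ^ r \<and>
    H1_norm L (\<lambda>x. \<eta>h t x - \<eta> t x) + H1_norm L (\<lambda>x. uh t x - u t x) \<le> K * mesh L N ^ (r - 1))"

text \<open>All constants are fixed before the mesh. Projection errors enter the fluxes in L2, at
  the full order \<open>\<delta> = mesh L N ^ r\<close>, and Gronwall's inequality for
  \<open>E\<close> preserves it. Returning to the H1 norm of \<open>\<theta>\<close> costs one power
  of the mesh size through the inverse inequality, which is what the H1 estimate allows.\<close>

lemma truncated_error_estimate:
  assumes r: "2 \<le> r" and mu: "\<mu> \<le> r - 2" and m: "r + 2 \<le> m" and b: "0 < b" and d: "0 < d"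
    and M: "0 \<le> M" "\<And>t x. t \<in> {0..T} \<Longrightarrow> x \<in> {-L..L} \<Longrightarrow> \<bar>\<eta> t x\<bar> \<le> M"
      "\<And>t x. t \<in> {0..T} \<Longrightarrow> x \<in> {-L..L} \<Longrightarrow> \<bar>u t x\<bar> \<le> M"
  obtains C where "0 \<le> C" "\<And>N \<eta>h uh. 0 < N \<Longrightarrow> fem.weak_solution L N \<mu> r T a b d M \<eta>h uh \<Longrightarrow>
    (\<And>x. x \<in> {-L..L} \<Longrightarrow> \<eta>h 0 x = Rh L N \<mu> r b \<eta>0 x) \<Longrightarrow> (\<And>x. x \<in> {-L..L} \<Longrightarrow> uh 0 x = Rh0 L N \<mu> r d u0 x) \<Longrightarrow>
    error_bound r N C \<eta>h uh"
proof -
  obtain B1 where B1: "0 \<le> B1" "\<And>t. t \<in> {0..T} \<Longrightarrow> Hs_norm L r (\<eta> t) \<le> B1"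
    using Hs_norm_bounded_in_time[OF eta_cont eta_C _ L, of r] m by auto
  obtain B2 where B2: "0 \<le> B2" "\<And>t. t \<in> {0..T} \<Longrightarrow> Hs_norm L (r + 2) (u t) \<le> B2"
    using Hs_norm_bounded_in_time[OF u_cont u_C _ L, of "r + 2"] m by auto
  have etaCr: "\<eta> t \<in> C_space L r" and uCr: "u t \<in> C_space L r" "u t \<in> C_space L (r + 2)" if "t \<in> {0..T}" for t
    using C_space_mono[OF eta_C[OF that]] C_space_mono[OF u_C[OF that]] m by auto
  obtain Ci where Ci: "0 < Ci" "\<And>N v. 0 < N \<Longrightarrow> v \<in> Sh L N \<mu> r \<Longrightarrow> L2_norm L (deriv v) \<le> Ci / mesh L N * L2_norm L v"
    using inverse_inequality[of r] L by blast
  obtain C1 where C1: "0 \<le> C1" "\<And>N g. 0 < N \<Longrightarrow> g \<in> C_space L r \<Longrightarrow>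
    H1_norm L (\<lambda>x. g x - Rh L N \<mu> r b g x) \<le> C1 * mesh L N ^ (r - 1) * Hs_norm L r g \<and>
    L2_norm L (\<lambda>x. g x - Rh L N \<mu> r b g x) \<le> C1 * mesh L N ^ r * Hs_norm L r g"
    using Rh_error[OF L b r mu, of r] r by auto
  obtain C2 where C2: "0 \<le> C2" "\<And>N g. 0 < N \<Longrightarrow> g \<in> C_space L r \<Longrightarrow> g (-L) = 0 \<Longrightarrow> g L = 0 \<Longrightarrow>
    H1_norm L (\<lambda>x. g x - Rh0 L N \<mu> r d g x) \<le> C2 * mesh L N ^ (r - 1) * Hs_norm L r g \<and>
    L2_norm L (\<lambda>x. g x - Rh0 L N \<mu> r d g x) \<le> C2 * mesh L N ^ r * Hs_norm L r g"
    using Rh0_error[OF L d r mu, of r] r by auto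
  obtain k1 where k1: "0 \<le> k1" "\<And>N \<Psi> \<xi>. 0 < N \<Longrightarrow> \<Psi> \<in> C_space L 2 \<Longrightarrow> dx L \<Psi> (-L) = 0 \<Longrightarrow> dx L \<Psi> L = 0 \<Longrightarrow> \<xi> \<in> Sh0 L N \<mu> r \<Longrightarrow>
     \<bar>ip L (discrete_laplacian L N \<mu> r \<xi>) (deriv (Rh L N \<mu> r b \<Psi>))\<bar> \<le> k1 * H1_norm L \<xi> * Hs_norm L 2 \<Psi>"
    using discrete_laplacian_test[OF L r mu b] by blast
  obtain C3 where C3: "0 \<le> C3" "\<And>N g. 0 < N \<Longrightarrow> g \<in> C_space L (r + 2) \<Longrightarrow> g (-L) = 0 \<Longrightarrow> g L = 0 \<Longrightarrow>
     (dx L ^^ 2) g (-L) = 0 \<Longrightarrow> (dx L ^^ 2) g L = 0 \<Longrightarrow>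
     L2_norm L (\<lambda>x. discrete_laplacian L N \<mu> r (Rh0 L N \<mu> r d g) x - (dx L ^^ 2) g x) \<le> C3 * mesh L N ^ r * Hs_norm L (r + 2) g"
    using discrete_laplacian_consistency[OF L r mu d] by blast
  obtain D where D: "0 \<le> D" "\<And>f. continuous_on {-L..L} f \<Longrightarrow> \<exists>\<Psi>\<in>C_space L 2.
    dx L \<Psi> (-L) = 0 \<and> dx L \<Psi> L = 0 \<and> Hs_norm L 2 \<Psi> \<le> D * L2_norm L f \<and>
    (\<forall>v. pw L v \<longrightarrow> A_form L b \<Psi> v = ip L f v)"
    using Neumann_dual[OF L b] by blast
  define k2 where "k2 = C3 * B2"
  define kr where "kr = C1 * B1"
  define ks where "ks = C2 * B2"
  define cs where "cs = max 1 b / min 1 b"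
  have nn: "0 \<le> k2" "0 \<le> kr" "0 \<le> ks" "0 \<le> cs" using C1 C2 C3 B1 B2 b by (auto simp: k2_def kr_def ks_def cs_def)
  \<comment> \<open>\<open>1 + M\<close> dominates the Lipschitz constants of both nonlinear fluxes;
    \<open>1 + ks + kr\<close> absorbs the projection errors into a multiple of
    \<open>E s + \<delta>\<close>.\<close>
  define Kp where "Kp = (1 + M) * (1 + ks + kr)"
  have Kp: "0 \<le> Kp" using M nn by (simp add: Kp_def)
  \<comment> \<open>\<open>cs * D\<close> bounds the H1 norm of the test function \<open>R\<close>
    by the L2 norm of \<open>\<theta> t\<close>; \<open>k2\<close> measures the consistency error of
    the discrete Laplacian, and \<open>k1 * D\<close> comes from
    \<open>discrete_laplacian_test\<close>.\<close>
  define Kt where "Kt = (Kp + \<bar>a\<bar> * k2) * (cs * D) + \<bar>a\<bar> * (k1 * D)"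
  have Kt: "0 \<le> Kt" using Kp nn D(1) k1(1) by (simp add: Kt_def)
  define C0 where "C0 = Kt + Kp / min 1 d"
  have C0: "0 \<le> C0" using Kt Kp d by (simp add: C0_def)
  define G where "G = C0 * (T * exp (C0 * T))"
  have G: "0 \<le> G" using C0 T by (simp add: G_def)
  \<comment> \<open>The summand \<open>G * (4 * L + Ci)\<close> serves the H1 estimate:
    \<open>2 * L\<close> for each component from
    \<open>\<delta> \<le> 2 * L * mesh L N ^ (r - 1)\<close>, and \<open>Ci\<close> from the inverse
    inequality for \<open>\<theta>\<close>.\<close>
  show ?thesis
  proof (rule that[of "G + kr + ks + G * (4 * L + Ci)"])
    show "0 \<le> G + kr + ks + G * (4 * L + Ci)" using G nn L Ci(1) by simp
    fix N :: nat and \<eta>h uh assume N: "0 < N" and w: "fem.weak_solution L N \<mu> r T a b d M \<eta>h uh"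
      and i1: "\<And>x. x \<in> {-L..L} \<Longrightarrow> \<eta>h 0 x = Rh L N \<mu> r b \<eta>0 x"
      and i2: "\<And>x. x \<in> {-L..L} \<Longrightarrow> uh 0 x = Rh0 L N \<mu> r d u0 x"
    interpret fem L N \<mu> r by unfold_locales (use L N r in auto)
    have r1: "1 \<le> r" using r by simp
    have h: "0 < mesh L N" by (rule mesh_pos[OF L N])
    define \<delta> where "\<delta> = mesh L N ^ r"
    have delta: "0 \<le> \<delta>" using h by (simp add: \<delta>_def)
    define P where "P = (\<lambda>t. Rh L N \<mu> r b (\<eta> t))"
    define Q where "Q = (\<lambda>t. Rh0 L N \<mu> r d (u t))"
    define \<theta> where "\<theta> = (\<lambda>t x. \<eta>h t x - P t x)"
    define \<xi> where "\<xi> = (\<lambda>t x. uh t x - Q t x)"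
    have hS: "\<eta>h s \<in> S" "uh s \<in> S0" if "s \<in> {0..T}" for s using w that by (auto simp: weak_solution_def)
    have Hh: "H1_continuous L T \<eta>h" "H1_continuous L T uh" using w by (auto simp: weak_solution_def)
    have PS: "P s \<in> S" "Q s \<in> S0" if "s \<in> {0..T}" for s
      using Rh_spec(1)[OF L N r1 b pw_eta[OF that]] Rh0_spec(1)[OF L N r1 d pw_u[OF that]] by (auto simp: P_def Q_def)
    have PA: "A_form L b (P s) \<psi> = A_form L b (\<eta> s) \<psi>" if "s \<in> {0..T}" "\<psi> \<in> S" for s \<psi>
      unfolding P_def by (rule Rh_spec(2)[OF L N r1 b pw_eta[OF that(1)] that(2)])
    have QA: "A_form L d (Q s) \<psi> = A_form L d (u s) \<psi>" if "s \<in> {0..T}" "\<psi> \<in> S0" for s \<psi>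
      unfolding Q_def by (rule Rh0_spec(2)[OF L N r1 d pw_u[OF that(1)] that(2)])
    obtain m' where m': "m = Suc m'" using m2 by (cases m) auto
    have Hex: "H1_continuous L T \<eta>" "H1_continuous L T u"
    proof -
      show "H1_continuous L T \<eta>" using continuous_in_C_H1[of L T m' \<eta>] eta_cont eta_C L m' by simp
      show "H1_continuous L T u" using continuous_in_C_H1[of L T m u] u_cont u_C L by simp
    qed
    have HP: "H1_continuous L T P" "H1_continuous L T Q"
      using projection_H1_continuous[OF b Hex(1) Sh_subspace[OF L] S_pw PS(1) PA]
        projection_H1_continuous[OF d Hex(2) Sh0_subspace[OF L] S0_pw PS(2) QA] by auto
    have Ht: "H1_continuous L T \<theta>" "H1_continuous L T \<xi>"
      unfolding \<theta>_def \<xi>_def using Hh HP by (auto intro: H1_continuous_diff)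
    have tS: "\<theta> s \<in> S" "\<xi> s \<in> S0" if "s \<in> {0..T}" for s
      unfolding \<theta>_def \<xi>_def using fun_subspace_diff[OF Sh_subspace[OF L] hS(1)[OF that] PS(1)[OF that]]
        fun_subspace_diff[OF Sh0_subspace[OF L] hS(2)[OF that] PS(2)[OF that]] by auto
    note pws = S_pw[OF hS(1)] S0_pw[OF hS(2)] S_pw[OF PS(1)] S0_pw[OF PS(2)] S_pw[OF tS(1)] S0_pw[OF tS(2)] pw_eta pw_u
    have rho: "L2_norm L (\<lambda>x. \<eta> s x - P s x) \<le> kr * \<delta>" "H1_norm L (\<lambda>x. \<eta> s x - P s x) \<le> kr * mesh L N ^ (r - 1)"
      and sig: "L2_norm L (\<lambda>x. u s x - Q s x) \<le> ks * \<delta>" "H1_norm L (\<lambda>x. u s x - Q s x) \<le> ks * mesh L N ^ (r - 1)"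
      and lapQ: "L2_norm L (\<lambda>x. lap (Q s) x - (dx L ^^ 2) (u s) x) \<le> k2 * \<delta>" if s: "s \<in> {0..T}" for s
    proof -
      have "C1 * mesh L N ^ r * Hs_norm L r (\<eta> s) \<le> C1 * mesh L N ^ r * B1"
        "C1 * mesh L N ^ (r - 1) * Hs_norm L r (\<eta> s) \<le> C1 * mesh L N ^ (r - 1) * B1"
        using C1(1) h B1(2)[OF s] by (auto intro!: mult_left_mono)
      then show "L2_norm L (\<lambda>x. \<eta> s x - P s x) \<le> kr * \<delta>" "H1_norm L (\<lambda>x. \<eta> s x - P s x) \<le> kr * mesh L N ^ (r - 1)"
        using C1(2)[OF N etaCr[OF s]] by (auto simp: P_def kr_def \<delta>_def mult_ac)
      have "Hs_norm L r (u s) \<le> B2" using Hs_norm_mono[of r "r + 2" L "u s"] B2(2)[OF s] by simp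
      then have "C2 * mesh L N ^ r * Hs_norm L r (u s) \<le> C2 * mesh L N ^ r * B2"
        "C2 * mesh L N ^ (r - 1) * Hs_norm L r (u s) \<le> C2 * mesh L N ^ (r - 1) * B2"
        using C2(1) h by (auto intro!: mult_left_mono)
      then show "L2_norm L (\<lambda>x. u s x - Q s x) \<le> ks * \<delta>" "H1_norm L (\<lambda>x. u s x - Q s x) \<le> ks * mesh L N ^ (r - 1)"
        using C2(2)[OF N uCr(1)[OF s] u_bd[OF s]] by (auto simp: Q_def ks_def \<delta>_def mult_ac)
      have "C3 * mesh L N ^ r * Hs_norm L (r + 2) (u s) \<le> C3 * mesh L N ^ r * B2"
        using C3(1) h B2(2)[OF s] by (intro mult_left_mono) auto
      then show "L2_norm L (\<lambda>x. lap (Q s) x - (dx L ^^ 2) (u s) x) \<le> k2 * \<delta>"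
        using C3(2)[OF N uCr(2)[OF s] u_bd[OF s] uxx_bd[OF s]] by (simp add: Q_def k2_def \<delta>_def mult_ac)
    qed
    define E where "E = (\<lambda>t. L2_norm L (\<theta> t) + H1_norm L (\<xi> t))"
    have cE: "continuous_on {0..T} E" unfolding E_def by (intro continuous_intros H1_continuous_norms Ht)
    have E0: "0 \<le> E s" for s by (simp add: E_def)
    have eu: "L2_norm L (\<lambda>x. uh s x - u s x) \<le> H1_norm L (\<xi> s) + ks * \<delta>"
      and ee: "L2_norm L (\<lambda>x. \<eta>h s x - \<eta> s x) \<le> L2_norm L (\<theta> s) + kr * \<delta>" if s: "s \<in> {0..T}" for s
    proof -
      have "L2_norm L (\<lambda>x. uh s x - u s x) = L2_norm L (\<lambda>x. \<xi> s x - (u s x - Q s x))" by (simp add: \<xi>_def)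
      also have "\<dots> \<le> L2_norm L (\<xi> s) + L2_norm L (\<lambda>x. u s x - Q s x)"
        using pws[OF s] by (intro L2_diff pc_diff pw_pc) auto
      finally show "L2_norm L (\<lambda>x. uh s x - u s x) \<le> H1_norm L (\<xi> s) + ks * \<delta>"
        using sig(1)[OF s] L2_le_H1[of L "\<xi> s"] by simp
      have "L2_norm L (\<lambda>x. \<eta>h s x - \<eta> s x) = L2_norm L (\<lambda>x. \<theta> s x - (\<eta> s x - P s x))" by (simp add: \<theta>_def)
      also have "\<dots> \<le> L2_norm L (\<theta> s) + L2_norm L (\<lambda>x. \<eta> s x - P s x)"
        using pws[OF s] by (intro L2_diff pc_diff pw_pc) auto
      finally show "L2_norm L (\<lambda>x. \<eta>h s x - \<eta> s x) \<le> L2_norm L (\<theta> s) + kr * \<delta>" using rho(1)[OF s] by simp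
    qed
    have pbound: "(1 + M) * (H1_norm L (\<xi> s) + ks * \<delta>) + M * (L2_norm L (\<theta> s) + kr * \<delta>) \<le> Kp * (E s + \<delta>)"
      "M * (H1_norm L (\<xi> s) + ks * \<delta>) + 1 * (L2_norm L (\<theta> s) + kr * \<delta>) \<le> Kp * (E s + \<delta>)" for s
    proof -
      define X where "X = H1_norm L (\<xi> s)"
      define Y where "Y = L2_norm L (\<theta> s)"
      have XY: "0 \<le> X" "0 \<le> Y" by (simp_all add: X_def Y_def)
      have "(1 + M) * (X + ks * \<delta>) + M * (Y + kr * \<delta>) \<le> (1 + M) * ((X + ks * \<delta>) + (Y + kr * \<delta>))"
        "M * (X + ks * \<delta>) + 1 * (Y + kr * \<delta>) \<le> (1 + M) * ((X + ks * \<delta>) + (Y + kr * \<delta>))"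
        using XY M(1) nn delta by (auto simp: algebra_simps)
      moreover have "(X + ks * \<delta>) + (Y + kr * \<delta>) \<le> (1 + ks + kr) * (X + Y + \<delta>)"
      proof -
        have "0 \<le> (ks + kr) * (X + Y) + \<delta>" using XY nn delta by simp
        then show ?thesis by (simp add: algebra_simps)
      qed
      then have "(1 + M) * ((X + ks * \<delta>) + (Y + kr * \<delta>)) \<le> (1 + M) * ((1 + ks + kr) * (X + Y + \<delta>))"
        using M(1) by (intro mult_left_mono) auto
      ultimately show "(1 + M) * (H1_norm L (\<xi> s) + ks * \<delta>) + M * (L2_norm L (\<theta> s) + kr * \<delta>) \<le> Kp * (E s + \<delta>)"
        "M * (H1_norm L (\<xi> s) + ks * \<delta>) + 1 * (L2_norm L (\<theta> s) + kr * \<delta>) \<le> Kp * (E s + \<delta>)"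
        by (simp_all add: E_def Kp_def X_def[symmetric] Y_def[symmetric] mult.assoc add.commute)
    qed
    \<comment> \<open>The discrete Laplacian of \<open>uh s\<close> splits into that of
      \<open>Q s\<close>, compared with u_xx by consistency, and that of \<open>\<xi> s\<close>,
      which is left as it is because only a special test function can bound it.\<close>
    have d1: "\<bar>F1 a M (\<eta>h s) (uh s) \<psi> - ip L (X1 s) (deriv \<psi>)\<bar>
        \<le> (Kp * (E s + \<delta>) + \<bar>a\<bar> * (k2 * \<delta>)) * H1_norm L \<psi> + \<bar>a\<bar> * \<bar>ip L (lap (\<xi> s)) (deriv \<psi>)\<bar>"
      if s: "s \<in> {0..T}" and psi: "pw L \<psi>" for s \<psi>
    proof -
      note pw = pws[OF s]
      let ?f = "\<lambda>x. uh s x + cl M (\<eta>h s x) * cl M (uh s x)" and ?g = "\<lambda>x. u s x + cl M (\<eta> s x) * cl M (u s x)"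
      let ?v = "(dx L ^^ 2) (u s)"
      have pd: "pc {-L..L} (deriv \<psi>)" by (rule pw_pc_deriv[OF psi])
      have pf: "pc {-L..L} ?f" "pc {-L..L} ?g" by (rule flux_pc(1)[OF pw(1,2)] flux_pc(1)[OF pw(7,8)])+
      have pl: "pc {-L..L} (lap (uh s))" "pc {-L..L} (lap (Q s))" "pc {-L..L} (lap (\<xi> s))"
        using pw_pc[OF S0_pw[OF lap_spec(1)]] pw by auto
      have pv: "pc {-L..L} ?v" using pw_pc[OF C1_pw(1)[OF L uxx_C1[OF s]]] .
      interpret I: psd_form "{g. pc {-L..L} g}" "ip L" by (rule ip_psd)
      have 1: "F1 a M (\<eta>h s) (uh s) \<psi> = ip L ?f (deriv \<psi>) + a * ip L (lap (uh s)) (deriv \<psi>)"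
        unfolding F1_def using I.add_left[of ?f "\<lambda>x. a * lap (uh s) x" "deriv \<psi>"] I.scale_left[of "lap (uh s)" "deriv \<psi>" a]
          pf pl pd pc_cmult by simp
      have "ip L (X1 s) (deriv \<psi>) = ip L (\<lambda>x. ?g x + a * ?v x) (deriv \<psi>)"
        by (rule ip_cong) (use M(2,3)[OF s] in \<open>auto simp: X1_def cl_id\<close>)
      also have "\<dots> = ip L ?g (deriv \<psi>) + a * ip L ?v (deriv \<psi>)"
        using I.add_left[of ?g "\<lambda>x. a * ?v x" "deriv \<psi>"] I.scale_left[of ?v "deriv \<psi>" a] pf pv pd pc_cmult by simp
      finally have 2: "ip L (X1 s) (deriv \<psi>) = ip L ?g (deriv \<psi>) + a * ip L ?v (deriv \<psi>)" .
      have "ip L (lap (\<xi> s)) (deriv \<psi>) = ip L (\<lambda>x. lap (uh s) x - lap (Q s) x) (deriv \<psi>)"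
        unfolding \<xi>_def by (rule ip_cong) (use lap_diff[OF pw(2,4)] in auto)
      also have "\<dots> = ip L (lap (uh s)) (deriv \<psi>) - ip L (lap (Q s)) (deriv \<psi>)" using I.diff_left pl pd by simp
      finally have 3: "ip L (lap (\<xi> s)) (deriv \<psi>) = ip L (lap (uh s)) (deriv \<psi>) - ip L (lap (Q s)) (deriv \<psi>)" .
      define x1 where "x1 = ip L ?f (deriv \<psi>) - ip L ?g (deriv \<psi>)"
      define x2 where "x2 = ip L (lap (Q s)) (deriv \<psi>) - ip L ?v (deriv \<psi>)"
      have "F1 a M (\<eta>h s) (uh s) \<psi> - ip L (X1 s) (deriv \<psi>) = x1 + a * (ip L (lap (\<xi> s)) (deriv \<psi>) + x2)"
        unfolding 1 2 3 x1_def x2_def by (simp add: algebra_simps)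
      also have "\<bar>\<dots>\<bar> \<le> \<bar>x1\<bar> + \<bar>a\<bar> * (\<bar>ip L (lap (\<xi> s)) (deriv \<psi>)\<bar> + \<bar>x2\<bar>)"
        by (rule order_trans[OF abs_triangle_ineq]) (simp add: abs_mult mult_left_mono abs_triangle_ineq)
      also have "\<bar>x1\<bar> \<le> Kp * (E s + \<delta>) * H1_norm L \<psi>"
      proof -
        have "L2_norm L (\<lambda>x. ?f x - ?g x) \<le> (1 + M) * L2_norm L (\<lambda>x. uh s x - u s x) + M * L2_norm L (\<lambda>x. \<eta>h s x - \<eta> s x)"
          by (rule truncated_product_diff[OF M(1) pw(2,1,8,7)])
        also have "\<dots> \<le> (1 + M) * (H1_norm L (\<xi> s) + ks * \<delta>) + M * (L2_norm L (\<theta> s) + kr * \<delta>)"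
          using M(1) eu[OF s] ee[OF s] by (intro add_mono mult_left_mono) auto
        also have "\<dots> \<le> Kp * (E s + \<delta>)" by (rule pbound(1))
        finally have "L2_norm L (\<lambda>x. ?f x - ?g x) * L2_norm L (deriv \<psi>) \<le> Kp * (E s + \<delta>) * H1_norm L \<psi>"
          using Kp E0[of s] delta by (intro mult_mono L2_deriv_le_H1) auto
        then show ?thesis unfolding x1_def using ip_diff_le[OF pf pd] by linarith
      qed
      also have "\<bar>x2\<bar> \<le> k2 * \<delta> * H1_norm L \<psi>"
      proof -
        have "L2_norm L (\<lambda>x. lap (Q s) x - ?v x) * L2_norm L (deriv \<psi>) \<le> k2 * \<delta> * H1_norm L \<psi>"
          using lapQ[OF s] nn delta by (intro mult_mono L2_deriv_le_H1) auto
        then show ?thesis unfolding x2_def using ip_diff_le[OF pl(2) pv pd] by linarith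
      qed
      finally have "\<bar>F1 a M (\<eta>h s) (uh s) \<psi> - ip L (X1 s) (deriv \<psi>)\<bar> \<le> Kp * (E s + \<delta>) * H1_norm L \<psi> +
          \<bar>a\<bar> * (\<bar>ip L (lap (\<xi> s)) (deriv \<psi>)\<bar> + k2 * \<delta> * H1_norm L \<psi>)"
        by (simp add: mult_left_mono)
      then show ?thesis by (simp add: algebra_simps)
    qed
    have d2: "\<bar>F2 M (\<eta>h s) (uh s) \<psi> - ip L (X2 s) (deriv \<psi>)\<bar> \<le> Kp * (E s + \<delta>) * H1_norm L \<psi>"
      if s: "s \<in> {0..T}" and psi: "pw L \<psi>" for s \<psi>
    proof -
      note pw = pws[OF s]
      let ?f = "\<lambda>x. \<eta>h s x + (1/2) * (cl M (uh s x))\<^sup>2" and ?g = "\<lambda>x. \<eta> s x + (1/2) * (cl M (u s x))\<^sup>2"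
      have "ip L (X2 s) (deriv \<psi>) = ip L ?g (deriv \<psi>)"
        by (rule ip_cong) (use M(2,3)[OF s] in \<open>auto simp: X2_def cl_id power2_eq_square\<close>)
      then have "\<bar>F2 M (\<eta>h s) (uh s) \<psi> - ip L (X2 s) (deriv \<psi>)\<bar> \<le> L2_norm L (\<lambda>x. ?f x - ?g x) * L2_norm L (deriv \<psi>)"
        unfolding F2_def using ip_diff_le[OF flux_pc(3)[OF pw(1,2)] flux_pc(3)[OF pw(7,8)] pw_pc_deriv[OF psi]] by simp
      also have "\<dots> \<le> Kp * (E s + \<delta>) * H1_norm L \<psi>"
      proof (intro mult_mono L2_deriv_le_H1)
        have "L2_norm L (\<lambda>x. ?f x - ?g x) \<le> M * L2_norm L (\<lambda>x. uh s x - u s x) + 1 * L2_norm L (\<lambda>x. \<eta>h s x - \<eta> s x)"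
          by (rule truncated_square_diff[OF M(1) pw(2,1,8,7)])
        also have "\<dots> \<le> M * (H1_norm L (\<xi> s) + ks * \<delta>) + 1 * (L2_norm L (\<theta> s) + kr * \<delta>)"
          using M(1) eu[OF s] ee[OF s] by (intro add_mono mult_left_mono) auto
        also have "\<dots> \<le> Kp * (E s + \<delta>)" by (rule pbound(2))
        finally show "L2_norm L (\<lambda>x. ?f x - ?g x) \<le> Kp * (E s + \<delta>)" .
      qed (use Kp E0[of s] delta in auto)
      finally show ?thesis .
    qed
    have T0: "0 \<in> {0..T}" using T by simp
    have init1: "A_form L b (\<eta>h 0) \<psi> = A_form L b (\<eta> 0) \<psi>" if "\<psi> \<in> S" for \<psi>
    proof -
      have pw0: "pw L \<eta>0" by (rule pw_cong[OF pw_eta[OF T0]]) (use init in auto)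
      have "A_form L b (\<eta>h 0) \<psi> = A_form L b (Rh L N \<mu> r b \<eta>0) \<psi>" by (rule A_form_cong) (use i1 in auto)
      also have "\<dots> = A_form L b \<eta>0 \<psi>" by (rule Rh_spec(2)[OF L N r1 b pw0 that])
      also have "\<dots> = A_form L b (\<eta> 0) \<psi>" by (rule A_form_cong) (use init in auto)
      finally show ?thesis .
    qed
    have init2: "A_form L d (uh 0) \<psi> = A_form L d (u 0) \<psi>" if "\<psi> \<in> S0" for \<psi>
    proof -
      have pw0: "pw L u0" by (rule pw_cong[OF pw_u[OF T0]]) (use init in auto)
      have "A_form L d (uh 0) \<psi> = A_form L d (Rh0 L N \<mu> r d u0) \<psi>" by (rule A_form_cong) (use i2 in auto)
      also have "\<dots> = A_form L d u0 \<psi>" by (rule Rh0_spec(2)[OF L N r1 d pw0 that])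
      also have "\<dots> = A_form L d (u 0) \<psi>" by (rule A_form_cong) (use init in auto)
      finally show ?thesis .
    qed
    have iE: "0 \<le> integral {0..s} (\<lambda>s. E s + \<delta>)" if "s \<in> {0..T}" for s
      using that delta E0 by (intro integral_nonneg integrable_continuous_interval continuous_intros continuous_on_subset[OF cE]) auto
    \<comment> \<open>The dual solution \<open>\<Psi>\<close> for the data \<open>\<theta> t\<close>
      may be replaced by its projection \<open>R\<close>, since \<open>\<theta> t\<close> is a
      spline. \<open>R\<close> depends on \<open>t\<close> but is fixed under the integral over
      \<open>s\<close>, so it is an admissible test function in both integrated equations.\<close>
    have bt: "L2_norm L (\<theta> t) \<le> Kt * integral {0..t} (\<lambda>s. E s + \<delta>)" if t: "t \<in> {0..T}" for t
    proof -
      interpret A: psd_form "{f. pw L f}" "A_form L b" by (rule A_form_psd) (use b in simp)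
      note pw = pws[OF t]
      have sub: "{0..t} \<subseteq> {0..T}" using t by auto
      obtain \<Psi> where Psi: "\<Psi> \<in> C_space L 2" "dx L \<Psi> (-L) = 0" "dx L \<Psi> L = 0" "Hs_norm L 2 \<Psi> \<le> D * L2_norm L (\<theta> t)"
        "\<And>v. pw L v \<Longrightarrow> A_form L b \<Psi> v = ip L (\<theta> t) v" using D(2)[OF pw_cont[OF pw(5)]] by blast
      have Psi': "\<Psi> \<in> C_space L (Suc 1)" using Psi(1) by (simp add: numeral_2_eq_2)
      have pwPsi: "pw L \<Psi>" by (rule C1_pw(1)[OF L Psi'])
      define R where "R = Rh L N \<mu> r b \<Psi>"
      have R: "R \<in> S" "pw L R" unfolding R_def using Rh_spec(1)[OF L N r1 b pwPsi] S_pw by auto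
      have RA: "A_form L b R \<psi> = A_form L b \<Psi> \<psi>" if "\<psi> \<in> S" for \<psi>
        unfolding R_def by (rule Rh_spec(2)[OF L N r1 b pwPsi that])
      have "H1_norm L R \<le> cs * H1_norm L \<Psi>" unfolding cs_def by (rule projection_stable[OF b pwPsi R(2) RA[OF R(1)]])
      also have "\<dots> \<le> cs * Hs_norm L 2 \<Psi>" using H1_le_Hs[OF L Psi'] nn by (intro mult_left_mono) (auto simp: numeral_2_eq_2)
      also have "\<dots> \<le> cs * (D * L2_norm L (\<theta> t))" using Psi(4) nn by (intro mult_left_mono) auto
      finally have RH: "H1_norm L R \<le> (cs * D) * L2_norm L (\<theta> t)" by simp
      have F1i: "(\<lambda>s. F1 a M (\<eta>h s) (uh s) R) integrable_on {0..t}"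
        by (intro integrable_continuous_interval continuous_on_subset[OF F_continuous(1)[OF M(1) Hh R(2)] sub])
      have Xi: "(\<lambda>s. ip L (X1 s) (deriv R)) integrable_on {0..t}"
        by (intro integrable_continuous_interval continuous_on_subset[OF X_continuous(1)[OF R(2)] sub])
      have "(L2_norm L (\<theta> t))\<^sup>2 = A_form L b R (\<theta> t)" using Psi(5)[OF pw(5)] RA[OF tS(1)[OF t]] by (simp add: L2_norm_sq)
      also have "\<dots> = A_form L b (\<eta>h t) R - A_form L b (P t) R"
        using A.diff_left[of "\<eta>h t" "P t" R] pw R A_form_commute[of L b R "\<theta> t"] by (simp add: \<theta>_def)
      also have "A_form L b (P t) R = A_form L b (\<eta> 0) R + integral {0..t} (\<lambda>s. ip L (X1 s) (deriv R))"
        using PA[OF t R(1)] weak_eta[OF R(2) t] by simp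
      also have "A_form L b (\<eta>h t) R = A_form L b (\<eta> 0) R + integral {0..t} (\<lambda>s. F1 a M (\<eta>h s) (uh s) R)"
      proof -
        have "A_form L b (\<eta>h t) R = A_form L b (\<eta>h 0) R + integral {0..t} (\<lambda>s. F1 a M (\<eta>h s) (uh s) R)"
          using w t R(1) unfolding weak_solution_def by blast
        then show ?thesis using init1[OF R(1)] by simp
      qed
      also have "A_form L b (\<eta> 0) R + integral {0..t} (\<lambda>s. F1 a M (\<eta>h s) (uh s) R) -
          (A_form L b (\<eta> 0) R + integral {0..t} (\<lambda>s. ip L (X1 s) (deriv R)))
        = integral {0..t} (\<lambda>s. F1 a M (\<eta>h s) (uh s) R - ip L (X1 s) (deriv R))"
        using integral_diff[OF F1i Xi] by simp
      also have "\<dots> \<le> norm \<dots>" by simp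
      also have "\<dots> \<le> integral {0..t} (\<lambda>s. (Kt * L2_norm L (\<theta> t)) * (E s + \<delta>))"
      proof (rule integral_norm_bound_integral)
        show "(\<lambda>s. F1 a M (\<eta>h s) (uh s) R - ip L (X1 s) (deriv R)) integrable_on {0..t}" by (rule integrable_diff[OF F1i Xi])
        show "(\<lambda>s. (Kt * L2_norm L (\<theta> t)) * (E s + \<delta>)) integrable_on {0..t}"
          by (intro integrable_continuous_interval continuous_intros continuous_on_subset[OF cE sub])
        fix s assume "s \<in> {0..t}"
        then have s: "s \<in> {0..T}" using sub by blast
        have "\<bar>ip L (lap (\<xi> s)) (deriv R)\<bar> \<le> k1 * H1_norm L (\<xi> s) * Hs_norm L 2 \<Psi>"
          unfolding R_def by (rule k1(2)[OF N Psi(1-3) tS(2)[OF s]])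
        also have "\<dots> \<le> k1 * (E s + \<delta>) * (D * L2_norm L (\<theta> t))"
          using k1(1) Psi(4) E0[of s] delta by (intro mult_mono) (auto simp: E_def)
        finally have x: "\<bar>ip L (lap (\<xi> s)) (deriv R)\<bar> \<le> k1 * (E s + \<delta>) * (D * L2_norm L (\<theta> t))" .
        have "\<bar>F1 a M (\<eta>h s) (uh s) R - ip L (X1 s) (deriv R)\<bar>
          \<le> (Kp * (E s + \<delta>) + \<bar>a\<bar> * (k2 * \<delta>)) * H1_norm L R + \<bar>a\<bar> * \<bar>ip L (lap (\<xi> s)) (deriv R)\<bar>"
          by (rule d1[OF s R(2)])
        also have "\<dots> \<le> ((Kp + \<bar>a\<bar> * k2) * (E s + \<delta>)) * ((cs * D) * L2_norm L (\<theta> t)) + \<bar>a\<bar> * (k1 * (E s + \<delta>) * (D * L2_norm L (\<theta> t)))"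
        proof (intro add_mono mult_mono RH x mult_left_mono)
          have "\<bar>a\<bar> * (k2 * \<delta>) \<le> \<bar>a\<bar> * k2 * (E s + \<delta>)" using nn E0[of s] by (simp add: algebra_simps)
          then show "Kp * (E s + \<delta>) + \<bar>a\<bar> * (k2 * \<delta>) \<le> (Kp + \<bar>a\<bar> * k2) * (E s + \<delta>)" by (simp add: algebra_simps)
        qed (use Kp nn E0[of s] delta in auto)
        also have "\<dots> = (Kt * L2_norm L (\<theta> t)) * (E s + \<delta>)" by (simp add: Kt_def algebra_simps)
        finally show "norm (F1 a M (\<eta>h s) (uh s) R - ip L (X1 s) (deriv R)) \<le> Kt * L2_norm L (\<theta> t) * (E s + \<delta>)" by simp
      qed
      also have "\<dots> = (Kt * L2_norm L (\<theta> t)) * integral {0..t} (\<lambda>s. E s + \<delta>)" by (rule integral_mult_right)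
      finally have "1 * (L2_norm L (\<theta> t))\<^sup>2 \<le> (Kt * integral {0..t} (\<lambda>s. E s + \<delta>)) * L2_norm L (\<theta> t)" by (simp add: mult_ac)
      then have "L2_norm L (\<theta> t) \<le> (Kt * integral {0..t} (\<lambda>s. E s + \<delta>)) / 1"
        by (rule le_of_square_le) (use Kt iE[OF t] in auto)
      then show ?thesis by simp
    qed
    \<comment> \<open>Here \<open>\<xi> t\<close> is its own test function:
      \<open>A_form L d\<close> controls its H1 norm, while \<open>F2\<close> asks only for the L2
      norms of both errors.\<close>
    have bx: "H1_norm L (\<xi> t) \<le> Kp / min 1 d * integral {0..t} (\<lambda>s. E s + \<delta>)" if t: "t \<in> {0..T}" for t
    proof -
      interpret A: psd_form "{f. pw L f}" "A_form L d" by (rule A_form_psd) (use d in simp)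
      note pw = pws[OF t]
      have sub: "{0..t} \<subseteq> {0..T}" using t by auto
      define R where "R = \<xi> t"
      have R: "R \<in> S0" "pw L R" unfolding R_def using tS(2)[OF t] pw by auto
      have F2i: "(\<lambda>s. F2 M (\<eta>h s) (uh s) R) integrable_on {0..t}"
        by (intro integrable_continuous_interval continuous_on_subset[OF F_continuous(2)[OF M(1) Hh R(2)] sub])
      have Xi: "(\<lambda>s. ip L (X2 s) (deriv R)) integrable_on {0..t}"
        by (intro integrable_continuous_interval continuous_on_subset[OF X_continuous(2)[OF R(2)] sub])
      have "A_form L d R R = A_form L d (uh t) R - A_form L d (Q t) R"
        using A.diff_left[of "uh t" "Q t" R] pw R by (simp add: R_def \<xi>_def)
      also have "A_form L d (Q t) R = A_form L d (u 0) R + integral {0..t} (\<lambda>s. ip L (X2 s) (deriv R))"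
        using QA[OF t R(1)] weak_u[OF R(2) S0_bd(2)[OF R(1)] S0_bd(1)[OF R(1)] t] by simp
      also have "A_form L d (uh t) R = A_form L d (u 0) R + integral {0..t} (\<lambda>s. F2 M (\<eta>h s) (uh s) R)"
      proof -
        have "A_form L d (uh t) R = A_form L d (uh 0) R + integral {0..t} (\<lambda>s. F2 M (\<eta>h s) (uh s) R)"
          using w t R(1) unfolding weak_solution_def by blast
        then show ?thesis using init2[OF R(1)] by simp
      qed
      also have "A_form L d (u 0) R + integral {0..t} (\<lambda>s. F2 M (\<eta>h s) (uh s) R) -
          (A_form L d (u 0) R + integral {0..t} (\<lambda>s. ip L (X2 s) (deriv R)))
        = integral {0..t} (\<lambda>s. F2 M (\<eta>h s) (uh s) R - ip L (X2 s) (deriv R))"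
        using integral_diff[OF F2i Xi] by simp
      also have "\<dots> \<le> norm \<dots>" by simp
      also have "\<dots> \<le> integral {0..t} (\<lambda>s. (Kp * H1_norm L R) * (E s + \<delta>))"
      proof (rule integral_norm_bound_integral)
        show "(\<lambda>s. F2 M (\<eta>h s) (uh s) R - ip L (X2 s) (deriv R)) integrable_on {0..t}" by (rule integrable_diff[OF F2i Xi])
        show "(\<lambda>s. (Kp * H1_norm L R) * (E s + \<delta>)) integrable_on {0..t}"
          by (intro integrable_continuous_interval continuous_intros continuous_on_subset[OF cE sub])
        fix s assume "s \<in> {0..t}"
        then have s: "s \<in> {0..T}" using sub by blast
        show "norm (F2 M (\<eta>h s) (uh s) R - ip L (X2 s) (deriv R)) \<le> Kp * H1_norm L R * (E s + \<delta>)"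
          using d2[OF s R(2)] by (simp add: mult_ac)
      qed
      also have "\<dots> = (Kp * H1_norm L R) * integral {0..t} (\<lambda>s. E s + \<delta>)" by (rule integral_mult_right)
      finally have "A_form L d R R \<le> (Kp * integral {0..t} (\<lambda>s. E s + \<delta>)) * H1_norm L R" by (simp add: mult_ac)
      then have "min 1 d * (H1_norm L R)\<^sup>2 \<le> (Kp * integral {0..t} (\<lambda>s. E s + \<delta>)) * H1_norm L R"
        using A_form_H1(1)[OF d, of L R] by simp
      then have "H1_norm L R \<le> (Kp * integral {0..t} (\<lambda>s. E s + \<delta>)) / min 1 d"
        by (rule le_of_square_le) (use Kp iE[OF t] d in auto)
      then show ?thesis by (simp add: R_def)
    qed
    have Eb: "E t \<le> G * \<delta>" if t: "t \<in> {0..T}" for t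
    proof -
      have "E t \<le> C0 * (\<delta> * T * exp (C0 * T))"
      proof (rule Gronwall_integral[OF cE C0 delta _ t])
        fix t assume "t \<in> {0..T}"
        from bt[OF this] bx[OF this] show "E t \<le> C0 * integral {0..t} (\<lambda>s. E s + \<delta>)"
          by (simp add: E_def C0_def distrib_right)
      qed
      then show ?thesis by (simp add: G_def mult_ac)
    qed
    have hr: "\<delta> = mesh L N * mesh L N ^ (r - 1)" unfolding \<delta>_def using r by (simp flip: power_Suc)
    have h2: "mesh L N \<le> 2 * L"
    proof -
      have "2 * L / real N \<le> 2 * L / 1" using L N by (intro divide_left_mono) auto
      then show ?thesis by (simp add: mesh_def)
    qed
    define \<epsilon> where "\<epsilon> = mesh L N ^ (r - 1)"
    have ep: "0 \<le> \<epsilon>" using h by (simp add: \<epsilon>_def)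
    have de: "\<delta> \<le> 2 * L * \<epsilon>" unfolding hr \<epsilon>_def using h2 h by (intro mult_right_mono) auto
    have Gde: "G * \<delta> \<le> G * (2 * L * \<epsilon>)" by (rule mult_left_mono[OF de G])
    show "error_bound r N (G + kr + ks + G * (4 * L + Ci)) \<eta>h uh" unfolding error_bound_def
    proof
      fix t assume t: "t \<in> {0..T}"
      have tb: "L2_norm L (\<theta> t) \<le> G * \<delta>" "H1_norm L (\<xi> t) \<le> G * \<delta>" using Eb[OF t] by (auto simp: E_def intro: order_trans[rotated])
      note pw = pws[OF t]
      have "L2_norm L (\<lambda>x. \<eta>h t x - \<eta> t x) + L2_norm L (\<lambda>x. uh t x - u t x) \<le> (G + kr + ks) * \<delta>"
        using eu[OF t] ee[OF t] Eb[OF t] by (simp add: E_def algebra_simps)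
      also have "\<dots> \<le> (G + kr + ks + G * (4 * L + Ci)) * \<delta>"
        using delta G L Ci(1) by (intro mult_right_mono) auto
      finally have conc1: "L2_norm L (\<lambda>x. \<eta>h t x - \<eta> t x) + L2_norm L (\<lambda>x. uh t x - u t x) \<le> (G + kr + ks + G * (4 * L + Ci)) * mesh L N ^ r"
        by (simp add: \<delta>_def)
      have "L2_norm L (deriv (\<theta> t)) \<le> Ci / mesh L N * (G * \<delta>)"
        using Ci(2)[OF N tS(1)[OF t]] mult_left_mono[OF tb(1), of "Ci / mesh L N"] Ci(1) h by simp
      also have "\<dots> = Ci * G * \<epsilon>" using h by (simp add: hr \<epsilon>_def)
      finally have H1t: "H1_norm L (\<theta> t) \<le> G * (2 * L * \<epsilon>) + Ci * G * \<epsilon>"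
        using H1_le_add[of L "\<theta> t"] tb(1) Gde by simp
      have "H1_norm L (\<lambda>x. \<eta>h t x - \<eta> t x) = H1_norm L (\<lambda>x. \<theta> t x - (\<eta> t x - P t x))" by (simp add: \<theta>_def)
      also have "\<dots> \<le> H1_norm L (\<theta> t) + H1_norm L (\<lambda>x. \<eta> t x - P t x)" using pw by (intro H1_diff pw_diff)
      finally have 1: "H1_norm L (\<lambda>x. \<eta>h t x - \<eta> t x) \<le> G * (2 * L * \<epsilon>) + Ci * G * \<epsilon> + kr * \<epsilon>"
        using H1t rho(2)[OF t] by (simp add: \<epsilon>_def)
      have "H1_norm L (\<lambda>x. uh t x - u t x) = H1_norm L (\<lambda>x. \<xi> t x - (u t x - Q t x))" by (simp add: \<xi>_def)
      also have "\<dots> \<le> H1_norm L (\<xi> t) + H1_norm L (\<lambda>x. u t x - Q t x)" using pw by (intro H1_diff pw_diff)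
      finally have 2: "H1_norm L (\<lambda>x. uh t x - u t x) \<le> G * (2 * L * \<epsilon>) + ks * \<epsilon>"
        using tb(2) Gde sig(2)[OF t] by (simp add: \<epsilon>_def)
      have "H1_norm L (\<lambda>x. \<eta>h t x - \<eta> t x) + H1_norm L (\<lambda>x. uh t x - u t x) \<le> (kr + ks + G * (4 * L + Ci)) * \<epsilon>"
        using 1 2 by (simp add: algebra_simps)
      also have "\<dots> \<le> (G + kr + ks + G * (4 * L + Ci)) * \<epsilon>" using G ep by (intro mult_right_mono) auto
      finally show "L2_norm L (\<lambda>x. \<eta>h t x - \<eta> t x) + L2_norm L (\<lambda>x. uh t x - u t x) \<le> (G + kr + ks + G * (4 * L + Ci)) * mesh L N ^ r \<and>
        H1_norm L (\<lambda>x. \<eta>h t x - \<eta> t x) + H1_norm L (\<lambda>x. uh t x - u t x) \<le> (G + kr + ks + G * (4 * L + Ci)) * mesh L N ^ (r - 1)"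
        using conc1 by (simp add: \<epsilon>_def)
    qed
  qed
qed

end


section \<open>Existence, uniqueness and convergence of the semidiscrete approximation\<close>

context fem
begin

lemma semidiscrete_unique:
  assumes s: "semidiscrete_solution L N \<mu> r T a b d \<eta>0 u0 \<eta>h uh" and s': "semidiscrete_solution L N \<mu> r T a b d \<eta>0 u0 \<eta>h' uh'"
    and T: "0 < T" and b: "0 < b" and d: "0 < d" and t: "t \<in> {0..T}" and x: "x \<in> {-L..L}"
  shows "\<eta>h t x = \<eta>h' t x \<and> uh t x = uh' t x"
proof -
  obtain M1 where M1: "0 \<le> M1" "\<And>M. M1 \<le> M \<Longrightarrow> weak_solution T a b d M \<eta>h uh"
    using semidiscrete_imp_weak[OF s T b d] by blast
  obtain M2 where M2: "0 \<le> M2" "\<And>M. M2 \<le> M \<Longrightarrow> weak_solution T a b d M \<eta>h' uh'"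
    using semidiscrete_imp_weak[OF s' T b d] by blast
  have w: "weak_solution T a b d (M1 + M2) \<eta>h uh" "weak_solution T a b d (M1 + M2) \<eta>h' uh'"
    using M1 M2 by auto
  show ?thesis
    by (rule weak_unique[OF w _ b d _ _ t x]) (use s s' M1 M2 in \<open>auto simp: semidiscrete_solution_def\<close>)
qed

text \<open>The last fact is conditional because existence alone gives no bound by \<open>M\<close>;
  on fine meshes the bound is derived later from the error estimate, which holds for the truncated
  solution in any case.\<close>

lemma weak_exists_semidiscrete:
  assumes T: "0 < T" and b: "0 < b" and d: "0 < d" and M: "0 \<le> M" and "pw L \<eta>0" "pw L u0"
  obtains \<eta>h uh where "weak_solution T a b d M \<eta>h uh"
    "\<And>x. x \<in> {-L..L} \<Longrightarrow> \<eta>h 0 x = Rh L N \<mu> r b \<eta>0 x" "\<And>x. x \<in> {-L..L} \<Longrightarrow> uh 0 x = Rh0 L N \<mu> r d u0 x"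
    "(\<And>t x. t \<in> {0..T} \<Longrightarrow> x \<in> {-L..L} \<Longrightarrow> \<bar>\<eta>h t x\<bar> \<le> M \<and> \<bar>uh t x\<bar> \<le> M) \<Longrightarrow>
      semidiscrete_solution L N \<mu> r T a b d \<eta>0 u0 \<eta>h uh"
proof -
  have r1: "1 \<le> r" using r by simp
  obtain \<eta>h uh where w: "weak_solution T a b d M \<eta>h uh"
    and i1: "\<And>x. x \<in> {-L..L} \<Longrightarrow> \<eta>h 0 x = Rh L N \<mu> r b \<eta>0 x" and i2: "\<And>x. x \<in> {-L..L} \<Longrightarrow> uh 0 x = Rh0 L N \<mu> r d u0 x"
    and df: "\<And>x t. t \<in> {0..T} \<Longrightarrow> (\<lambda>s. \<eta>h s x) differentiable (at t within {0..T})"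
    "\<And>x t. t \<in> {0..T} \<Longrightarrow> (\<lambda>s. uh s x) differentiable (at t within {0..T})"
    and A1: "\<And>t \<psi>. t \<in> {0..T} \<Longrightarrow> \<psi> \<in> S \<Longrightarrow> A_form L b (dt T \<eta>h t) \<psi> = F1 a M (\<eta>h t) (uh t) \<psi>"
    and A2: "\<And>t \<phi>. t \<in> {0..T} \<Longrightarrow> \<phi> \<in> S0 \<Longrightarrow> A_form L d (dt T uh t) \<phi> = F2 M (\<eta>h t) (uh t) \<phi>"
    using weak_exists[OF T b d M Rh_spec(1)[OF L N r1 b assms(5)] Rh0_spec(1)[OF L N r1 d assms(6)], of a] by blast
  have mem: "\<eta>h t \<in> S" "uh t \<in> S0" if "t \<in> {0..T}" for t using w that by (auto simp: weak_solution_def)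
  show ?thesis
  proof (rule that[OF w i1 i2])
    assume bd: "\<And>t x. t \<in> {0..T} \<Longrightarrow> x \<in> {-L..L} \<Longrightarrow> \<bar>\<eta>h t x\<bar> \<le> M \<and> \<bar>uh t x\<bar> \<le> M"
    show "semidiscrete_solution L N \<mu> r T a b d \<eta>0 u0 \<eta>h uh"
      unfolding semidiscrete_solution_def
    proof (intro conjI ballI)
      show "continuous_on {0..T} (\<lambda>t. \<eta>h t x)" "continuous_on {0..T} (\<lambda>t. uh t x)" for x
        using df[of _ x] by (auto simp: continuous_on_eq_continuous_within intro: differentiable_imp_continuous_within)
    next
      fix t \<psi> assume t: "t \<in> {0<..T}" and psi: "\<psi> \<in> S"
      then have t': "t \<in> {0..T}" by auto
      show "A_form L b (dt T \<eta>h t) \<psi> + ip L (deriv (\<lambda>x. uh t x + \<eta>h t x * uh t x + a * lap (uh t) x)) \<psi> = 0"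
        using A1[OF t' psi] strong_form(1)[OF mem[OF t'] _ _ psi, of M a] bd[OF t'] by simp
    next
      fix t \<phi> assume t: "t \<in> {0<..T}" and phi: "\<phi> \<in> S0"
      then have t': "t \<in> {0..T}" by auto
      show "A_form L d (dt T uh t) \<phi> + ip L (\<lambda>x. deriv (\<eta>h t) x + uh t x * deriv (uh t) x) \<phi> = 0"
        using A2[OF t' phi] strong_form(2)[OF mem[OF t'] _ _ phi, of M] bd[OF t'] by simp
    qed (use mem df i1 i2 in auto)
  qed auto
qed

end

section \<open>Removing the truncation\<close>

context exact
begin

lemma error_bound_cong:
  assumes "error_bound r N K \<eta>h uh"
    and "\<And>t x. t \<in> {0..T} \<Longrightarrow> x \<in> {-L..L} \<Longrightarrow> \<eta>h' t x = \<eta>h t x \<and> uh' t x = uh t x"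
  shows "error_bound r N K \<eta>h' uh'"
  unfolding error_bound_def
proof
  fix t assume t: "t \<in> {0..T}"
  have n: "L2_norm L (\<lambda>x. \<eta>h' t x - \<eta> t x) = L2_norm L (\<lambda>x. \<eta>h t x - \<eta> t x)" "L2_norm L (\<lambda>x. uh' t x - u t x) = L2_norm L (\<lambda>x. uh t x - u t x)"
    "H1_norm L (\<lambda>x. \<eta>h' t x - \<eta> t x) = H1_norm L (\<lambda>x. \<eta>h t x - \<eta> t x)" "H1_norm L (\<lambda>x. uh' t x - u t x) = H1_norm L (\<lambda>x. uh t x - u t x)"
    by (rule L2_norm_cong H1_norm_cong; use assms(2)[OF t] in simp)+
  show "L2_norm L (\<lambda>x. \<eta>h' t x - \<eta> t x) + L2_norm L (\<lambda>x. uh' t x - u t x) \<le> K * mesh L N ^ r \<and>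
    H1_norm L (\<lambda>x. \<eta>h' t x - \<eta> t x) + H1_norm L (\<lambda>x. uh' t x - u t x) \<le> K * mesh L N ^ (r - 1)"
    unfolding n using assms(1) t unfolding error_bound_def by blast
qed

lemma error_bound_mono:
  assumes "error_bound r N K \<eta>h uh" "K \<le> K'" "0 < N"
  shows "error_bound r N K' \<eta>h uh"
proof -
  have "K * mesh L N ^ k \<le> K' * mesh L N ^ k" for k
    using assms(2) mesh_pos[OF L assms(3)] by (intro mult_right_mono) auto
  then show ?thesis using assms(1) unfolding error_bound_def by (meson order_trans)
qed

text \<open>On one mesh a solution has bounded error by compactness in time, and dividing by the two
  powers of the mesh size yields a constant. Uniqueness makes it valid for all solutions on that
  mesh.\<close>

lemma semidiscrete_bounded_error:
  assumes r: "2 \<le> r" and N: "0 < N" and b: "0 < b" and d: "0 < d"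
  shows "\<exists>K\<ge>0. \<forall>\<eta>h uh. semidiscrete_solution L N \<mu> r T a b d \<eta>0 u0 \<eta>h uh \<longrightarrow> error_bound r N K \<eta>h uh"
proof (cases "\<exists>\<eta>h uh. semidiscrete_solution L N \<mu> r T a b d \<eta>0 u0 \<eta>h uh")
  case True
  then obtain \<eta>h uh where s: "semidiscrete_solution L N \<mu> r T a b d \<eta>0 u0 \<eta>h uh" by blast
  interpret fem L N \<mu> r by unfold_locales (use L N r in auto)
  have h: "0 < mesh L N" by (rule mesh_pos[OF L N])
  obtain M0 where "\<And>M. M0 \<le> M \<Longrightarrow> weak_solution T a b d M \<eta>h uh" using semidiscrete_imp_weak[OF s T b d] by blast
  then have Hh: "H1_continuous L T \<eta>h" "H1_continuous L T uh" unfolding weak_solution_def by blast+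
  obtain m' where m': "m = Suc m'" using m2 by (cases m) auto
  have Hex: "H1_continuous L T \<eta>" "H1_continuous L T u"
    using continuous_in_C_H1[of L T m' \<eta>] eta_cont eta_C continuous_in_C_H1[of L T m u] u_cont u_C L m' by auto
  obtain B1 where B1: "0 \<le> B1" "\<And>t. t \<in> {0..T} \<Longrightarrow> H1_norm L (\<lambda>x. \<eta>h t x - \<eta> t x) \<le> B1"
    using H1_continuous_bounded[OF H1_continuous_diff[OF Hh(1) Hex(1)] L] by metis
  obtain B2 where B2: "0 \<le> B2" "\<And>t. t \<in> {0..T} \<Longrightarrow> H1_norm L (\<lambda>x. uh t x - u t x) \<le> B2"
    using H1_continuous_bounded[OF H1_continuous_diff[OF Hh(2) Hex(2)] L] by metis
  define K where "K = (B1 + B2) / mesh L N ^ r + (B1 + B2) / mesh L N ^ (r - 1)"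
  have K: "0 \<le> K" "B1 + B2 \<le> K * mesh L N ^ r" "B1 + B2 \<le> K * mesh L N ^ (r - 1)"
  proof -
    have *: "0 < mesh L N ^ r" "0 < mesh L N ^ (r - 1)" "0 \<le> B1 + B2" using h B1 B2 by auto
    show "0 \<le> K" using * by (simp add: K_def)
    have "(B1 + B2) / mesh L N ^ r \<le> K" "(B1 + B2) / mesh L N ^ (r - 1) \<le> K" using * by (auto simp: K_def)
    then show "B1 + B2 \<le> K * mesh L N ^ r" "B1 + B2 \<le> K * mesh L N ^ (r - 1)"
      using * by (simp_all add: pos_divide_le_eq)
  qed
  have "error_bound r N K \<eta>h uh"
    unfolding error_bound_def
  proof (intro ballI conjI)
    fix t assume t: "t \<in> {0..T}"
    show "L2_norm L (\<lambda>x. \<eta>h t x - \<eta> t x) + L2_norm L (\<lambda>x. uh t x - u t x) \<le> K * mesh L N ^ r"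
      "H1_norm L (\<lambda>x. \<eta>h t x - \<eta> t x) + H1_norm L (\<lambda>x. uh t x - u t x) \<le> K * mesh L N ^ (r - 1)"
      using B1(2)[OF t] B2(2)[OF t] K L2_le_H1[of L "\<lambda>x. \<eta>h t x - \<eta> t x"] L2_le_H1[of L "\<lambda>x. uh t x - u t x"] by linarith+
  qed
  then have "error_bound r N K \<eta>h' uh'" if "semidiscrete_solution L N \<mu> r T a b d \<eta>0 u0 \<eta>h' uh'" for \<eta>h' uh'
    by (rule error_bound_cong) (rule semidiscrete_unique[OF that s T b d])
  then show ?thesis using K(1) by blast
qed auto

lemma semidiscrete_convergence:
  assumes r: "2 \<le> r" and mu: "\<mu> \<le> r - 2" and m: "r + 2 \<le> m" and b: "0 < b" and d: "0 < d"
  obtains C h0 where "0 < h0"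
    "\<And>N. 0 < N \<Longrightarrow> mesh L N \<le> h0 \<Longrightarrow> \<exists>\<eta>h uh. semidiscrete_solution L N \<mu> r T a b d \<eta>0 u0 \<eta>h uh"
    "\<And>N \<eta>h uh. 0 < N \<Longrightarrow> semidiscrete_solution L N \<mu> r T a b d \<eta>0 u0 \<eta>h uh \<Longrightarrow> error_bound r N C \<eta>h uh"
proof -
  obtain B1 where B1: "0 \<le> B1" "\<And>t x. t \<in> {0..T} \<Longrightarrow> x \<in> {-L..L} \<Longrightarrow> \<bar>\<eta> t x\<bar> \<le> B1" using joint_bounded[OF joint0(1)] by blast
  obtain B2 where B2: "0 \<le> B2" "\<And>t x. t \<in> {0..T} \<Longrightarrow> x \<in> {-L..L} \<Longrightarrow> \<bar>u t x\<bar> \<le> B2" using joint_bounded[OF joint0(2)] by blast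
  \<comment> \<open>The unit of slack above the exact solution is the amount that the maximum norm
    of the error may use up.\<close>
  define M where "M = B1 + B2 + 1"
  have M: "0 \<le> M" "\<And>t x. t \<in> {0..T} \<Longrightarrow> x \<in> {-L..L} \<Longrightarrow> \<bar>\<eta> t x\<bar> + 1 \<le> M"
      "\<And>t x. t \<in> {0..T} \<Longrightarrow> x \<in> {-L..L} \<Longrightarrow> \<bar>u t x\<bar> + 1 \<le> M"
    using B1 B2 by (fastforce simp: M_def)+
  obtain C where C: "0 \<le> C" "\<And>N \<eta>h uh. 0 < N \<Longrightarrow> fem.weak_solution L N \<mu> r T a b d M \<eta>h uh \<Longrightarrow>
    (\<And>x. x \<in> {-L..L} \<Longrightarrow> \<eta>h 0 x = Rh L N \<mu> r b \<eta>0 x) \<Longrightarrow> (\<And>x. x \<in> {-L..L} \<Longrightarrow> uh 0 x = Rh0 L N \<mu> r d u0 x) \<Longrightarrow>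
    error_bound r N C \<eta>h uh"
  proof -
    have "\<bar>\<eta> t x\<bar> \<le> M" "\<bar>u t x\<bar> \<le> M" if "t \<in> {0..T}" "x \<in> {-L..L}" for t x
      using M(2)[OF that] M(3)[OF that] by auto
    then show ?thesis using truncated_error_estimate[OF r mu m b d M(1)] that by blast
  qed
  define c where "c = 1 / sqrt (2 * L) + sqrt (2 * L)"
  have c: "0 \<le> c" using L by (simp add: c_def)
  \<comment> \<open>\<open>mesh L N \<le> 1\<close> gives
    \<open>mesh L N ^ (r - 1) \<le> mesh L N\<close>, and the second bound then keeps the Sobolev
    constant \<open>c\<close> times the H1 error below 1. The 1 in the denominator covers the case
    \<open>C = 0\<close>.\<close>
  define h0 where "h0 = min 1 (1 / (c * C + 1))"
  have cC: "0 < c * C + 1" using c C(1) by (simp add: add_nonneg_pos)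
  have h0: "0 < h0" using cC by (simp add: h0_def)
  have T0: "0 \<in> {0..T}" using T by simp
  have pw0: "pw L \<eta>0" "pw L u0"
    by (rule pw_cong[OF pw_eta[OF T0]] pw_cong[OF pw_u[OF T0]]; use init in auto)+
  have ex: "\<exists>\<eta>h uh. semidiscrete_solution L N \<mu> r T a b d \<eta>0 u0 \<eta>h uh \<and> error_bound r N C \<eta>h uh"
    if N: "0 < N" and hh: "mesh L N \<le> h0" for N
  proof -
    interpret fem L N \<mu> r by unfold_locales (use L N r in auto)
    have h: "0 < mesh L N" by (rule mesh_pos[OF L N])
    obtain \<eta>h uh where w: "weak_solution T a b d M \<eta>h uh"
      and i: "\<And>x. x \<in> {-L..L} \<Longrightarrow> \<eta>h 0 x = Rh L N \<mu> r b \<eta>0 x" "\<And>x. x \<in> {-L..L} \<Longrightarrow> uh 0 x = Rh0 L N \<mu> r d u0 x"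
      and sd: "(\<And>t x. t \<in> {0..T} \<Longrightarrow> x \<in> {-L..L} \<Longrightarrow> \<bar>\<eta>h t x\<bar> \<le> M \<and> \<bar>uh t x\<bar> \<le> M) \<Longrightarrow>
      semidiscrete_solution L N \<mu> r T a b d \<eta>0 u0 \<eta>h uh"
      using weak_exists_semidiscrete[OF T b d M(1) pw0, of a] by blast
    have err: "error_bound r N C \<eta>h uh" by (rule C(2)[OF N w i])
    have small: "c * (C * mesh L N ^ (r - 1)) \<le> 1"
    proof -
      have "mesh L N ^ (r - 1) \<le> mesh L N ^ 1"
        using r h hh by (intro power_decreasing) (auto simp: h0_def)
      also have "\<dots> \<le> 1 / (c * C + 1)" using hh by (simp add: h0_def)
      finally have "c * C * mesh L N ^ (r - 1) \<le> c * C * (1 / (c * C + 1))" using c C(1) by (intro mult_left_mono) auto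
      also have "\<dots> \<le> 1" using cC by simp
      finally show ?thesis by (simp add: mult.assoc)
    qed
    have mem: "\<eta>h t \<in> S" "uh t \<in> S0" if "t \<in> {0..T}" for t using w that by (auto simp: weak_solution_def)
    have "\<bar>\<eta>h t x\<bar> \<le> M \<and> \<bar>uh t x\<bar> \<le> M" if t: "t \<in> {0..T}" and x: "x \<in> {-L..L}" for t x
    proof -
      have "H1_norm L (\<lambda>x. \<eta>h t x - \<eta> t x) + H1_norm L (\<lambda>x. uh t x - u t x) \<le> C * mesh L N ^ (r - 1)"
        using err t unfolding error_bound_def by blast
      then have H: "H1_norm L (\<lambda>x. \<eta>h t x - \<eta> t x) \<le> C * mesh L N ^ (r - 1)" "H1_norm L (\<lambda>x. uh t x - u t x) \<le> C * mesh L N ^ (r - 1)"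
        using H1_norm_nonneg[of L "\<lambda>x. \<eta>h t x - \<eta> t x"] H1_norm_nonneg[of L "\<lambda>x. uh t x - u t x"] by linarith+
      have "\<bar>\<eta>h t x - \<eta> t x\<bar> \<le> c * H1_norm L (\<lambda>x. \<eta>h t x - \<eta> t x)"
        unfolding c_def by (rule Sobolev[OF pw_diff[OF S_pw[OF mem(1)[OF t]] pw_eta[OF t]] x L])
      also have "\<dots> \<le> 1" by (rule order_trans[OF mult_left_mono[OF H(1) c] small])
      finally have 1: "\<bar>\<eta>h t x - \<eta> t x\<bar> \<le> 1" .
      have "\<bar>uh t x - u t x\<bar> \<le> c * H1_norm L (\<lambda>x. uh t x - u t x)"
        unfolding c_def by (rule Sobolev[OF pw_diff[OF S0_pw[OF mem(2)[OF t]] pw_u[OF t]] x L])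
      also have "\<dots> \<le> 1" by (rule order_trans[OF mult_left_mono[OF H(2) c] small])
      finally have 2: "\<bar>uh t x - u t x\<bar> \<le> 1" .
      show ?thesis using 1 2 M(2)[OF t x] M(3)[OF t x] by linarith
    qed
    then show ?thesis using sd err by blast
  qed
  have "\<forall>N. \<exists>K\<ge>0. 0 < N \<longrightarrow> (\<forall>\<eta>h uh. semidiscrete_solution L N \<mu> r T a b d \<eta>0 u0 \<eta>h uh \<longrightarrow> error_bound r N K \<eta>h uh)"
    using semidiscrete_bounded_error[OF r _ b d] by blast
  then obtain K where K: "\<And>N. 0 \<le> K N"
    and KE: "\<And>N \<eta>h uh. 0 < N \<Longrightarrow> semidiscrete_solution L N \<mu> r T a b d \<eta>0 u0 \<eta>h uh \<Longrightarrow> error_bound r N (K N) \<eta>h uh"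
    by metis
  \<comment> \<open>A mesh coarser than \<open>h0\<close> has \<open>N < 2 * L / h0\<close>, so
    finitely many of the constants \<open>K N\<close> are involved, and their sum dominates each of
    them.\<close>
  define n0 where "n0 = nat \<lceil>2 * L / h0\<rceil>"
  define C' where "C' = C + (\<Sum>N\<le>n0. K N)"
  have KC: "C \<le> C'" "\<And>N. N \<le> n0 \<Longrightarrow> K N \<le> C'"
  proof -
    show "C \<le> C'" unfolding C'_def using sum_nonneg[of "{..n0}" K] K by simp
    show "K N \<le> C'" if "N \<le> n0" for N
      unfolding C'_def using member_le_sum[of N "{..n0}" K] that K C(1) by simp
  qed
  show ?thesis
  proof (rule that[of h0 C', OF h0])
    show "\<exists>\<eta>h uh. semidiscrete_solution L N \<mu> r T a b d \<eta>0 u0 \<eta>h uh" if "0 < N" "mesh L N \<le> h0" for N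
      using ex[OF that] by blast
  next
    fix N \<eta>h uh assume N: "0 < N" and s: "semidiscrete_solution L N \<mu> r T a b d \<eta>0 u0 \<eta>h uh"
    show "error_bound r N C' \<eta>h uh"
    proof (cases "mesh L N \<le> h0")
      case True
      interpret fem L N \<mu> r by unfold_locales (use L N r in auto)
      obtain \<eta>h' uh' where s': "semidiscrete_solution L N \<mu> r T a b d \<eta>0 u0 \<eta>h' uh'"
        and e: "error_bound r N C \<eta>h' uh'" using ex[OF N True] by blast
      have "error_bound r N C \<eta>h uh" by (rule error_bound_cong[OF e]) (rule semidiscrete_unique[OF s s' T b d])
      then show ?thesis by (rule error_bound_mono[OF _ KC(1) N])
    next
      case False
      then have "h0 * real N < 2 * L" using N by (simp add: mesh_def field_simps)
      then have "real N < 2 * L / h0" using h0 by (simp add: field_simps)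
      then have "N \<le> n0" unfolding n0_def by linarith
      from error_bound_mono[OF KE[OF N s] KC(2)[OF this] N] show ?thesis .
    qed
  qed
qed

end

text \<open>The threshold \<open>r + 2\<close> for the regularity index provides approximation of
  order \<open>r\<close> for \<open>\<eta> t\<close> and \<open>u t\<close> and, with two further
  derivatives, for u_xx. The constant \<open>C\<close> serves every mesh, whereas existence, and
  with it the limit, refers to meshes of size at most \<open>h0\<close>.\<close>

theorem proposition4p1:
  fixes r :: nat
  assumes "2 \<le> r"
  shows "\<exists>m0\<ge>1. \<forall>m\<ge>m0. \<forall>(\<mu>::nat) (L::real) (a::real) (b::real) (d::real) (T::real) \<eta>0 u0 \<eta> u.
    \<mu> \<le> r - 2 \<longrightarrow> 0 < L \<longrightarrow> a < 0 \<longrightarrow> 0 < b \<longrightarrow> 0 < d \<longrightarrow> a + b + d = 1/3 \<longrightarrow> 0 < T \<longrightarrow>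
    smooth_solution m L T a b d \<eta>0 u0 \<eta> u \<longrightarrow>
    (\<exists>C h0. 0 < h0 \<and>
      (\<forall>N>0. mesh L N \<le> h0 \<longrightarrow> (\<exists>\<eta>h uh. semidiscrete_solution L N \<mu> r T a b d \<eta>0 u0 \<eta>h uh)) \<and>
      (\<forall>N>0. \<forall>\<eta>h uh \<eta>h' uh'.
        semidiscrete_solution L N \<mu> r T a b d \<eta>0 u0 \<eta>h uh \<longrightarrow>
        semidiscrete_solution L N \<mu> r T a b d \<eta>0 u0 \<eta>h' uh' \<longrightarrow>
        (\<forall>t\<in>{0..T}. \<forall>x\<in>{-L..L}. \<eta>h t x = \<eta>h' t x \<and> uh t x = uh' t x)) \<and>
      (\<forall>\<eta>h uh.
        (\<forall>N>0. mesh L N \<le> h0 \<longrightarrow>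
           semidiscrete_solution L N \<mu> r T a b d \<eta>0 u0 (\<eta>h N) (uh N)) \<longrightarrow>
        uniform_limit {0..T}
          (\<lambda>N t. H1_norm L (\<lambda>x. \<eta>h N t x - \<eta> t x) + H1_norm L (\<lambda>x. uh N t x - u t x))
          (\<lambda>t. 0) sequentially) \<and>
      (\<forall>N>0. \<forall>\<eta>h uh. semidiscrete_solution L N \<mu> r T a b d \<eta>0 u0 \<eta>h uh \<longrightarrow>
        (\<forall>t\<in>{0..T}.
           L2_norm L (\<lambda>x. \<eta>h t x - \<eta> t x) + L2_norm L (\<lambda>x. uh t x - u t x)
             \<le> C * mesh L N ^ r \<and>
           H1_norm L (\<lambda>x. \<eta>h t x - \<eta> t x) + H1_norm L (\<lambda>x. uh t x - u t x)
             \<le> C * mesh L N ^ (r - 1))))"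
proof (intro exI[of _ "r + 2"] conjI allI impI)
  show "1 \<le> r + 2" by simp
  fix m \<mu> :: nat and L a b d T :: real and \<eta>0 u0 :: "real \<Rightarrow> real" and \<eta> u :: "real \<Rightarrow> real \<Rightarrow> real"
  assume m: "r + 2 \<le> m" and mu: "\<mu> \<le> r - 2" and L: "0 < L" and b: "0 < b" and d: "0 < d" and T: "0 < T"
    and sol: "smooth_solution m L T a b d \<eta>0 u0 \<eta> u"
  interpret exact m L T a b d \<eta>0 u0 \<eta> u by unfold_locales (use m L T sol in auto)
  obtain C h0 where h0: "0 < h0"
    and ex: "\<And>N. 0 < N \<Longrightarrow> mesh L N \<le> h0 \<Longrightarrow> \<exists>\<eta>h uh. semidiscrete_solution L N \<mu> r T a b d \<eta>0 u0 \<eta>h uh"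
    and err: "\<And>N \<eta>h uh. 0 < N \<Longrightarrow> semidiscrete_solution L N \<mu> r T a b d \<eta>0 u0 \<eta>h uh \<Longrightarrow> error_bound r N C \<eta>h uh"
    by (rule semidiscrete_convergence[OF assms mu m b d]) (rule that)
  show "\<exists>C h0. 0 < h0 \<and>
      (\<forall>N>0. mesh L N \<le> h0 \<longrightarrow> (\<exists>\<eta>h uh. semidiscrete_solution L N \<mu> r T a b d \<eta>0 u0 \<eta>h uh)) \<and>
      (\<forall>N>0. \<forall>\<eta>h uh \<eta>h' uh'.
        semidiscrete_solution L N \<mu> r T a b d \<eta>0 u0 \<eta>h uh \<longrightarrow>
        semidiscrete_solution L N \<mu> r T a b d \<eta>0 u0 \<eta>h' uh' \<longrightarrow>
        (\<forall>t\<in>{0..T}. \<forall>x\<in>{-L..L}. \<eta>h t x = \<eta>h' t x \<and> uh t x = uh' t x)) \<and>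
      (\<forall>\<eta>h uh.
        (\<forall>N>0. mesh L N \<le> h0 \<longrightarrow>
           semidiscrete_solution L N \<mu> r T a b d \<eta>0 u0 (\<eta>h N) (uh N)) \<longrightarrow>
        uniform_limit {0..T}
          (\<lambda>N t. H1_norm L (\<lambda>x. \<eta>h N t x - \<eta> t x) + H1_norm L (\<lambda>x. uh N t x - u t x))
          (\<lambda>t. 0) sequentially) \<and>
      (\<forall>N>0. \<forall>\<eta>h uh. semidiscrete_solution L N \<mu> r T a b d \<eta>0 u0 \<eta>h uh \<longrightarrow>
        (\<forall>t\<in>{0..T}.
           L2_norm L (\<lambda>x. \<eta>h t x - \<eta> t x) + L2_norm L (\<lambda>x. uh t x - u t x)
             \<le> C * mesh L N ^ r \<and>
           H1_norm L (\<lambda>x. \<eta>h t x - \<eta> t x) + H1_norm L (\<lambda>x. uh t x - u t x)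
             \<le> C * mesh L N ^ (r - 1)))"
  proof (rule exI[of _ C], rule exI[of _ h0], intro conjI)
    show "\<forall>N>0. \<forall>\<eta>h uh \<eta>h' uh'. semidiscrete_solution L N \<mu> r T a b d \<eta>0 u0 \<eta>h uh \<longrightarrow>
        semidiscrete_solution L N \<mu> r T a b d \<eta>0 u0 \<eta>h' uh' \<longrightarrow>
        (\<forall>t\<in>{0..T}. \<forall>x\<in>{-L..L}. \<eta>h t x = \<eta>h' t x \<and> uh t x = uh' t x)"
    proof (intro allI impI ballI)
      fix N \<eta>h uh \<eta>h' uh' t x assume N: "(0::nat) < N" and s: "semidiscrete_solution L N \<mu> r T a b d \<eta>0 u0 \<eta>h uh"
        "semidiscrete_solution L N \<mu> r T a b d \<eta>0 u0 \<eta>h' uh'" and tx: "t \<in> {0..T}" "x \<in> {-L..L}"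
      interpret fem L N \<mu> r by unfold_locales (use L N assms in auto)
      show "\<eta>h t x = \<eta>h' t x \<and> uh t x = uh' t x" by (rule semidiscrete_unique[OF s T b d tx])
    qed
    show "\<forall>\<eta>h uh. (\<forall>N>0. mesh L N \<le> h0 \<longrightarrow> semidiscrete_solution L N \<mu> r T a b d \<eta>0 u0 (\<eta>h N) (uh N)) \<longrightarrow>
        uniform_limit {0..T} (\<lambda>N t. H1_norm L (\<lambda>x. \<eta>h N t x - \<eta> t x) + H1_norm L (\<lambda>x. uh N t x - u t x)) (\<lambda>t. 0) sequentially"
    proof (intro allI impI)
      fix \<eta>h uh assume s: "\<forall>N>0. mesh L N \<le> h0 \<longrightarrow> semidiscrete_solution L N \<mu> r T a b d \<eta>0 u0 (\<eta>h N) (uh N)"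
      have lim: "(\<lambda>N. mesh L N) \<longlonglongrightarrow> 0" unfolding mesh_def by (rule lim_const_over_n)
      have "(\<lambda>N. C * mesh L N ^ (r - 1)) \<longlonglongrightarrow> C * 0 ^ (r - 1)" by (intro tendsto_intros lim)
      \<comment> \<open>The exponent \<open>r - 1\<close> is positive because
        \<open>2 \<le> r\<close>, so the H1 bound itself tends to 0, uniformly in time.\<close>
      then have lim2: "(\<lambda>N. C * mesh L N ^ (r - 1)) \<longlonglongrightarrow> 0" using assms by (simp add: power_0_left)
      have ev: "\<forall>\<^sub>F N in sequentially. 0 < N \<and> mesh L N < h0"
        using order_tendstoD(2)[OF lim h0] eventually_gt_at_top[of 0] by eventually_elim auto
      show "uniform_limit {0..T} (\<lambda>N t. H1_norm L (\<lambda>x. \<eta>h N t x - \<eta> t x) + H1_norm L (\<lambda>x. uh N t x - u t x)) (\<lambda>t. 0) sequentially"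
      proof (rule uniform_limitI)
        fix e :: real assume e: "0 < e"
        show "\<forall>\<^sub>F N in sequentially. \<forall>t\<in>{0..T}. dist (H1_norm L (\<lambda>x. \<eta>h N t x - \<eta> t x) + H1_norm L (\<lambda>x. uh N t x - u t x)) 0 < e"
          using order_tendstoD(2)[OF lim2 e] ev
        proof eventually_elim
          case (elim N)
          show ?case
          proof
            fix t assume t: "t \<in> {0..T}"
            have "semidiscrete_solution L N \<mu> r T a b d \<eta>0 u0 (\<eta>h N) (uh N)" using s elim by simp
            then have "error_bound r N C (\<eta>h N) (uh N)" using err elim by blast
            then have "H1_norm L (\<lambda>x. \<eta>h N t x - \<eta> t x) + H1_norm L (\<lambda>x. uh N t x - u t x) \<le> C * mesh L N ^ (r - 1)"
              unfolding error_bound_def using t by blast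
            then have "H1_norm L (\<lambda>x. \<eta>h N t x - \<eta> t x) + H1_norm L (\<lambda>x. uh N t x - u t x) < e" using elim by linarith
            then show "dist (H1_norm L (\<lambda>x. \<eta>h N t x - \<eta> t x) + H1_norm L (\<lambda>x. uh N t x - u t x)) 0 < e" by simp
          qed
        qed
      qed
    qed
    show "0 < h0" by (rule h0)
    show "\<forall>N>0. mesh L N \<le> h0 \<longrightarrow> (\<exists>\<eta>h uh. semidiscrete_solution L N \<mu> r T a b d \<eta>0 u0 \<eta>h uh)"
      by (intro allI impI) (rule ex)
  qed (use err in \<open>simp add: error_bound_def\<close>)
qed

end
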